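(* Let $m>1$, $N\ge 1$ and $\max\{-2,-N\}<\sigma<0$. Let $\mathcal{X}:=H^1(\mathbb{R}^N)\cap L^{(m+1)/m}(\mathbb{R}^N)$, let $$\theta:=\frac{N(m-1)}{N(m-1)+2(m+1)}\in(0,1),$$ and define, for $v\in\mathcal{X}\setminus\{0\}$, $$\mathcal{S}(v):=\frac{\|\nabla v\|_2^{(\sigma+2)\theta-\sigma}\,\|v\|_{(m+1)/m}^{(\sigma+2)(1-\theta)}}{\|v\|^2_{L^2(\mathbb{R}^N,|x|^\sigma dx)}}.$$ Then there exists a non-negative radially symmetric function $v_*\in\mathcal{X}$, $v_*\not\equiv0$, with non-increasing radial profile, such that $$\mathcal{S}(v_* )=\inf_{v\in\mathcal{X}\setminus\{0\}}\mathcal{S}(v)>0,$$ and $v_*$ is a variational solution to $$-\Delta v(x)+\frac{1}{m-1}v^{1/m}(x)=|x|^\sigma v(x),\quad x\in\mathbb{R}^N. \qquad (\ast)$$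
   Context: $\|\cdot\|_p$ denotes the $L^p(\mathbb{R}^N)$ norm and $\|v\|^2_{L^2(\mathbb{R}^N,|x|^\sigma dx)}=\int_{\mathbb{R}^N}|x|^\sigma v(x)^2\,dx$. A variational solution to $(\ast)$ is a function $v\in\mathcal{X}$, $v\ge0$, with $\int_{\mathbb{R}^N}|x|^\sigma v^2\,dx<\infty$, such that for every $\varphi\in H^1(\mathbb{R}^N)$, $$\int_{\mathbb{R}^N}\Big[\nabla v\cdot\nabla\varphi+\frac{1}{m-1}v^{1/m}\varphi-|x|^\sigma v\varphi\Big]\,dx=0.$$ *)

theory Defs
  imports "HOL-Analysis.Analysis"
begin

text \<open>Functions on R^N are modelled as functions on an arbitrary Euclidean space 'a,
  with N = DIM('a). Integrals are Lebesgue integrals w.r.t. Lebesgue measure.\<close>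

fun dderiv :: "'a::euclidean_space list \<Rightarrow> ('a \<Rightarrow> real) \<Rightarrow> 'a \<Rightarrow> real" where
  "dderiv [] f = f"
| "dderiv (d # ds) f = (\<lambda>x. frechet_derivative (dderiv ds f) (at x) d)"

definition smooth_fun :: "('a::euclidean_space \<Rightarrow> real) \<Rightarrow> bool" where
  "smooth_fun f \<longleftrightarrow> (\<forall>ds x. dderiv ds f differentiable (at x))"

definition test_fun :: "('a::euclidean_space \<Rightarrow> real) \<Rightarrow> bool" where
  "test_fun \<phi> \<longleftrightarrow> smooth_fun \<phi> \<and> compact (closure {x. \<phi> x \<noteq> 0})"

definition Lp :: "real \<Rightarrow> ('a::euclidean_space \<Rightarrow> real) set" where
  "Lp p = {v. v \<in> borel_measurable lebesgue \<and> integrable lebesgue (\<lambda>x. \<bar>v x\<bar> powr p)}"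

definition Lp_norm :: "real \<Rightarrow> ('a::euclidean_space \<Rightarrow> real) \<Rightarrow> real" where
  "Lp_norm p v = (LINT x|lebesgue. \<bar>v x\<bar> powr p) powr (1 / p)"

definition weak_grad :: "('a::euclidean_space \<Rightarrow> real) \<Rightarrow> ('a \<Rightarrow> 'a) \<Rightarrow> bool" where
  "weak_grad v G \<longleftrightarrow>
     v \<in> borel_measurable lebesgue \<and> G \<in> borel_measurable lebesgue \<and>
     (\<forall>K. compact K \<longrightarrow> integrable (restrict_space lebesgue K) v \<and>
                          integrable (restrict_space lebesgue K) G) \<and>
     (\<forall>\<phi>. test_fun \<phi> \<longrightarrow> (\<forall>i\<in>Basis.
        (LINT x|lebesgue. v x * frechet_derivative \<phi> (at x) i)
          = - (LINT x|lebesgue. \<phi> x * (G x \<bullet> i))))"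

definition H1 :: "('a::euclidean_space \<Rightarrow> real) set" where
  "H1 = {v. v \<in> Lp 2 \<and> (\<exists>G. weak_grad v G \<and> (\<lambda>x. norm (G x)) \<in> Lp 2)}"

text \<open>The (a.e. unique) weak gradient of an H^1 function.\<close>
definition wgrad :: "('a::euclidean_space \<Rightarrow> real) \<Rightarrow> 'a \<Rightarrow> 'a" where
  "wgrad v = (SOME G. weak_grad v G \<and> (\<lambda>x. norm (G x)) \<in> Lp 2)"

definition Xsp :: "real \<Rightarrow> ('a::euclidean_space \<Rightarrow> real) set" where
  "Xsp m = H1 \<inter> Lp ((m + 1) / m)"

definition wnorm2 :: "real \<Rightarrow> ('a::euclidean_space \<Rightarrow> real) \<Rightarrow> real" where
  "wnorm2 \<sigma> v = (LINT x|lebesgue. norm x powr \<sigma> * (v x)\<^sup>2)"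

definition theta :: "nat \<Rightarrow> real \<Rightarrow> real" where
  "theta N m = (real N * (m - 1)) / (real N * (m - 1) + 2 * (m + 1))"

definition Sfun :: "real \<Rightarrow> real \<Rightarrow> ('a::euclidean_space \<Rightarrow> real) \<Rightarrow> real" where
  "Sfun m \<sigma> v =
     (let \<theta> = theta DIM('a) m in
      Lp_norm 2 (\<lambda>x. norm (wgrad v x)) powr ((\<sigma> + 2) * \<theta> - \<sigma>)
      * Lp_norm ((m + 1) / m) v powr ((\<sigma> + 2) * (1 - \<theta>))
      / wnorm2 \<sigma> v)"

text \<open>Variational solution of  -Lap v + v^(1/m)/(m-1) = |x|^sigma v.
  The integral in the weak formulation is required to exist (be integrable) and vanish.\<close>
definition var_solution :: "real \<Rightarrow> real \<Rightarrow> ('a::euclidean_space \<Rightarrow> real) \<Rightarrow> bool" where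
  "var_solution m \<sigma> v \<longleftrightarrow>
     v \<in> Xsp m \<and> (\<forall>x. 0 \<le> v x) \<and>
     integrable lebesgue (\<lambda>x. norm x powr \<sigma> * (v x)\<^sup>2) \<and>
     (\<forall>\<phi>\<in>H1.
        integrable lebesgue (\<lambda>x. wgrad v x \<bullet> wgrad \<phi> x + 1 / (m - 1) * v x powr (1 / m) * \<phi> x
                                 - norm x powr \<sigma> * v x * \<phi> x) \<and>
        (LINT x|lebesgue. wgrad v x \<bullet> wgrad \<phi> x + 1 / (m - 1) * v x powr (1 / m) * \<phi> x
                                 - norm x powr \<sigma> * v x * \<phi> x) = 0)"

end

theory Submission
  imports Defs "HOL-Complex_Analysis.Great_Picard"
begin

text \<open>The exponents of \<open>\<S>\<close> sum to 2 and make it invariant under \<open>v \<mapsto> c v(\<lambda> x)\<close>, so minimising it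
  amounts to maximising \<open>\<integral>|x|\<^sup>\<sigma> v\<^sup>2\<close> under \<open>\<parallel>\<nabla>v\<parallel>\<^sub>2 = 1\<close> and \<open>\<integral>|v|\<^sup>p = 1\<close> with \<open>p = (m + 1)/m\<close>.
  A Nash-type inequality bounds \<open>\<parallel>v\<parallel>\<^sub>2\<close> under these constraints. Hardy's inequality with a smaller exponent
  near the origin and the decay of the weight at infinity then make a maximising sequence compact in the
  weighted space, and the parallelogram law applied to almost optimal midpoints upgrades this to strong
  convergence of the gradients. Since polarization across a hyperplane missing the origin can only increase
  the weighted norm, strictly unless the function is already polarized, a nonnegative extremal is
  radially non-increasing. Scaling so that the multipliers in the Euler-Lagrange equation become those of \<open>(\<ast>)\<close>
  gives a solution. Its radial profile is bounded at the origin, as testing with \<open>(v - f(r))\<^sup>+\<close> bounds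
  \<open>f(r/2)/f(r)\<close> by \<open>1 + C r\<^sup>\<sigma>\<^sup>+\<^sup>2\<close>, so that the profile can be extended to a finite value at 0.\<close>

section \<open>Square integrable vector fields\<close>

text \<open>Sobolev functions are handled as pairs \<open>(v, G)\<close> of Borel functions with an
  explicit gradient, tested against \<open>C1\<close> functions of bounded support; Lebesgue
  measurable functions and the chosen gradient \<open>wgrad\<close> only enter through a translation
  at the end. The obstacle for the direct method is that compactness controls only the weighted
  norm: a maximising sequence has gradients that are merely bounded, and its L^p integral may drop
  in the limit. A drop is harmless because the right-hand side of the inequality is monotone in both
  integrals. Symmetry is reached without rearrangements and without iterating polarizations: an
  extremal is already fixed by all of them, and averaging against a radially decreasing kernel turns
  this family of a.e. inequalities into pointwise monotonicity of continuous functions. A further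
  difficulty is that \<open>(\<ast>)\<close> is tested with all of H1, while the first variation
  only makes sense for test functions that also lie in L^p, since v^(1/m) need not be square
  integrable.\<close>

definition L2 :: "('a::euclidean_space \<Rightarrow> 'b::euclidean_space) \<Rightarrow> bool" where
  "L2 f \<longleftrightarrow> f \<in> borel_measurable borel \<and> integrable lborel (\<lambda>x. (norm (f x))\<^sup>2)"

text \<open>The square of the norm. Without the root the parallelogram law and the expansion along a
  line are polynomial identities, and the factor 2 in \<open>n2_add_le\<close> replaces the triangle
  inequality wherever only smallness matters.\<close>

definition n2 :: "('a::euclidean_space \<Rightarrow> 'b::euclidean_space) \<Rightarrow> real" where
  "n2 f = (LINT x|lborel. (norm (f x))\<^sup>2)"

lemma L2_meas [simp]: "L2 f \<Longrightarrow> f \<in> borel_measurable borel"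
  and L2_int [simp]: "L2 f \<Longrightarrow> integrable lborel (\<lambda>x. (norm (f x))\<^sup>2)"
  by (auto simp: L2_def)

lemma n2_nonneg [simp]: "0 \<le> n2 f"
  by (simp add: n2_def)

lemma L2_dominated:
  assumes "L2 g" "f \<in> borel_measurable borel" "AE x in lborel. norm (f x) \<le> norm (g x)"
  shows "L2 f" "n2 f \<le> n2 g"
proof -
  have m: "AE x in lborel. (norm (f x))\<^sup>2 \<le> (norm (g x))\<^sup>2"
    using assms(3) by eventually_elim (simp add: power_mono)
  show "L2 f" unfolding L2_def
    using assms(2) m by (auto intro!: Bochner_Integration.integrable_bound[OF L2_int[OF assms(1)]])
  then show "n2 f \<le> n2 g"
    unfolding n2_def using m assms(1) by (intro integral_mono_AE) auto
qed

lemma L2_scaleR: "L2 f \<Longrightarrow> L2 (\<lambda>x. c *\<^sub>R f x)"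
  and n2_scaleR: "n2 (\<lambda>x. c *\<^sub>R f x) = c\<^sup>2 * n2 f"
  by (auto simp del: L2_int L2_meas simp: L2_def n2_def power_mult_distrib)

lemma L2_cmult: "L2 f \<Longrightarrow> L2 (\<lambda>x. c * f x :: real)"
  and n2_cmult: "n2 (\<lambda>x. c * f x :: real) = c\<^sup>2 * n2 f"
  using L2_scaleR[of f c] n2_scaleR[of c f] by auto

lemma L2_minus: "L2 f \<Longrightarrow> L2 (\<lambda>x. - f x)"
  and n2_minus: "n2 (\<lambda>x. - f x) = n2 f"
  by (auto simp del: L2_int L2_meas simp: L2_def n2_def)

lemma norm_add_sq_le: "(norm (a + b :: 'a::real_inner))\<^sup>2 \<le> 2 * (norm a)\<^sup>2 + 2 * (norm b)\<^sup>2"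
proof -
  have "(norm (a + b))\<^sup>2 + (norm (a - b))\<^sup>2 = 2 * (norm a)\<^sup>2 + 2 * (norm b)\<^sup>2"
    by (simp add: power2_norm_eq_inner algebra_simps inner_commute)
  then show ?thesis by (smt (verit) zero_le_power2)
qed

lemma L2_add:
  assumes "L2 f" "L2 g" shows "L2 (\<lambda>x. f x + g x)"
proof -
  have [measurable]: "f \<in> borel_measurable borel" "g \<in> borel_measurable borel" using assms by auto
  have "integrable lborel (\<lambda>x. (norm (f x + g x))\<^sup>2)"
    by (rule Bochner_Integration.integrable_bound[where f="\<lambda>x. 2 * (norm (f x))\<^sup>2 + 2 * (norm (g x))\<^sup>2"])
      (use assms norm_add_sq_le in auto)
  then show ?thesis by (auto simp del: L2_int L2_meas simp: L2_def)
qed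

lemma L2_diff: "L2 f \<Longrightarrow> L2 g \<Longrightarrow> L2 (\<lambda>x. f x - g x)"
  using L2_add[of f "\<lambda>x. - g x"] L2_minus[of g] by auto

lemma L2_zero [simp]: "L2 (\<lambda>x. 0)" "n2 (\<lambda>x. 0) = 0"
  by (auto simp del: L2_int L2_meas simp: L2_def n2_def)

lemma n2_add_le:
  assumes "L2 f" "L2 g" shows "n2 (\<lambda>x. f x + g x) \<le> 2 * n2 f + 2 * n2 g"
proof -
  have "n2 (\<lambda>x. f x + g x) \<le> (LINT x|lborel. 2 * (norm (f x))\<^sup>2 + 2 * (norm (g x))\<^sup>2)"
    unfolding n2_def using assms L2_add[OF assms]
    by (intro integral_mono) (auto simp: norm_add_sq_le)
  then show ?thesis using assms by (simp add: n2_def L2_int)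
qed

lemma n2_diff_le: "L2 f \<Longrightarrow> L2 g \<Longrightarrow> n2 (\<lambda>x. f x - g x) \<le> 2 * n2 f + 2 * n2 g"
  using n2_add_le[of f "\<lambda>x. - g x"] L2_minus[of g] by (auto simp: n2_minus)

lemma n2_diff_commute: "n2 (\<lambda>x. f x - g x) = n2 (\<lambda>x. g x - f x)"
  by (simp add: n2_def norm_minus_commute)

lemma n2_triangle2:
  assumes "L2 f" "L2 g" "L2 h"
  shows "n2 (\<lambda>x. f x - h x) \<le> 2 * n2 (\<lambda>x. f x - g x) + 2 * n2 (\<lambda>x. g x - h x)"
  using n2_add_le[OF L2_diff[OF assms(1,2)] L2_diff[OF assms(2,3)]] by simp

lemma n2_parallelogram:
  assumes "L2 f" "L2 g"
  shows "n2 (\<lambda>x. f x + g x) + n2 (\<lambda>x. f x - g x) = 2 * n2 f + 2 * n2 g"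
proof -
  have "n2 (\<lambda>x. f x + g x) + n2 (\<lambda>x. f x - g x)
     = (LINT x|lborel. (norm (f x + g x))\<^sup>2 + (norm (f x - g x))\<^sup>2)"
    unfolding n2_def using L2_add[OF assms] L2_diff[OF assms]
    by (intro Bochner_Integration.integral_add[symmetric]) auto
  also have "\<dots> = (LINT x|lborel. 2 * (norm (f x))\<^sup>2 + 2 * (norm (g x))\<^sup>2)"
    by (intro Bochner_Integration.integral_cong) (auto simp: power2_norm_eq_inner algebra_simps inner_commute)
  finally show ?thesis using assms by (simp add: n2_def L2_int)
qed

lemma norm_inner_le_sq: "\<bar>a \<bullet> b\<bar> \<le> (norm a)\<^sup>2 + (norm (b::'a::real_inner))\<^sup>2"
proof -
  have "\<bar>a \<bullet> b\<bar> \<le> norm a * norm b" by (rule Cauchy_Schwarz_ineq2)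
  moreover have "0 \<le> (norm a - norm b)\<^sup>2" by simp
  moreover have "0 \<le> norm a * norm b" by simp
  ultimately show ?thesis by (simp add: power2_diff)
qed

lemma norm_scaleR_le_sq: "norm (a *\<^sub>R b) \<le> (norm a)\<^sup>2 + (norm (b::'a::real_normed_vector))\<^sup>2"
proof -
  have "norm (a *\<^sub>R b) = norm a * norm b" by simp
  then show ?thesis
    using sum_squares_bound[of "norm a" "norm b"] mult_nonneg_nonneg[OF norm_ge_zero[of a] norm_ge_zero[of b]]
    by linarith
qed

lemma L2_scaleR_integrable:
  fixes g :: "'a::euclidean_space \<Rightarrow> 'b::euclidean_space"
  assumes "L2 v" "L2 g" shows "integrable lborel (\<lambda>x. v x *\<^sub>R g x)"
proof (rule Bochner_Integration.integrable_bound[where f="\<lambda>x. (norm (v x))\<^sup>2 + (norm (g x))\<^sup>2"])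
  have [measurable]: "v \<in> borel_measurable borel" "g \<in> borel_measurable borel" using assms by auto
  show "(\<lambda>x. v x *\<^sub>R g x) \<in> borel_measurable lborel" by measurable
  have "norm (v x *\<^sub>R g x) \<le> norm ((norm (v x))\<^sup>2 + (norm (g x))\<^sup>2)" for x
    using norm_scaleR_le_sq[of "v x" "g x"] by (metis abs_ge_self order_trans real_norm_def)
  then show "AE x in lborel. norm (v x *\<^sub>R g x) \<le> norm ((norm (v x))\<^sup>2 + (norm (g x))\<^sup>2)"
    by blast
  show "integrable lborel (\<lambda>x. (norm (v x))\<^sup>2 + (norm (g x))\<^sup>2)"
    by (intro Bochner_Integration.integrable_add L2_int assms)
qed

lemma L2_inner_integrable:
  assumes "L2 f" "L2 g" shows "integrable lborel (\<lambda>x. f x \<bullet> g x)"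
proof -
  have [measurable]: "f \<in> borel_measurable borel" "g \<in> borel_measurable borel" using assms by auto
  show ?thesis
    by (rule Bochner_Integration.integrable_bound[where f="\<lambda>x. (norm (f x))\<^sup>2 + (norm (g x))\<^sup>2"])
      (use assms norm_inner_le_sq in auto)
qed

lemma L2_mult_integrable: "L2 f \<Longrightarrow> L2 g \<Longrightarrow> integrable lborel (\<lambda>x. f x * g x :: real)"
  using L2_inner_integrable[of f g] by simp

lemma discriminant_nonpos:
  fixes a b c :: real
  assumes "\<And>t. 0 \<le> a + 2 * t * b + t\<^sup>2 * c" "0 \<le> c" "0 \<le> a"
  shows "b\<^sup>2 \<le> a * c"
proof (cases "c = 0")
  case True
  have "b = 0"
  proof (rule ccontr)
    assume "b \<noteq> 0"
    \<comment> \<open>With \<open>c = 0\<close> the expression is linear in \<open>t\<close>, and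
      this \<open>t\<close> gives it the value -1.\<close>
    with assms(1)[of "-(a + 1) / (2 * b)"] True assms(3) show False by (simp add: field_simps)
  qed
  then show ?thesis using True by simp
next
  case False
  then have c: "c > 0" using assms(2) by simp
  \<comment> \<open>Evaluation at the vertex \<open>t = - b / c\<close> of the parabola, multiplied
    by \<open>c\<close> to clear the denominator.\<close>
  have "0 \<le> c * (a + 2 * (- b / c) * b + (- b / c)\<^sup>2 * c)"
    using assms(1)[of "- b / c"] c by (intro mult_nonneg_nonneg) auto
  also have "\<dots> = a * c - b\<^sup>2"
    using c by (simp add: field_simps power2_eq_square)
  finally show ?thesis by simp
qed

lemma n2_add_expand:
  assumes "L2 f" "L2 g"
  shows "n2 (\<lambda>x. f x + t *\<^sub>R g x) = n2 f + 2 * t * (LINT x|lborel. f x \<bullet> g x) + t\<^sup>2 * n2 g"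
proof -
  have "n2 (\<lambda>x. f x + t *\<^sub>R g x)
      = (LINT x|lborel. (norm (f x))\<^sup>2 + (2 * t) * (f x \<bullet> g x) + t\<^sup>2 * (norm (g x))\<^sup>2)"
    unfolding n2_def
    by (intro Bochner_Integration.integral_cong)
      (simp_all only: power2_norm_eq_inner, auto simp: algebra_simps inner_commute power2_eq_square)
  also have "\<dots> = n2 f + 2 * t * (LINT x|lborel. f x \<bullet> g x) + t\<^sup>2 * n2 g"
    using assms L2_inner_integrable[OF assms] by (simp add: n2_def L2_int)
  finally show ?thesis .
qed

lemma L2_Cauchy_Schwarz:
  assumes "L2 f" "L2 g"
  shows "(LINT x|lborel. f x \<bullet> g x)\<^sup>2 \<le> n2 f * n2 g"
  by (rule discriminant_nonpos) (auto simp: n2_add_expand[OF assms, symmetric])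

lemma L2_Cauchy_Schwarz_abs:
  assumes "L2 f" "L2 g"
  shows "\<bar>LINT x|lborel. f x \<bullet> g x\<bar> \<le> sqrt (n2 f) * sqrt (n2 g)"
  using real_sqrt_le_mono[OF L2_Cauchy_Schwarz[OF assms]] by (simp add: real_sqrt_mult)

lemma n2_eq_0_iff: "L2 f \<Longrightarrow> n2 f = 0 \<longleftrightarrow> (AE x in lborel. f x = 0)"
  unfolding n2_def by (subst integral_nonneg_eq_0_iff_AE) auto

lemma n2_cong_AE:
  assumes "AE x in lborel. f x = g x" "f \<in> borel_measurable borel" "g \<in> borel_measurable borel"
  shows "n2 f = n2 g"
  unfolding n2_def using assms by (intro integral_cong_AE) auto

text \<open>Fatou's lemma in a form that yields integrability of the limit together with the bound.
  It closes the estimates along sequences for which only a.e. convergence and a uniform bound are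
  known.\<close>

lemma fatou_bound:
  fixes f :: "'a::euclidean_space \<Rightarrow> real"
  assumes i: "\<And>n::nat. integrable lborel (g n)" and nn: "\<And>n x. 0 \<le> g n x"
    and K: "\<And>n. (LINT x|lborel. g n x) \<le> K"
    and lim: "AE x in lborel. (\<lambda>n. g n x) \<longlonglongrightarrow> f x" and m: "f \<in> borel_measurable borel"
  shows "integrable lborel f" "(LINT x|lborel. f x) \<le> K"
proof -
  have K0: "0 \<le> K" using K[of 0] nn by (smt (verit) Bochner_Integration.integral_nonneg)
  have m': "\<And>n. g n \<in> borel_measurable lborel" using i by auto
  have f0: "AE x in lborel. 0 \<le> f x"
    using lim by eventually_elim (auto intro: LIMSEQ_le_const nn)
  have "(\<integral>\<^sup>+ x. ennreal (f x) \<partial>lborel) = (\<integral>\<^sup>+ x. liminf (\<lambda>n. ennreal (g n x)) \<partial>lborel)"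
    using lim
    by (intro nn_integral_cong_AE, eventually_elim)
      (metis lim_imp_Liminf tendsto_ennrealI trivial_limit_sequentially)
  also have "\<dots> \<le> liminf (\<lambda>n. \<integral>\<^sup>+ x. ennreal (g n x) \<partial>lborel)"
    using m' by (intro nn_integral_liminf) auto
  also have "\<dots> \<le> ennreal K"
  proof (rule Liminf_le)
    show "\<forall>\<^sub>F n in sequentially. (\<integral>\<^sup>+ x. ennreal (g n x) \<partial>lborel) \<le> ennreal K"
      using i nn K by (intro always_eventually allI) (simp add: nn_integral_eq_integral ennreal_leI)
  qed simp
  finally have le: "(\<integral>\<^sup>+ x. ennreal (f x) \<partial>lborel) \<le> ennreal K" .
  show int: "integrable lborel f"
    using m f0 le by (intro integrableI_nonneg) (auto simp: less_top[symmetric] top_unique)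
  have "ennreal (LINT x|lborel. f x) \<le> ennreal K"
    using le nn_integral_eq_integral[OF int f0] by simp
  then show "(LINT x|lborel. f x) \<le> K" using K0 ennreal_le_iff by blast
qed

lemma L2_fatou:
  assumes i: "\<And>n::nat. L2 (g n)" and K: "\<And>n. n2 (g n) \<le> K"
    and lim: "AE x in lborel. (\<lambda>n. g n x) \<longlonglongrightarrow> f x" and m: "f \<in> borel_measurable borel"
  shows "L2 f" "n2 f \<le> K"
proof -
  have "AE x in lborel. (\<lambda>n. (norm (g n x))\<^sup>2) \<longlonglongrightarrow> (norm (f x))\<^sup>2"
    using lim by eventually_elim (intro tendsto_intros)
  note * = fatou_bound[OF L2_int[OF i] _ K[unfolded n2_def] this]
  show "L2 f" "n2 f \<le> K" using *  m by (auto simp del: L2_int L2_meas simp: L2_def n2_def)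
qed

lemma L2_dominated_convergence:
  fixes g :: "'a::euclidean_space \<Rightarrow> 'b::euclidean_space"
  assumes g: "L2 g" and m: "\<And>n::nat. f n \<in> borel_measurable borel" "f' \<in> borel_measurable borel"
    and lim: "AE x in lborel. (\<lambda>n. f n x) \<longlonglongrightarrow> f' x"
    and bd: "\<And>n. AE x in lborel. norm (f n x) \<le> norm (g x)"
  shows "(\<lambda>n. n2 (\<lambda>x. f n x - f' x)) \<longlonglongrightarrow> 0" "L2 f'"
proof -
  have [measurable]: "g \<in> borel_measurable borel" using g by auto
  note m[measurable]
  have "AE x in lborel. \<forall>n. norm (f n x) \<le> norm (g x)" using bd by (simp add: AE_all_countable)
  with lim have bd': "AE x in lborel. norm (f' x) \<le> norm (g x)"
  proof eventually_elim
    case (elim x)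
    have "(\<lambda>n. norm (f n x)) \<longlonglongrightarrow> norm (f' x)" using elim by (intro tendsto_intros)
    then show ?case using elim by (intro LIMSEQ_le_const2) auto
  qed
  then show "L2 f'" using L2_dominated[OF g] m by blast
  have "(\<lambda>n. n2 (\<lambda>x. f n x - f' x)) \<longlonglongrightarrow> (LINT x::'a|lborel. (0::real))"
    unfolding n2_def
  proof (rule integral_dominated_convergence[where w="\<lambda>x. 4 * (norm (g x))\<^sup>2"])
    show "integrable lborel (\<lambda>x. 4 * (norm (g x))\<^sup>2)" using g by auto
    show "AE x in lborel. (\<lambda>n. (norm (f n x - f' x))\<^sup>2) \<longlonglongrightarrow> 0"
      using lim
    proof eventually_elim
      case (elim x)
      then have "(\<lambda>n. (norm (f n x - f' x))\<^sup>2) \<longlonglongrightarrow> (norm (f' x - f' x))\<^sup>2" by (intro tendsto_intros)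
      then show ?case by simp
    qed
    show "AE x in lborel. norm ((norm (f n x - f' x))\<^sup>2) \<le> 4 * (norm (g x))\<^sup>2" for n
      using bd[of n] bd'
    proof eventually_elim
      case (elim x)
      have "norm (f n x - f' x) \<le> 2 * norm (g x)"
        using elim norm_triangle_ineq4[of "f n x" "f' x"] by linarith
      then have "(norm (f n x - f' x))\<^sup>2 \<le> (2 * norm (g x))\<^sup>2" by (intro power_mono) auto
      then show ?case by (simp add: power_mult_distrib)
    qed
  qed auto
  then show "(\<lambda>n. n2 (\<lambda>x. f n x - f' x)) \<longlonglongrightarrow> 0" by simp
qed

lemma L2_lim_inner:
  assumes "\<And>n::nat. L2 (f n)" "L2 f'" "L2 g" "(\<lambda>n. n2 (\<lambda>x. f n x - f' x)) \<longlonglongrightarrow> 0"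
  shows "(\<lambda>n. LINT x|lborel. f n x \<bullet> g x) \<longlonglongrightarrow> (LINT x|lborel. f' x \<bullet> g x)"
proof -
  have "(\<lambda>n. sqrt (n2 (\<lambda>x. f n x - f' x)) * sqrt (n2 g)) \<longlonglongrightarrow> sqrt 0 * sqrt (n2 g)"
    by (intro tendsto_intros assms)
  then have z: "(\<lambda>n. sqrt (n2 (\<lambda>x. f n x - f' x)) * sqrt (n2 g)) \<longlonglongrightarrow> 0" by simp
  have "(\<lambda>n. (LINT x|lborel. f n x \<bullet> g x) - (LINT x|lborel. f' x \<bullet> g x)) \<longlonglongrightarrow> 0"
  proof (rule Lim_null_comparison[OF _ z], rule always_eventually, rule allI)
    fix n
    have "(LINT x|lborel. f n x \<bullet> g x) - (LINT x|lborel. f' x \<bullet> g x) = (LINT x|lborel. (f n x - f' x) \<bullet> g x)"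
      unfolding inner_diff_left
      by (intro Bochner_Integration.integral_diff[symmetric] L2_inner_integrable assms)
    then show "norm ((LINT x|lborel. f n x \<bullet> g x) - (LINT x|lborel. f' x \<bullet> g x))
        \<le> sqrt (n2 (\<lambda>x. f n x - f' x)) * sqrt (n2 g)"
      using L2_Cauchy_Schwarz_abs[OF L2_diff[OF assms(1,2)] assms(3)] by simp
  qed
  then show ?thesis by (simp add: LIM_zero_iff)
qed

lemma sqrt_n2_triangle:
  assumes "L2 f" "L2 g"
  shows "sqrt (n2 (\<lambda>x. f x + g x)) \<le> sqrt (n2 f) + sqrt (n2 g)"
proof (rule real_le_lsqrt)
  have "n2 (\<lambda>x. f x + g x) = n2 f + 2 * (LINT x|lborel. f x \<bullet> g x) + n2 g"
    using n2_add_expand[OF assms, of 1] by simp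
  also have "\<dots> \<le> n2 f + 2 * (sqrt (n2 f) * sqrt (n2 g)) + n2 g"
    using L2_Cauchy_Schwarz_abs[OF assms] by linarith
  also have "\<dots> = (sqrt (n2 f) + sqrt (n2 g))\<^sup>2"
    by (simp add: power2_sum)
  finally show "n2 (\<lambda>x. f x + g x) \<le> (sqrt (n2 f) + sqrt (n2 g))\<^sup>2" .
qed auto

lemma sqrt_n2_diff_bound:
  assumes "L2 f" "L2 g"
  shows "\<bar>sqrt (n2 f) - sqrt (n2 g)\<bar> \<le> sqrt (n2 (\<lambda>x. f x - g x))"
  using sqrt_n2_triangle[OF L2_diff[OF assms] assms(2)]
    sqrt_n2_triangle[OF L2_diff[OF assms(2,1)] assms(1)] n2_diff_commute[of f g] by simp

lemma L2_lim_n2: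
  assumes "\<And>n::nat. L2 (f n)" "L2 f'" "(\<lambda>n. n2 (\<lambda>x. f n x - f' x)) \<longlonglongrightarrow> 0"
  shows "(\<lambda>n. n2 (f n)) \<longlonglongrightarrow> n2 f'"
proof -
  have z: "(\<lambda>n. sqrt (n2 (\<lambda>x. f n x - f' x))) \<longlonglongrightarrow> 0"
    using tendsto_real_sqrt[OF assms(3)] by simp
  have "(\<lambda>n. sqrt (n2 (f n)) - sqrt (n2 f')) \<longlonglongrightarrow> 0"
    by (rule Lim_null_comparison[OF _ z], rule always_eventually)
      (use sqrt_n2_diff_bound assms in auto)
  then have "(\<lambda>n. sqrt (n2 (f n))) \<longlonglongrightarrow> sqrt (n2 f')" by (simp add: LIM_zero_iff)
  from tendsto_power[OF this, of 2] show ?thesis by simp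
qed

lemma L2_lim_AE_subseq:
  assumes "\<And>n::nat. L2 (f n)" "L2 f'" "(\<lambda>n. n2 (\<lambda>x. f n x - f' x)) \<longlonglongrightarrow> 0"
  shows "\<exists>r::nat\<Rightarrow>nat. strict_mono r \<and> (AE x in lborel. (\<lambda>n. f (r n) x) \<longlonglongrightarrow> f' x)"
proof -
  have "\<exists>r::nat\<Rightarrow>nat. strict_mono r \<and> (AE x in lborel. (\<lambda>n. (norm (f (r n) x - f' x))\<^sup>2) \<longlonglongrightarrow> 0)"
    using assms(3) L2_diff[OF assms(1,2)]
    by (intro tendsto_L1_AE_subseq) (auto simp: n2_def)
  then obtain r where r: "strict_mono (r::nat\<Rightarrow>nat)" "AE x in lborel. (\<lambda>n. (norm (f (r n) x - f' x))\<^sup>2) \<longlonglongrightarrow> 0"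
    by blast
  have "AE x in lborel. (\<lambda>n. f (r n) x) \<longlonglongrightarrow> f' x"
    using r(2)
  proof eventually_elim
    case (elim x)
    have "(\<lambda>n. norm (f (r n) x - f' x)) \<longlonglongrightarrow> 0"
      using tendsto_real_sqrt[OF elim] by simp
    then show ?case by (simp add: LIM_zero_iff tendsto_norm_zero_iff)
  qed
  with r(1) show ?thesis by blast
qed

text \<open>Along a subsequence with squared increments below \<open>4\<^sup>-\<^sup>k\<close>, the bound
  \<open>2 |d| \<le> 2\<^sup>k d\<^sup>2 + 2\<^sup>-\<^sup>k\<close> turns summability of the integrals into absolute convergence a.e.\<close>
lemma L2_complete:
  fixes f :: "nat \<Rightarrow> 'a::euclidean_space \<Rightarrow> 'b::euclidean_space"
  assumes L: "\<And>n. L2 (f n)"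
    and C: "\<And>e. e > 0 \<Longrightarrow> \<exists>N. \<forall>m\<ge>N. \<forall>n\<ge>N. n2 (\<lambda>x. f m x - f n x) < e"
  shows "\<exists>f'. L2 f' \<and> (\<lambda>n. n2 (\<lambda>x. f n x - f' x)) \<longlonglongrightarrow> 0"
proof -
  have [measurable]: "f n \<in> borel_measurable borel" for n using L by auto
  have "\<exists>N. \<forall>m\<ge>N. \<forall>n\<ge>N. n2 (\<lambda>x. f m x - f n x) < (1/4)^k" for k :: nat
    by (rule C) simp
  then obtain N where N: "\<And>k m n. m \<ge> N k \<Longrightarrow> n \<ge> N k \<Longrightarrow> n2 (\<lambda>x. f m x - f n x) < (1/4)^k"
    by metis
  \<comment> \<open>The partial sum makes the indices increase while \<open>r k\<close> stays above
    both \<open>k\<close> and \<open>N k\<close>.\<close>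
  define r where "r k = k + (\<Sum>j\<le>k. N j)" for k
  have rN: "r k \<ge> N k" for k
  proof -
    have "N k \<le> (\<Sum>j\<le>k. N j)" by (rule member_le_sum) auto
    then show ?thesis by (simp add: r_def)
  qed
  have rinc: "r k \<le> r (Suc k)" for k by (simp add: r_def)
  have rk: "r k \<ge> k" for k by (simp add: r_def)
  have d: "n2 (\<lambda>x. f (r (Suc k)) x - f (r k) x) < (1/4)^k" for k
    by (rule N) (use rN[of k] rinc[of k] in linarith)+
  define D where "D k x = 2^k * (norm (f (r (Suc k)) x - f (r k) x))\<^sup>2" for k :: nat and x
  have Dint: "integrable lborel (D k)" for k
    unfolding D_def using L2_int[OF L2_diff[OF L L]] by simp
  have Dval: "(LINT x|lborel. D k x) \<le> (1/2)^k" for k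
  proof -
    have "(LINT x|lborel. D k x) = 2^k * n2 (\<lambda>x. f (r (Suc k)) x - f (r k) x)"
      by (simp add: D_def n2_def)
    also have "\<dots> \<le> 2^k * (1/4)^k" using d[of k] by (intro mult_left_mono) auto
    also have "\<dots> = (1/2)^k" by (simp add: power_mult_distrib[symmetric])
    finally show ?thesis .
  qed
  have "(\<integral>\<^sup>+x. (\<Sum>k. ennreal (D k x)) \<partial>lborel) = (\<Sum>k. \<integral>\<^sup>+x. ennreal (D k x) \<partial>lborel)"
    using Dint by (intro nn_integral_suminf) auto
  also have "\<dots> \<le> (\<Sum>k. ennreal ((1/2)^k))"
  proof (intro suminf_le)
    fix k
    have "(\<integral>\<^sup>+x. ennreal (D k x) \<partial>lborel) = ennreal (LINT x|lborel. D k x)"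
      by (rule nn_integral_eq_integral[OF Dint]) (simp add: D_def)
    then show "(\<integral>\<^sup>+x. ennreal (D k x) \<partial>lborel) \<le> ennreal ((1/2)^k)"
      using Dval[of k] by (simp add: ennreal_leI)
  qed auto
  also have "\<dots> < \<infinity>"
    using summable_geometric[of "1/2::real"] by (subst suminf_ennreal2) auto
  finally have "AE x in lborel. (\<Sum>k. ennreal (D k x)) \<noteq> \<infinity>"
    using Dint by (intro nn_integral_noteq_infinite) auto
  then have ae: "AE x in lborel. convergent (\<lambda>k. f (r k) x)"
  proof eventually_elim
    case (elim x)
    have sD: "summable (\<lambda>k. D k x)"
      using elim by (intro summable_suminf_not_top) (auto simp: D_def)
    have "summable (\<lambda>k. norm (f (r (Suc k)) x - f (r k) x))"
    proof (rule summable_comparison_test')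
      show "summable (\<lambda>k. D k x + (1/2)^k)"
        by (intro summable_add sD summable_geometric) auto
      fix k :: nat assume "0 \<le> k"
      define a where "a = norm (f (r (Suc k)) x - f (r k) x)"
      have "0 \<le> 2^k * (a - (1/2)^k)\<^sup>2" by simp
      also have "2^k * (a - (1/2)^k)\<^sup>2 = 2^k * a\<^sup>2 - 2 * a + (1/2)^k"
        by (simp add: power2_diff algebra_simps power_one_over power2_eq_square)
      finally have "2 * a \<le> 2^k * a\<^sup>2 + (1/2)^k" by simp
      moreover have "a \<ge> 0" by (simp add: a_def)
      ultimately show "norm (norm (f (r (Suc k)) x - f (r k) x)) \<le> D k x + (1/2)^k"
        unfolding D_def a_def real_norm_def abs_norm_cancel by linarith
    qed
    then have "summable (\<lambda>k. f (r (Suc k)) x - f (r k) x)" by (rule summable_norm_cancel)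
    then have "convergent (\<lambda>n. \<Sum>k<n. f (r (Suc k)) x - f (r k) x)"
      by (simp add: summable_iff_convergent)
    then have "convergent (\<lambda>n. f (r n) x - f (r 0) x)"
      using sum_lessThan_telescope[of "\<lambda>k. f (r k) x"] by simp
    then show ?case
      using convergent_add[OF _ convergent_const[of "f (r 0) x"]] by fastforce
  qed
  define f' where "f' x = lim (\<lambda>k. f (r k) x)" for x
  have [measurable]: "f' \<in> borel_measurable borel" unfolding f'_def
    by (rule borel_measurable_lim_metric) auto
  have lim: "AE x in lborel. (\<lambda>k. f (r k) x) \<longlonglongrightarrow> f' x"
    using ae by eventually_elim (simp add: f'_def convergent_LIMSEQ_iff)
  \<comment> \<open>Fatou along the subsequence bounds the distance of every late member of the full
    sequence to the limit, so no separate argument is needed to leave the subsequence.\<close>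
  have key: "L2 (\<lambda>x. f n x - f' x) \<and> n2 (\<lambda>x. f n x - f' x) \<le> (1/4)^k" if "n \<ge> N k" for n k
  proof -
    have "n2 (\<lambda>x. f n x - f (r (j + N k)) x) \<le> (1/4)^k" for j
      using N[of k n "r (j + N k)"] that rk[of "j + N k"] by simp
    moreover have "AE x in lborel. (\<lambda>j. f n x - f (r (j + N k)) x) \<longlonglongrightarrow> f n x - f' x"
      using lim
    proof eventually_elim
      case (elim x)
      show ?case by (intro tendsto_intros LIMSEQ_ignore_initial_segment[OF elim])
    qed
    ultimately show ?thesis
      using L2_fatou[of "\<lambda>j x. f n x - f (r (j + N k)) x" "(1/4)^k" "\<lambda>x. f n x - f' x"]
        L2_diff[OF L L] by auto
  qed
  have "L2 f'"
    using L2_diff[OF L[of "N 0"] conjunct1[OF key[of 0 "N 0"]]] by simp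
  moreover have "(\<lambda>n. n2 (\<lambda>x. f n x - f' x)) \<longlonglongrightarrow> 0"
  proof (rule LIMSEQ_I)
    fix e :: real assume "e > 0"
    then obtain k where "(1/4)^k < e" using real_arch_pow_inv[of e "1/4"] by auto
    then have "norm (n2 (\<lambda>x. f n x - f' x) - 0) < e" if "n \<ge> N k" for n
      using key[OF that] n2_nonneg[of "\<lambda>x. f n x - f' x"] by simp
    then show "\<exists>no. \<forall>n\<ge>no. norm (n2 (\<lambda>x. f n x - f' x) - 0) < e"
      by blast
  qed
  ultimately show ?thesis by blast
qed

section \<open>Changes of variables\<close>

text \<open>One notion for translations, reflections and dilations: \<open>\<kappa>\<close> is the
  reciprocal of the absolute Jacobian determinant. Equality of the image measure with a multiple of
  \<open>lborel\<close> settles integrals, integrability and null sets at once.\<close>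

definition vol_map :: "real \<Rightarrow> ('a::euclidean_space \<Rightarrow> 'a) \<Rightarrow> bool" where
  "vol_map \<kappa> T \<longleftrightarrow> 0 < \<kappa> \<and> T \<in> borel_measurable borel \<and>
     distr lborel borel T = density lborel (\<lambda>_. ennreal \<kappa>)"

lemma vol_map_meas: "vol_map \<kappa> T \<Longrightarrow> T \<in> borel_measurable borel"
  by (simp add: vol_map_def)

lemma vol_map_nn:
  assumes "vol_map \<kappa> T" and [measurable]: "f \<in> borel_measurable borel"
  shows "(\<integral>\<^sup>+x. f (T x) \<partial>lborel) = ennreal \<kappa> * (\<integral>\<^sup>+x. f x \<partial>lborel)"
proof -
  have [measurable]: "T \<in> borel_measurable borel" using assms by (auto simp: vol_map_def)
  have "(\<integral>\<^sup>+x. f (T x) \<partial>lborel) = (\<integral>\<^sup>+x. f x \<partial>distr lborel borel T)"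
    by (simp add: nn_integral_distr)
  then show ?thesis using assms(1) by (simp add: vol_map_def nn_integral_density nn_integral_cmult)
qed

lemma vol_map_AE:
  assumes "vol_map \<kappa> T" "AE x in lborel. P x" shows "AE x in lborel. P (T x)"
proof -
  have [measurable]: "T \<in> borel_measurable borel" using assms by (auto simp: vol_map_def)
  obtain N where N: "{x. \<not> P x} \<subseteq> N" "N \<in> sets borel" "emeasure lborel N = 0"
    using assms(2) by (auto elim!: AE_E simp: null_sets_def)
  have "(\<integral>\<^sup>+x. indicator N (T x) \<partial>lborel) = ennreal \<kappa> * (\<integral>\<^sup>+x. indicator N x \<partial>lborel)"
    using N by (intro vol_map_nn[OF assms(1)]) auto
  also have "\<dots> = 0" using N by simp
  finally have "AE x in lborel. indicator N (T x) = (0::ennreal)"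
    using N by (subst (asm) nn_integral_0_iff_AE) auto
  then show ?thesis by eventually_elim (use N in \<open>auto simp: indicator_def split: if_splits\<close>)
qed

lemma
  fixes f :: "'a::euclidean_space \<Rightarrow> 'b::{banach, second_countable_topology}"
  assumes "vol_map \<kappa> T" and [measurable]: "f \<in> borel_measurable borel"
  shows vol_map_integral: "(LINT x|lborel. f (T x)) = \<kappa> *\<^sub>R (LINT x|lborel. f x)"
    and vol_map_integrable: "integrable lborel (\<lambda>x. f (T x)) \<longleftrightarrow> integrable lborel f"
proof -
  have [measurable]: "T \<in> borel_measurable borel" and k: "\<kappa> > 0" using assms by (auto simp: vol_map_def)
  have "(LINT x|lborel. f (T x)) = (LINT x|distr lborel borel T. f x)"
    by (simp add: integral_distr)
  also have "\<dots> = \<kappa> *\<^sub>R (LINT x|lborel. f x)"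
    using assms(1) k by (simp add: vol_map_def integral_density)
  finally show "(LINT x|lborel. f (T x)) = \<kappa> *\<^sub>R (LINT x|lborel. f x)" .
  have "integrable lborel (\<lambda>x. f (T x)) \<longleftrightarrow> integrable (distr lborel borel T) f"
    by (simp add: integrable_distr_eq)
  also have "\<dots> \<longleftrightarrow> integrable lborel f"
  proof -
    have "integrable lborel (\<lambda>x. \<kappa> *\<^sub>R f x) \<Longrightarrow> integrable lborel f"
      using integrable_scaleR_right[of "1/\<kappa>" lborel "\<lambda>x. \<kappa> *\<^sub>R f x"] k by simp
    then show ?thesis using assms(1) k by (auto simp: vol_map_def integrable_density)
  qed
  finally show "integrable lborel (\<lambda>x. f (T x)) \<longleftrightarrow> integrable lborel f" .
qed

lemma vol_map_L2:
  assumes "vol_map \<kappa> T" "L2 f"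
  shows "L2 (\<lambda>x. f (T x))" "n2 (\<lambda>x. f (T x)) = \<kappa> * n2 f"
proof -
  have [measurable]: "T \<in> borel_measurable borel" "f \<in> borel_measurable borel"
    using assms by (auto simp: vol_map_def)
  show "L2 (\<lambda>x. f (T x))" "n2 (\<lambda>x. f (T x)) = \<kappa> * n2 f"
    using vol_map_integrable[OF assms(1), of "\<lambda>x. (norm (f x))\<^sup>2"]
      vol_map_integral[OF assms(1), of "\<lambda>x. (norm (f x))\<^sup>2"] assms(2)
    by (simp_all add: L2_def n2_def del: L2_int L2_meas)
qed

lemma vol_map_I:
  fixes T :: "'a::euclidean_space \<Rightarrow> 'a"
  assumes "0 < \<kappa>" and [measurable]: "T \<in> borel_measurable borel"
    and "\<And>S. S \<in> sets borel \<Longrightarrow> (\<integral>\<^sup>+x. indicator S (T x) \<partial>lborel) = ennreal \<kappa> * emeasure lborel S"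
  shows "vol_map \<kappa> T"
proof -
  have "distr lborel borel T = density lborel (\<lambda>_. ennreal \<kappa>)"
  proof (rule measure_eqI)
    fix S assume "S \<in> sets (distr lborel borel T)"
    then have S[measurable]: "S \<in> sets borel" by simp
    have "emeasure (distr lborel borel T) S = (\<integral>\<^sup>+x. indicator S x \<partial>distr lborel borel T)"
      using S by (subst nn_integral_indicator) auto
    also have "\<dots> = (\<integral>\<^sup>+x. indicator S (T x) \<partial>lborel)"
      by (rule nn_integral_distr) auto
    also have "\<dots> = emeasure (density lborel (\<lambda>_. ennreal \<kappa>)) S"
      using S by (simp add: assms(3) emeasure_density nn_integral_cmult)
    finally show "emeasure (distr lborel borel T) S = emeasure (density lborel (\<lambda>_. ennreal \<kappa>)) S" .
  qed simp
  then show ?thesis using assms by (simp add: vol_map_def)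
qed

lemma vol_map_affine:
  fixes a :: "'a::euclidean_space"
  assumes c: "c \<noteq> 0" shows "vol_map (1 / \<bar>c\<bar> ^ DIM('a)) (\<lambda>x. a + c *\<^sub>R x)"
proof (rule vol_map_I)
  fix S :: "'a set" assume S[measurable]: "S \<in> sets borel"
  have "emeasure lborel S = (\<integral>\<^sup>+x. indicator S x \<partial>density (distr lborel borel (\<lambda>x. a + c *\<^sub>R x)) (\<lambda>_. \<bar>c\<bar>^DIM('a)))"
    using S by (subst lborel_affine[OF c, of a]) simp
  also have "\<dots> = ennreal (\<bar>c\<bar>^DIM('a)) * (\<integral>\<^sup>+x. indicator S (a + c *\<^sub>R x) \<partial>lborel)"
    by (subst nn_integral_density; simp add: nn_integral_cmult del: nn_integral_indicator)
      (subst nn_integral_distr; simp del: nn_integral_indicator)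
  finally have "ennreal (1 / \<bar>c\<bar>^DIM('a)) * emeasure lborel S
     = ennreal (1 / \<bar>c\<bar>^DIM('a)) * (ennreal (\<bar>c\<bar>^DIM('a)) * (\<integral>\<^sup>+x. indicator S (a + c *\<^sub>R x) \<partial>lborel))"
    by simp
  also have "\<dots> = ennreal (1 / \<bar>c\<bar>^DIM('a) * \<bar>c\<bar>^DIM('a)) * (\<integral>\<^sup>+x. indicator S (a + c *\<^sub>R x) \<partial>lborel)"
    by (subst ennreal_mult) (auto simp: mult.assoc)
  also have "1 / \<bar>c\<bar>^DIM('a) * \<bar>c\<bar>^DIM('a) = 1" using c by simp
  finally show "(\<integral>\<^sup>+x. indicator S (a + c *\<^sub>R x) \<partial>lborel) = ennreal (1 / \<bar>c\<bar> ^ DIM('a)) * emeasure lborel S"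
    by simp
qed (use c in auto)

lemma vol_map_translate: "vol_map 1 (\<lambda>x. x + a)"
  using vol_map_affine[of 1 a] by (simp add: add.commute)

lemma vol_map_flip: "vol_map 1 (\<lambda>x. a - x)"
  using vol_map_affine[of "-1" a] by simp

lemma vol_map_homothety:
  fixes c :: real
  shows "c \<noteq> 0 \<Longrightarrow> vol_map (1 / \<bar>c\<bar> ^ DIM('a)) (\<lambda>x::'a::euclidean_space. c *\<^sub>R x)"
  using vol_map_affine[of c "0::'a"] by simp

lemma vol_map_compose:
  assumes "vol_map \<kappa> T" "vol_map \<mu> U" shows "vol_map (\<kappa> * \<mu>) (\<lambda>x. U (T x))"
proof (rule vol_map_I)
  have [measurable]: "T \<in> borel_measurable borel" "U \<in> borel_measurable borel"
    using assms by (auto simp: vol_map_def)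
  have k: "\<kappa> > 0" "\<mu> > 0" using assms by (auto simp: vol_map_def)
  then show "0 < \<kappa> * \<mu>" by simp
  show "(\<lambda>x. U (T x)) \<in> borel_measurable borel" by measurable
  fix S :: "'a set" assume S[measurable]: "S \<in> sets borel"
  have "(\<integral>\<^sup>+x. indicator S (U (T x)) \<partial>lborel) = ennreal \<kappa> * (\<integral>\<^sup>+x. indicator S (U x) \<partial>lborel)"
    by (rule vol_map_nn[OF assms(1)]) simp
  also have "\<dots> = ennreal \<kappa> * (ennreal \<mu> * (\<integral>\<^sup>+x. indicator S x \<partial>lborel))"
    by (subst vol_map_nn[OF assms(2)]) auto
  finally show "(\<integral>\<^sup>+x. indicator S (U (T x)) \<partial>lborel) = ennreal (\<kappa> * \<mu>) * emeasure lborel S"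
    using k by (simp add: ennreal_mult mult.assoc)
qed

text \<open>Uniqueness of Haar measure in miniature: with \<open>B\<close> the unit ball,
  \<open>\<integral>\<integral> 1\<^sub>B(x) 1\<^sub>S(x + L y) dx dy\<close> is evaluated in both orders.\<close>
lemma vol_map_involutive_isometry:
  fixes L :: "'a::euclidean_space \<Rightarrow> 'a"
  assumes lin: "linear L" and inv: "\<And>x. L (L x) = x" and iso: "\<And>x. norm (L x) = norm x"
  shows "vol_map 1 L"
proof (rule vol_map_I)
  have cont: "continuous_on UNIV L" using lin by (simp add: linear_continuous_on linear_conv_bounded_linear)
  then show m[measurable]: "L \<in> borel_measurable borel" by (rule borel_measurable_continuous_onI)
  interpret linear L by fact
  fix S :: "'a set" assume S[measurable]: "S \<in> sets borel"
  let ?B = "ball 0 1 :: 'a set"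
  let ?I = "indicator :: 'a set \<Rightarrow> 'a \<Rightarrow> ennreal"
  have mB[measurable]: "?I ?B \<in> borel_measurable borel"
    by (rule borel_measurable_indicator) simp
  \<comment> \<open>What allows the measure of the ball to be cancelled at the end.\<close>
  have eB: "emeasure lborel ?B \<noteq> \<infinity>" "emeasure lborel ?B \<noteq> 0"
    using emeasure_bounded_finite[of ?B] open_not_negligible[of ?B]
    by (auto simp: negligible_iff_null_sets null_sets_def)
  \<comment> \<open>Since \<open>L\<close> is its own inverse, the shift by \<open>x\<close> after
    \<open>L\<close> is a shift by \<open>L x\<close> before \<open>L\<close>, which does not change
    the integral.\<close>
  have S1: "(\<integral>\<^sup>+y. ?I S (x + L y) \<partial>lborel) = (\<integral>\<^sup>+y. ?I S (L y) \<partial>lborel)" for x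
  proof -
    have "(\<integral>\<^sup>+y. ?I S (x + L y) \<partial>lborel) = (\<integral>\<^sup>+y. ?I S (L (y + L x)) \<partial>lborel)"
      by (simp add: add inv add.commute)
    also have "\<dots> = (\<integral>\<^sup>+y. ?I S (L y) \<partial>lborel)"
      using vol_map_nn[OF vol_map_translate, of "\<lambda>y. ?I S (L y)" "L x"] by simp
    finally show ?thesis .
  qed
  have B1: "(\<integral>\<^sup>+y. ?I ?B (x - L y) \<partial>lborel) = emeasure lborel ?B" for x
  proof -
    have "norm (x - L y) = norm (L x - y)" for y
      using iso[of "L x - y"] by (simp add: diff inv)
    then have "(\<integral>\<^sup>+y. ?I ?B (x - L y) \<partial>lborel) = (\<integral>\<^sup>+y. ?I ?B (L x - y) \<partial>lborel)"
      by (simp add: indicator_def)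
    also have "\<dots> = ennreal 1 * (\<integral>\<^sup>+y. ?I ?B y \<partial>lborel)"
      by (rule vol_map_nn[OF vol_map_flip]) (rule mB)
    also have "\<dots> = emeasure lborel ?B" by simp
    finally show ?thesis .
  qed
  have "emeasure lborel ?B * (\<integral>\<^sup>+y. ?I S (L y) \<partial>lborel)
      = (\<integral>\<^sup>+x. ?I ?B x * (\<integral>\<^sup>+y. ?I S (x + L y) \<partial>lborel) \<partial>lborel)"
    unfolding S1 by (subst nn_integral_multc) auto
  also have "\<dots> = (\<integral>\<^sup>+x. (\<integral>\<^sup>+y. ?I ?B x * ?I S (x + L y) \<partial>lborel) \<partial>lborel)"
    by (simp add: nn_integral_cmult)
  also have "\<dots> = (\<integral>\<^sup>+y. (\<integral>\<^sup>+x. ?I ?B x * ?I S (x + L y) \<partial>lborel) \<partial>lborel)"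
    by (rule lborel_pair.Fubini') measurable
  also have "\<dots> = (\<integral>\<^sup>+y. (\<integral>\<^sup>+x. ?I ?B (x - L y) * ?I S x \<partial>lborel) \<partial>lborel)"
  proof (rule nn_integral_cong)
    fix y
    show "(\<integral>\<^sup>+x. ?I ?B x * ?I S (x + L y) \<partial>lborel) = (\<integral>\<^sup>+x. ?I ?B (x - L y) * ?I S x \<partial>lborel)"
      using vol_map_nn[OF vol_map_translate, of "\<lambda>x. ?I ?B (x - L y) * ?I S x" "L y"] by simp
  qed
  also have "\<dots> = (\<integral>\<^sup>+x. (\<integral>\<^sup>+y. ?I ?B (x - L y) * ?I S x \<partial>lborel) \<partial>lborel)"
    by (rule lborel_pair.Fubini') measurable
  also have "\<dots> = emeasure lborel ?B * emeasure lborel S"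
    by (simp add: nn_integral_multc B1 nn_integral_cmult)
  finally show "(\<integral>\<^sup>+y. ?I S (L y) \<partial>lborel) = ennreal 1 * emeasure lborel S"
    using eB by (simp add: ennreal_mult_cancel_left)
qed simp

section \<open>Continuity of translations in L^1 and L^2\<close>

lemma integrable_translate:
  fixes f :: "'a::euclidean_space \<Rightarrow> 'b::{banach, second_countable_topology}"
  assumes "integrable lborel f" shows "integrable lborel (\<lambda>x. f (x + a))"
  using vol_map_integrable[OF vol_map_translate, of f a] assms by auto

lemma integral_translate:
  fixes f :: "'a::euclidean_space \<Rightarrow> 'b::{banach, second_countable_topology}"
  assumes "f \<in> borel_measurable borel" shows "(LINT x|lborel. f (x + a)) = (LINT x|lborel. f x)"
  using vol_map_integral[OF vol_map_translate, of f a] assms by auto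

text \<open>The class of functions with this property contains indicators of sets of finite measure
  and is closed under sums and dominated pointwise limits, which is exactly the induction principle
  for integrable functions. Only the indicator case has content; it rests on outer
  regularity.\<close>

lemma L1_translation_continuous:
  fixes f :: "'a::euclidean_space \<Rightarrow> real"
  assumes "integrable lborel f" "h \<longlonglongrightarrow> 0"
  shows "(\<lambda>n. LINT x|lborel. \<bar>f (x + h n) - f x\<bar>) \<longlonglongrightarrow> 0"
  using assms(1)
proof (induction rule: integrable_induct)
  case (base A c)
  then have A[measurable]: "A \<in> sets borel" and fin: "emeasure lborel A < \<infinity>" by auto
  let ?I = "indicator :: 'a set \<Rightarrow> 'a \<Rightarrow> real"
  have iA: "integrable lborel (?I A)" using A fin by simp
  have "(\<lambda>n. LINT x|lborel. \<bar>?I A (x + h n) - ?I A x\<bar>) \<longlonglongrightarrow> 0"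
  proof (rule LIMSEQ_I)
    fix e :: real assume e: "e > 0"
    \<comment> \<open>An open superset with small excess: points of \<open>A\<close> stay inside
      \<open>U\<close> under small shifts, which says nothing about \<open>A\<close> itself but
      controls the part of \<open>A\<close> that is shifted far away.\<close>
    obtain U where U: "open U" "A \<subseteq> U" "emeasure lborel (U - A) < ennreal (e / 4)"
      using outer_regular_lborel[OF A, of "e/4"] e by auto
    have [measurable]: "U \<in> sets borel" using U by auto
    have iU: "integrable lborel (?I (U - A))"
      using U A order.strict_trans[OF U(3) ennreal_less_top] by simp
    have mU: "(LINT x|lborel. ?I (U - A) x) < e / 4"
    proof -
      have "measure lborel (U - A) < e / 4"
        using U(3) e by (metis emeasure_eq_ennreal_measure ennreal_less_iff ennreal_less_top measure_nonneg order_less_imp_not_eq order_less_trans top.not_eq_extremum)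
      then show ?thesis by simp
    qed
    have l1: "(\<lambda>n. LINT x|lborel. ?I A x * (1 - ?I U (x + h n))) \<longlonglongrightarrow> (LINT x::'a|lborel. 0)"
    proof (rule integral_dominated_convergence[where w="?I A"])
      show "AE x in lborel. (\<lambda>n. ?I A x * (1 - ?I U (x + h n))) \<longlonglongrightarrow> 0"
      proof (rule AE_I2)
        fix x
        show "(\<lambda>n. ?I A x * (1 - ?I U (x + h n))) \<longlonglongrightarrow> 0"
        proof (cases "x \<in> A")
          case True
          have "(\<lambda>n. x + h n) \<longlonglongrightarrow> x + 0" by (intro tendsto_intros assms(2))
          then have "\<forall>\<^sub>F n in sequentially. x + h n \<in> U"
            using True U(1,2) by (auto intro: topological_tendstoD)
          then have "\<forall>\<^sub>F n in sequentially. ?I A x * (1 - ?I U (x + h n)) = 0"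
            by eventually_elim auto
          then show ?thesis by (rule tendsto_eventually)
        qed simp
      qed
    qed (use iA in \<open>auto simp: indicator_def\<close>)
    then obtain N where N: "\<And>n. n \<ge> N \<Longrightarrow> (LINT x|lborel. ?I A x * (1 - ?I U (x + h n))) < e / 4"
      using order_tendstoD(2)[OF l1, of "e/4"] e by (auto simp: eventually_sequentially)
    show "\<exists>no. \<forall>n\<ge>no. norm ((LINT x|lborel. \<bar>?I A (x + h n) - ?I A x\<bar>) - 0) < e"
    proof (intro exI[of _ N] allI impI)
      fix n assume n: "n \<ge> N"
      have iT: "integrable lborel (\<lambda>x. ?I A x * (1 - ?I U (x + h n)))"
        by (rule Bochner_Integration.integrable_bound[OF iA]) (auto simp: indicator_def)
      note iUt = integrable_translate[OF iU, of "h n"] and iAt = integrable_translate[OF iA, of "h n"]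
      \<comment> \<open>An absolute value is the number itself plus twice its negative part. The
        number integrates to 0 by translation invariance, and its negative part is 1 only if
        \<open>x\<close> lies in \<open>A\<close> while \<open>x + h n\<close> has left
        \<open>A\<close>, that is, has left \<open>U\<close> or lies in
        \<open>U - A\<close>.\<close>
      have "(LINT x|lborel. \<bar>?I A (x + h n) - ?I A x\<bar>)
         \<le> (LINT x|lborel. 2 * (?I A x * (1 - ?I U (x + h n)) + ?I (U - A) (x + h n)) + (?I A (x + h n) - ?I A x))"
      proof (rule integral_mono)
        show "integrable lborel (\<lambda>x. \<bar>?I A (x + h n) - ?I A x\<bar>)"
          by (intro integrable_abs Bochner_Integration.integrable_diff iAt iA)
        show "integrable lborel (\<lambda>x. 2 * (?I A x * (1 - ?I U (x + h n)) + ?I (U - A) (x + h n)) + (?I A (x + h n) - ?I A x))"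
          by (intro Bochner_Integration.integrable_add integrable_mult_right Bochner_Integration.integrable_diff iT iUt iAt iA)
        show "\<bar>?I A (x + h n) - ?I A x\<bar>
          \<le> 2 * (?I A x * (1 - ?I U (x + h n)) + ?I (U - A) (x + h n)) + (?I A (x + h n) - ?I A x)" for x
          by (auto simp: indicator_def)
      qed
      also have "\<dots> = 2 * ((LINT x|lborel. ?I A x * (1 - ?I U (x + h n))) + (LINT x|lborel. ?I (U - A) (x + h n)))
         + ((LINT x|lborel. ?I A (x + h n)) - (LINT x|lborel. ?I A x))"
        using iT iUt iAt iA by simp
      also have "\<dots> = 2 * ((LINT x|lborel. ?I A x * (1 - ?I U (x + h n))) + (LINT x|lborel. ?I (U - A) x))"
        using integral_translate[of "?I (U - A)" "h n"] integral_translate[of "?I A" "h n"] by simp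
      also have "\<dots> < e" using N[OF n] mU by simp
      finally show "norm ((LINT x|lborel. \<bar>?I A (x + h n) - ?I A x\<bar>) - 0) < e" by simp
    qed
  qed
  from tendsto_mult_left_zero[OF this, of "\<bar>c\<bar>"]
  have "(\<lambda>n. LINT x|lborel. \<bar>c\<bar> * \<bar>?I A (x + h n) - ?I A x\<bar>) \<longlonglongrightarrow> 0"
    by (simp add: mult.commute)
  moreover have "\<bar>c\<bar> * \<bar>?I A (x + h n) - ?I A x\<bar> = \<bar>?I A (x + h n) *\<^sub>R c - ?I A x *\<^sub>R c\<bar>" for x n
    by (simp add: abs_mult[symmetric] algebra_simps)
  ultimately show ?case by simp
next
  case (add f g)
  note tr = integrable_translate
  have "(\<lambda>n. (LINT x|lborel. \<bar>f (x + h n) - f x\<bar>) + (LINT x|lborel. \<bar>g (x + h n) - g x\<bar>)) \<longlonglongrightarrow> 0 + 0"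
    by (intro tendsto_add add)
  then have z: "(\<lambda>n. (LINT x|lborel. \<bar>f (x + h n) - f x\<bar>) + (LINT x|lborel. \<bar>g (x + h n) - g x\<bar>)) \<longlonglongrightarrow> 0" by simp
  show ?case
  proof (rule Lim_null_comparison[OF _ z], rule always_eventually, rule allI)
    fix n
    have i: "integrable lborel (\<lambda>x. \<bar>f (x + h n) - f x\<bar>)" "integrable lborel (\<lambda>x. \<bar>g (x + h n) - g x\<bar>)"
      using add(1,2) tr by (auto intro!: integrable_abs Bochner_Integration.integrable_diff)
    have "(LINT x|lborel. \<bar>f (x + h n) + g (x + h n) - (f x + g x)\<bar>)
       \<le> (LINT x|lborel. \<bar>f (x + h n) - f x\<bar> + \<bar>g (x + h n) - g x\<bar>)"
      using add(1,2) tr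
      by (intro integral_mono integrable_abs Bochner_Integration.integrable_diff Bochner_Integration.integrable_add) auto
    also have "\<dots> = (LINT x|lborel. \<bar>f (x + h n) - f x\<bar>) + (LINT x|lborel. \<bar>g (x + h n) - g x\<bar>)"
      using i by simp
    finally show "norm (LINT x|lborel. \<bar>f (x + h n) + g (x + h n) - (f x + g x)\<bar>) \<le>
       (LINT x|lborel. \<bar>f (x + h n) - f x\<bar>) + (LINT x|lborel. \<bar>g (x + h n) - g x\<bar>)" by simp
  qed
next
  case (lim f s)
  note si = lim(1) and sl = lim(2) and sb = lim(3) and fi = lim(4) and IH = lim(5)
  have [measurable]: "f \<in> borel_measurable borel" "\<And>i. s i \<in> borel_measurable borel" using fi si by auto
  have d: "(\<lambda>i. LINT x|lborel. \<bar>s i x - f x\<bar>) \<longlonglongrightarrow> (LINT x::'a|lborel. 0)"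
  proof (rule integral_dominated_convergence[where w="\<lambda>x. 3 * \<bar>f x\<bar>"])
    show "AE x in lborel. (\<lambda>i. \<bar>s i x - f x\<bar>) \<longlonglongrightarrow> 0"
    proof (rule AE_I2)
      fix x
      have "(\<lambda>i. \<bar>s i x - f x\<bar>) \<longlonglongrightarrow> \<bar>f x - f x\<bar>" by (intro tendsto_intros sl) simp
      then show "(\<lambda>i. \<bar>s i x - f x\<bar>) \<longlonglongrightarrow> 0" by simp
    qed
    show "AE x in lborel. norm \<bar>s i x - f x\<bar> \<le> 3 * \<bar>f x\<bar>" for i
    proof (rule AE_I2)
      fix x show "norm \<bar>s i x - f x\<bar> \<le> 3 * \<bar>f x\<bar>"
        using sb[of x i] by (simp add: abs_if split: if_splits)
    qed
  qed (use fi in auto)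
  show ?case
  proof (rule LIMSEQ_I)
    fix e :: real assume e: "e > 0"
    \<comment> \<open>The distance from \<open>s i\<close> to \<open>f\<close> enters twice, once
      shifted and once unshifted, and the translation of \<open>s i\<close> once: three quarters of
      \<open>e\<close> in total.\<close>
    obtain i where i: "(LINT x|lborel. \<bar>s i x - f x\<bar>) < e / 4"
      using order_tendstoD(2)[OF d, of "e/4"] e by (auto simp: eventually_sequentially)
    obtain N where N: "\<And>n. n \<ge> N \<Longrightarrow> (LINT x|lborel. \<bar>s i (x + h n) - s i x\<bar>) < e / 4"
      using order_tendstoD(2)[OF IH[of i], of "e/4"] e by (auto simp: eventually_sequentially)
    show "\<exists>no. \<forall>n\<ge>no. norm ((LINT x|lborel. \<bar>f (x + h n) - f x\<bar>) - 0) < e"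
    proof (intro exI[of _ N] allI impI)
      fix n assume n: "n \<ge> N"
      have i1: "integrable lborel (\<lambda>x. \<bar>s i x - f x\<bar>)" using si[of i] fi by auto
      have i2: "integrable lborel (\<lambda>x. \<bar>s i (x + h n) - f (x + h n)\<bar>)"
        using integrable_translate[OF i1, of "h n"] by simp
      have i3: "integrable lborel (\<lambda>x. \<bar>s i (x + h n) - s i x\<bar>)"
        using integrable_translate[OF si[of i], of "h n"] si[of i] by auto
      have i4: "integrable lborel (\<lambda>x. \<bar>f (x + h n) - f x\<bar>)"
        using integrable_translate[OF fi, of "h n"] fi by auto
      have "(LINT x|lborel. \<bar>f (x + h n) - f x\<bar>)
        \<le> (LINT x|lborel. \<bar>s i (x + h n) - f (x + h n)\<bar> + \<bar>s i (x + h n) - s i x\<bar> + \<bar>s i x - f x\<bar>)"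
        by (intro integral_mono Bochner_Integration.integrable_add i1 i2 i3 i4) auto
      also have "\<dots> = 2 * (LINT x|lborel. \<bar>s i x - f x\<bar>) + (LINT x|lborel. \<bar>s i (x + h n) - s i x\<bar>)"
        using i1 i2 i3 integral_translate[of "\<lambda>x. \<bar>s i x - f x\<bar>" "h n"] by simp
      also have "\<dots> < e" using N[OF n] i e by linarith
      finally show "norm ((LINT x|lborel. \<bar>f (x + h n) - f x\<bar>) - 0) < e" by simp
    qed
  qed
qed

lemma L2_translate: "L2 f \<Longrightarrow> L2 (\<lambda>x. f (x + a))" "L2 f \<Longrightarrow> n2 (\<lambda>x. f (x + a)) = n2 f"
  using vol_map_L2[OF vol_map_translate] by auto

lemma sq_diff_le: "0 \<le> a \<Longrightarrow> 0 \<le> b \<Longrightarrow> (a - b)\<^sup>2 \<le> \<bar>a\<^sup>2 - (b::real)\<^sup>2\<bar>"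
proof -
  assume ab: "0 \<le> a" "0 \<le> b"
  have "(a - b)\<^sup>2 = \<bar>a - b\<bar> * \<bar>a - b\<bar>" by (simp add: power2_eq_square)
  also have "\<dots> \<le> \<bar>a - b\<bar> * \<bar>a + b\<bar>" using ab by (intro mult_left_mono) auto
  also have "\<dots> = \<bar>a\<^sup>2 - b\<^sup>2\<bar>" by (simp add: abs_mult[symmetric] power2_eq_square algebra_simps)
  finally show ?thesis .
qed

text \<open>For nonnegative numbers the squared difference is at most the difference of the squares,
  so the claim follows from the L^1 statement for the square of \<open>f\<close>.\<close>

lemma L2_translation_nonneg:
  fixes f :: "'a::euclidean_space \<Rightarrow> real"
  assumes f: "L2 f" and nn: "\<And>x. 0 \<le> f x" and h: "h \<longlonglongrightarrow> 0"
  shows "(\<lambda>n. n2 (\<lambda>x. f (x + h n) - f x)) \<longlonglongrightarrow> 0"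
proof -
  have i: "integrable lborel (\<lambda>x. (f x)\<^sup>2)" using L2_int[OF f] by simp
  note z = L1_translation_continuous[OF this h]
  show ?thesis
  proof (rule Lim_null_comparison[OF _ z], rule always_eventually, rule allI)
    fix n
    have "n2 (\<lambda>x. f (x + h n) - f x) \<le> (LINT x|lborel. \<bar>(f (x + h n))\<^sup>2 - (f x)\<^sup>2\<bar>)"
      unfolding n2_def
      using L2_int[OF L2_diff[OF L2_translate(1)[OF f, of "h n"] f]] integrable_translate[OF i, of "h n"] i
      by (intro integral_mono) (auto simp: nn sq_diff_le)
    then show "norm (n2 (\<lambda>x. f (x + h n) - f x)) \<le> (LINT x|lborel. \<bar>(f (x + h n))\<^sup>2 - (f x)\<^sup>2\<bar>)"
      by simp
  qed
qed

lemma n2_sum_Basis: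
  fixes f :: "'a::euclidean_space \<Rightarrow> 'b::euclidean_space"
  assumes "L2 f" shows "n2 f = (\<Sum>b\<in>Basis. n2 (\<lambda>x. f x \<bullet> b))"
proof -
  have [measurable]: "f \<in> borel_measurable borel" using assms by auto
  have L: "L2 (\<lambda>x. f x \<bullet> b)" if "b \<in> Basis" for b
    by (rule L2_dominated(1)[OF assms]) (use that in \<open>auto simp: Basis_le_norm\<close>)
  have "n2 f = (LINT x|lborel. (\<Sum>b\<in>Basis. (f x \<bullet> b)\<^sup>2))"
    unfolding n2_def by (simp add: norm_eq_sqrt_inner euclidean_inner[of "f _" "f _"] sum_nonneg power2_eq_square)
  also have "\<dots> = (\<Sum>b\<in>Basis. n2 (\<lambda>x. f x \<bullet> b))"
    unfolding n2_def using L2_int[OF L] by (subst Bochner_Integration.integral_sum) auto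
  finally show ?thesis .
qed

lemma L2_component: "L2 f \<Longrightarrow> L2 (\<lambda>x. f x \<bullet> e)"
proof -
  assume f: "L2 f"
  then have [measurable]: "f \<in> borel_measurable borel" by auto
  show ?thesis
  proof (rule L2_dominated(1)[OF L2_scaleR[OF f, of "norm e"]], measurable, rule AE_I2)
    fix x show "norm (f x \<bullet> e) \<le> norm (norm e *\<^sub>R f x)"
      using Cauchy_Schwarz_ineq2[of "f x" e] by (simp add: mult.commute)
  qed
qed

lemma L2_translation_continuous:
  fixes f :: "'a::euclidean_space \<Rightarrow> 'b::euclidean_space"
  assumes f: "L2 f" and h: "h \<longlonglongrightarrow> 0"
  shows "(\<lambda>n. n2 (\<lambda>x. f (x + h n) - f x)) \<longlonglongrightarrow> 0"
proof -
  have R: "(\<lambda>n. n2 (\<lambda>x. g (x + h n) - g x)) \<longlonglongrightarrow> 0" if g: "L2 g" for g :: "'a \<Rightarrow> real"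
  proof -
    have [measurable]: "g \<in> borel_measurable borel" using g by auto
    define p where "p x = max 0 (g x)" for x
    define q where "q x = max 0 (- g x)" for x
    have Lp: "L2 p" unfolding p_def by (rule L2_dominated(1)[OF g]) auto
    have Lq: "L2 q" unfolding q_def by (rule L2_dominated(1)[OF g]) auto
    have "(\<lambda>n. 2 * n2 (\<lambda>x. p (x + h n) - p x) + 2 * n2 (\<lambda>x. q (x + h n) - q x)) \<longlonglongrightarrow> 2 * 0 + 2 * 0"
      by (intro tendsto_intros L2_translation_nonneg Lp Lq h) (auto simp: p_def q_def)
    then have z: "(\<lambda>n. 2 * n2 (\<lambda>x. p (x + h n) - p x) + 2 * n2 (\<lambda>x. q (x + h n) - q x)) \<longlonglongrightarrow> 0" by simp
    show ?thesis
    proof (rule Lim_null_comparison[OF _ z], rule always_eventually, rule allI)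
      fix n
      have "(\<lambda>x. g (x + h n) - g x) = (\<lambda>x. (p (x + h n) - p x) - (q (x + h n) - q x))"
        by (auto simp: p_def q_def max_def fun_eq_iff)
      then have "n2 (\<lambda>x. g (x + h n) - g x) \<le> 2 * n2 (\<lambda>x. p (x + h n) - p x) + 2 * n2 (\<lambda>x. q (x + h n) - q x)"
        using n2_diff_le[OF L2_diff[OF L2_translate(1)[OF Lp, of "h n"] Lp] L2_diff[OF L2_translate(1)[OF Lq, of "h n"] Lq]]
        by simp
      then show "norm (n2 (\<lambda>x. g (x + h n) - g x)) \<le> 2 * n2 (\<lambda>x. p (x + h n) - p x) + 2 * n2 (\<lambda>x. q (x + h n) - q x)"
        by simp
    qed
  qed
  have "(\<lambda>n. \<Sum>b\<in>Basis. n2 (\<lambda>x. f (x + h n) \<bullet> b - f x \<bullet> b)) \<longlonglongrightarrow> (\<Sum>b\<in>(Basis::'b set). 0)"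
    by (intro tendsto_sum R L2_component f)
  then show ?thesis
    by (subst n2_sum_Basis[OF L2_diff[OF L2_translate(1)[OF f] f]]) (simp add: inner_diff_left)
qed

section \<open>Test functions and mollification\<close>

definition C1 :: "('a::euclidean_space \<Rightarrow> real) \<Rightarrow> ('a \<Rightarrow> 'a) \<Rightarrow> bool" where
  "C1 f Df \<longleftrightarrow> (\<forall>x. (f has_derivative (\<lambda>h. Df x \<bullet> h)) (at x)) \<and> continuous_on UNIV Df"

definition bsupp :: "('a::euclidean_space \<Rightarrow> 'b::zero) \<Rightarrow> bool" where
  "bsupp f \<longleftrightarrow> (\<exists>R. \<forall>x. norm x \<ge> R \<longrightarrow> f x = 0)"

lemma C1_D: "C1 f Df \<Longrightarrow> (f has_derivative (\<lambda>h. Df x \<bullet> h)) (at x)"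
  by (simp add: C1_def)

lemma C1_cont: "C1 f Df \<Longrightarrow> continuous_on UNIV f"
  using C1_D has_derivative_continuous by (fastforce simp: continuous_on_eq_continuous_at)

lemma C1_contD: "C1 f Df \<Longrightarrow> continuous_on UNIV Df"
  by (simp add: C1_def)

lemma C1_meas: "C1 f Df \<Longrightarrow> f \<in> borel_measurable borel" "C1 f Df \<Longrightarrow> Df \<in> borel_measurable borel"
  by (auto intro: borel_measurable_continuous_onI C1_cont C1_contD)

lemma C1_frechet: "C1 f Df \<Longrightarrow> frechet_derivative f (at x) e = Df x \<bullet> e"
  using frechet_derivative_at[OF C1_D[of f Df x]] by metis

lemma C1_cmult: "C1 f Df \<Longrightarrow> C1 (\<lambda>x. c * f x) (\<lambda>x. c *\<^sub>R Df x)"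
  unfolding C1_def inner_scaleR_left by (auto intro!: continuous_intros has_derivative_mult_right)

lemma C1_mult:
  assumes "C1 f Df" "C1 g Dg"
  shows "C1 (\<lambda>x. f x * g x) (\<lambda>x. f x *\<^sub>R Dg x + g x *\<^sub>R Df x)"
  unfolding C1_def
proof (intro conjI allI)
  fix x
  have "((\<lambda>x. f x * g x) has_derivative (\<lambda>h. f x * (Dg x \<bullet> h) + (Df x \<bullet> h) * g x)) (at x)"
    using assms by (intro has_derivative_mult C1_D)
  then show "((\<lambda>x. f x * g x) has_derivative (\<lambda>h. (f x *\<^sub>R Dg x + g x *\<^sub>R Df x) \<bullet> h)) (at x)"
    by (simp add: inner_add_left mult.commute)
  show "continuous_on UNIV (\<lambda>x. f x *\<^sub>R Dg x + g x *\<^sub>R Df x)"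
    using assms by (intro continuous_intros C1_cont C1_contD)
qed

lemma C1_chain:
  assumes f: "C1 f Df" and F: "\<And>t. (F has_real_derivative F' t) (at t)" and c: "continuous_on UNIV F'"
  shows "C1 (\<lambda>x. F (f x)) (\<lambda>x. F' (f x) *\<^sub>R Df x)"
  unfolding C1_def
proof (intro conjI allI)
  fix x
  have "((\<lambda>x. F (f x)) has_derivative (\<lambda>h. F' (f x) * (Df x \<bullet> h))) (at x)"
    using F[of "f x"] by (intro has_derivative_compose[OF C1_D[OF f]]) (simp add: has_field_derivative_def)
  then show "((\<lambda>x. F (f x)) has_derivative (\<lambda>h. (F' (f x) *\<^sub>R Df x) \<bullet> h)) (at x)" by simp
  show "continuous_on UNIV (\<lambda>x. F' (f x) *\<^sub>R Df x)"
    using continuous_on_compose2[OF c C1_cont[OF f]] by (intro continuous_intros C1_contD[OF f]) auto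
qed

lemma C1_normsq: "C1 (\<lambda>x. (norm (x - a))\<^sup>2) (\<lambda>x. 2 *\<^sub>R (x - a))"
  unfolding C1_def power2_norm_eq_inner
  by (auto intro!: derivative_eq_intros continuous_intros simp: inner_commute algebra_simps)

lemma bsupp_gradient:
  assumes "C1 f Df" "bsupp f" shows "bsupp Df"
proof -
  obtain R where R: "\<And>x. norm x \<ge> R \<Longrightarrow> f x = 0" using assms(2) by (auto simp: bsupp_def)
  have "Df x = 0" if x: "norm x \<ge> R + 1" for x
  proof -
    have "((\<lambda>_. 0) has_derivative (\<lambda>h. Df x \<bullet> h)) (at x)"
    proof (rule has_derivative_transform_within_open[OF C1_D[OF assms(1)]])
      show "open {y. norm y > R}" using open_Collect_less continuous_on_norm_id continuous_on_const by blast
    qed (use x R in auto)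
    then have "(\<lambda>h. Df x \<bullet> h) = (\<lambda>h. 0)"
      using has_derivative_unique has_derivative_const by blast
    then have "Df x \<bullet> Df x = 0" by metis
    then show ?thesis by simp
  qed
  then show ?thesis by (auto simp: bsupp_def)
qed

lemma bsupp_mult_left: "bsupp f \<Longrightarrow> bsupp (\<lambda>x. g x * f x :: real)"
  and bsupp_mult_right: "bsupp f \<Longrightarrow> bsupp (\<lambda>x. f x * g x :: real)"
  by (auto simp: bsupp_def)

lemma bsupp_integrable:
  fixes f :: "'a::euclidean_space \<Rightarrow> 'b::euclidean_space"
  assumes "continuous_on UNIV f" "bsupp f" shows "integrable lborel f"
proof -
  obtain R where R: "\<And>x. norm x \<ge> R \<Longrightarrow> f x = 0" using assms(2) by (auto simp: bsupp_def)
  have "integrable lborel (\<lambda>x. indicator (cball 0 R) x *\<^sub>R f x)"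
    using assms(1) by (intro borel_integrable_compact) (auto intro: continuous_on_subset)
  moreover have "(\<lambda>x. indicator (cball 0 R) x *\<^sub>R f x) = f"
    using R by (force simp: fun_eq_iff indicator_def)
  ultimately show ?thesis by simp
qed

lemma L2_I: "f \<in> borel_measurable borel \<Longrightarrow> integrable lborel (\<lambda>x. (norm (f x))\<^sup>2) \<Longrightarrow> L2 f"
  by (simp add: L2_def del: L2_int)

lemma bsupp_L2:
  fixes f :: "'a::euclidean_space \<Rightarrow> 'b::euclidean_space"
  assumes "continuous_on UNIV f" "bsupp f" shows "L2 f"
proof -
  have "bsupp (\<lambda>x. (norm (f x))\<^sup>2)" using assms(2) by (auto simp: bsupp_def)
  then have "integrable lborel (\<lambda>x. (norm (f x))\<^sup>2)"
    using assms(1) by (intro bsupp_integrable continuous_intros) auto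
  then show ?thesis by (rule L2_I[OF borel_measurable_continuous_onI[OF assms(1)]])
qed

lemma bsupp_bounded:
  fixes f :: "'a::euclidean_space \<Rightarrow> 'b::euclidean_space"
  assumes "continuous_on UNIV f" "bsupp f" shows "\<exists>M\<ge>0. \<forall>x. norm (f x) \<le> M"
proof -
  obtain R where R: "\<And>x. norm x \<ge> R \<Longrightarrow> f x = 0" using assms(2) by (auto simp: bsupp_def)
  have "compact (f ` cball 0 R)"
    using assms(1) by (intro compact_continuous_image) (auto intro: continuous_on_subset)
  then obtain M where M: "\<And>x. x \<in> cball 0 R \<Longrightarrow> norm (f x) \<le> M"
    using compact_imp_bounded[of "f ` cball 0 R"] unfolding bounded_iff by blast
  have "norm (f x) \<le> max M 0" for x
    using M[of x] R[of x] by (cases "norm x \<le> R") auto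
  then show ?thesis by (intro exI[of _ "max M 0"]) auto
qed

text \<open>Difference quotients integrate to 0 by translation invariance and are dominated by the
  Lipschitz constant on a fixed ball. The derivative is required only a.e., so that the lemma also
  covers functions with a kink along a hyperplane, as in
  \<open>half_space_integral_zero\<close>.\<close>

lemma integral_dir_deriv_zero:
  fixes f :: "'a::euclidean_space \<Rightarrow> real"
  assumes fm[measurable]: "f \<in> borel_measurable borel" and gm[measurable]: "g \<in> borel_measurable borel"
    and f: "integrable lborel f" and R: "bsupp f"
    and lip: "\<And>x t. \<bar>t\<bar> \<le> 1 \<Longrightarrow> \<bar>f (x + t *\<^sub>R e) - f x\<bar> \<le> L * \<bar>t\<bar>"
    and lim: "AE x in lborel. (\<lambda>n. (f (x + (1 / real (Suc n)) *\<^sub>R e) - f x) * real (Suc n)) \<longlonglongrightarrow> g x"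
  shows "integrable lborel g" "(LINT x|lborel. g x) = 0"
proof -
  obtain R where R: "\<And>x. norm x \<ge> R \<Longrightarrow> f x = 0" using R by (auto simp: bsupp_def)
  define q where "q n x = (f (x + (1 / real (Suc n)) *\<^sub>R e) - f x) * real (Suc n)" for n x
  have [measurable]: "q n \<in> borel_measurable borel" for n unfolding q_def by measurable
  \<comment> \<open>All steps have length at most \<open>norm e\<close>, so this ball contains the
    supports of all difference quotients.\<close>
  let ?B = "cball 0 (R + norm e) :: 'a set"
  have L0: "0 \<le> L" using order_trans[OF abs_ge_zero lip[of 1 0]] by simp
  have w: "integrable lborel (\<lambda>x. L * indicator ?B x)"
    using emeasure_bounded_finite[of ?B] by (intro integrable_mult_right) (auto simp: less_top)
  have bd: "norm (q n x) \<le> L * indicator ?B x" for n x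
  proof (cases "x \<in> ?B")
    case True
    have "\<bar>q n x\<bar> = \<bar>f (x + (1 / real (Suc n)) *\<^sub>R e) - f x\<bar> * real (Suc n)"
      by (simp add: q_def abs_mult)
    also have "\<dots> \<le> (L * \<bar>1 / real (Suc n)\<bar>) * real (Suc n)"
      by (intro mult_right_mono lip) auto
    finally show ?thesis using True by simp
  next
    case False
    have "norm ((1 / real (Suc n)) *\<^sub>R e) \<le> norm e"
      by (simp add: divide_simps) (simp add: mult_le_cancel_left1)
    then have "norm (x + (1 / real (Suc n)) *\<^sub>R e) \<ge> R"
      using False norm_triangle_ineq2[of x "- ((1 / real (Suc n)) *\<^sub>R e)"] by simp
    moreover have "norm x \<ge> R" using False norm_ge_zero[of e] unfolding mem_cball dist_0_norm by linarith
    ultimately show ?thesis using R L0 by (simp add: q_def)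
  qed
  have z: "(LINT x|lborel. q n x) = 0" for n
  proof -
    have "(LINT x|lborel. q n x) = ((LINT x|lborel. f (x + (1 / real (Suc n)) *\<^sub>R e)) - (LINT x|lborel. f x)) * real (Suc n)"
      unfolding q_def using f integrable_translate[OF f] by simp
    also have "\<dots> = 0" using integral_translate[OF fm] by simp
    finally show ?thesis .
  qed
  have lim': "AE x in lborel. (\<lambda>n. q n x) \<longlonglongrightarrow> g x" using lim by (simp add: q_def)
  show "integrable lborel g"
    by (rule integrable_dominated_convergence[OF _ _ w lim' AE_I2[OF bd]]) auto
  have "(\<lambda>n. LINT x|lborel. q n x) \<longlonglongrightarrow> (LINT x|lborel. g x)"
    by (rule integral_dominated_convergence[OF _ _ w lim' AE_I2[OF bd]]) auto
  then show "(LINT x|lborel. g x) = 0" using z by (simp add: LIMSEQ_const_iff)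
qed

lemma C1_lipschitz:
  assumes "C1 f Df" "\<And>x. norm (Df x) \<le> M"
  shows "\<bar>f x - f y\<bar> \<le> M * norm (x - y)"
proof -
  have "norm (f x - f y) \<le> M * norm (x - y)"
  proof (rule differentiable_bound[of UNIV f "\<lambda>x h. Df x \<bullet> h"])
    fix z
    show "(f has_derivative (\<bullet>) (Df z)) (at z)" using C1_D[OF assms(1)] .
    show "onorm ((\<bullet>) (Df z)) \<le> M"
      using assms(2)[of z] by (intro onorm_le) (smt (verit) Cauchy_Schwarz_ineq2 mult_right_mono norm_ge_zero real_norm_def)
  qed auto
  then show ?thesis by simp
qed

lemma dir_difference_quotient:
  assumes "(f has_derivative (\<lambda>h. d \<bullet> h)) (at x)"
  shows "(\<lambda>n. (f (x + (1 / real (Suc n)) *\<^sub>R e) - f x) * real (Suc n)) \<longlonglongrightarrow> (d \<bullet> e :: real)"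
proof -
  have "((\<lambda>t. f (x + t *\<^sub>R e)) has_derivative (\<lambda>t. d \<bullet> (t *\<^sub>R e))) (at 0)"
    by (rule has_derivative_compose[of "\<lambda>t. x + t *\<^sub>R e" "\<lambda>t. t *\<^sub>R e"])
      (use assms in \<open>auto intro!: derivative_eq_intros\<close>)
  then have "((\<lambda>t. f (x + t *\<^sub>R e)) has_real_derivative (d \<bullet> e)) (at 0)"
    by (simp add: has_field_derivative_def mult.commute[of _ "d \<bullet> e"])
  then have l: "((\<lambda>h. (f (x + h *\<^sub>R e) - f x) / h) \<longlongrightarrow> d \<bullet> e) (at 0)"
    by (simp add: DERIV_def)
  have "filterlim (\<lambda>n. 1 / real (Suc n)) (at 0) sequentially"
    using LIMSEQ_Suc[OF lim_1_over_n] by (auto simp: filterlim_at)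
  from filterlim_compose[OF l this] show ?thesis by simp
qed

lemma C1_integral_zero:
  assumes "C1 f Df" "bsupp f"
  shows "(LINT x|lborel. Df x \<bullet> e) = 0"
proof -
  obtain M where M: "\<And>x. norm (Df x) \<le> M"
    using bsupp_bounded[OF C1_contD bsupp_gradient] assms by blast
  show ?thesis
  proof (rule integral_dir_deriv_zero(2))
    show "f \<in> borel_measurable borel" "(\<lambda>x. Df x \<bullet> e) \<in> borel_measurable borel"
      using C1_meas[OF assms(1)] by auto
    show "integrable lborel f" using assms bsupp_integrable C1_cont by blast
    show "bsupp f" by fact
    show "\<bar>f (x + t *\<^sub>R e) - f x\<bar> \<le> (M * norm e) * \<bar>t\<bar>" for x t
      using C1_lipschitz[OF assms(1) M, of "x + t *\<^sub>R e" x] by (simp add: mult_ac)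
    show "AE x in lborel. (\<lambda>n. (f (x + (1 / real (Suc n)) *\<^sub>R e) - f x) * real (Suc n)) \<longlonglongrightarrow> Df x \<bullet> e"
      using dir_difference_quotient C1_D[OF assms(1)] by blast
  qed
qed

lemma C1_integration_by_parts:
  assumes u: "C1 u Du" and p: "C1 \<psi> D\<psi>" and b: "bsupp \<psi>"
  shows "(LINT x|lborel. u x * (D\<psi> x \<bullet> e)) = - (LINT x|lborel. \<psi> x * (Du x \<bullet> e))"
proof -
  note c = C1_cont[OF u] C1_cont[OF p] C1_contD[OF u] C1_contD[OF p]
  have bD: "bsupp D\<psi>" by (rule bsupp_gradient[OF p b])
  have "integrable lborel (\<lambda>x. u x * (D\<psi> x \<bullet> e))"
    using bD by (intro bsupp_integrable continuous_intros c) (auto simp: bsupp_def, metis inner_zero_left)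
  moreover have "integrable lborel (\<lambda>x. \<psi> x * (Du x \<bullet> e))"
    using bsupp_mult_right[OF b] by (intro bsupp_integrable continuous_intros c)
  moreover have "(LINT x|lborel. (u x *\<^sub>R D\<psi> x + \<psi> x *\<^sub>R Du x) \<bullet> e) = 0"
    by (rule C1_integral_zero[OF C1_mult[OF u p] bsupp_mult_left[OF b]])
  ultimately show ?thesis by (simp add: inner_add_left)
qed

text \<open>Continuity of the partial derivatives comes from their own differentiability, the case
  \<open>ds = [i]\<close> of \<open>smooth_fun\<close>.\<close>

lemma smooth_fun_C1:
  fixes f :: "'a::euclidean_space \<Rightarrow> real"
  assumes "smooth_fun f"
  shows "C1 f (\<lambda>x. \<Sum>i\<in>Basis. frechet_derivative f (at x) i *\<^sub>R i)"
  unfolding C1_def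
proof (intro conjI allI)
  fix x :: 'a
  have "dderiv [] f differentiable (at x)" using assms unfolding smooth_fun_def by blast
  then have d: "f differentiable (at x)" by simp
  then interpret linear "frechet_derivative f (at x)" by (rule linear_frechet_derivative)
  have "frechet_derivative f (at x) = (\<lambda>h. (\<Sum>i\<in>Basis. frechet_derivative f (at x) i *\<^sub>R i) \<bullet> h)"
  proof
    fix h
    have "frechet_derivative f (at x) h = frechet_derivative f (at x) (\<Sum>i\<in>Basis. (h \<bullet> i) *\<^sub>R i)"
      by (simp add: euclidean_representation)
    also have "\<dots> = (\<Sum>i\<in>Basis. frechet_derivative f (at x) i *\<^sub>R i) \<bullet> h"
      by (simp add: sum scale inner_sum_left) (simp add: inner_commute mult.commute)
    finally show "frechet_derivative f (at x) h = (\<Sum>i\<in>Basis. frechet_derivative f (at x) i *\<^sub>R i) \<bullet> h" .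
  qed
  then show "(f has_derivative (\<lambda>h. (\<Sum>i\<in>Basis. frechet_derivative f (at x) i *\<^sub>R i) \<bullet> h)) (at x)"
    using frechet_derivative_works[of f "at x"] d by metis
next
  have "continuous_on UNIV (\<lambda>x. frechet_derivative f (at x) i)" for i
  proof (rule differentiable_imp_continuous_on)
    have "\<And>x. dderiv [i] f differentiable (at x)" using assms unfolding smooth_fun_def by blast
    then show "(\<lambda>x. frechet_derivative f (at x) i) differentiable_on UNIV"
      by (simp add: differentiable_on_def)
  qed
  then show "continuous_on UNIV (\<lambda>x. \<Sum>i\<in>Basis. frechet_derivative f (at x) i *\<^sub>R i)"
    by (intro continuous_intros)
qed

lemma test_fun_bsupp: "test_fun f \<Longrightarrow> bsupp f"
proof -
  assume "test_fun f"
  then have "bounded (closure {x. f x \<noteq> 0})" by (simp add: test_fun_def compact_imp_bounded)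
  then obtain b where b: "\<forall>x\<in>closure {x. f x \<noteq> 0}. norm x \<le> b" unfolding bounded_iff by blast
  have "f x = 0" if "norm x \<ge> b + 1" for x
    using b closure_subset[of "{x. f x \<noteq> 0}"] that by fastforce
  then show ?thesis by (auto simp: bsupp_def)
qed

section \<open>Smooth bump functions and a radial mollifier\<close>

definition flat :: "nat \<Rightarrow> real \<Rightarrow> real" where
  "flat k t = (if t > 0 then exp (- 1 / t) / t ^ k else 0)"

lemma power_div_fact_le_exp: "0 \<le> x \<Longrightarrow> x ^ n / fact n \<le> exp (x::real)"
proof -
  assume x: "0 \<le> x"
  have "(\<Sum>i\<in>{n}. x ^ i /\<^sub>R fact i) \<le> (\<Sum>i. x ^ i /\<^sub>R fact i)"
    using x sums_summable[OF exp_converges[of x]] by (intro sum_le_suminf) auto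
  then show ?thesis using sums_unique[OF exp_converges[of x]] by (simp add: divide_inverse mult.commute)
qed

text \<open>From the single term of order \<open>k + 2\<close> in the exponential series at
  \<open>1 / t\<close>. A quadratic bound is what forces the derivative at 0 to vanish.\<close>

lemma flat_bound: "\<bar>flat k t\<bar> \<le> fact (k + 2) * t\<^sup>2"
proof (cases "t > 0")
  case True
  have "(1 / t) ^ (k + 2) / fact (k + 2) \<le> exp (1 / t)"
    using True by (intro power_div_fact_le_exp) auto
  then have "exp (- (1 / t)) \<le> fact (k + 2) * t ^ (k + 2)"
    using True by (simp add: exp_minus power_divide divide_simps del: fact_Suc power_Suc add_2_eq_Suc')
      (simp add: mult_ac del: fact_Suc power_Suc add_2_eq_Suc')
  then have "exp (- (1 / t)) / t ^ k \<le> fact (k + 2) * t ^ (k + 2) / t ^ k"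
    using True by (intro divide_right_mono) auto
  also have "\<dots> = fact (k + 2) * t\<^sup>2" using True by (simp add: power_add power2_eq_square)
  finally show ?thesis using True by (simp add: flat_def)
qed (simp add: flat_def)

text \<open>The powers of \<open>t\<close> in the denominator are there for this formula: it shows
  that the family \<open>flat k\<close> is closed under differentiation up to linear
  combinations.\<close>

lemma flat_deriv: "(flat k has_real_derivative flat (k + 2) t - real k * flat (k + 1) t) (at t)"
proof (cases "t = 0")
  case True
  have "(\<lambda>h. flat k (0 + h) / h) \<midarrow>0\<rightarrow> 0"
  proof (rule Lim_null_comparison)
    show "\<forall>\<^sub>F h in at 0. norm (flat k (0 + h) / h) \<le> fact (k + 2) * \<bar>h\<bar>"
    proof (rule eventually_at_filter[THEN iffD2], rule always_eventually, intro allI impI)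
      fix h :: real assume h: "h \<noteq> 0"
      have "\<bar>flat k h\<bar> / \<bar>h\<bar> \<le> fact (k + 2) * h\<^sup>2 / \<bar>h\<bar>" using flat_bound by (intro divide_right_mono) auto
      also have "\<dots> = fact (k + 2) * (h\<^sup>2 / \<bar>h\<bar>)" by simp
      also have "h\<^sup>2 / \<bar>h\<bar> = \<bar>h\<bar>" using h by (simp add: power2_eq_square abs_if)
      finally show "norm (flat k (0 + h) / h) \<le> fact (k + 2) * \<bar>h\<bar>" by simp
    qed
    have "(\<lambda>h. fact (k + 2) * \<bar>h\<bar>) \<midarrow>0\<rightarrow> fact (k + 2) * \<bar>0::real\<bar>" by (intro tendsto_intros)
    then show "(\<lambda>h::real. fact (k + 2) * \<bar>h\<bar>) \<midarrow>0\<rightarrow> (0::real)" by simp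
  qed
  then show ?thesis using True by (simp add: DERIV_def flat_def)
next
  case False
  show ?thesis
  proof (cases "t > 0")
    case True
    have "((\<lambda>t. exp (- 1 / t) / t ^ k) has_real_derivative
        exp (- 1 / t) / t ^ (k + 2) - real k * (exp (- 1 / t) / t ^ (k + 1))) (at t)"
    proof -
      have "((\<lambda>t. exp (- 1 / t) / t ^ k) has_real_derivative
        (exp (- 1 / t) * (1 / (t * t)) * t ^ k - exp (- 1 / t) * (real k * t ^ (k - 1))) / (t ^ k * t ^ k)) (at t)"
        using True by (auto intro!: derivative_eq_intros)
      moreover have e: "real k * t ^ (k - 1) = real k * t ^ k / t" using True by (cases k) auto
      moreover have "(exp (- 1 / t) * (1 / (t * t)) * t ^ k - exp (- 1 / t) * (real k * t ^ (k - 1))) / (t ^ k * t ^ k)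
        = exp (- 1 / t) / t ^ (k + 2) - real k * (exp (- 1 / t) / t ^ (k + 1))"
        unfolding e using True by (simp add: field_simps)
      ultimately show ?thesis by simp
    qed
    then have "((\<lambda>t. exp (- 1 / t) / t ^ k) has_real_derivative flat (k + 2) t - real k * flat (k + 1) t) (at t)"
      using True by (simp add: flat_def)
    then show ?thesis
      by (rule has_field_derivative_transform_within_open[of _ _ _ "{0<..}"]) (use True in \<open>auto simp: flat_def\<close>)
  next
    case nt: False
    have "((\<lambda>t. 0) has_real_derivative flat (k + 2) t - real k * flat (k + 1) t) (at t)"
      using nt by (simp add: flat_def)
    then show ?thesis
      by (rule has_field_derivative_transform_within_open[of _ _ _ "{..<0}"]) (use False nt in \<open>auto simp: flat_def\<close>)
  qed
qed

text \<open>A class of functions containing the translates of the bump \<open>flat 0 (r\<^sup>2 - |x|\<^sup>2)\<close> and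
  closed under directional derivatives, which makes its members smooth.\<close>
inductive bump_algebra :: "('a::euclidean_space \<Rightarrow> real) \<Rightarrow> bool" where
  const: "bump_algebra (\<lambda>x. c)"
| lin: "bump_algebra (\<lambda>x. x \<bullet> d)"
| flat: "bump_algebra (\<lambda>x. flat k (s - (norm (x - a))\<^sup>2))"
| add: "bump_algebra f \<Longrightarrow> bump_algebra g \<Longrightarrow> bump_algebra (\<lambda>x. f x + g x)"
| mult: "bump_algebra f \<Longrightarrow> bump_algebra g \<Longrightarrow> bump_algebra (\<lambda>x. f x * g x)"

lemma bump_algebra_derivative:
  "bump_algebra f \<Longrightarrow> \<exists>D. (\<forall>x. (f has_derivative D x) (at x)) \<and> (\<forall>d. bump_algebra (\<lambda>x. D x d))"
proof (induction rule: bump_algebra.induct)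
  case (const c)
  show ?case by (rule exI[of _ "\<lambda>x h. 0"]) (auto intro: bump_algebra.const)
next
  case (lin d)
  show ?case by (rule exI[of _ "\<lambda>x h. h \<bullet> d"]) (auto intro!: bump_algebra.const derivative_eq_intros)
next
  case (flat k s a)
  \<comment> \<open>The derivative is written with sums and products only, all signs being moved
    into constants, so that the introduction rules of \<open>bump_algebra\<close> apply
    literally.\<close>
  let ?D = "\<lambda>x h. (flat (k + 2) (s - (norm (x - a))\<^sup>2) + - real k * flat (k + 1) (s - (norm (x - a))\<^sup>2)) * (-2 * (x \<bullet> h + - (a \<bullet> h)))"
  show ?case
  proof (rule exI[of _ ?D], intro conjI allI)
    fix x
    have "((\<lambda>x. s - (norm (x - a))\<^sup>2) has_derivative (\<lambda>h. -2 * (x \<bullet> h + - (a \<bullet> h)))) (at x)"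
      unfolding power2_norm_eq_inner
      by (auto intro!: derivative_eq_intros simp: inner_commute algebra_simps)
    from has_derivative_compose[OF this flat_deriv[of k, unfolded has_field_derivative_def]]
    show "((\<lambda>x. flat k (s - (norm (x - a))\<^sup>2)) has_derivative ?D x) (at x)" by simp
  next
    fix d
    show "bump_algebra (\<lambda>x. ?D x d)" by (intro bump_algebra.intros)
  qed
next
  case (add f g)
  then obtain D E where "\<forall>x. (f has_derivative D x) (at x)" "\<forall>d. bump_algebra (\<lambda>x. D x d)"
    "\<forall>x. (g has_derivative E x) (at x)" "\<forall>d. bump_algebra (\<lambda>x. E x d)" by blast
  then show ?case
    by (intro exI[of _ "\<lambda>x h. D x h + E x h"]) (auto intro: bump_algebra.add has_derivative_add)
next
  case (mult f g)
  from mult.IH obtain D E where "\<forall>x. (f has_derivative D x) (at x)" "\<forall>d. bump_algebra (\<lambda>x. D x d)"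
    "\<forall>x. (g has_derivative E x) (at x)" "\<forall>d. bump_algebra (\<lambda>x. E x d)" by blast
  then show ?case
    by (intro exI[of _ "\<lambda>x h. f x * E x h + D x h * g x"])
      (simp add: bump_algebra.add bump_algebra.mult has_derivative_mult mult.hyps)
qed

lemma bump_algebra_smooth: "bump_algebra f \<Longrightarrow> smooth_fun f"
proof -
  assume f: "bump_algebra f"
  have "bump_algebra (dderiv ds f)" for ds
  proof (induction ds)
    case (Cons d ds)
    obtain D where D: "\<forall>x. (dderiv ds f has_derivative D x) (at x)" "\<forall>d. bump_algebra (\<lambda>x. D x d)"
      using bump_algebra_derivative[OF Cons] by blast
    then have "frechet_derivative (dderiv ds f) (at x) = D x" for x
      using frechet_derivative_at by metis
    then show ?case using D by simp
  qed (simp add: f)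
  then show ?thesis
    unfolding smooth_fun_def using bump_algebra_derivative differentiable_def by metis
qed

definition bump :: "real \<Rightarrow> 'a::euclidean_space \<Rightarrow> real" where
  "bump r x = flat 0 (r\<^sup>2 - (norm x)\<^sup>2)"

text \<open>Besides being smooth and of mass 1, this kernel is radial and radially nonincreasing.
  Radiality preserves oddness under reflections (\<open>sob_half_space\<close>), and monotonicity
  transfers polarization inequalities to mollified functions
  (\<open>extremal_moll_antimono\<close>).\<close>

definition kern :: "real \<Rightarrow> 'a::euclidean_space \<Rightarrow> real" where
  "kern r x = bump r x / (LINT y::'a|lborel. bump r y)"

lemma bump_nonneg: "0 \<le> bump r x"
  by (simp add: bump_def flat_def)

lemma bump_zero: "0 < r \<Longrightarrow> norm x \<ge> r \<Longrightarrow> bump r x = 0"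
  using power_mono[of r "norm x" 2] by (simp add: bump_def flat_def not_less)

lemma bump_pos: "norm x < r \<Longrightarrow> 0 < bump r x"
  using power_strict_mono[of "norm x" r 2] by (simp add: bump_def flat_def)

lemma flat_mono: "a \<le> b \<Longrightarrow> flat 0 a \<le> flat 0 b"
  by (auto simp: flat_def divide_simps)

lemma bump_antimono: "norm x \<le> norm y \<Longrightarrow> bump r y \<le> bump r x"
  unfolding bump_def using power_mono[of "norm x" "norm y" 2] by (intro flat_mono) auto

lemma bump_C1: "\<exists>D. C1 (bump r :: 'a::euclidean_space \<Rightarrow> real) D"
  using smooth_fun_C1[OF bump_algebra_smooth[OF bump_algebra.flat[of 0 "r\<^sup>2" "0::'a"]]]
  unfolding bump_def by auto

lemma bump_bsupp: "0 < r \<Longrightarrow> bsupp (bump r)"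
  using bump_zero unfolding bsupp_def by blast

lemma bump_integrable: "0 < r \<Longrightarrow> integrable lborel (bump r)"
  using bump_C1 C1_cont bump_bsupp bsupp_integrable by blast

lemma bump_integral_pos:
  assumes "0 < r" shows "0 < (LINT y::'a::euclidean_space|lborel. bump r y)"
proof -
  have "(LINT y::'a|lborel. bump r y) \<noteq> 0"
  proof
    assume "(LINT y::'a|lborel. bump r y) = 0"
    then have "AE x::'a in lborel. bump r x = 0"
      using integral_nonneg_eq_0_iff_AE[OF bump_integrable[OF assms]] by (auto simp: bump_nonneg)
    then have "AE x::'a in lborel. x \<notin> ball 0 r"
      by eventually_elim (auto dest: bump_pos)
    then have "ball (0::'a) r \<in> null_sets lborel" by (subst AE_iff_null_sets) auto
    then show False using open_not_negligible[of "ball (0::'a) r"] assms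
      by (auto simp: negligible_iff_null_sets null_sets_completionI)
  qed
  moreover have "0 \<le> (LINT y::'a|lborel. bump r y)" by (simp add: bump_nonneg)
  ultimately show ?thesis by simp
qed

lemma kern_nonneg: "0 < r \<Longrightarrow> 0 \<le> kern r x"
  by (simp add: kern_def bump_nonneg)

lemma kern_zero: "0 < r \<Longrightarrow> norm x \<ge> r \<Longrightarrow> kern r x = 0"
  by (simp add: kern_def bump_zero)

lemma kern_antimono:
  fixes x y :: "'a::euclidean_space"
  shows "0 < r \<Longrightarrow> norm x \<le> norm y \<Longrightarrow> kern r y \<le> kern r x"
  unfolding kern_def by (intro divide_right_mono bump_antimono) (auto intro!: less_imp_le[OF bump_integral_pos])

lemma kern_integral: "0 < r \<Longrightarrow> (LINT y::'a::euclidean_space|lborel. kern r y) = 1"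
  using bump_integral_pos[where 'a='a, of r] by (simp add: kern_def)

lemma kern_C1: "\<exists>D. C1 (kern r :: 'a::euclidean_space \<Rightarrow> real) D"
proof -
  obtain D where "C1 (bump r :: 'a \<Rightarrow> real) D" using bump_C1 by blast
  from C1_cmult[OF this, of "1 / (LINT y::'a|lborel. bump r y)"] show ?thesis
    unfolding kern_def[abs_def] by auto
qed

lemma kern_cont: "continuous_on UNIV (kern r)"
  using kern_C1 C1_cont by blast

lemma kern_meas [measurable]: "kern r \<in> borel_measurable borel"
  using kern_cont by (rule borel_measurable_continuous_onI)

lemma kern_bsupp: "0 < r \<Longrightarrow> bsupp (kern r)"
  using kern_zero unfolding bsupp_def by blast

lemma kern_integrable: "0 < r \<Longrightarrow> integrable lborel (kern r)"
  by (rule bsupp_integrable[OF kern_cont kern_bsupp])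

lemma kern_le: "0 < r \<Longrightarrow> kern r (x::'a::euclidean_space) \<le> kern r (0::'a)"
  by (rule kern_antimono) auto

lemma kern_test_fun:
  fixes x :: "'a::euclidean_space"
  assumes "0 < r" shows "test_fun (\<lambda>y. kern r (x - y))"
proof -
  let ?Z = "LINT y::'a|lborel. bump r y"
  have "bump_algebra (\<lambda>y. (1 / ?Z) * flat 0 (r\<^sup>2 - (norm (y - x))\<^sup>2))"
    by (intro bump_algebra.intros)
  then have "smooth_fun (\<lambda>y. kern r (x - y))"
    using bump_algebra_smooth by (simp add: kern_def bump_def norm_minus_commute)
  moreover have "{y. kern r (x - y) \<noteq> 0} \<subseteq> cball x r"
    using kern_zero[OF assms] by (force simp: dist_norm)
  then have "bounded {y. kern r (x - y) \<noteq> 0}" using bounded_cball bounded_subset by blast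
  then have "compact (closure {y. kern r (x - y) \<noteq> 0})" by (simp add: compact_closure)
  ultimately show ?thesis by (simp add: test_fun_def)
qed

section \<open>Mollification of square integrable functions and differentiation of
  convolutions\<close>

definition moll :: "real \<Rightarrow> ('a::euclidean_space \<Rightarrow> 'b::euclidean_space) \<Rightarrow> 'a \<Rightarrow> 'b" where
  "moll r f x = (LINT y|lborel. kern r y *\<^sub>R f (x - y))"

lemma kern_L2: "0 < r \<Longrightarrow> L2 (kern r)"
  by (rule bsupp_L2[OF kern_cont kern_bsupp])

lemma L2_flip: "L2 f \<Longrightarrow> L2 (\<lambda>y. f (x - y))" "L2 f \<Longrightarrow> n2 (\<lambda>y. f (x - y)) = n2 f"
  using vol_map_L2[OF vol_map_flip] by auto

lemma moll_integrable: "0 < r \<Longrightarrow> L2 f \<Longrightarrow> integrable lborel (\<lambda>y. kern r y *\<^sub>R f (x - y))"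
  by (intro L2_scaleR_integrable kern_L2 L2_flip)

lemma moll_flip:
  fixes x :: "'a::euclidean_space" and f :: "'a \<Rightarrow> 'b::euclidean_space"
  assumes "f \<in> borel_measurable borel"
  shows "moll r f x = (LINT y|lborel. kern r (x - y) *\<^sub>R f y)"
proof -
  have [measurable]: "f \<in> borel_measurable borel" by fact
  have "(\<lambda>y. kern r y *\<^sub>R f (x - y)) \<in> borel_measurable borel" by measurable
  from vol_map_integral[OF vol_map_flip this, of x] show ?thesis by (simp add: moll_def)
qed

lemma moll_meas:
  fixes f :: "'a::euclidean_space \<Rightarrow> 'b::euclidean_space"
  assumes [measurable]: "f \<in> borel_measurable borel"
  shows "moll r f \<in> borel_measurable borel"
  unfolding moll_def[abs_def] by (rule lborel.borel_measurable_lebesgue_integral) measurable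

lemma moll_diff:
  assumes "0 < r" "L2 f" "L2 g"
  shows "moll r (\<lambda>x. f x - g x) x = moll r f x - moll r g x"
  unfolding moll_def scaleR_diff_right using assms moll_integrable
  by (intro Bochner_Integration.integral_diff) auto

lemma moll_add:
  assumes "0 < r" "L2 f" "L2 g"
  shows "moll r (\<lambda>x. f x + g x) x = moll r f x + moll r g x"
  unfolding moll_def scaleR_add_right using assms moll_integrable
  by (intro Bochner_Integration.integral_add) auto

lemma moll_cong_AE:
  assumes "AE x in lborel. f x = g x" "f \<in> borel_measurable borel" "g \<in> borel_measurable borel"
  shows "moll r f x = moll r g x"
proof -
  have "(\<lambda>y. kern r (x - y) *\<^sub>R f y) \<in> borel_measurable lborel"
    "(\<lambda>y. kern r (x - y) *\<^sub>R g y) \<in> borel_measurable lborel"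
    using assms(2,3) by measurable
  then show ?thesis
    unfolding moll_flip[OF assms(2)] moll_flip[OF assms(3)]
    using assms(1) by (intro integral_cong_AE) auto
qed

text \<open>Jensen's inequality for the probability density \<open>k\<close>, in the form of the
  nonnegativity of a variance.\<close>
lemma weighted_mean_sq_le:
  fixes g :: "'a::euclidean_space \<Rightarrow> 'b::euclidean_space"
  assumes k: "integrable lborel k" "\<And>x. 0 \<le> k x" "(LINT x|lborel. k x) = 1"
    and gm[measurable]: "g \<in> borel_measurable borel"
  shows "ennreal ((norm (LINT x|lborel. k x *\<^sub>R g x))\<^sup>2) \<le> (\<integral>\<^sup>+x. ennreal (k x * (norm (g x))\<^sup>2) \<partial>lborel)"
proof (cases "(\<integral>\<^sup>+x. ennreal (k x * (norm (g x))\<^sup>2) \<partial>lborel) = \<infinity>")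
  case False
  have km[measurable]: "k \<in> borel_measurable borel" using k by auto
  have i2: "integrable lborel (\<lambda>x. k x * (norm (g x))\<^sup>2)"
    using False k(2) by (intro integrableI_nonneg) (auto simp: less_top[symmetric])
  have "norm (k x *\<^sub>R g x) \<le> norm (k x + k x * (norm (g x))\<^sup>2)" for x
  proof -
    have "norm (g x) \<le> 1 + (norm (g x))\<^sup>2"
      using sum_squares_bound[of "norm (g x)" 1] norm_ge_zero[of "g x"]
      unfolding one_power2 mult_1_right by linarith
    from mult_left_mono[OF this k(2)[of x]]
    have "k x * norm (g x) \<le> k x + k x * (norm (g x))\<^sup>2" by (simp add: distrib_left)
    moreover have "0 \<le> k x + k x * (norm (g x))\<^sup>2" using k(2)[of x] by simp
    moreover have "norm (k x *\<^sub>R g x) = k x * norm (g x)" using k(2)[of x] by simp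
    ultimately show ?thesis unfolding real_norm_def by linarith
  qed
  then have i1: "integrable lborel (\<lambda>x. k x *\<^sub>R g x)"
    by (intro Bochner_Integration.integrable_bound[OF Bochner_Integration.integrable_add[OF k(1) i2]] AE_I2) measurable
  define c where "c = (LINT x|lborel. k x *\<^sub>R g x)"
  have "0 \<le> (LINT x|lborel. k x * (norm (g x - c))\<^sup>2)" using k by simp
  also have "\<dots> = (LINT x|lborel. k x * (norm (g x))\<^sup>2 - 2 * (k x *\<^sub>R g x \<bullet> c) + k x * (norm c)\<^sup>2)"
    by (intro Bochner_Integration.integral_cong)
      (auto simp: power2_norm_eq_inner inner_diff_left inner_diff_right inner_commute algebra_simps)
  also have "\<dots> = (LINT x|lborel. k x * (norm (g x))\<^sup>2) - 2 * (c \<bullet> c) + (norm c)\<^sup>2"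
    using i1 i2 k by (simp add: c_def del: inner_scaleR_left)
  finally have "(norm c)\<^sup>2 \<le> (LINT x|lborel. k x * (norm (g x))\<^sup>2)"
    by (simp add: power2_norm_eq_inner)
  then show ?thesis using nn_integral_eq_integral[OF i2] k(2) by (simp add: c_def ennreal_leI)
qed simp

text \<open>Jensen's inequality followed by Tonelli; only the \<open>y\<close> in the support of the
  kernel contribute. With \<open>F y\<close> a translate of \<open>f\<close> it gives contractivity
  of mollification, and with \<open>F y\<close> the difference of \<open>f\<close> and a translate
  it gives convergence.\<close>

lemma kern_average_L2:
  fixes F :: "'a::euclidean_space \<Rightarrow> 'a \<Rightarrow> 'b::euclidean_space"
  assumes r: "0 < r" and Fm[measurable]: "(\<lambda>(y, x). F y x) \<in> borel_measurable (borel \<Otimes>\<^sub>M borel)"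
    and L: "\<And>y. L2 (F y)" and d: "\<And>y. norm y \<le> r \<Longrightarrow> n2 (F y) \<le> \<delta>"
  shows "L2 (\<lambda>x. LINT y|lborel. kern r y *\<^sub>R F y x)" "n2 (\<lambda>x. LINT y|lborel. kern r y *\<^sub>R F y x) \<le> \<delta>"
proof -
  let ?M = "\<lambda>x. LINT y|lborel. kern r y *\<^sub>R F y x"
  have d0: "0 \<le> \<delta>" using order_trans[OF n2_nonneg[of "F 0"] d[of 0]] r by simp
  have Fm1: "(\<lambda>x. F y x) \<in> borel_measurable borel" for y using L by auto
  have [measurable]: "(\<lambda>(x, y). kern r y *\<^sub>R F y x) \<in> borel_measurable (borel \<Otimes>\<^sub>M borel)"
    using measurable_compose[OF measurable_Pair[OF measurable_snd measurable_fst] Fm] by (simp add: case_prod_beta')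
  have Mm[measurable]: "?M \<in> borel_measurable borel"
    by (rule lborel.borel_measurable_lebesgue_integral) simp
  have m2[measurable]: "(\<lambda>y. F y x) \<in> borel_measurable borel" for x
    using measurable_compose[OF measurable_Pair2'[of x] Fm] measurable_compose[OF measurable_Pair1' Fm] by auto
  have [measurable]: "(\<lambda>(x, y). ennreal (kern r y * (norm (F y x))\<^sup>2)) \<in> borel_measurable (borel \<Otimes>\<^sub>M borel)"
    using measurable_compose[OF measurable_Pair[OF measurable_snd measurable_fst] Fm] by (simp add: case_prod_beta')
  have "(\<integral>\<^sup>+x. ennreal ((norm (?M x))\<^sup>2) \<partial>lborel)
      \<le> (\<integral>\<^sup>+x. \<integral>\<^sup>+y. ennreal (kern r y * (norm (F y x))\<^sup>2) \<partial>lborel \<partial>lborel)"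
    by (intro nn_integral_mono weighted_mean_sq_le kern_integrable kern_nonneg kern_integral r m2)
  also have "\<dots> = (\<integral>\<^sup>+y. \<integral>\<^sup>+x. ennreal (kern r y * (norm (F y x))\<^sup>2) \<partial>lborel \<partial>lborel)"
    by (rule lborel_pair.Fubini') simp
  also have "\<dots> \<le> (\<integral>\<^sup>+y. ennreal (kern r (y::'a)) * ennreal \<delta> \<partial>lborel)"
  proof (rule nn_integral_mono)
    fix y :: 'a
    have "(\<integral>\<^sup>+x. ennreal (kern r y * (norm (F y x))\<^sup>2) \<partial>lborel)
       = (\<integral>\<^sup>+x. ennreal (kern r y) * ennreal ((norm (F y x))\<^sup>2) \<partial>lborel)"
      using kern_nonneg[OF r, of y] by (simp add: ennreal_mult)
    also have "\<dots> = ennreal (kern r y) * (\<integral>\<^sup>+x. ennreal ((norm (F y x))\<^sup>2) \<partial>lborel)"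
      using Fm1 by (intro nn_integral_cmult) auto
    also have "\<dots> = ennreal (kern r y) * ennreal (n2 (F y))"
      unfolding n2_def by (subst nn_integral_eq_integral[OF L2_int[OF L]]) auto
    also have "\<dots> \<le> ennreal (kern r y) * ennreal \<delta>"
    proof (cases "norm y \<le> r")
      case True
      then show ?thesis by (intro mult_left_mono ennreal_leI d) auto
    qed (use kern_zero[OF r, of y] in auto)
    finally show "(\<integral>\<^sup>+x. ennreal (kern r y * (norm (F y x))\<^sup>2) \<partial>lborel) \<le> ennreal (kern r y) * ennreal \<delta>" .
  qed
  also have "\<dots> = (\<integral>\<^sup>+y. ennreal (kern r (y::'a)) \<partial>lborel) * ennreal \<delta>"
    by (rule nn_integral_multc) measurable
  also have "(\<integral>\<^sup>+y. ennreal (kern r (y::'a)) \<partial>lborel) = 1"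
    using nn_integral_eq_integral[OF kern_integrable[OF r, where 'a='a]] kern_nonneg[OF r, where 'a='a]
      kern_integral[OF r, where 'a='a] by simp
  finally have le: "(\<integral>\<^sup>+x. ennreal ((norm (?M x))\<^sup>2) \<partial>lborel) \<le> ennreal \<delta>" by simp
  then have i: "integrable lborel (\<lambda>x. (norm (?M x))\<^sup>2)"
    by (intro integrableI_nonneg) (auto simp: less_top[symmetric] top_unique)
  then show "L2 ?M" by (intro L2_I Mm)
  have "ennreal (n2 ?M) \<le> ennreal \<delta>"
    unfolding n2_def using nn_integral_eq_integral[OF i] le by simp
  then show "n2 ?M \<le> \<delta>" using d0 ennreal_le_iff by blast
qed

lemma moll_L2:
  fixes f :: "'a::euclidean_space \<Rightarrow> 'b::euclidean_space"
  assumes r: "0 < r" and f: "L2 f" shows "L2 (moll r f)" "n2 (moll r f) \<le> n2 f"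
proof -
  have [measurable]: "f \<in> borel_measurable borel" using f by auto
  have t: "L2 (\<lambda>x. f (x - y))" "n2 (\<lambda>x. f (x - y)) = n2 f" for y
    using L2_translate[OF f, of "- y"] by auto
  have "(\<lambda>(y, x). f (x - y)) \<in> borel_measurable (borel \<Otimes>\<^sub>M borel)" by measurable
  from kern_average_L2[OF r this t(1), of "n2 f"] t(2)
  show "L2 (moll r f)" "n2 (moll r f) \<le> n2 f" by (simp_all add: moll_def[abs_def])
qed

lemma moll_close:
  fixes f :: "'a::euclidean_space \<Rightarrow> 'b::euclidean_space"
  assumes r: "0 < r" and f: "L2 f" and d: "\<And>y. norm y \<le> r \<Longrightarrow> n2 (\<lambda>x. f (x + y) - f x) \<le> \<delta>"
  shows "n2 (\<lambda>x. moll r f x - f x) \<le> \<delta>"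
proof -
  have [measurable]: "f \<in> borel_measurable borel" using f by auto
  have t: "L2 (\<lambda>x. f (x - y) - f x)" for y
    using L2_diff[OF L2_translate(1)[OF f, of "- y"] f] by auto
  have "(\<lambda>(y, x). f (x - y) - f x) \<in> borel_measurable (borel \<Otimes>\<^sub>M borel)" by measurable
  from kern_average_L2(2)[OF r this t, of \<delta>] d[of "- y" for y]
  have "n2 (\<lambda>x. LINT y|lborel. kern r y *\<^sub>R (f (x - y) - f x)) \<le> \<delta>" by simp
  moreover have "(LINT y|lborel. kern r y *\<^sub>R (f (x - y) - f x)) = moll r f x - f x" for x
    unfolding scaleR_diff_right moll_def
    using moll_integrable[OF r f, of x] kern_integrable[OF r, where 'a='a] kern_integral[OF r, where 'a='a]
    by (subst Bochner_Integration.integral_diff) auto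
  ultimately show ?thesis by simp
qed

lemma L2_translation_continuous_eps:
  fixes f :: "'a::euclidean_space \<Rightarrow> 'b::euclidean_space"
  assumes "L2 f" "0 < e"
  shows "\<exists>d>0. \<forall>y. norm y < d \<longrightarrow> n2 (\<lambda>x. f (x + y) - f x) < e"
proof -
  have "continuous (at 0) (\<lambda>y. n2 (\<lambda>x. f (x + y) - f x))"
    unfolding continuous_at_sequentially using L2_translation_continuous[OF assms(1)] by (auto simp: o_def)
  then obtain d where "d > 0" "\<And>y. dist y 0 < d \<Longrightarrow> dist (n2 (\<lambda>x. f (x + y) - f x)) (n2 (\<lambda>x. f (x + 0) - f x)) < e"
    unfolding continuous_at_eps_delta using assms(2) by blast
  then show ?thesis by (intro exI[of _ d]) (auto simp: dist_real_def)
qed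

lemma moll_tendsto:
  assumes f: "L2 f"
  shows "(\<lambda>n. n2 (\<lambda>x. moll (1 / real (Suc n)) f x - f x)) \<longlonglongrightarrow> 0"
proof (rule LIMSEQ_I)
  fix e :: real assume e: "e > 0"
  obtain d where d: "d > 0" "\<And>y. norm y < d \<Longrightarrow> n2 (\<lambda>x. f (x + y) - f x) < e / 2"
    using L2_translation_continuous_eps[OF f, of "e/2"] e by auto
  obtain N where N: "1 / real (Suc N) < d" using d(1) by (metis nat_approx_posE)
  have "n2 (\<lambda>x. moll (1 / real (Suc n)) f x - f x) \<le> e / 2" if "n \<ge> N" for n
  proof (rule moll_close[OF _ f])
    fix y :: 'a assume "norm y \<le> 1 / real (Suc n)"
    moreover have "1 / real (Suc n) \<le> 1 / real (Suc N)" using that by (simp add: frac_le)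
    ultimately show "n2 (\<lambda>x. f (x + y) - f x) \<le> e / 2" using d(2)[of y] N by simp
  qed simp
  then show "\<exists>no. \<forall>n\<ge>no. norm (n2 (\<lambda>x. moll (1 / real (Suc n)) f x - f x) - 0) < e"
    using e by (intro exI[of _ N]) (fastforce simp: abs_of_nonneg)
qed

lemma L2_norm_fun: "L2 g \<Longrightarrow> L2 (\<lambda>x. norm (g x))" "n2 (\<lambda>x. norm (g x)) = n2 g"
  by (auto simp: L2_def n2_def simp del: L2_int L2_meas)

lemma L2_scaleR_bound:
  fixes v :: "'a::euclidean_space \<Rightarrow> real" and g :: "'a \<Rightarrow> 'b::euclidean_space"
  assumes "L2 v" "L2 g"
  shows "norm (LINT x|lborel. v x *\<^sub>R g x) \<le> sqrt (n2 v) * sqrt (n2 g)"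
proof -
  have "norm (LINT x|lborel. v x *\<^sub>R g x) \<le> (LINT x|lborel. norm (v x *\<^sub>R g x))"
    by (rule integral_norm_bound)
  also have "\<dots> = (LINT x|lborel. norm (v x) \<bullet> norm (g x))" by simp
  also have "\<dots> \<le> sqrt (n2 v) * sqrt (n2 g)"
    using L2_Cauchy_Schwarz_abs[OF L2_norm_fun(1)[OF assms(1)] L2_norm_fun(1)[OF assms(2)]]
    by (simp add: L2_norm_fun(2)[of v, unfolded real_norm_def] L2_norm_fun(2)[of g])
  finally show ?thesis .
qed

lemma n2_flip_diff:
  assumes "L2 \<phi>"
  shows "n2 (\<lambda>y. \<phi> (x - y) - \<phi> (x' - y)) = n2 (\<lambda>y. \<phi> (y + (x - x')) - \<phi> y)"
proof -
  have "L2 (\<lambda>y. \<phi> (y + (x - x')) - \<phi> y)" by (intro L2_diff L2_translate assms)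
  from L2_flip(2)[OF this, of x'] show ?thesis by (simp add: algebra_simps)
qed

text \<open>Cauchy-Schwarz puts the whole modulus of continuity on \<open>\<phi>\<close>. Hence
  \<open>d\<close> does not depend on \<open>v\<close>, and the convolutions of a bounded family are
  equicontinuous, which the selection of subsequences in \<open>sob_bounded_subseq\<close> relies
  on.\<close>

lemma convolution_equicontinuous:
  fixes \<phi> :: "'a::euclidean_space \<Rightarrow> 'b::euclidean_space"
  assumes "L2 \<phi>" "0 < e"
  shows "\<exists>d>0. \<forall>x x' v. norm (x - x') < d \<longrightarrow> L2 v \<longrightarrow>
    norm ((LINT y|lborel. v y *\<^sub>R \<phi> (x - y)) - (LINT y|lborel. v y *\<^sub>R \<phi> (x' - y))) \<le> sqrt (n2 v) * e"
proof -
  obtain d where d: "d > 0" "\<And>y. norm y < d \<Longrightarrow> n2 (\<lambda>x. \<phi> (x + y) - \<phi> x) < e\<^sup>2"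
    using L2_translation_continuous_eps[OF assms(1), of "e\<^sup>2"] assms(2) by auto
  show ?thesis
  proof (intro exI conjI allI impI)
    fix x x' :: 'a and v :: "'a \<Rightarrow> real" assume x: "norm (x - x') < d" and v: "L2 v"
    note L = L2_flip(1)[OF assms(1)]
    have "(LINT y|lborel. v y *\<^sub>R \<phi> (x - y)) - (LINT y|lborel. v y *\<^sub>R \<phi> (x' - y))
        = (LINT y|lborel. v y *\<^sub>R (\<phi> (x - y) - \<phi> (x' - y)))"
      unfolding scaleR_diff_right
      by (intro Bochner_Integration.integral_diff[symmetric] L2_scaleR_integrable v L)
    also have "norm \<dots> \<le> sqrt (n2 v) * sqrt (n2 (\<lambda>y. \<phi> (x - y) - \<phi> (x' - y)))"
      by (intro L2_scaleR_bound v L2_diff L)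
    also have "\<dots> \<le> sqrt (n2 v) * e"
      using d(2)[OF x] assms(2) unfolding n2_flip_diff[OF assms(1)]
      by (intro mult_left_mono real_le_lsqrt) auto
    finally show "norm ((LINT y|lborel. v y *\<^sub>R \<phi> (x - y)) - (LINT y|lborel. v y *\<^sub>R \<phi> (x' - y))) \<le> sqrt (n2 v) * e" .
  qed (rule d(1))
qed

lemma indicator_norm_sq: "(norm (indicator A x :: real))\<^sup>2 = indicator A x"
  by (auto simp: indicator_def)

lemma L2_indicator:
  "integrable lborel (indicator A :: 'a::euclidean_space \<Rightarrow> real) \<Longrightarrow> L2 (indicator A :: 'a \<Rightarrow> real)"
  by (intro L2_I) (simp_all only: indicator_norm_sq, auto)

lemma n2_indicator: "n2 (indicator A :: 'a::euclidean_space \<Rightarrow> real) = measure lborel A"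
  by (simp only: n2_def indicator_norm_sq, simp)

text \<open>Differentiability of \<open>k\<close> measured in L^2: the Taylor remainder is uniformly
  small because \<open>Dk\<close> is uniformly continuous, and it lives on a fixed ball. This is the
  form that can be paired with a function known only to be in L^2.\<close>

lemma C1_bsupp_uniform_diff:
  assumes k: "C1 k Dk" "bsupp k" and e: "0 < e"
  shows "\<exists>d>0. \<forall>h. norm h < d \<longrightarrow> L2 (\<lambda>z. k (z + h) - k z - Dk z \<bullet> h) \<and>
     sqrt (n2 (\<lambda>z. k (z + h) - k z - Dk z \<bullet> h)) \<le> e * norm h"
proof -
  obtain R0 where R0: "\<And>x. norm x \<ge> R0 \<Longrightarrow> k x = 0" using k(2) by (auto simp: bsupp_def)
  obtain R1 where R1: "\<And>x. norm x \<ge> R1 \<Longrightarrow> Dk x = 0" using bsupp_gradient[OF k] by (auto simp: bsupp_def)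
  define R where "R = max R0 R1"
  let ?B = "cball 0 (R + 1) :: 'a set"
  define V where "V = measure lborel ?B"
  have V0: "0 \<le> V" by (simp add: V_def)
  have iB: "integrable lborel (indicator ?B :: 'a \<Rightarrow> real)"
    using emeasure_bounded_finite[of ?B] by (auto simp: less_top)
  \<comment> \<open>The squared remainder integrates to at most (e' |h|)^2 \<open>V\<close>, and
    \<open>V\<close> is at most the square of \<open>1 + V\<close>; this avoids a root.\<close>
  define e' where "e' = e / (1 + V)"
  have e': "e' > 0" using e V0 by (simp add: e'_def)
  have "uniformly_continuous_on (cball 0 (R + 2)) Dk"
    using C1_contD[OF k(1)] by (intro compact_uniformly_continuous) (auto intro: continuous_on_subset)
  then obtain d where d: "d > 0" "\<And>x y. x \<in> cball 0 (R + 2) \<Longrightarrow> y \<in> cball 0 (R + 2) \<Longrightarrow> dist y x < d \<Longrightarrow> dist (Dk y) (Dk x) < e'"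
    unfolding uniformly_continuous_on_def using e' by metis
  show ?thesis
  proof (intro exI conjI allI impI)
    show "min d 1 > 0" using d(1) by simp
    fix h :: 'a assume h: "norm h < min d 1"
    have bd: "\<bar>k (z + h) - k z - Dk z \<bullet> h\<bar> \<le> norm ((e' * norm h) * indicator ?B z)" for z
    proof (cases "z \<in> ?B")
      case True
      have "norm (k (z + h) - k z - (\<lambda>x h. Dk x \<bullet> h) z ((z + h) - z)) \<le> norm ((z + h) - z) * e'"
      proof (rule differentiable_bound_linearization[where S="ball z (min d 1)" and f'="\<lambda>x h. Dk x \<bullet> h" and f=k and a=z and b="z + h" and ?x0.0=z])
        show "z + t *\<^sub>R (z + h - z) \<in> ball z (min d 1)" if "t \<in> {0..1}" for t
        proof -
          have "norm (t *\<^sub>R h) \<le> 1 * norm h" using that by (simp add: mult_left_le_one_le)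
          then show ?thesis using h by (simp add: dist_norm)
        qed
        show "(k has_derivative (\<lambda>h. Dk x \<bullet> h)) (at x within ball z (min d 1))" for x
          using C1_D[OF k(1)] has_derivative_at_withinI by blast
        show "onorm ((\<lambda>i. Dk x \<bullet> i) - (\<lambda>i. Dk z \<bullet> i)) \<le> e'" if x: "x \<in> ball z (min d 1)" for x
        proof (rule onorm_le)
          fix i
          have "norm x \<le> R + 2"
            using x True norm_triangle_ineq2[of x z] by (simp add: dist_norm norm_minus_commute)
          then have "norm (Dk x - Dk z) \<le> e'"
            using d(2)[of z x] x True by (auto simp: dist_norm norm_minus_commute)
          then show "norm (((\<lambda>i. Dk x \<bullet> i) - (\<lambda>i. Dk z \<bullet> i)) i) \<le> e' * norm i"
            using Cauchy_Schwarz_ineq2[of "Dk x - Dk z" i] mult_right_mono[of "norm (Dk x - Dk z)" e' "norm i"]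
            by (simp add: inner_diff_left)
        qed
        show "z \<in> ball z (min d 1)" using d(1) by simp
      qed
      then show ?thesis using True e' by (simp add: mult.commute)
    next
      case False
      have "norm (z + h) \<ge> R" using False h norm_triangle_ineq2[of z "- h"] by simp
      moreover have "norm z \<ge> R" using False by simp
      ultimately have "k (z + h) = 0" "k z = 0" "Dk z = 0" using R0 R1 by (auto simp: R_def)
      then show ?thesis by simp
    qed
    have LB: "L2 (\<lambda>z. (e' * norm h) * indicator ?B z :: real)"
      by (intro L2_cmult L2_indicator iB)
    have m: "(\<lambda>z. k (z + h) - k z - Dk z \<bullet> h) \<in> borel_measurable borel"
      using C1_meas[OF k(1)] by measurable
    from L2_dominated[OF LB m] bd
    show "L2 (\<lambda>z. k (z + h) - k z - Dk z \<bullet> h)" by simp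
    have "n2 (\<lambda>z. k (z + h) - k z - Dk z \<bullet> h) \<le> n2 (\<lambda>z. (e' * norm h) * indicator ?B z :: real)"
      using L2_dominated(2)[OF LB m] bd by simp
    also have "\<dots> = (e' * norm h)\<^sup>2 * V"
      unfolding n2_cmult V_def by (simp add: n2_indicator)
    also have "\<dots> \<le> (e' * norm h)\<^sup>2 * (1 + V)\<^sup>2"
      using V0 by (intro mult_left_mono) (auto simp: power2_sum)
    also have "\<dots> = (e * norm h)\<^sup>2" using V0 by (simp add: e'_def power_mult_distrib power_divide)
    finally show "sqrt (n2 (\<lambda>z. k (z + h) - k z - Dk z \<bullet> h)) \<le> e * norm h"
      using e by (intro real_le_lsqrt) auto
  qed
qed

text \<open>All derivatives fall on the kernel. The error in the difference quotient is an integral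
  of \<open>v\<close> against the Taylor remainder of \<open>k\<close>, and Cauchy-Schwarz
  applies.\<close>

lemma convolution_C1:
  fixes v :: "'a::euclidean_space \<Rightarrow> real"
  assumes v: "L2 v" and k: "C1 k Dk" "bsupp k"
  shows "C1 (\<lambda>x. LINT y|lborel. v y *\<^sub>R k (x - y)) (\<lambda>x. LINT y|lborel. v y *\<^sub>R Dk (x - y))"
  unfolding C1_def
proof (intro conjI allI)
  have Lk: "L2 k" by (rule bsupp_L2[OF C1_cont[OF k(1)] k(2)])
  have LD: "L2 Dk" by (rule bsupp_L2[OF C1_contD[OF k(1)] bsupp_gradient[OF k]])
  note L = L2_flip(1)[OF Lk] L2_flip(1)[OF LD]
  {
    fix x
    show "((\<lambda>x. LINT y|lborel. v y *\<^sub>R k (x - y)) has_derivative (\<lambda>h. (LINT y|lborel. v y *\<^sub>R Dk (x - y)) \<bullet> h)) (at x)"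
      unfolding has_derivative_at_alt
    proof (intro conjI allI impI)
      show "bounded_linear (\<lambda>h. (LINT y|lborel. v y *\<^sub>R Dk (x - y)) \<bullet> h)" by (rule bounded_linear_inner_right)
      fix e :: real assume e: "e > 0"
      \<comment> \<open>The summand 1 makes the division legitimate when \<open>v\<close> has norm
        0.\<close>
      define e' where "e' = e / (1 + sqrt (n2 v))"
      have e': "e' > 0" using e by (simp add: e'_def add_pos_nonneg)
      obtain d where d: "d > 0" "\<And>h. norm h < d \<Longrightarrow> L2 (\<lambda>z. k (z + h) - k z - Dk z \<bullet> h)"
         "\<And>h. norm h < d \<Longrightarrow> sqrt (n2 (\<lambda>z. k (z + h) - k z - Dk z \<bullet> h)) \<le> e' * norm h"
        using C1_bsupp_uniform_diff[OF k e'] by blast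
      have "norm ((LINT y|lborel. v y *\<^sub>R k (x' - y)) - (LINT y|lborel. v y *\<^sub>R k (x - y)) - (LINT y|lborel. v y *\<^sub>R Dk (x - y)) \<bullet> (x' - x)) \<le> e * norm (x' - x)"
        if x': "norm (x' - x) < d" for x'
      proof -
        define h where "h = x' - x"
        let ?q = "\<lambda>z. k (z + h) - k z - Dk z \<bullet> h"
        have i: "integrable lborel (\<lambda>y. v y *\<^sub>R k (x' - y))" "integrable lborel (\<lambda>y. v y *\<^sub>R k (x - y))"
          "integrable lborel (\<lambda>y. v y *\<^sub>R Dk (x - y))"
          by (intro L2_scaleR_integrable v L)+
        have "(LINT y|lborel. v y *\<^sub>R ?q (x - y))
          = (LINT y|lborel. v y *\<^sub>R k (x' - y) - v y *\<^sub>R k (x - y) - (v y *\<^sub>R Dk (x - y)) \<bullet> h)"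
          by (intro Bochner_Integration.integral_cong) (auto simp: h_def algebra_simps)
        also have "\<dots> = (LINT y|lborel. v y *\<^sub>R k (x' - y)) - (LINT y|lborel. v y *\<^sub>R k (x - y)) - (LINT y|lborel. v y *\<^sub>R Dk (x - y)) \<bullet> h"
          using i by (simp del: inner_scaleR_left real_scaleR_def)
        finally have "norm ((LINT y|lborel. v y *\<^sub>R k (x' - y)) - (LINT y|lborel. v y *\<^sub>R k (x - y)) - (LINT y|lborel. v y *\<^sub>R Dk (x - y)) \<bullet> h)
           = norm (LINT y|lborel. v y *\<^sub>R ?q (x - y))" by simp
        also have "\<dots> \<le> sqrt (n2 v) * sqrt (n2 (\<lambda>y. ?q (x - y)))"
          using x' by (intro L2_scaleR_bound v L2_flip(1)[OF d(2)]) (simp add: h_def)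
        also have "\<dots> \<le> sqrt (n2 v) * (e' * norm h)"
          using x' L2_flip(2)[OF d(2), of h x] d(3)[of h] by (intro mult_left_mono) (auto simp: h_def)
        also have "\<dots> \<le> (1 + sqrt (n2 v)) * (e' * norm h)"
          using e' by (intro mult_right_mono) auto
        also have "\<dots> = e * norm h" unfolding e'_def
          using n2_nonneg[of v] by (simp add: add_nonneg_eq_0_iff)
        finally show ?thesis by (simp add: h_def)
      qed
      then show "\<exists>d>0. \<forall>x'. norm (x' - x) < d \<longrightarrow> norm ((LINT y|lborel. v y *\<^sub>R k (x' - y)) - (LINT y|lborel. v y *\<^sub>R k (x - y)) - (LINT y|lborel. v y *\<^sub>R Dk (x - y)) \<bullet> (x' - x)) \<le> e * norm (x' - x)"
        using d(1) by blast
    qed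
  }
  show "continuous_on UNIV (\<lambda>x. LINT y|lborel. v y *\<^sub>R Dk (x - y))"
    unfolding continuous_on_iff
  proof (intro ballI allI impI)
    fix x :: 'a and e :: real assume e: "e > 0"
    define e' where "e' = e / (1 + sqrt (n2 v))"
    have e': "e' > 0" using e by (simp add: e'_def add_pos_nonneg)
    obtain d where d: "d > 0" "\<And>x x'. norm (x - x') < d \<Longrightarrow>
        norm ((LINT y|lborel. v y *\<^sub>R Dk (x - y)) - (LINT y|lborel. v y *\<^sub>R Dk (x' - y))) \<le> sqrt (n2 v) * e'"
      using convolution_equicontinuous[OF LD e'] v by meson
    have "sqrt (n2 v) * e' < (1 + sqrt (n2 v)) * e'" using e' by (intro mult_strict_right_mono) auto
    also have "\<dots> = e" unfolding e'_def using n2_nonneg[of v] by (simp add: add_nonneg_eq_0_iff)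
    finally have "sqrt (n2 v) * e' < e" .
    then show "\<exists>d>0. \<forall>x'\<in>UNIV. dist x' x < d \<longrightarrow> dist (LINT y|lborel. v y *\<^sub>R Dk (x' - y)) (LINT y|lborel. v y *\<^sub>R Dk (x - y)) < e"
      using d by (intro exI[of _ d]) (auto simp: dist_norm intro: le_less_trans)
  qed
qed

section \<open>Weak gradients\<close>

text \<open>The pair of a function and its weak gradient. The test functions are merely
  \<open>C1\<close> with bounded support, a class that is stable under multiplication by cutoffs and
  under affine substitutions; \<open>weak_test_imp_sob\<close> shows that smooth test functions give
  the same notion.\<close>

definition sob :: "('a::euclidean_space \<Rightarrow> real) \<Rightarrow> ('a \<Rightarrow> 'a) \<Rightarrow> bool" where
  "sob v G \<longleftrightarrow> L2 v \<and> L2 G \<and> (\<forall>\<psi> D\<psi> e. C1 \<psi> D\<psi> \<longrightarrow> bsupp \<psi> \<longrightarrow>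
     (LINT x|lborel. v x * (D\<psi> x \<bullet> e)) = - (LINT x|lborel. \<psi> x * (G x \<bullet> e)))"

lemma sobD: "sob v G \<Longrightarrow> L2 v" "sob v G \<Longrightarrow> L2 G"
  and sob_parts: "sob v G \<Longrightarrow> C1 \<psi> D\<psi> \<Longrightarrow> bsupp \<psi> \<Longrightarrow>
     (LINT x|lborel. v x * (D\<psi> x \<bullet> e)) = - (LINT x|lborel. \<psi> x * (G x \<bullet> e))"
  unfolding sob_def by blast+

lemma C1_sob: "C1 u Du \<Longrightarrow> L2 u \<Longrightarrow> L2 Du \<Longrightarrow> sob u Du"
  unfolding sob_def using C1_integration_by_parts by blast

text \<open>The reflected translates of the kernel are themselves smooth test functions, and testing
  with them says that the gradient of the mollified function is the mollified gradient. The
  hypothesis asks only for smooth test functions, so that the lemma serves \<open>weak_grad\<close>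
  as well as \<open>sob\<close>.\<close>

lemma weak_test_moll_C1:
  fixes v :: "'a::euclidean_space \<Rightarrow> real"
  assumes v: "L2 v" and G: "L2 G" and r: "0 < r"
    and w: "\<And>\<phi> i. test_fun \<phi> \<Longrightarrow> i \<in> Basis \<Longrightarrow>
      (LINT x|lborel. v x * frechet_derivative \<phi> (at x) i) = - (LINT x|lborel. \<phi> x * (G x \<bullet> i))"
  shows "C1 (moll r v) (moll r G)"
proof -
  obtain Dk where k: "C1 (kern r :: 'a \<Rightarrow> real) Dk" using kern_C1 by blast
  have LD: "L2 Dk" by (rule bsupp_L2[OF C1_contD[OF k] bsupp_gradient[OF k kern_bsupp[OF r]]])
  have "C1 (\<lambda>x. LINT y|lborel. v y *\<^sub>R kern r (x - y)) (\<lambda>x. LINT y|lborel. v y *\<^sub>R Dk (x - y))"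
    by (rule convolution_C1[OF v k kern_bsupp[OF r]])
  moreover have "(\<lambda>x. LINT y|lborel. v y *\<^sub>R kern r (x - y)) = moll r v"
    using moll_flip[of v r] v by (simp add: fun_eq_iff mult.commute)
  moreover have "(LINT y|lborel. v y *\<^sub>R Dk (x - y)) = moll r G x" for x
  proof (rule euclidean_eqI)
    fix i :: 'a assume i: "i \<in> Basis"
    have "((\<lambda>y. kern r (x - y)) has_derivative (\<lambda>h. Dk (x - y) \<bullet> (- h))) (at y)" for y
      by (rule has_derivative_compose[OF _ C1_D[OF k]]) (auto intro!: derivative_eq_intros)
    then have fd: "frechet_derivative (\<lambda>y. kern r (x - y)) (at y) i = - (Dk (x - y) \<bullet> i)" for y
      using frechet_derivative_at by (metis inner_minus_right)
    have "(LINT y|lborel. v y *\<^sub>R Dk (x - y)) \<bullet> i = (LINT y|lborel. v y * (Dk (x - y) \<bullet> i))"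
      using L2_scaleR_integrable[OF v L2_flip(1)[OF LD], of x] by (subst integral_inner_left[symmetric]) auto
    also have "\<dots> = - (LINT y|lborel. v y * frechet_derivative (\<lambda>y. kern r (x - y)) (at y) i)"
      by (simp add: fd)
    also have "\<dots> = (LINT y|lborel. kern r (x - y) * (G y \<bullet> i))"
      using w[OF kern_test_fun[OF r, of x] i] by simp
    also have "\<dots> = (LINT y|lborel. (kern r (x - y) *\<^sub>R G y) \<bullet> i)" by simp
    also have "\<dots> = moll r G x \<bullet> i"
      unfolding moll_flip[OF L2_meas[OF G]]
      by (intro integral_inner_left L2_scaleR_integrable L2_flip kern_L2 r G)
    finally show "(LINT y|lborel. v y *\<^sub>R Dk (x - y)) \<bullet> i = moll r G x \<bullet> i" .
  qed
  ultimately show ?thesis by (simp add: fun_eq_iff)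
qed

text \<open>Both sides of the integration by parts are continuous in L^2 for a fixed test function,
  so the graph of the weak gradient is closed. Nearly every construction of a weak gradient below
  ends with this lemma.\<close>

lemma sob_limit:
  assumes s: "\<And>n::nat. sob (v n) (G n)" and L: "L2 v'" "L2 G'"
    and lv: "(\<lambda>n. n2 (\<lambda>x. v n x - v' x)) \<longlonglongrightarrow> 0" and lG: "(\<lambda>n. n2 (\<lambda>x. G n x - G' x)) \<longlonglongrightarrow> 0"
  shows "sob v' G'"
  unfolding sob_def
proof (intro conjI allI impI)
  fix \<psi> :: "'a \<Rightarrow> real" and D\<psi> e assume p: "C1 \<psi> D\<psi>" "bsupp \<psi>"
  have Lp: "L2 \<psi>" by (rule bsupp_L2[OF C1_cont[OF p(1)] p(2)])
  have LD: "L2 (\<lambda>x. D\<psi> x \<bullet> e)"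
    by (intro L2_component bsupp_L2[OF C1_contD[OF p(1)] bsupp_gradient[OF p]])
  have Lpe: "L2 (\<lambda>x. \<psi> x *\<^sub>R e)"
    by (rule L2_dominated(1)[OF L2_cmult[OF Lp, of "norm e"]]) (use L2_meas[OF Lp] in \<open>auto simp: abs_mult\<close>)
  have "(\<lambda>n. LINT x|lborel. v n x \<bullet> (D\<psi> x \<bullet> e)) \<longlonglongrightarrow> (LINT x|lborel. v' x \<bullet> (D\<psi> x \<bullet> e))"
    by (intro L2_lim_inner sobD(1)[OF s] L LD lv)
  moreover have "(\<lambda>n. LINT x|lborel. G n x \<bullet> (\<psi> x *\<^sub>R e)) \<longlonglongrightarrow> (LINT x|lborel. G' x \<bullet> (\<psi> x *\<^sub>R e))"
    by (intro L2_lim_inner sobD(2)[OF s] L Lpe lG)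
  then have "(\<lambda>n. - (LINT x|lborel. \<psi> x * (G n x \<bullet> e))) \<longlonglongrightarrow> - (LINT x|lborel. \<psi> x * (G' x \<bullet> e))"
    by (intro tendsto_minus) simp
  moreover have "(LINT x|lborel. v n x \<bullet> (D\<psi> x \<bullet> e)) = - (LINT x|lborel. \<psi> x * (G n x \<bullet> e))" for n
    using sob_parts[OF s p] by simp
  ultimately show "(LINT x|lborel. v' x * (D\<psi> x \<bullet> e)) = - (LINT x|lborel. \<psi> x * (G' x \<bullet> e))"
    using LIMSEQ_unique by fastforce
qed (use L in auto)

text \<open>Mollified pairs are classically differentiable, hence satisfy integration by parts
  against every \<open>C1\<close> test function, and this passes to the limit.\<close>

lemma weak_test_imp_sob:
  fixes v :: "'a::euclidean_space \<Rightarrow> real"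
  assumes v: "L2 v" and G: "L2 G"
    and w: "\<And>\<phi> i. test_fun \<phi> \<Longrightarrow> i \<in> Basis \<Longrightarrow>
      (LINT x|lborel. v x * frechet_derivative \<phi> (at x) i) = - (LINT x|lborel. \<phi> x * (G x \<bullet> i))"
  shows "sob v G"
proof (rule sob_limit[OF _ v G moll_tendsto[OF v] moll_tendsto[OF G]])
  fix n
  show "sob (moll (1 / real (Suc n)) v) (moll (1 / real (Suc n)) G)"
    by (intro C1_sob weak_test_moll_C1 moll_L2 v G w) auto
qed

lemma test_fun_C1:
  assumes "test_fun \<phi>"
  obtains D where "C1 \<phi> D" "bsupp \<phi>"
  using smooth_fun_C1[of \<phi>] test_fun_bsupp[OF assms] assms unfolding test_fun_def by blast

lemma sob_moll_C1:
  assumes "sob v G" "0 < r" shows "C1 (moll r v) (moll r G)"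
proof (rule weak_test_moll_C1[OF sobD[OF assms(1)] assms(2)])
  fix \<phi> :: "'a \<Rightarrow> real" and i :: 'a assume p: "test_fun \<phi>"
  then obtain D where D: "C1 \<phi> D" "bsupp \<phi>" by (rule test_fun_C1)
  show "(LINT x|lborel. v x * frechet_derivative \<phi> (at x) i) = - (LINT x|lborel. \<phi> x * (G x \<bullet> i))"
    using sob_parts[OF assms(1) D] by (simp add: C1_frechet[OF D(1)])
qed

text \<open>The mollified function vanishes identically, so its gradient, the mollification of
  \<open>G\<close>, vanishes at every scale; \<open>G\<close> is the L^2 limit of these.\<close>

lemma sob_AE_zero:
  assumes s: "sob v G" and z: "AE x in lborel. v x = 0"
  shows "AE x in lborel. G x = 0"
proof -
  have "moll r G x = 0" if r: "r > 0" for r x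
  proof -
    have "moll r v y = 0" for y
      using moll_cong_AE[of v "\<lambda>_. 0" r y] z sobD(1)[OF s] by (auto simp: moll_def)
    then have "((\<lambda>y. 0) has_derivative (\<lambda>h. moll r G x \<bullet> h)) (at x)"
      using C1_D[OF sob_moll_C1[OF s r], of x] by presburger
    then have "(\<lambda>h. moll r G x \<bullet> h) = (\<lambda>h. 0)"
      using has_derivative_unique has_derivative_const by blast
    then show ?thesis by (metis inner_eq_zero_iff)
  qed
  then have "(\<lambda>n::nat. n2 (\<lambda>x. - G x)) \<longlonglongrightarrow> 0"
    using moll_tendsto[OF sobD(2)[OF s]] by simp
  then have "n2 G = 0" by (simp add: n2_minus LIMSEQ_const_iff)
  then show ?thesis using n2_eq_0_iff[OF sobD(2)[OF s]] by simp
qed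

lemma L2_parts_integrable:
  assumes "L2 f" "L2 g" shows "integrable lborel (\<lambda>x. f x * (g x \<bullet> e) :: real)"
  by (intro L2_mult_integrable assms L2_component)

lemma sob_lincomb:
  assumes "sob v G" "sob w H"
  shows "sob (\<lambda>x. a * v x + b * w x) (\<lambda>x. a *\<^sub>R G x + b *\<^sub>R H x)"
  unfolding sob_def
proof (intro conjI allI impI)
  note L = sobD[OF assms(1)] sobD[OF assms(2)]
  show "L2 (\<lambda>x. a * v x + b * w x)" "L2 (\<lambda>x. a *\<^sub>R G x + b *\<^sub>R H x)"
    by (intro L2_add L2_cmult L2_scaleR L)+
  fix \<psi> :: "'a \<Rightarrow> real" and D\<psi> e assume p: "C1 \<psi> D\<psi>" "bsupp \<psi>"
  have Lp: "L2 \<psi>" by (rule bsupp_L2[OF C1_cont[OF p(1)] p(2)])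
  have LD: "L2 D\<psi>" by (rule bsupp_L2[OF C1_contD[OF p(1)] bsupp_gradient[OF p]])
  note i = L2_parts_integrable[OF L(1) LD, of e] L2_parts_integrable[OF L(3) LD, of e]
    L2_parts_integrable[OF Lp L(2), of e] L2_parts_integrable[OF Lp L(4), of e]
  have "(LINT x|lborel. (a * v x + b * w x) * (D\<psi> x \<bullet> e))
      = (LINT x|lborel. a * (v x * (D\<psi> x \<bullet> e)) + b * (w x * (D\<psi> x \<bullet> e)))"
    by (simp add: algebra_simps)
  also have "\<dots> = a * (LINT x|lborel. v x * (D\<psi> x \<bullet> e)) + b * (LINT x|lborel. w x * (D\<psi> x \<bullet> e))"
    using i by simp
  also have "\<dots> = - (a * (LINT x|lborel. \<psi> x * (G x \<bullet> e)) + b * (LINT x|lborel. \<psi> x * (H x \<bullet> e)))"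
    by (simp add: sob_parts[OF assms(1) p] sob_parts[OF assms(2) p])
  also have "\<dots> = - (LINT x|lborel. a * (\<psi> x * (G x \<bullet> e)) + b * (\<psi> x * (H x \<bullet> e)))"
    using i by simp
  also have "\<dots> = - (LINT x|lborel. \<psi> x * ((a *\<^sub>R G x + b *\<^sub>R H x) \<bullet> e))"
    by (simp add: algebra_simps inner_add_left)
  finally show "(LINT x|lborel. (a * v x + b * w x) * (D\<psi> x \<bullet> e)) = - (LINT x|lborel. \<psi> x * ((a *\<^sub>R G x + b *\<^sub>R H x) \<bullet> e))" .
qed

lemma sob_add: "sob v G \<Longrightarrow> sob w H \<Longrightarrow> sob (\<lambda>x. v x + w x) (\<lambda>x. G x + H x)"
  using sob_lincomb[of v G w H 1 1] by simp

lemma sob_diff: "sob v G \<Longrightarrow> sob w H \<Longrightarrow> sob (\<lambda>x. v x - w x) (\<lambda>x. G x - H x)"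
  using sob_lincomb[of v G w H 1 "-1"] by simp

lemma sob_cmult: "sob v G \<Longrightarrow> sob (\<lambda>x. c * v x) (\<lambda>x. c *\<^sub>R G x)"
  using sob_lincomb[of v G v G c 0] by simp

lemma sob_unique:
  assumes "sob v G" "sob w H" "AE x in lborel. v x = w x"
  shows "AE x in lborel. G x = H x"
proof -
  have "AE x in lborel. v x - w x = 0" using assms(3) by eventually_elim simp
  from sob_AE_zero[OF sob_diff[OF assms(1,2)] this] show ?thesis by eventually_elim simp
qed

lemma sob_cong_AE:
  assumes "sob v G" "w \<in> borel_measurable borel" "H \<in> borel_measurable borel"
    "AE x in lborel. v x = w x" "AE x in lborel. G x = H x"
  shows "sob w H"
proof -
  have L: "L2 w" "L2 H"
  proof -
    have "AE x in lborel. norm (w x) \<le> norm (v x)" using assms(4) by eventually_elim simp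
    then show "L2 w" using L2_dominated(1)[OF sobD(1)[OF assms(1)] assms(2)] by simp
    have "AE x in lborel. norm (H x) \<le> norm (G x)" using assms(5) by eventually_elim simp
    then show "L2 H" using L2_dominated(1)[OF sobD(2)[OF assms(1)] assms(3)] by simp
  qed
  have z: "n2 (\<lambda>x. v x - w x) = 0" "n2 (\<lambda>x. G x - H x) = 0"
  proof -
    have "AE x in lborel. v x - w x = 0" using assms(4) by eventually_elim simp
    then show "n2 (\<lambda>x. v x - w x) = 0" using n2_eq_0_iff[OF L2_diff[OF sobD(1)[OF assms(1)] L(1)]] by simp
    have "AE x in lborel. G x - H x = 0" using assms(5) by eventually_elim simp
    then show "n2 (\<lambda>x. G x - H x) = 0" using n2_eq_0_iff[OF L2_diff[OF sobD(2)[OF assms(1)] L(2)]] by simp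
  qed
  show ?thesis
    \<comment> \<open>Closedness of the graph for a constant sequence, whose distance to the new
      pair is 0.\<close>
    by (rule sob_limit[where v="\<lambda>_. v" and G="\<lambda>_. G"]) (use assms(1) L z in auto)
qed

section \<open>Translation estimates in terms of the gradient\<close>

lemma C1_translation_bound:
  fixes f :: "'a::euclidean_space \<Rightarrow> real"
  assumes f: "C1 f Df" "L2 f" "L2 Df"
  shows "n2 (\<lambda>x. f (x + h) - f x) \<le> (norm h)\<^sup>2 * n2 Df"
proof -
  have [measurable]: "f \<in> borel_measurable borel" "Df \<in> borel_measurable borel" using C1_meas[OF f(1)] by auto
  let ?k = "indicator {0..1} :: real \<Rightarrow> real"
  define g where "g x t = Df (x + t *\<^sub>R h) \<bullet> h" for x t
  have [measurable]: "(\<lambda>t. g x t) \<in> borel_measurable borel" for x unfolding g_def by measurable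
  \<comment> \<open>The increment is an average of directional derivatives for the uniform density
    on the unit interval, so that Jensen's inequality in the form \<open>weighted_mean_sq_le\<close>
    applies.\<close>
  have ftc: "f (x + h) - f x = (LINT t|lborel. ?k t *\<^sub>R g x t)" for x
  proof -
    have "((\<lambda>t. f (x + t *\<^sub>R h)) has_real_derivative g x t) (at t)" for t
    proof -
      have "((\<lambda>t. f (x + t *\<^sub>R h)) has_derivative (\<lambda>s. Df (x + t *\<^sub>R h) \<bullet> (s *\<^sub>R h))) (at t)"
        by (rule has_derivative_compose[OF _ C1_D[OF f(1)]]) (auto intro!: derivative_eq_intros)
      then show ?thesis by (simp add: has_field_derivative_def g_def mult.commute[of _ "_ \<bullet> _"])
    qed
    then have "(LINT t|lborel. g x t * ?k t) = f (x + 1 *\<^sub>R h) - f (x + 0 *\<^sub>R h)"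
    proof (intro integral_FTC_Icc_real)
      fix t :: real
      have "continuous_on UNIV (g x)" unfolding g_def
        by (intro continuous_intros continuous_on_compose2[OF C1_contD[OF f(1)]]) auto
      then show "isCont (g x) t" by (simp add: continuous_on_eq_continuous_at)
    qed auto
    then show ?thesis by (simp add: mult.commute)
  qed
  have i1: "integrable lborel (\<lambda>x. (norm (f (x + h) - f x))\<^sup>2)"
    by (intro L2_int L2_diff L2_translate f)
  have "(\<integral>\<^sup>+x. ennreal ((norm (f (x + h) - f x))\<^sup>2) \<partial>lborel)
      \<le> (\<integral>\<^sup>+x. \<integral>\<^sup>+t. ennreal (?k t * (norm (g x t))\<^sup>2) \<partial>lborel \<partial>lborel)"
    unfolding ftc
    by (intro nn_integral_mono weighted_mean_sq_le) auto
  also have "\<dots> \<le> (\<integral>\<^sup>+x. \<integral>\<^sup>+t. ennreal (?k t * ((norm h)\<^sup>2 * (norm (Df (x + t *\<^sub>R h)))\<^sup>2)) \<partial>lborel \<partial>lborel)"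
  proof (intro nn_integral_mono ennreal_leI mult_left_mono)
    fix x t
    have "norm (g x t) \<le> norm h * norm (Df (x + t *\<^sub>R h))"
      using Cauchy_Schwarz_ineq2[of "Df (x + t *\<^sub>R h)" h] by (simp add: g_def mult.commute)
    from power_mono[OF this norm_ge_zero, of 2]
    show "(norm (g x t))\<^sup>2 \<le> (norm h)\<^sup>2 * (norm (Df (x + t *\<^sub>R h)))\<^sup>2" by (simp add: power_mult_distrib)
  qed auto
  also have "\<dots> = (\<integral>\<^sup>+t. \<integral>\<^sup>+x. ennreal (?k t * ((norm h)\<^sup>2 * (norm (Df (x + t *\<^sub>R h)))\<^sup>2)) \<partial>lborel \<partial>lborel)"
    by (rule lborel_pair.Fubini') measurable
  also have "\<dots> = (\<integral>\<^sup>+t. ennreal (?k t * ((norm h)\<^sup>2 * n2 Df)) \<partial>lborel)"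
  proof (rule nn_integral_cong)
    fix t
    have "L2 (\<lambda>x. Df (x + t *\<^sub>R h))" "n2 (\<lambda>x. Df (x + t *\<^sub>R h)) = n2 Df"
      using L2_translate[OF f(3)] by auto
    then show "(\<integral>\<^sup>+x. ennreal (?k t * ((norm h)\<^sup>2 * (norm (Df (x + t *\<^sub>R h)))\<^sup>2)) \<partial>lborel) = ennreal (?k t * ((norm h)\<^sup>2 * n2 Df))"
      by (subst nn_integral_eq_integral) (auto simp: n2_def)
  qed
  also have "\<dots> = ennreal ((norm h)\<^sup>2 * n2 Df)"
  proof -
    have "ennreal (?k t * ((norm h)\<^sup>2 * n2 Df)) = ennreal ((norm h)\<^sup>2 * n2 Df) * indicator {0..1} t" for t
      by (simp add: indicator_def)
    then show ?thesis by (simp add: nn_integral_cmult_indicator)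
  qed
  finally have "ennreal (n2 (\<lambda>x. f (x + h) - f x)) \<le> ennreal ((norm h)\<^sup>2 * n2 Df)"
    unfolding n2_def[of "\<lambda>x. f (x + h) - f x"] using nn_integral_eq_integral[OF i1] by simp
  then show ?thesis using ennreal_le_iff[of "(norm h)\<^sup>2 * n2 Df"] by simp
qed

definition approx :: "nat \<Rightarrow> ('a::euclidean_space \<Rightarrow> 'b::euclidean_space) \<Rightarrow> 'a \<Rightarrow> 'b" where
  "approx n f = moll (1 / real (Suc n)) f"

lemma approx_L2: "L2 f \<Longrightarrow> L2 (approx n f)"
  and approx_n2: "L2 f \<Longrightarrow> n2 (approx n f) \<le> n2 f"
  and approx_tendsto: "L2 f \<Longrightarrow> (\<lambda>n. n2 (\<lambda>x. approx n f x - f x)) \<longlonglongrightarrow> 0"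
  using moll_L2[of "1 / real (Suc n)" f] moll_tendsto[of f] by (auto simp: approx_def)

lemma approx_C1: "sob v G \<Longrightarrow> C1 (approx n v) (approx n G)"
  unfolding approx_def by (rule sob_moll_C1) auto

lemma sob_translation_bound:
  assumes s: "sob v G"
  shows "n2 (\<lambda>x. v (x + h) - v x) \<le> (norm h)\<^sup>2 * n2 G"
proof -
  note L = sobD[OF s]
  have a: "L2 (\<lambda>x. approx n v (x + h) - approx n v x)" for n
    by (intro L2_diff L2_translate approx_L2 L)
  have b: "L2 (\<lambda>x. v (x + h) - v x)" by (intro L2_diff L2_translate L)
  have "(\<lambda>n. 2 * n2 (\<lambda>x. approx n v x - v x) + 2 * n2 (\<lambda>x. approx n v x - v x)) \<longlonglongrightarrow> 2 * 0 + 2 * 0"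
    by (intro tendsto_intros approx_tendsto L)
  then have z: "(\<lambda>n. 2 * n2 (\<lambda>x. approx n v x - v x) + 2 * n2 (\<lambda>x. approx n v x - v x)) \<longlonglongrightarrow> 0" by simp
  have "(\<lambda>n. n2 (\<lambda>x. (approx n v (x + h) - approx n v x) - (v (x + h) - v x))) \<longlonglongrightarrow> 0"
  proof (rule Lim_null_comparison[OF _ z], rule always_eventually, rule allI)
    fix n
    have d: "L2 (\<lambda>x. approx n v x - v x)" by (intro L2_diff approx_L2 L)
    have "n2 (\<lambda>x. (approx n v (x + h) - approx n v x) - (v (x + h) - v x))
       = n2 (\<lambda>x. (approx n v (x + h) - v (x + h)) - (approx n v x - v x))" by (simp add: algebra_simps)
    also have "\<dots> \<le> 2 * n2 (\<lambda>x. approx n v (x + h) - v (x + h)) + 2 * n2 (\<lambda>x. approx n v x - v x)"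
      by (rule n2_diff_le[OF L2_translate(1)[OF d] d])
    also have "n2 (\<lambda>x. approx n v (x + h) - v (x + h)) = n2 (\<lambda>x. approx n v x - v x)"
      by (rule L2_translate(2)[OF d])
    finally show "norm (n2 (\<lambda>x. (approx n v (x + h) - approx n v x) - (v (x + h) - v x)))
      \<le> 2 * n2 (\<lambda>x. approx n v x - v x) + 2 * n2 (\<lambda>x. approx n v x - v x)" by simp
  qed
  then have "(\<lambda>n. n2 (\<lambda>x. approx n v (x + h) - approx n v x)) \<longlonglongrightarrow> n2 (\<lambda>x. v (x + h) - v x)"
    by (rule L2_lim_n2[OF a b])
  moreover have "n2 (\<lambda>x. approx n v (x + h) - approx n v x) \<le> (norm h)\<^sup>2 * n2 G" for n
  proof -
    have "n2 (\<lambda>x. approx n v (x + h) - approx n v x) \<le> (norm h)\<^sup>2 * n2 (approx n G)"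
      by (intro C1_translation_bound approx_C1 approx_L2 L s)
    also have "\<dots> \<le> (norm h)\<^sup>2 * n2 G" by (intro mult_left_mono approx_n2 L) auto
    finally show ?thesis .
  qed
  ultimately show ?thesis by (intro LIMSEQ_le_const2) auto
qed

text \<open>The rate depends on \<open>v\<close> only through its gradient norm. This uniformity is
  what makes mollification usable for compactness and for the Nash-type inequality.\<close>

lemma sob_moll_close:
  assumes "sob v G" "0 < r"
  shows "n2 (\<lambda>x. moll r v x - v x) \<le> r\<^sup>2 * n2 G"
proof (rule moll_close[OF assms(2) sobD(1)[OF assms(1)]])
  fix y :: 'a assume y: "norm y \<le> r"
  have "n2 (\<lambda>x. v (x + y) - v x) \<le> (norm y)\<^sup>2 * n2 G" by (rule sob_translation_bound[OF assms(1)])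
  also have "\<dots> \<le> r\<^sup>2 * n2 G" using y by (intro mult_right_mono power_mono) auto
  finally show "n2 (\<lambda>x. v (x + y) - v x) \<le> r\<^sup>2 * n2 G" .
qed

section \<open>Chain rule, truncation, products and affine substitutions\<close>

lemma sob_chain:
  fixes F :: "real \<Rightarrow> real"
  assumes s: "sob v G" and F: "\<And>t. (F has_real_derivative F' t) (at t)" and c: "continuous_on UNIV F'"
    and b: "\<And>t. \<bar>F' t\<bar> \<le> 1" and z: "F 0 = 0"
  shows "sob (\<lambda>x. F (v x)) (\<lambda>x. F' (v x) *\<^sub>R G x)"
proof -
  note L = sobD[OF s]
  have [measurable]: "v \<in> borel_measurable borel" "G \<in> borel_measurable borel" using L by auto
  have cF: "continuous_on UNIV F" using F DERIV_isCont by (auto simp: continuous_on_eq_continuous_at)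
  have [measurable]: "F' \<in> borel_measurable borel" "F \<in> borel_measurable borel"
    using c cF by (auto intro: borel_measurable_continuous_onI)
  have lip: "\<bar>F a - F b\<bar> \<le> \<bar>a - b\<bar>" for a b
  proof -
    have "norm (F a - F b) \<le> 1 * norm (a - b)"
      by (rule field_differentiable_bound[of UNIV F F' 1]) (use F b in \<open>auto intro: DERIV_subset\<close>)
    then show ?thesis by simp
  qed
  then have F0: "\<bar>F t\<bar> \<le> \<bar>t\<bar>" for t using lip[of t 0] z by simp
  obtain r where r: "strict_mono (r::nat\<Rightarrow>nat)" "AE x in lborel. (\<lambda>n. approx (r n) v x) \<longlonglongrightarrow> v x"
    using L2_lim_AE_subseq[OF approx_L2[OF L(1)] L(1) approx_tendsto[OF L(1)]] by blast
  define \<phi> where "\<phi> n = approx (r n) v" for n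
  define g where "g n = approx (r n) G" for n
  have C: "C1 (\<phi> n) (g n)" and Lp: "L2 (\<phi> n)" "L2 (g n)" for n
    using s L by (auto simp: \<phi>_def g_def approx_C1 approx_L2)
  have lim: "(\<lambda>n. n2 (\<lambda>x. \<phi> n x - v x)) \<longlonglongrightarrow> 0" "(\<lambda>n. n2 (\<lambda>x. g n x - G x)) \<longlonglongrightarrow> 0"
    unfolding \<phi>_def g_def using LIMSEQ_subseq_LIMSEQ[OF approx_tendsto[OF L(1)] r(1)]
      LIMSEQ_subseq_LIMSEQ[OF approx_tendsto[OF L(2)] r(1)] by (auto simp: o_def)
  have [measurable]: "\<phi> n \<in> borel_measurable borel" "g n \<in> borel_measurable borel" for n using Lp by auto
  have LF: "L2 (\<lambda>x. F (\<phi> n x))" "L2 (\<lambda>x. F' (\<phi> n x) *\<^sub>R g n x)" for n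
  proof -
    show "L2 (\<lambda>x. F (\<phi> n x))" by (rule L2_dominated(1)[OF Lp(1)[of n]]) (auto simp: F0)
    show "L2 (\<lambda>x. F' (\<phi> n x) *\<^sub>R g n x)"
      by (rule L2_dominated(1)[OF Lp(2)[of n]]) (auto intro!: mult_left_le_one_le b)
  qed
  have LFv: "L2 (\<lambda>x. F (v x))" by (rule L2_dominated(1)[OF L(1)]) (auto simp: F0)
  have LFG: "L2 (\<lambda>x. F' (v x) *\<^sub>R G x)" by (rule L2_dominated(1)[OF L(2)]) (auto intro!: mult_left_le_one_le b)
  show ?thesis
  proof (rule sob_limit[OF C1_sob[OF C1_chain[OF C F c] LF] LFv LFG])
    show "(\<lambda>n. n2 (\<lambda>x. F (\<phi> n x) - F (v x))) \<longlonglongrightarrow> 0"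
    proof (rule Lim_null_comparison[OF _ lim(1)], rule always_eventually, rule allI)
      fix n
      have "n2 (\<lambda>x. F (\<phi> n x) - F (v x)) \<le> n2 (\<lambda>x. \<phi> n x - v x)"
        by (rule L2_dominated(2)[OF L2_diff[OF Lp(1) L(1)]]) (auto simp: lip)
      then show "norm (n2 (\<lambda>x. F (\<phi> n x) - F (v x))) \<le> n2 (\<lambda>x. \<phi> n x - v x)" by simp
    qed
    \<comment> \<open>The difference of two derivatives is at most 2 in absolute value; with the
      factor 1/2 the function \<open>G\<close> itself dominates. The factor 8 below undoes this: 2
      from the sum of two terms, 4 from the square.\<close>
    have d: "(\<lambda>n. n2 (\<lambda>x. (1/2) *\<^sub>R (F' (\<phi> n x) - F' (v x)) *\<^sub>R G x - 0)) \<longlonglongrightarrow> 0"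
    proof (rule L2_dominated_convergence(1)[OF L(2)])
      show "AE x in lborel. (\<lambda>n. (1/2) *\<^sub>R (F' (\<phi> n x) - F' (v x)) *\<^sub>R G x) \<longlonglongrightarrow> 0"
        using r(2)
      proof eventually_elim
        case (elim x)
        have "isCont F' (v x)" using c by (simp add: continuous_on_eq_continuous_at)
        then have "(\<lambda>n. F' (\<phi> n x)) \<longlonglongrightarrow> F' (v x)"
          unfolding \<phi>_def by (rule isCont_tendsto_compose[OF _ elim])
        then have "(\<lambda>n. (1/2) *\<^sub>R (F' (\<phi> n x) - F' (v x)) *\<^sub>R G x) \<longlonglongrightarrow> (1/2) *\<^sub>R (F' (v x) - F' (v x)) *\<^sub>R G x"
          by (intro tendsto_intros)
        then show ?case by simp
      qed
      show "AE x in lborel. norm ((1/2) *\<^sub>R (F' (\<phi> n x) - F' (v x)) *\<^sub>R G x) \<le> norm (G x)" for n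
      proof (rule AE_I2)
        fix x
        have "\<bar>F' (\<phi> n x) - F' (v x)\<bar> \<le> 2" using b[of "\<phi> n x"] b[of "v x"] by linarith
        then have "\<bar>F' (\<phi> n x) - F' (v x)\<bar> * norm (G x) \<le> 2 * norm (G x)" by (intro mult_right_mono) auto
        then show "norm ((1/2) *\<^sub>R (F' (\<phi> n x) - F' (v x)) *\<^sub>R G x) \<le> norm (G x)" by simp
      qed
    qed auto
    have "(\<lambda>n. 2 * n2 (\<lambda>x. g n x - G x) + 8 * n2 (\<lambda>x. (1/2) *\<^sub>R (F' (\<phi> n x) - F' (v x)) *\<^sub>R G x - 0)) \<longlonglongrightarrow> 2 * 0 + 8 * 0"
      by (intro tendsto_intros lim d)
    then have zz: "(\<lambda>n. 2 * n2 (\<lambda>x. g n x - G x) + 8 * n2 (\<lambda>x. (1/2) *\<^sub>R (F' (\<phi> n x) - F' (v x)) *\<^sub>R G x - 0)) \<longlonglongrightarrow> 0" by simp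
    show "(\<lambda>n. n2 (\<lambda>x. F' (\<phi> n x) *\<^sub>R g n x - F' (v x) *\<^sub>R G x)) \<longlonglongrightarrow> 0"
    proof (rule Lim_null_comparison[OF _ zz], rule always_eventually, rule allI)
      fix n
      let ?A = "\<lambda>x. F' (\<phi> n x) *\<^sub>R (g n x - G x)" and ?B = "\<lambda>x. (F' (\<phi> n x) - F' (v x)) *\<^sub>R G x"
      have A: "L2 ?A" "n2 ?A \<le> n2 (\<lambda>x. g n x - G x)"
        by (rule L2_dominated[OF L2_diff[OF Lp(2)[of n] L(2)]]; auto intro!: mult_left_le_one_le b)+
      have "L2 (\<lambda>x. F' (\<phi> n x) *\<^sub>R G x)" by (rule L2_dominated(1)[OF L(2)]) (auto intro!: mult_left_le_one_le b)
      from L2_diff[OF this LFG] have B: "L2 ?B" by (simp add: scaleR_diff_left)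
      have "n2 (\<lambda>x. F' (\<phi> n x) *\<^sub>R g n x - F' (v x) *\<^sub>R G x) = n2 (\<lambda>x. ?A x + ?B x)"
        by (simp add: algebra_simps)
      also have "\<dots> \<le> 2 * n2 ?A + 2 * n2 ?B" by (rule n2_add_le[OF A(1) B])
      also have "\<dots> \<le> 2 * n2 (\<lambda>x. g n x - G x) + 2 * n2 ?B" using A(2) by simp
      also have "2 * n2 ?B = 8 * n2 (\<lambda>x. (1/2) *\<^sub>R (F' (\<phi> n x) - F' (v x)) *\<^sub>R G x - 0)"
        using n2_scaleR[of "1/2" ?B] by (simp add: power2_eq_square)
      finally show "norm (n2 (\<lambda>x. F' (\<phi> n x) *\<^sub>R g n x - F' (v x) *\<^sub>R G x))
         \<le> 2 * n2 (\<lambda>x. g n x - G x) + 8 * n2 (\<lambda>x. (1/2) *\<^sub>R (F' (\<phi> n x) - F' (v x)) *\<^sub>R G x - 0)" by simp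
    qed
  qed
qed

text \<open>The limit \<open>H'\<close> may be discontinuous. Its value at a kink is whatever the
  approximating derivatives converge to there, and dominated convergence takes care of the
  rest.\<close>

lemma sob_chain_limit:
  fixes F :: "nat \<Rightarrow> real \<Rightarrow> real"
  assumes s: "sob v G" and F: "\<And>n t. (F n has_real_derivative F' n t) (at t)" and c: "\<And>n. continuous_on UNIV (F' n)"
    and b: "\<And>n t. \<bar>F' n t\<bar> \<le> 1" and z: "\<And>n. F n 0 = 0"
    and l: "\<And>t. (\<lambda>n. F n t) \<longlonglongrightarrow> H t" "\<And>t. (\<lambda>n. F' n t) \<longlonglongrightarrow> H' t"
  shows "sob (\<lambda>x. H (v x)) (\<lambda>x. H' (v x) *\<^sub>R G x)"
proof -
  note L = sobD[OF s]
  have [measurable]: "v \<in> borel_measurable borel" "G \<in> borel_measurable borel" using L by auto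
  have cF: "continuous_on UNIV (F n)" for n using DERIV_isCont[OF F[of n]] by (simp add: continuous_on_eq_continuous_at)
  have Fm[measurable]: "F' n \<in> borel_measurable borel" "F n \<in> borel_measurable borel" for n
    using c cF by (auto intro: borel_measurable_continuous_onI)
  have [measurable]: "H \<in> borel_measurable borel" "H' \<in> borel_measurable borel"
    by (rule borel_measurable_LIMSEQ_metric[OF _ l(1)], simp) (rule borel_measurable_LIMSEQ_metric[OF _ l(2)], simp)
  have F0: "\<bar>F n t\<bar> \<le> \<bar>t\<bar>" for t n
  proof -
    have "norm (F n t - F n 0) \<le> 1 * norm (t - 0)"
      by (rule field_differentiable_bound[of UNIV "F n" "F' n" 1]) (use F b in \<open>auto intro: DERIV_subset\<close>)
    then show ?thesis using z by simp
  qed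
  have L1: "(\<lambda>n. n2 (\<lambda>x. F n (v x) - H (v x))) \<longlonglongrightarrow> 0" "L2 (\<lambda>x. H (v x))"
    using L2_dominated_convergence[OF L(1), of "\<lambda>n x. F n (v x)" "\<lambda>x. H (v x)"] by (simp_all add: F0 l)
  have bG: "norm (F' n (v x) *\<^sub>R G x) \<le> norm (G x)" for n x
    by (auto intro!: mult_left_le_one_le b)
  have L2': "(\<lambda>n. n2 (\<lambda>x. F' n (v x) *\<^sub>R G x - H' (v x) *\<^sub>R G x)) \<longlonglongrightarrow> 0" "L2 (\<lambda>x. H' (v x) *\<^sub>R G x)"
  proof -
    have m: "(\<lambda>x. F' n (v x) *\<^sub>R G x) \<in> borel_measurable borel" "(\<lambda>x. H' (v x) *\<^sub>R G x) \<in> borel_measurable borel" for n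
      by measurable
    have "AE x in lborel. (\<lambda>n. F' n (v x) *\<^sub>R G x) \<longlonglongrightarrow> H' (v x) *\<^sub>R G x"
      by (intro AE_I2 tendsto_intros l)
    note * = L2_dominated_convergence[OF L(2) m this AE_I2[OF bG]]
    show "(\<lambda>n. n2 (\<lambda>x. F' n (v x) *\<^sub>R G x - H' (v x) *\<^sub>R G x)) \<longlonglongrightarrow> 0" by (rule *(1))
    show "L2 (\<lambda>x. H' (v x) *\<^sub>R G x)" by (rule *(2))
  qed
  show ?thesis
    by (rule sob_limit[OF sob_chain[OF s F c b z] L1(2) L2'(2) L1(1) L2'(1)])
qed

text \<open>The square of the positive part is the simplest \<open>C1\<close> function with a
  one-sided support. It regularizes the truncation in \<open>sob_pos_part\<close> and builds the
  profile of the cutoff.\<close>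

lemma DERIV_max_sq: "((\<lambda>t. (max 0 t)\<^sup>2) has_real_derivative 2 * max 0 t) (at t)" for t :: real
proof (cases "t = 0")
  case True
  have "(\<lambda>h. ((max 0 (0 + h))\<^sup>2 - (max 0 0)\<^sup>2) / h) \<midarrow>0\<rightarrow> (0::real)"
  proof (rule Lim_null_comparison)
    show "\<forall>\<^sub>F h in at 0. norm (((max 0 (0 + h))\<^sup>2 - (max 0 0)\<^sup>2) / h) \<le> \<bar>h::real\<bar>"
      by (rule always_eventually) (auto simp: max_def power2_eq_square)
    show "(\<lambda>h::real. \<bar>h\<bar>) \<midarrow>0\<rightarrow> 0" using tendsto_rabs[OF tendsto_ident_at, of "0::real" UNIV] by simp
  qed
  then show ?thesis using True by (simp add: DERIV_def)
next
  case False
  show ?thesis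
  proof (cases "t > 0")
    case True
    have "((\<lambda>t. t\<^sup>2) has_real_derivative 2 * max 0 t) (at t)"
      using True by (auto intro!: derivative_eq_intros)
    then show ?thesis
      by (rule has_field_derivative_transform_within_open[of _ _ _ "{0<..}"]) (use True in auto)
  next
    case nt: False
    have "((\<lambda>t. 0) has_real_derivative 2 * max 0 t) (at t)" using nt by simp
    then show ?thesis
      by (rule has_field_derivative_transform_within_open[of _ _ _ "{..<0}"]) (use nt False in auto)
  qed
qed

text \<open>The threshold is nonnegative so that the truncation vanishes at 0 and stays square
  integrable. The regularized derivatives all vanish where \<open>v x = k\<close>, hence the strict
  inequality in the gradient.\<close>

lemma sob_pos_part:
  assumes s: "sob v G" and k: "0 \<le> k"
  shows "sob (\<lambda>x. max 0 (v x - k)) (\<lambda>x. (if v x > k then 1 else 0) *\<^sub>R G x)"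
proof -
  define e where "e n = 1 / real (Suc n)" for n
  have e0: "e n > 0" for n by (simp add: e_def)
  have e: "e \<longlonglongrightarrow> 0" unfolding e_def using LIMSEQ_Suc[OF lim_1_over_n] by simp
  \<comment> \<open>A hyperbola smoothing the kink at \<open>k\<close>; subtracting
    \<open>e n\<close> restores the value 0 at 0.\<close>
  define S where "S n t = sqrt ((max 0 (t - k))\<^sup>2 + (e n)\<^sup>2)" for n t
  have Sp: "S n t > 0" "S n t \<ge> max 0 (t - k)" for n t
    using e0[of n] by (auto simp: S_def add_nonneg_pos intro: real_le_rsqrt)
  have Sl: "(\<lambda>n. S n t) \<longlonglongrightarrow> max 0 (t - k)" for t
  proof -
    have "(\<lambda>n. S n t) \<longlonglongrightarrow> sqrt ((max 0 (t - k))\<^sup>2 + 0\<^sup>2)" unfolding S_def by (intro tendsto_intros e)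
    then show ?thesis by simp
  qed
  have ptd: "((\<lambda>t. (max 0 (t - k))\<^sup>2) has_real_derivative 2 * max 0 (t - k)) (at t)" for t
  proof -
    have "((\<lambda>t. t - k) has_real_derivative 1) (at t)" by (auto intro!: derivative_eq_intros)
    from DERIV_chain2[OF DERIV_max_sq this] show ?thesis by simp
  qed
  show ?thesis
  proof (rule sob_chain_limit[OF s, where F="\<lambda>n t. S n t - e n" and F'="\<lambda>n t. max 0 (t - k) / S n t"])
    fix n :: nat and t :: real
    have p: "0 < (max 0 (t - k))\<^sup>2 + (e n)\<^sup>2" using e0[of n] by (simp add: add_nonneg_pos)
    have "((\<lambda>t. sqrt ((max 0 (t - k))\<^sup>2 + (e n)\<^sup>2)) has_real_derivative
        (2 * max 0 (t - k) + 0) * (inverse (sqrt ((max 0 (t - k))\<^sup>2 + (e n)\<^sup>2)) / 2)) (at t)"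
      using DERIV_chain2[OF DERIV_real_sqrt[OF p] DERIV_add[OF ptd[of t] DERIV_const[of "(e n)\<^sup>2"]]]
      by (simp add: mult.commute)
    note d = DERIV_diff[OF this DERIV_const[of "e n"]]
    have "(2 * max 0 (t - k) + 0) * (inverse (S n t) / 2) - 0 = max 0 (t - k) / S n t"
      using Sp(1)[of n t] by (simp only: divide_inverse) simp
    from this[unfolded S_def]
    show "((\<lambda>t. S n t - e n) has_real_derivative max 0 (t - k) / S n t) (at t)"
      unfolding S_def using d by (rule subst)
    show "\<bar>max 0 (t - k) / S n t\<bar> \<le> 1" using Sp(1)[of n t] Sp(2)[where n=n and t=t] by simp
    show "S n 0 - e n = 0" using k e0[of n] by (simp add: S_def)
  next
    fix n :: nat
    show "continuous_on UNIV (\<lambda>t. max 0 (t - k) / S n t)"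
    proof (rule continuous_on_divide)
      have "continuous_on UNIV (\<lambda>t. sqrt ((max 0 (t - k))\<^sup>2 + (e n)\<^sup>2))"
        by (rule continuous_on_real_sqrt[OF continuous_on_add[OF continuous_on_power[OF continuous_on_max[OF continuous_on_const continuous_on_diff[OF continuous_on_id continuous_on_const]]] continuous_on_const]])
      then show "continuous_on UNIV (S n)" by (simp add: S_def[abs_def])
      show "\<forall>t\<in>UNIV. S n t \<noteq> 0" using Sp(1)[of n] less_irrefl by metis
      show "continuous_on UNIV (\<lambda>t. max 0 (t - k))"
        by (rule continuous_on_max[OF continuous_on_const continuous_on_diff[OF continuous_on_id continuous_on_const]])
    qed
  next
    fix t
    have "(\<lambda>n. S n t - e n) \<longlonglongrightarrow> max 0 (t - k) - 0" by (intro tendsto_intros Sl e)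
    then show "(\<lambda>n. S n t - e n) \<longlonglongrightarrow> max 0 (t - k)" by simp
    show "(\<lambda>n. max 0 (t - k) / S n t) \<longlonglongrightarrow> (if t > k then 1 else 0)"
    proof (cases "t > k")
      case True
      then have "(\<lambda>n. max 0 (t - k) / S n t) \<longlonglongrightarrow> max 0 (t - k) / max 0 (t - k)"
        by (intro tendsto_intros Sl) auto
      then show ?thesis using True by simp
    qed simp
  qed
qed

lemma sob_abs:
  assumes s: "sob v G" shows "sob (\<lambda>x. \<bar>v x\<bar>) (\<lambda>x. sgn (v x) *\<^sub>R G x)"
proof -
  have 1: "sob (\<lambda>x. max 0 (v x)) (\<lambda>x. (if v x > 0 then 1 else 0) *\<^sub>R G x)"
    using sob_pos_part[OF s, of 0] by simp
  have 2: "sob (\<lambda>x. max 0 (- v x)) (\<lambda>x. (if - v x > 0 then 1 else 0) *\<^sub>R (- G x))"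
    using sob_pos_part[OF sob_cmult[OF s, of "-1"], of 0] by simp
  have "(\<lambda>x. \<bar>v x\<bar>) = (\<lambda>x. max 0 (v x) + max 0 (- v x))"
    "(\<lambda>x. sgn (v x) *\<^sub>R G x) = (\<lambda>x. (if v x > 0 then 1 else 0) *\<^sub>R G x + (if - v x > 0 then 1 else 0) *\<^sub>R (- G x))"
    by (auto simp: fun_eq_iff sgn_if)
  then show ?thesis using sob_add[OF 1 2] by simp
qed

text \<open>If \<open>\<psi>\<close> is a test function then so is \<open>\<eta> \<psi>\<close>;
  testing \<open>v\<close> with it and applying the product rule moves the factor
  \<open>\<eta>\<close> from the test function to \<open>v\<close>.\<close>

lemma sob_product:
  fixes \<eta> :: "'a::euclidean_space \<Rightarrow> real"
  assumes s: "sob v G" and e: "C1 \<eta> D\<eta>" and M: "\<And>x. \<bar>\<eta> x\<bar> \<le> M" "\<And>x. norm (D\<eta> x) \<le> M"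
  shows "sob (\<lambda>x. \<eta> x * v x) (\<lambda>x. \<eta> x *\<^sub>R G x + v x *\<^sub>R D\<eta> x)"
  unfolding sob_def
proof (intro conjI allI impI)
  note L = sobD[OF s]
  have [measurable]: "v \<in> borel_measurable borel" "G \<in> borel_measurable borel" using L by auto
  note [measurable] = C1_meas[OF e]
  have M0: "0 \<le> M" using order_trans[OF abs_ge_zero M(1)] by blast
  show L1: "L2 (\<lambda>x. \<eta> x * v x)"
    by (rule L2_dominated(1)[OF L2_cmult[OF L(1), of M]]) (auto simp: abs_mult M0 intro!: mult_right_mono M)
  have L2: "L2 (\<lambda>x. \<eta> x *\<^sub>R G x)"
    by (rule L2_dominated(1)[OF L2_scaleR[OF L(2), of M]]) (auto simp: M0 intro!: mult_right_mono M)
  have L3: "L2 (\<lambda>x. v x *\<^sub>R D\<eta> x)"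
    by (rule L2_dominated(1)[OF L2_cmult[OF L(1), of M]])
      (auto simp: M0 abs_mult mult.commute[of M] intro!: mult_left_mono M)
  show "L2 (\<lambda>x. \<eta> x *\<^sub>R G x + v x *\<^sub>R D\<eta> x)" by (rule L2_add[OF L2 L3])
  fix \<psi> :: "'a \<Rightarrow> real" and D\<psi> u assume p: "C1 \<psi> D\<psi>" "bsupp \<psi>"
  have Lp: "L2 \<psi>" by (rule bsupp_L2[OF C1_cont[OF p(1)] p(2)])
  have LD: "L2 D\<psi>" by (rule bsupp_L2[OF C1_contD[OF p(1)] bsupp_gradient[OF p]])
  note i = L2_parts_integrable[OF L1 LD, of u] L2_parts_integrable[OF Lp L2, of u] L2_parts_integrable[OF Lp L3, of u]
  have "(LINT x|lborel. v x * ((\<eta> x *\<^sub>R D\<psi> x + \<psi> x *\<^sub>R D\<eta> x) \<bullet> u)) = - (LINT x|lborel. (\<eta> x * \<psi> x) * (G x \<bullet> u))"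
    by (rule sob_parts[OF s C1_mult[OF e p(1)] bsupp_mult_left[OF p(2)]])
  moreover have "(LINT x|lborel. v x * ((\<eta> x *\<^sub>R D\<psi> x + \<psi> x *\<^sub>R D\<eta> x) \<bullet> u))
      = (LINT x|lborel. (\<eta> x * v x) * (D\<psi> x \<bullet> u) + \<psi> x * ((v x *\<^sub>R D\<eta> x) \<bullet> u))"
    by (simp add: inner_add_left algebra_simps)
  moreover have "\<dots> = (LINT x|lborel. (\<eta> x * v x) * (D\<psi> x \<bullet> u)) + (LINT x|lborel. \<psi> x * ((v x *\<^sub>R D\<eta> x) \<bullet> u))"
    using i by (intro Bochner_Integration.integral_add) auto
  moreover have "(LINT x|lborel. (\<eta> x * \<psi> x) * (G x \<bullet> u)) = (LINT x|lborel. \<psi> x * ((\<eta> x *\<^sub>R G x) \<bullet> u))"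
    by (simp add: algebra_simps)
  moreover have "(LINT x|lborel. \<psi> x * ((\<eta> x *\<^sub>R G x + v x *\<^sub>R D\<eta> x) \<bullet> u))
     = (LINT x|lborel. \<psi> x * ((\<eta> x *\<^sub>R G x) \<bullet> u)) + (LINT x|lborel. \<psi> x * ((v x *\<^sub>R D\<eta> x) \<bullet> u))"
    unfolding inner_add_left distrib_left using i by (intro Bochner_Integration.integral_add) auto
  ultimately show "(LINT x|lborel. \<eta> x * v x * (D\<psi> x \<bullet> u)) = - (LINT x|lborel. \<psi> x * ((\<eta> x *\<^sub>R G x + v x *\<^sub>R D\<eta> x) \<bullet> u))"
    by linarith
qed

lemma C1_affine:
  fixes L :: "'a::euclidean_space \<Rightarrow> 'a"
  assumes f: "C1 f Df" and L: "linear L" and sa: "\<And>x y. L x \<bullet> y = x \<bullet> L y"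
  shows "C1 (\<lambda>x. f (t + L x)) (\<lambda>x. L (Df (t + L x)))"
  unfolding C1_def
proof (intro conjI allI)
  have bl: "bounded_linear L" using L linear_conv_bounded_linear by blast
  fix x
  have "((\<lambda>x. f (t + L x)) has_derivative (\<lambda>h. Df (t + L x) \<bullet> L h)) (at x)"
    by (rule has_derivative_compose[OF _ C1_D[OF f]])
      (auto intro!: derivative_eq_intros bounded_linear_imp_has_derivative[OF bl])
  then show "((\<lambda>x. f (t + L x)) has_derivative (\<bullet>) (L (Df (t + L x)))) (at x)" using sa[of "Df (t + L x)"] by presburger
  show "continuous_on UNIV (\<lambda>x. L (Df (t + L x)))"
    by (intro bounded_linear.continuous_on[OF bl] continuous_on_compose2[OF C1_contD[OF f]] continuous_intros) auto
qed

text \<open>A selfadjoint \<open>L\<close> whose square is a multiple of the identity covers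
  dilations and reflections in one stroke: no transpose occurs, the inverse is a multiple of
  \<open>L\<close>, and \<open>L\<close> scales all norms by \<open>c\<close>.\<close>

lemma sob_affine:
  fixes L :: "'a::euclidean_space \<Rightarrow> 'a"
  assumes s: "sob v G" and L: "linear L" and sa: "\<And>x y. L x \<bullet> y = x \<bullet> L y"
    and sq: "\<And>x. L (L x) = c\<^sup>2 *\<^sub>R x" and c: "c > 0" and vm: "vol_map \<kappa> (\<lambda>x. t + L x)"
  shows "sob (\<lambda>x. v (t + L x)) (\<lambda>x. L (G (t + L x)))"
    "n2 (\<lambda>x. L (G (t + L x))) = \<kappa> * c\<^sup>2 * n2 G"
proof -
  note LL = sobD[OF s]
  interpret L: linear L by fact
  have bl: "bounded_linear L" using L linear_conv_bounded_linear by blast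
  have [measurable]: "L \<in> borel_measurable borel"
    by (intro borel_measurable_continuous_onI linear_continuous_on bl)
  have nL: "(norm (L x))\<^sup>2 = c\<^sup>2 * (norm x)\<^sup>2" for x
    unfolding power2_norm_eq_inner sa sq by simp
  then have nL': "norm (L x) = norm (c *\<^sub>R x)" for x
    using power2_eq_imp_eq[of "norm (L x)" "norm (c *\<^sub>R x)"] by (simp add: power_mult_distrib)
  note LT = vol_map_L2[OF vm LL(1)] vol_map_L2[OF vm LL(2)]
  have [measurable]: "v \<in> borel_measurable borel" "G \<in> borel_measurable borel" using LL by auto
  have LG: "L2 (\<lambda>x. L (G (t + L x)))"
    by (rule L2_dominated(1)[OF L2_scaleR[OF LT(3), of c]]) (auto simp: nL')
  show "n2 (\<lambda>x. L (G (t + L x))) = \<kappa> * c\<^sup>2 * n2 G"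
    using LT(4) by (simp add: n2_def nL mult_ac)
  show "sob (\<lambda>x. v (t + L x)) (\<lambda>x. L (G (t + L x)))"
    unfolding sob_def
  proof (intro conjI allI impI LT(1) LG)
    fix \<psi> :: "'a \<Rightarrow> real" and D\<psi> e assume p: "C1 \<psi> D\<psi>" "bsupp \<psi>"
    \<comment> \<open>The inverse of \<open>L\<close>. The test function is transported by the
      inverse of the affine map, the integral is rewritten there, and the result is carried
      back.\<close>
    define M where "M x = (1 / c\<^sup>2) *\<^sub>R L x" for x
    have linM: "linear M" unfolding M_def using L by (intro linear_compose_scale_right)
    define b where "b = - M t"
    define \<psi>' where "\<psi>' y = \<psi> (b + M y)" for y
    define D' where "D' y = M (D\<psi> (b + M y))" for y
    have p': "C1 \<psi>' D'" unfolding \<psi>'_def[abs_def] D'_def[abs_def]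
      by (rule C1_affine[OF p(1) linM]) (simp add: M_def sa)
    have MLid: "M (L x) = x" "L (M x) = x" for x using c by (simp_all add: M_def sq L.scale)
    have invT: "b + M (t + L x) = x" for x by (simp add: b_def linear_add[OF linM] MLid)
    have e1: "\<psi>' (t + L x) = \<psi> x" "D' (t + L x) \<bullet> L e = D\<psi> x \<bullet> e" for x
      by (simp_all add: \<psi>'_def D'_def invT MLid sa[symmetric])
    have "bsupp \<psi>'"
    proof -
      obtain R where R: "\<And>x. norm x \<ge> R \<Longrightarrow> \<psi> x = 0" using p(2) by (auto simp: bsupp_def)
      have "\<psi>' y = 0" if y: "norm y \<ge> c * (\<bar>R\<bar> + norm b)" for y
      proof -
        have "norm (M y) = norm y / c" using c by (simp add: M_def nL' power2_eq_square)
        then have "norm (M y) \<ge> \<bar>R\<bar> + norm b" using y c by (simp add: pos_le_divide_eq mult.commute)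
        then have "norm (b + M y) \<ge> R" using norm_triangle_ineq2[of "M y" "- b"] by (simp add: add.commute)
        then show ?thesis by (simp add: \<psi>'_def R)
      qed
      then show ?thesis by (auto simp: bsupp_def)
    qed
    note ip = sob_parts[OF s p' this, of "L e"]
    note [measurable] = C1_meas[OF p']
    have "(LINT x|lborel. v (t + L x) * (D\<psi> x \<bullet> e)) = (LINT x|lborel. v (t + L x) * (D' (t + L x) \<bullet> L e))"
      by (simp add: e1)
    also have "\<dots> = \<kappa> *\<^sub>R (LINT x|lborel. v x * (D' x \<bullet> L e))"
      by (rule vol_map_integral[OF vm]) measurable
    also have "\<dots> = - (\<kappa> *\<^sub>R (LINT x|lborel. \<psi>' x * (G x \<bullet> L e)))" by (simp add: ip)
    also have "\<kappa> *\<^sub>R (LINT x|lborel. \<psi>' x * (G x \<bullet> L e)) = (LINT x|lborel. \<psi>' (t + L x) * (G (t + L x) \<bullet> L e))"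
      by (rule vol_map_integral[OF vm, symmetric]) measurable
    also have "\<dots> = (LINT x|lborel. \<psi> x * (L (G (t + L x)) \<bullet> e))" by (simp add: e1 sa)
    finally show "(LINT x|lborel. v (t + L x) * (D\<psi> x \<bullet> e)) = - (LINT x|lborel. \<psi> x * (L (G (t + L x)) \<bullet> e))" .
  qed
qed

lemma sob_dilate:
  fixes v :: "'a::euclidean_space \<Rightarrow> real"
  assumes s: "sob v G" and c: "c > 0"
  shows "sob (\<lambda>x. v (c *\<^sub>R x)) (\<lambda>x. c *\<^sub>R G (c *\<^sub>R x))"
    "n2 (\<lambda>x. c *\<^sub>R G (c *\<^sub>R x)) = c\<^sup>2 / c ^ DIM('a) * n2 G"
  using sob_affine[OF s, of "\<lambda>x. c *\<^sub>R x" c "1 / \<bar>c\<bar> ^ DIM('a)" 0] c vol_map_homothety[where 'a='a, of c]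
  by (simp_all add: linear_scaleR power2_eq_square)

section \<open>Reflections\<close>

definition mirror :: "'a::euclidean_space \<Rightarrow> real \<Rightarrow> 'a \<Rightarrow> 'a" where
  "mirror n b x = x - (2 * (x \<bullet> n - b)) *\<^sub>R n"

definition mirror0 :: "'a::euclidean_space \<Rightarrow> 'a \<Rightarrow> 'a" where
  "mirror0 n x = x - (2 * (x \<bullet> n)) *\<^sub>R n"

lemma mirror_eq: "mirror n b x = (2 * b) *\<^sub>R n + mirror0 n x"
  by (simp add: mirror_def mirror0_def algebra_simps)

lemma linear_mirror0: "linear (mirror0 n)"
  unfolding mirror0_def by (rule linearI) (auto simp: algebra_simps inner_add_left)

lemma mirror0_selfadjoint: "mirror0 n x \<bullet> y = x \<bullet> mirror0 n y"
  by (simp add: mirror0_def inner_diff_left inner_diff_right inner_commute)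

lemma mirror0_involution: "norm n = 1 \<Longrightarrow> mirror0 n (mirror0 n x) = x"
  by (simp add: mirror0_def inner_diff_left norm_eq_1 algebra_simps)

lemma norm_mirror0: "norm n = 1 \<Longrightarrow> norm (mirror0 n x) = norm x"
  by (simp add: norm_eq_sqrt_inner mirror0_selfadjoint mirror0_involution)

lemma mirror_inner: "norm n = 1 \<Longrightarrow> mirror n b x \<bullet> n - b = - (x \<bullet> n - b)"
  by (simp add: mirror_def inner_diff_left norm_eq_1 algebra_simps)

lemma mirror_mirror: "norm n = 1 \<Longrightarrow> mirror n b (mirror n b x) = x"
  unfolding mirror_def[of n b "mirror n b x"] by (simp add: mirror_inner) (simp add: mirror_def algebra_simps)

lemma vol_map_mirror0: "norm n = 1 \<Longrightarrow> vol_map 1 (mirror0 n)"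
  by (rule vol_map_involutive_isometry) (auto simp: linear_mirror0 mirror0_involution norm_mirror0)

lemma vol_map_mirror: "norm n = 1 \<Longrightarrow> vol_map 1 (mirror n b)"
  using vol_map_compose[OF vol_map_mirror0[of n] vol_map_affine[of 1 "(2 * b) *\<^sub>R n"]]
  by (simp add: mirror_eq[abs_def])

lemma sob_mirror:
  assumes "sob v G" "norm n = 1"
  shows "sob (\<lambda>x. v (mirror n b x)) (\<lambda>x. mirror0 n (G (mirror n b x)))"
    "n2 (\<lambda>x. mirror0 n (G (mirror n b x))) = n2 G"
  using sob_affine[OF assms(1) linear_mirror0[of n] mirror0_selfadjoint, of 1 1 "(2 * b) *\<^sub>R n"]
    vol_map_mirror[OF assms(2), of b] mirror0_involution[OF assms(2)]
  by (simp_all add: mirror_eq[abs_def] mirror_eq)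

lemma hyperplane_null:
  fixes n :: "'a::euclidean_space"
  assumes "norm n = 1" shows "AE x in lborel. x \<bullet> n \<noteq> b"
proof -
  have "negligible {x. n \<bullet> x = b}" using assms by (intro negligible_hyperplane) auto
  moreover have "{x. n \<bullet> x = b} \<in> sets borel" by (intro borel_closed closed_hyperplane)
  ultimately have "{x. n \<bullet> x = b} \<in> null_sets lborel"
    by (simp add: negligible_iff_null_sets null_sets_completion_iff)
  then have "AE x in lborel. x \<notin> {x. n \<bullet> x = b}" by (rule AE_not_in)
  then show ?thesis by eventually_elim (auto simp: inner_commute)
qed

text \<open>Since \<open>f\<close> vanishes on the hyperplane, cutting it off at the hyperplane
  leaves a Lipschitz function, which is differentiable off a null set;
  \<open>integral_dir_deriv_zero\<close> applies to it.\<close>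

lemma half_space_integral_zero:
  assumes f: "C1 f Df" "bsupp f" and n: "norm n = 1" and z: "\<And>x. x \<bullet> n = b \<Longrightarrow> f x = 0"
  shows "(LINT x|lborel. indicator {x. x \<bullet> n < b} x * (Df x \<bullet> e)) = 0"
proof -
  let ?I = "indicator {x. x \<bullet> n < b} :: 'a \<Rightarrow> real"
  have [measurable]: "f \<in> borel_measurable borel" "Df \<in> borel_measurable borel" using C1_meas[OF f(1)] by auto
  have oH: "open {x. x \<bullet> n < b}" "open {x. x \<bullet> n > b}"
    by (intro open_Collect_less continuous_intros)+
  then have [measurable]: "?I \<in> borel_measurable borel" by (intro borel_measurable_indicator) auto
  obtain M where M: "\<And>x. norm (Df x) \<le> M"
    using bsupp_bounded[OF C1_contD bsupp_gradient] f by blast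
  have M0: "0 \<le> M" using order_trans[OF norm_ge_zero M] by blast
  have dist: "\<bar>f x\<bar> \<le> M * \<bar>x \<bullet> n - b\<bar>" for x
  proof -
    \<comment> \<open>The orthogonal projection of \<open>x\<close> onto the hyperplane, a zero of
      \<open>f\<close>.\<close>
    define p where "p = x - (x \<bullet> n - b) *\<^sub>R n"
    have "p \<bullet> n = b" using n by (simp add: p_def inner_diff_left norm_eq_1)
    then have "f p = 0" by (rule z)
    then show ?thesis using C1_lipschitz[OF f(1) M, of x p] n by (simp add: p_def)
  qed
  have cross: "\<bar>f x\<bar> \<le> M * norm (x - y)" if "x \<bullet> n < b \<and> \<not> y \<bullet> n < b \<or> \<not> x \<bullet> n < b \<and> y \<bullet> n < b" for x y
  proof -
    have "\<bar>x \<bullet> n - b\<bar> \<le> \<bar>(x - y) \<bullet> n\<bar>" using that by (auto simp: inner_diff_left)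
    also have "\<dots> \<le> norm (x - y)" using Cauchy_Schwarz_ineq2[of "x - y" n] n by simp
    finally show ?thesis using dist[of x] M0 by (meson mult_left_mono order_trans)
  qed
  have lip: "\<bar>?I x * f x - ?I y * f y\<bar> \<le> M * norm (x - y)" for x y
    using C1_lipschitz[OF f(1) M, of x y] cross[of x y] cross[of y x] M0
    by (auto simp: indicator_def norm_minus_commute)
  have i: "integrable lborel f" using f bsupp_integrable C1_cont by blast
  show ?thesis
  proof (rule integral_dir_deriv_zero(2)[where f="\<lambda>x. ?I x * f x"])
    show "integrable lborel (\<lambda>x. ?I x * f x)"
      by (rule Bochner_Integration.integrable_bound[OF i]) (auto simp: indicator_def)
    show "bsupp (\<lambda>x. ?I x * f x)" by (rule bsupp_mult_left[OF f(2)])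
    show "\<bar>?I (x + t *\<^sub>R e) * f (x + t *\<^sub>R e) - ?I x * f x\<bar> \<le> (M * norm e) * \<bar>t\<bar>" for x t
      using lip[of "x + t *\<^sub>R e" x] by (simp add: mult_ac)
    show "AE x in lborel. (\<lambda>k. (?I (x + (1 / real (Suc k)) *\<^sub>R e) * f (x + (1 / real (Suc k)) *\<^sub>R e) - ?I x * f x) * real (Suc k)) \<longlonglongrightarrow> ?I x * (Df x \<bullet> e)"
      using hyperplane_null[OF n, of b]
    proof eventually_elim
      case (elim x)
      \<comment> \<open>The open side of the hyperplane that contains \<open>x\<close>; the
        indicator is constant on it.\<close>
      define U where "U = (if x \<bullet> n < b then {x. x \<bullet> n < b} else {x. x \<bullet> n > b})"
      have U: "open U" "x \<in> U" using oH elim by (auto simp: U_def)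
      have IU: "?I y = ?I x" if "y \<in> U" for y
        using that elim by (auto simp: U_def indicator_def split: if_splits)
      have "(\<lambda>k. x + (1 / real (Suc k)) *\<^sub>R e) \<longlonglongrightarrow> x + 0 *\<^sub>R e"
        using LIMSEQ_Suc[OF lim_1_over_n] by (intro tendsto_intros) simp
      then have "\<forall>\<^sub>F k in sequentially. x + (1 / real (Suc k)) *\<^sub>R e \<in> U"
        using U by (intro topological_tendstoD) auto
      then have ev: "\<forall>\<^sub>F k in sequentially. ?I x * ((f (x + (1 / real (Suc k)) *\<^sub>R e) - f x) * real (Suc k))
          = (?I (x + (1 / real (Suc k)) *\<^sub>R e) * f (x + (1 / real (Suc k)) *\<^sub>R e) - ?I x * f x) * real (Suc k)"
        by eventually_elim (simp add: IU algebra_simps)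
      have "(\<lambda>k. ?I x * ((f (x + (1 / real (Suc k)) *\<^sub>R e) - f x) * real (Suc k))) \<longlonglongrightarrow> ?I x * (Df x \<bullet> e)"
        by (intro tendsto_intros dir_difference_quotient C1_D[OF f(1)])
      then show ?case using ev by (rule Lim_transform_eventually)
    qed
  qed measurable
qed

text \<open>Mollification with a radial kernel preserves oddness, so the approximants vanish on the mirror.\<close>
lemma sob_half_space:
  assumes s: "sob d G" and n: "norm n = 1" and odd: "\<And>x. d (mirror n b x) = - d x"
  shows "sob (\<lambda>x. indicator {x. x \<bullet> n < b} x * d x) (\<lambda>x. indicator {x. x \<bullet> n < b} x *\<^sub>R G x)"
proof -
  let ?I = "indicator {x. x \<bullet> n < b} :: 'a \<Rightarrow> real"
  note L = sobD[OF s]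
  have "{x. x \<bullet> n < b} \<in> sets borel" by (intro borel_open open_Collect_less continuous_intros)
  then have [measurable]: "?I \<in> borel_measurable borel" by (intro borel_measurable_indicator) auto
  have LI: "L2 f \<Longrightarrow> L2 (\<lambda>x. ?I x *\<^sub>R f x)" "L2 f \<Longrightarrow> n2 (\<lambda>x. ?I x *\<^sub>R f x) \<le> n2 f"
    for f :: "'a \<Rightarrow> 'c::euclidean_space"
  proof -
    assume f: "L2 f"
    then have [measurable]: "f \<in> borel_measurable borel" by auto
    have "(\<lambda>x. ?I x *\<^sub>R f x) \<in> borel_measurable borel" by measurable
    from L2_dominated[OF f this] show "L2 (\<lambda>x. ?I x *\<^sub>R f x)" "n2 (\<lambda>x. ?I x *\<^sub>R f x) \<le> n2 f"
      by (auto simp: indicator_def)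
  qed
  have lim: "(\<lambda>k. n2 (\<lambda>x. ?I x *\<^sub>R f k x - ?I x *\<^sub>R f' x)) \<longlonglongrightarrow> 0"
    if "\<And>k. L2 (f k)" "L2 f'" "(\<lambda>k. n2 (\<lambda>x. f k x - f' x)) \<longlonglongrightarrow> 0" for f :: "nat \<Rightarrow> 'a \<Rightarrow> 'c::euclidean_space" and f'
  proof (rule Lim_null_comparison[OF always_eventually that(3)], rule allI)
    fix k
    show "norm (n2 (\<lambda>x. ?I x *\<^sub>R f k x - ?I x *\<^sub>R f' x)) \<le> n2 (\<lambda>x. f k x - f' x)"
      using LI(2)[OF L2_diff[OF that(1,2)], of k] by (simp add: scaleR_diff_right)
  qed
  have oddk: "approx k d (mirror n b x) = - approx k d x" for k x
  proof -
    let ?r = "1 / real (Suc k)"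
    have [measurable]: "d \<in> borel_measurable borel" using L by auto
    have m: "(\<lambda>y. kern ?r y *\<^sub>R d (mirror n b x - y)) \<in> borel_measurable borel" by measurable
    have "moll ?r d (mirror n b x) = (LINT y|lborel. kern ?r (mirror0 n y) *\<^sub>R d (mirror n b x - mirror0 n y))"
      unfolding moll_def using vol_map_integral[OF vol_map_mirror0[OF n] m] by simp
    also have "\<dots> = (LINT y|lborel. - (kern ?r y *\<^sub>R d (x - y)))"
    proof (intro Bochner_Integration.integral_cong refl)
      fix y
      have "mirror n b x - mirror0 n y = mirror n b (x - y)"
        by (simp add: mirror_eq linear_diff[OF linear_mirror0])
      moreover have "kern ?r (mirror0 n y) = kern ?r y" by (simp add: kern_def bump_def norm_mirror0[OF n])
      ultimately show "kern ?r (mirror0 n y) *\<^sub>R d (mirror n b x - mirror0 n y) = - (kern ?r y *\<^sub>R d (x - y))"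
        by (simp add: odd)
    qed
    also have "\<dots> = - moll ?r d x" by (simp add: moll_def)
    finally show ?thesis by (simp add: approx_def)
  qed
  have zb: "approx k d x = 0" if "x \<bullet> n = b" for k x
  proof -
    have "mirror n b x = x" using that by (simp add: mirror_def)
    then show ?thesis using oddk[of k x] by simp
  qed
  have "sob (\<lambda>x. ?I x *\<^sub>R approx k d x) (\<lambda>x. ?I x *\<^sub>R approx k G x)" for k
    unfolding sob_def
  proof (intro conjI allI impI LI approx_L2 L)
    note C = approx_C1[OF s, of k]
    fix \<psi> :: "'a \<Rightarrow> real" and D\<psi> e assume p: "C1 \<psi> D\<psi>" "bsupp \<psi>"
    have Lp: "L2 \<psi>" by (rule bsupp_L2[OF C1_cont[OF p(1)] p(2)])
    have LD: "L2 D\<psi>" by (rule bsupp_L2[OF C1_contD[OF p(1)] bsupp_gradient[OF p]])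
    note i = L2_parts_integrable[OF LI(1)[OF approx_L2[OF L(1)]] LD, of k e]
      L2_parts_integrable[OF Lp LI(1)[OF approx_L2[OF L(2)]], of k e]
    have "(LINT x|lborel. ?I x * ((approx k d x *\<^sub>R D\<psi> x + \<psi> x *\<^sub>R approx k G x) \<bullet> e)) = 0"
      by (rule half_space_integral_zero[OF C1_mult[OF C p(1)] bsupp_mult_left[OF p(2)] n]) (simp add: zb)
    moreover have "(LINT x|lborel. ?I x * ((approx k d x *\<^sub>R D\<psi> x + \<psi> x *\<^sub>R approx k G x) \<bullet> e))
      = (LINT x|lborel. (?I x *\<^sub>R approx k d x) * (D\<psi> x \<bullet> e) + \<psi> x * ((?I x *\<^sub>R approx k G x) \<bullet> e))"
      by (simp add: inner_add_left algebra_simps)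
    moreover have "\<dots> = (LINT x|lborel. (?I x *\<^sub>R approx k d x) * (D\<psi> x \<bullet> e)) + (LINT x|lborel. \<psi> x * ((?I x *\<^sub>R approx k G x) \<bullet> e))"
      using i by (rule Bochner_Integration.integral_add)
    ultimately show "(LINT x|lborel. ?I x *\<^sub>R approx k d x * (D\<psi> x \<bullet> e)) = - (LINT x|lborel. \<psi> x * (?I x *\<^sub>R approx k G x \<bullet> e))"
      by linarith
  qed
  from sob_limit[OF this LI(1)[OF L(1)] LI(1)[OF L(2)]
      lim[OF approx_L2[OF L(1)] L(1) approx_tendsto[OF L(1)]] lim[OF approx_L2[OF L(2)] L(2) approx_tendsto[OF L(2)]]]
  show ?thesis by simp
qed

section \<open>Hardy inequality and compactness in the weighted space\<close>

text \<open>Two nested squared positive parts give a \<open>C1\<close> profile equal to 1 up to 1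
  and to 0 from 2 on. It is composed with the squared norm, so that the cutoff is differentiable at
  the origin as well.\<close>

definition cutoff_profile :: "real \<Rightarrow> real" where
  "cutoff_profile s = (max 0 (1 - (max 0 (s - 1))\<^sup>2))\<^sup>2"

definition cutoff_profile' :: "real \<Rightarrow> real" where
  "cutoff_profile' s = - (4 * max 0 (1 - (max 0 (s - 1))\<^sup>2) * max 0 (s - 1))"

definition cutoff :: "real \<Rightarrow> 'a::euclidean_space \<Rightarrow> real" where
  "cutoff R x = cutoff_profile ((norm x)\<^sup>2 / R\<^sup>2)"

definition Dcutoff :: "real \<Rightarrow> 'a::euclidean_space \<Rightarrow> 'a" where
  "Dcutoff R x = (cutoff_profile' ((norm x)\<^sup>2 / R\<^sup>2) * (2 / R\<^sup>2)) *\<^sub>R x"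

lemma cutoff_profile_deriv: "(cutoff_profile has_real_derivative cutoff_profile' s) (at s)"
proof -
  have "((\<lambda>t. t - 1) has_real_derivative 1) (at s)" by (auto intro!: derivative_eq_intros)
  from DERIV_chain2[OF DERIV_max_sq this]
  have "((\<lambda>t. 1 - (max 0 (t - 1))\<^sup>2) has_real_derivative 0 - 2 * max 0 (s - 1) * 1) (at s)"
    by (intro DERIV_diff DERIV_const)
  from DERIV_chain2[OF DERIV_max_sq this] show ?thesis
    unfolding cutoff_profile_def[abs_def] cutoff_profile'_def by (simp add: mult_ac)
qed

lemma cut_C1: "C1 (cutoff R) (Dcutoff R)"
proof -
  have c: "continuous_on UNIV cutoff_profile'"
    unfolding cutoff_profile'_def[abs_def]
    by (intro continuous_on_minus continuous_on_mult continuous_on_max continuous_on_diff continuous_on_power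
        continuous_on_const continuous_on_id)
  have "C1 (\<lambda>x::'a. (1 / R\<^sup>2) * (norm (x - 0))\<^sup>2) (\<lambda>x. (1 / R\<^sup>2) *\<^sub>R (2 *\<^sub>R (x - 0)))"
    by (intro C1_cmult C1_normsq)
  from C1_chain[OF this cutoff_profile_deriv c] show ?thesis
    by (simp add: cutoff_def[abs_def] Dcutoff_def[abs_def])
qed

lemma cut_bounds: "0 \<le> cutoff R x" "cutoff R x \<le> 1"
proof -
  have "(max 0 (1 - (max 0 (s - 1))\<^sup>2))\<^sup>2 \<le> 1" for s :: real
    using power_mono[of "max 0 (1 - (max 0 (s - 1))\<^sup>2)" 1 2] by simp
  then show "0 \<le> cutoff R x" "cutoff R x \<le> 1" by (simp_all add: cutoff_def cutoff_profile_def)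
qed

lemma cut_inside:
  assumes "0 < R" "norm x \<le> R" shows "cutoff R x = 1" "Dcutoff R x = 0"
proof -
  have "(norm x)\<^sup>2 / R\<^sup>2 \<le> 1" using assms by (simp add: power_mono)
  then show "cutoff R x = 1" "Dcutoff R x = 0"
    by (simp_all add: cutoff_def Dcutoff_def cutoff_profile_def cutoff_profile'_def)
qed

lemma cut_outside:
  assumes "0 < R" "norm x \<ge> 2 * R" shows "cutoff R x = 0" "Dcutoff R x = 0"
proof -
  have "(2 * R)\<^sup>2 \<le> (norm x)\<^sup>2" using assms by (intro power_mono) auto
  then have "(norm x)\<^sup>2 / R\<^sup>2 \<ge> 4" using assms by (simp add: pos_le_divide_eq power_mult_distrib)
  then have "max 0 ((norm x)\<^sup>2 / R\<^sup>2 - 1) \<ge> 1" by linarith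
  then have "(max 0 ((norm x)\<^sup>2 / R\<^sup>2 - 1))\<^sup>2 \<ge> 1" by (rule one_le_power)
  then have "max 0 (1 - (max 0 ((norm x)\<^sup>2 / R\<^sup>2 - 1))\<^sup>2) = 0" by simp
  then show "cutoff R x = 0" "Dcutoff R x = 0"
    by (simp_all add: cutoff_def Dcutoff_def cutoff_profile_def cutoff_profile'_def)
qed

lemma cut_bsupp: "0 < R \<Longrightarrow> bsupp (cutoff R)"
  using cut_outside(1) unfolding bsupp_def by blast

lemma cutoff_profile'_bound: "\<bar>cutoff_profile' s\<bar> \<le> 4"
proof -
  define m where "m = max 0 (s - 1)"
  have m: "0 \<le> m" by (simp add: m_def)
  have "max 0 (1 - m\<^sup>2) * m \<le> 1"
  proof (cases "m \<le> 1")
    case True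
    then show ?thesis using m by (intro mult_le_one) auto
  next
    case False
    then have "m\<^sup>2 \<ge> 1" by (intro one_le_power) auto
    then show ?thesis by simp
  qed
  moreover have "0 \<le> max 0 (1 - m\<^sup>2) * m" using m by simp
  ultimately show ?thesis unfolding cutoff_profile'_def m_def[symmetric] by (simp add: abs_mult mult.assoc)
qed

lemma Dcutoff_bound: "0 < R \<Longrightarrow> norm (Dcutoff R x) \<le> 16 / R"
proof (cases "norm x \<ge> 2 * R")
  case False
  assume R: "0 < R"
  have "norm (Dcutoff R x) = \<bar>cutoff_profile' ((norm x)\<^sup>2 / R\<^sup>2)\<bar> * (2 / R\<^sup>2) * norm x"
    by (simp add: Dcutoff_def abs_mult)
  \<comment> \<open>The profile has slope at most 4, and only points with
    \<open>norm x < 2 * R\<close> are left; together this is the constant 16.\<close>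
  also have "\<dots> \<le> 4 * (2 / R\<^sup>2) * (2 * R)"
    using False R by (intro mult_mono cutoff_profile'_bound) auto
  also have "\<dots> = 16 / R" using R by (simp add: power2_eq_square)
  finally show ?thesis .
qed (use cut_outside(2)[of R x] in auto)

lemma sob_cut:
  assumes "sob v G" "0 < R"
  shows "sob (\<lambda>x. cutoff R x * v x) (\<lambda>x. cutoff R x *\<^sub>R G x + v x *\<^sub>R Dcutoff R x)"
proof (rule sob_product[OF assms(1) cut_C1, of R "max 1 (16 / R)"])
  show "\<bar>cutoff R x\<bar> \<le> max 1 (16 / R)" for x :: 'a using cut_bounds[of R x] by simp
  show "norm (Dcutoff R x) \<le> max 1 (16 / R)" for x :: 'a using Dcutoff_bound[OF assms(2), of x] by simp
qed

section \<open>Hardy's inequality\<close>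

lemma C1_powr_weight:
  assumes d: "0 < \<delta>"
  shows "C1 (\<lambda>x::'a::euclidean_space. ((norm x)\<^sup>2 + \<delta>) powr s) (\<lambda>x. (2 * s * ((norm x)\<^sup>2 + \<delta>) powr (s - 1)) *\<^sub>R x)"
  unfolding C1_def
proof (intro conjI allI)
  have p: "0 < (norm (x::'a))\<^sup>2 + \<delta>" for x using d by (simp add: add_nonneg_pos)
  fix x :: 'a
  have "((\<lambda>x. (norm (x - 0))\<^sup>2 + \<delta>) has_derivative (\<lambda>h. (2 *\<^sub>R (x - 0)) \<bullet> h + 0)) (at x)"
    using C1_D[OF C1_normsq[of 0], of x] by (intro has_derivative_add) auto
  moreover have "((\<lambda>t. t powr s) has_derivative (\<lambda>h. (s * ((norm x)\<^sup>2 + \<delta>) powr (s - 1)) * h)) (at ((norm x)\<^sup>2 + \<delta>))"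
    using has_real_derivative_powr[OF p[of x], of s] by (simp add: has_field_derivative_def)
  ultimately have "((\<lambda>x. ((norm (x - 0))\<^sup>2 + \<delta>) powr s) has_derivative
      (\<lambda>h. (s * ((norm x)\<^sup>2 + \<delta>) powr (s - 1)) * ((2 *\<^sub>R (x - 0)) \<bullet> h + 0))) (at x)"
    using has_derivative_compose[of "\<lambda>x. (norm (x - 0))\<^sup>2 + \<delta>" _ x UNIV "\<lambda>t. t powr s"] by simp
  then show "((\<lambda>x. ((norm x)\<^sup>2 + \<delta>) powr s) has_derivative (\<bullet>) ((2 * s * ((norm x)\<^sup>2 + \<delta>) powr (s - 1)) *\<^sub>R x)) (at x)"
    unfolding diff_zero by (rule has_derivative_eq_rhs) (simp add: fun_eq_iff mult_ac)
  have "(norm (x::'a))\<^sup>2 + \<delta> \<noteq> 0" for x using p[of x] by simp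
  then show "continuous_on UNIV (\<lambda>x::'a. (2 * s * ((norm x)\<^sup>2 + \<delta>) powr (s - 1)) *\<^sub>R x)"
    by (intro continuous_on_scaleR continuous_on_mult continuous_on_const continuous_on_powr continuous_on_add
        continuous_on_power continuous_on_norm continuous_on_id) auto
qed

definition wt :: "real \<Rightarrow> 'a::euclidean_space \<Rightarrow> real" where
  "wt \<sigma> x = norm x powr \<sigma>"

lemma wt_meas [measurable]: "wt \<sigma> \<in> borel_measurable borel"
  unfolding wt_def[abs_def] by measurable

lemma wt_nonneg [simp]: "0 \<le> wt \<sigma> x" by (simp add: wt_def)

text \<open>The divergence of the field x f^2 w integrates to 0. As \<sigma> is negative,
  differentiating the weight costs at most \<sigma> w f^2, which leaves \<open>N + \<sigma>\<close>
  times the weighted integral, positive by assumption, against a cross term of f and its gradient;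
  Cauchy-Schwarz and division finish. The factor \<open>K\<close> bounds the weight that remains
  with the gradient.\<close>

lemma hardy_regularized:
  fixes f :: "'a::euclidean_space \<Rightarrow> real"
  assumes f: "C1 f Df" "bsupp f" and s: "\<sigma> < 0" "- real DIM('a) < \<sigma>" and d: "0 < \<delta>"
    and K: "\<And>x. f x \<noteq> 0 \<Longrightarrow> Df x \<noteq> 0 \<Longrightarrow> norm x powr (\<sigma> + 2) \<le> K" and K0: "0 \<le> K"
  shows "(real DIM('a) + \<sigma>)\<^sup>2 * (LINT x|lborel. ((norm x)\<^sup>2 + \<delta>) powr (\<sigma> / 2) * (f x)\<^sup>2) \<le> 4 * K * n2 Df"
    "integrable lborel (\<lambda>x. ((norm x)\<^sup>2 + \<delta>) powr (\<sigma> / 2) * (f x)\<^sup>2)"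
proof -
  define w where "w x = ((norm x)\<^sup>2 + \<delta>) powr (\<sigma> / 2)" for x :: 'a
  define Dw where "Dw x = (\<sigma> * ((norm x)\<^sup>2 + \<delta>) powr (\<sigma> / 2 - 1)) *\<^sub>R x" for x :: 'a
  let ?N = "real DIM('a)"
  have p: "0 < (norm (x::'a))\<^sup>2 + \<delta>" for x using d by (simp add: add_nonneg_pos)
  have Cw: "C1 w Dw"
    using C1_powr_weight[OF d, of "\<sigma> / 2", where 'a='a] by (simp add: w_def[abs_def] Dw_def[abs_def])
  have w0: "0 \<le> w x" for x by (simp add: w_def)
  define P where "P x = f x * f x * w x" for x
  define DP where "DP x = (f x * f x) *\<^sub>R Dw x + w x *\<^sub>R (f x *\<^sub>R Df x + f x *\<^sub>R Df x)" for x
  have CP: "C1 P DP" unfolding P_def[abs_def] DP_def[abs_def] by (intro C1_mult f(1) Cw)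
  have Ci: "C1 (\<lambda>x::'a. x \<bullet> i) (\<lambda>x. i)" for i
    unfolding C1_def by (auto intro!: derivative_eq_intros simp: inner_commute)
  have bP: "bsupp P" unfolding P_def[abs_def] by (intro bsupp_mult_right f(2))
  \<comment> \<open>The integrand is the derivative of (x \<bullet> i) P in direction
    \<open>i\<close>; summed over the basis this is the divergence of x P.\<close>
  have z: "(LINT x|lborel. (P x *\<^sub>R i + (x \<bullet> i) *\<^sub>R DP x) \<bullet> i) = 0" for i :: 'a
    by (rule C1_integral_zero[OF C1_mult[OF CP Ci[of i]] bsupp_mult_right[OF bP]])
  note c = C1_cont[OF CP] C1_contD[OF CP] C1_cont[OF f(1)] C1_contD[OF f(1)] C1_cont[OF Cw] C1_contD[OF Cw]
  have bi: "bsupp (\<lambda>x. (P x *\<^sub>R i + (x \<bullet> i) *\<^sub>R DP x) \<bullet> i)" for i :: 'a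
    using bP bsupp_gradient[OF CP bP] unfolding bsupp_def
  proof (elim exE)
    fix R R' assume "\<forall>x. R \<le> norm x \<longrightarrow> P x = 0" "\<forall>x. R' \<le> norm x \<longrightarrow> DP x = 0"
    then show "\<exists>R. \<forall>x. R \<le> norm x \<longrightarrow> (P x *\<^sub>R i + (x \<bullet> i) *\<^sub>R DP x) \<bullet> i = 0"
      by (intro exI[of _ "max R R'"]) simp
  qed
  have ii: "integrable lborel (\<lambda>x. (P x *\<^sub>R i + (x \<bullet> i) *\<^sub>R DP x) \<bullet> i)" for i :: 'a
    by (intro bsupp_integrable bi continuous_intros c)
  have "0 = (\<Sum>i\<in>Basis. (LINT x|lborel. (P x *\<^sub>R i + (x \<bullet> i) *\<^sub>R DP x) \<bullet> i))" by (simp add: z)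
  also have "\<dots> = (LINT x|lborel. (\<Sum>i\<in>Basis. (P x *\<^sub>R i + (x \<bullet> i) *\<^sub>R DP x) \<bullet> i))"
    by (rule Bochner_Integration.integral_sum[symmetric]) (rule ii)
  also have "\<dots> = (LINT x|lborel. ?N * P x + x \<bullet> DP x)"
  proof (intro Bochner_Integration.integral_cong refl)
    fix x
    have "(\<Sum>i\<in>Basis. (P x *\<^sub>R i + (x \<bullet> i) *\<^sub>R DP x) \<bullet> i) = (\<Sum>i\<in>Basis. P x + (x \<bullet> i) * (DP x \<bullet> i))"
      by (intro sum.cong) (auto simp: inner_add_left inner_Basis)
    also have "\<dots> = ?N * P x + x \<bullet> DP x" by (simp add: sum.distrib euclidean_inner[of x "DP x"])
    finally show "(\<Sum>i\<in>Basis. (P x *\<^sub>R i + (x \<bullet> i) *\<^sub>R DP x) \<bullet> i) = ?N * P x + x \<bullet> DP x" .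
  qed
  finally have zero: "(LINT x|lborel. ?N * P x + x \<bullet> DP x) = 0" by simp
  have iP: "integrable lborel P" by (intro bsupp_integrable bP c)
  then show int: "integrable lborel (\<lambda>x. ((norm x)\<^sup>2 + \<delta>) powr (\<sigma> / 2) * (f x)\<^sup>2)"
    by (simp add: P_def[abs_def] w_def power2_eq_square mult_ac)
  define J where "J x = sqrt (w x) * f x" for x
  \<comment> \<open>The gradient factor of the cross term. It is switched off where \<open>f\<close>
    vanishes, because \<open>K\<close> controls the weight only where \<open>f\<close> and
    \<open>Df\<close> are nonzero.\<close>
  define Q where "Q x = (sqrt (w x) * \<bar>f x\<bar>) * 0 + sqrt (w x) * norm x * norm (Df x) * (if f x = 0 then 0 else 1)" for x
  have LJ: "L2 J" unfolding J_def[abs_def]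
    by (intro bsupp_L2 bsupp_mult_left f(2) continuous_on_mult continuous_on_real_sqrt c)
  have n2J: "n2 J = (LINT x|lborel. w x * (f x)\<^sup>2)"
    by (simp add: n2_def J_def power_mult_distrib w0)
  have LDf: "L2 Df" by (rule bsupp_L2[OF C1_contD[OF f(1)] bsupp_gradient[OF f]])
  have [measurable]: "f \<in> borel_measurable borel" "Df \<in> borel_measurable borel" "w \<in> borel_measurable borel"
    using C1_meas[OF f(1)] C1_meas[OF Cw] by auto
  have wK: "w x * (norm x)\<^sup>2 \<le> norm x powr (\<sigma> + 2)" for x
  proof (cases "x = 0")
    case False
    have "w x \<le> ((norm x)\<^sup>2) powr (\<sigma> / 2)"
      unfolding w_def using s d False by (intro powr_mono2') auto
    also have "\<dots> = norm x powr \<sigma>" using False by (simp add: powr_powr flip: powr_numeral)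
    finally have "w x * (norm x)\<^sup>2 \<le> norm x powr \<sigma> * (norm x)\<^sup>2" by (rule mult_right_mono) simp
    also have "\<dots> = norm x powr (\<sigma> + 2)" using False by (simp add: powr_add)
    finally show ?thesis .
  qed simp
  have Qb: "norm (Q x) \<le> norm (sqrt K *\<^sub>R Df x)" for x
  proof (cases "f x = 0 \<or> Df x = 0")
    case False
    have "(sqrt (w x) * norm x)\<^sup>2 \<le> (sqrt K)\<^sup>2"
      using wK[of x] K[of x] False K0 w0[of x] by (simp add: power_mult_distrib)
    then have "sqrt (w x) * norm x \<le> sqrt K" by (rule power2_le_imp_le) (simp add: K0)
    then have "(sqrt (w x) * norm x) * norm (Df x) \<le> sqrt K * norm (Df x)" by (rule mult_right_mono) simp
    then show ?thesis using False K0 w0[of x] by (simp add: Q_def abs_mult)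
  qed (auto simp: Q_def K0)
  have LQ: "L2 Q" and n2Q: "n2 Q \<le> K * n2 Df"
    using L2_dominated[OF L2_scaleR[OF LDf, of "sqrt K"], of Q] Qb K0 unfolding n2_scaleR
    by (simp_all add: Q_def[abs_def])
  have LaJ: "L2 (\<lambda>x. \<bar>J x\<bar>)" "n2 (\<lambda>x. \<bar>J x\<bar>) = n2 J"
    using L2_norm_fun(1)[OF LJ] L2_norm_fun(2)[of J] by simp_all
  have "(?N + \<sigma>) * n2 J = (LINT x|lborel. (?N + \<sigma>) * P x)"
  proof -
    have "(\<lambda>x. w x * (f x)\<^sup>2) = P" by (auto simp: P_def power2_eq_square)
    then show ?thesis unfolding n2J by simp
  qed
  also have "\<dots> \<le> (LINT x|lborel. (?N * P x + x \<bullet> DP x) + 2 * (\<bar>J x\<bar> * Q x))"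
  proof (rule integral_mono)
    show "integrable lborel (\<lambda>x. (?N + \<sigma>) * P x)" using iP by simp
    show "integrable lborel (\<lambda>x. ?N * P x + x \<bullet> DP x + 2 * (\<bar>J x\<bar> * Q x))"
    proof (intro Bochner_Integration.integrable_add integrable_mult_right iP L2_mult_integrable LaJ LQ)
      have "bsupp (\<lambda>x. x \<bullet> DP x)" using bsupp_gradient[OF CP bP] by (auto simp: bsupp_def) (metis inner_zero_right)
      then show "integrable lborel (\<lambda>x. x \<bullet> DP x)" by (intro bsupp_integrable continuous_intros c)
    qed
    fix x
    \<comment> \<open>Replacing |x|^2 by |x|^2 + \<delta> increases the factor after \<sigma>; since
      \<sigma> is negative, this is a lower bound.\<close>
    have fw: "f x * f x * (\<sigma> * ((norm x)\<^sup>2 + \<delta>) powr (\<sigma> / 2 - 1) * (x \<bullet> x)) \<ge> \<sigma> * P x"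
    proof -
      have "((norm x)\<^sup>2 + \<delta>) powr (\<sigma> / 2 - 1) * (norm x)\<^sup>2 \<le> ((norm x)\<^sup>2 + \<delta>) powr (\<sigma> / 2 - 1) * ((norm x)\<^sup>2 + \<delta>)"
        using d by (intro mult_left_mono) auto
      also have "\<dots> = w x" unfolding w_def using p[of x] by (simp add: powr_diff)
      finally have "((norm x)\<^sup>2 + \<delta>) powr (\<sigma> / 2 - 1) * (norm x)\<^sup>2 \<le> w x" .
      then have "\<sigma> * w x \<le> \<sigma> * (((norm x)\<^sup>2 + \<delta>) powr (\<sigma> / 2 - 1) * (norm x)\<^sup>2)"
        using s by (intro mult_left_mono_neg) auto
      then have "(f x * f x) * (\<sigma> * w x) \<le> (f x * f x) * (\<sigma> * (((norm x)\<^sup>2 + \<delta>) powr (\<sigma> / 2 - 1) * (norm x)\<^sup>2))"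
        by (rule mult_left_mono) simp
      then show ?thesis by (simp add: P_def power2_norm_eq_inner mult_ac)
    qed
    have cs: "- (\<bar>J x\<bar> * Q x) \<le> w x * f x * (Df x \<bullet> x)"
    proof -
      have "\<bar>f x * (Df x \<bullet> x)\<bar> \<le> \<bar>f x\<bar> * (norm (Df x) * norm x)"
        unfolding abs_mult by (intro mult_left_mono Cauchy_Schwarz_ineq2) auto
      then have "w x * - (\<bar>f x\<bar> * (norm (Df x) * norm x)) \<le> w x * (f x * (Df x \<bullet> x))"
        using w0 by (intro mult_left_mono) auto
      moreover have "\<bar>J x\<bar> * Q x = (sqrt (w x) * sqrt (w x)) * (\<bar>f x\<bar> * (norm (Df x) * norm x))"
        using w0[of x] by (simp add: J_def Q_def abs_mult)
      ultimately show ?thesis using w0[of x] by (simp add: mult.assoc)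
    qed
    have "x \<bullet> DP x = f x * f x * (\<sigma> * ((norm x)\<^sup>2 + \<delta>) powr (\<sigma> / 2 - 1) * (x \<bullet> x)) + 2 * (w x * f x * (Df x \<bullet> x))"
      by (simp add: DP_def Dw_def inner_add_right inner_commute algebra_simps)
    then show "(?N + \<sigma>) * P x \<le> (?N * P x + x \<bullet> DP x) + 2 * (\<bar>J x\<bar> * Q x)"
      using fw cs by (simp add: algebra_simps)
  qed
  also have "\<dots> = 2 * (LINT x|lborel. \<bar>J x\<bar> * Q x)"
  proof -
    have "integrable lborel (\<lambda>x. x \<bullet> DP x)"
    proof -
      have "bsupp (\<lambda>x. x \<bullet> DP x)" using bsupp_gradient[OF CP bP] by (auto simp: bsupp_def) (metis inner_zero_right)
      then show ?thesis by (intro bsupp_integrable continuous_intros c)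
    qed
    then have "integrable lborel (\<lambda>x. ?N * P x + x \<bullet> DP x)"
      using iP by (intro Bochner_Integration.integrable_add integrable_mult_right)
    then show ?thesis using zero L2_mult_integrable[OF LaJ(1) LQ] by simp
  qed
  also have "\<dots> \<le> 2 * (sqrt (n2 J) * sqrt (n2 Q))"
    using L2_Cauchy_Schwarz_abs[OF LaJ(1) LQ] by (simp add: LaJ(2))
  finally have le: "(?N + \<sigma>) * n2 J \<le> 2 * (sqrt (n2 J) * sqrt (n2 Q))" .
  \<comment> \<open>Squaring gives one factor \<open>n2 J\<close> too many, which is cancelled
    unless it is 0.\<close>
  have "(?N + \<sigma>)\<^sup>2 * n2 J \<le> 4 * n2 Q"
  proof (cases "n2 J = 0")
    case False
    then have pos: "0 < n2 J" using n2_nonneg[of J] by linarith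
    have *: "((?N + \<sigma>) * n2 J)\<^sup>2 \<le> (2 * (sqrt (n2 J) * sqrt (n2 Q)))\<^sup>2"
      using le s by (intro power_mono) auto
    have "n2 J * ((?N + \<sigma>)\<^sup>2 * n2 J) \<le> n2 J * (4 * n2 Q)"
    proof -
      have "(2 * (sqrt (n2 J) * sqrt (n2 Q)))\<^sup>2 = 4 * n2 J * n2 Q"
        unfolding power_mult_distrib real_sqrt_pow2[OF n2_nonneg] by simp
      moreover have "((?N + \<sigma>) * n2 J)\<^sup>2 = n2 J * ((?N + \<sigma>)\<^sup>2 * n2 J)"
        by (simp add: power2_eq_square)
      ultimately show ?thesis using * by simp
    qed
    then show ?thesis using pos by simp
  qed simp
  also have "\<dots> \<le> 4 * K * n2 Df" using n2Q by simp
  finally show "(?N + \<sigma>)\<^sup>2 * (LINT x|lborel. ((norm x)\<^sup>2 + \<delta>) powr (\<sigma> / 2) * (f x)\<^sup>2) \<le> 4 * K * n2 Df"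
    unfolding n2J w_def .
qed

text \<open>The regularized bound does not depend on \<delta>, so \<delta> may tend to 0 by Fatou;
  away from the origin the regularized weights converge to the singular one.\<close>

lemma hardy_C1:
  fixes f :: "'a::euclidean_space \<Rightarrow> real"
  assumes f: "C1 f Df" "bsupp f" and s: "\<sigma> < 0" "- real DIM('a) < \<sigma>"
    and K: "\<And>x. f x \<noteq> 0 \<Longrightarrow> Df x \<noteq> 0 \<Longrightarrow> norm x powr (\<sigma> + 2) \<le> K" and K0: "0 \<le> K"
  shows "integrable lborel (\<lambda>x. wt \<sigma> x * (f x)\<^sup>2)"
    "(LINT x|lborel. wt \<sigma> x * (f x)\<^sup>2) \<le> 4 / (real DIM('a) + \<sigma>)\<^sup>2 * K * n2 Df"
proof -
  have [measurable]: "f \<in> borel_measurable borel" using C1_meas[OF f(1)] by auto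
  define g where "g n x = ((norm x)\<^sup>2 + 1 / real (Suc n)) powr (\<sigma> / 2) * (f x)\<^sup>2" for n and x :: 'a
  have N: "0 < (real DIM('a) + \<sigma>)\<^sup>2" using s by simp
  have h: "integrable lborel (g n)" "(LINT x|lborel. g n x) \<le> 4 / (real DIM('a) + \<sigma>)\<^sup>2 * K * n2 Df" for n
  proof -
    have d: "0 < 1 / real (Suc n)" by simp
    note hr = hardy_regularized[OF f s d K K0]
    show "integrable lborel (g n)" unfolding g_def[abs_def] by (rule hr(2))
    have "(real DIM('a) + \<sigma>)\<^sup>2 * (LINT x|lborel. g n x) \<le> 4 * K * n2 Df" unfolding g_def by (rule hr(1))
    then show "(LINT x|lborel. g n x) \<le> 4 / (real DIM('a) + \<sigma>)\<^sup>2 * K * n2 Df"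
      using N by (simp add: pos_le_divide_eq mult.commute)
  qed
  have lim: "AE x in lborel. (\<lambda>n. g n x) \<longlonglongrightarrow> wt \<sigma> x * (f x)\<^sup>2"
    using AE_lborel_singleton[of "0::'a"]
  proof eventually_elim
    case (elim x)
    have "(\<lambda>n. ((norm x)\<^sup>2 + 1 / real (Suc n)) powr (\<sigma> / 2) * (f x)\<^sup>2) \<longlonglongrightarrow> ((norm x)\<^sup>2 + 0) powr (\<sigma> / 2) * (f x)\<^sup>2"
      using LIMSEQ_Suc[OF lim_1_over_n] elim by (intro tendsto_intros) auto
    moreover have "((norm x)\<^sup>2 + 0) powr (\<sigma> / 2) = wt \<sigma> x"
      using elim by (simp add: wt_def powr_powr flip: powr_numeral)
    ultimately show ?case by (simp add: g_def)
  qed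
  have gn: "0 \<le> g n x" for n x by (simp add: g_def)
  show "integrable lborel (\<lambda>x. wt \<sigma> x * (f x)\<^sup>2)"
    "(LINT x|lborel. wt \<sigma> x * (f x)\<^sup>2) \<le> 4 / (real DIM('a) + \<sigma>)\<^sup>2 * K * n2 Df"
    by (rule fatou_bound[OF h(1) gn h(2) lim]; measurable)+
qed

text \<open>Mollified functions need not have bounded support, so the cutoff is applied after
  mollification. On its support the norm is at most \<open>2 * R\<close>, which supplies the
  constant required by \<open>hardy_C1\<close>.\<close>

lemma hardy_cut:
  fixes v :: "'a::euclidean_space \<Rightarrow> real"
  assumes v: "sob v G" and s: "-2 < \<sigma>" "\<sigma> < 0" "- real DIM('a) < \<sigma>" and R: "0 < R"
  shows "integrable lborel (\<lambda>x. wt \<sigma> x * (cutoff R x * v x)\<^sup>2)"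
    "(LINT x|lborel. wt \<sigma> x * (cutoff R x * v x)\<^sup>2)
      \<le> 4 / (real DIM('a) + \<sigma>)\<^sup>2 * (2 * R) powr (\<sigma> + 2) * n2 (\<lambda>x. cutoff R x *\<^sub>R G x + v x *\<^sub>R Dcutoff R x)"
proof -
  note L = sobD[OF v]
  have [measurable]: "v \<in> borel_measurable borel" "cutoff R \<in> borel_measurable borel" using L C1_meas[OF cut_C1] by auto
  let ?C = "4 / (real DIM('a) + \<sigma>)\<^sup>2 * (2 * R) powr (\<sigma> + 2)"
  have C0: "0 \<le> ?C" by simp
  define DD where "DD w H = (\<lambda>x. cutoff R x *\<^sub>R H x + w x *\<^sub>R Dcutoff R x)" for w :: "'a \<Rightarrow> real" and H
  obtain r where r: "strict_mono (r::nat\<Rightarrow>nat)" "AE x in lborel. (\<lambda>n. approx (r n) v x) \<longlonglongrightarrow> v x"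
    using L2_lim_AE_subseq[OF approx_L2[OF L(1)] L(1) approx_tendsto[OF L(1)]] by blast
  define \<phi> where "\<phi> n = approx (r n) v" for n
  define g where "g n = approx (r n) G" for n
  have C: "C1 (\<phi> n) (g n)" and Lp: "L2 (\<phi> n)" "L2 (g n)" for n
    using v L by (auto simp: \<phi>_def g_def approx_C1 approx_L2)
  have sp: "sob (\<phi> n) (g n)" for n by (intro C1_sob C Lp)
  have LD: "L2 (DD v G)" "L2 (DD (\<phi> n) (g n))" for n
    unfolding DD_def using sobD(2)[OF sob_cut[OF v R]] sobD(2)[OF sob_cut[OF sp R]] by auto
  have lim: "(\<lambda>n. n2 (\<lambda>x. \<phi> n x - v x)) \<longlonglongrightarrow> 0" "(\<lambda>n. n2 (\<lambda>x. g n x - G x)) \<longlonglongrightarrow> 0"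
    unfolding \<phi>_def g_def using LIMSEQ_subseq_LIMSEQ[OF approx_tendsto[OF L(1)] r(1)]
      LIMSEQ_subseq_LIMSEQ[OF approx_tendsto[OF L(2)] r(1)] by (auto simp: o_def)
  have limD: "(\<lambda>n. n2 (\<lambda>x. DD (\<phi> n) (g n) x - DD v G x)) \<longlonglongrightarrow> 0"
  proof (rule Lim_null_comparison[OF always_eventually])
    have "(\<lambda>n. 2 * n2 (\<lambda>x. g n x - G x) + 2 * ((16 / R)\<^sup>2 * n2 (\<lambda>x. \<phi> n x - v x))) \<longlonglongrightarrow> 2 * 0 + 2 * ((16 / R)\<^sup>2 * 0)"
      by (intro tendsto_intros lim)
    then show "(\<lambda>n. 2 * n2 (\<lambda>x. g n x - G x) + 2 * ((16 / R)\<^sup>2 * n2 (\<lambda>x. \<phi> n x - v x))) \<longlonglongrightarrow> 0" by simp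
    show "\<forall>n. norm (n2 (\<lambda>x. DD (\<phi> n) (g n) x - DD v G x)) \<le> 2 * n2 (\<lambda>x. g n x - G x) + 2 * ((16 / R)\<^sup>2 * n2 (\<lambda>x. \<phi> n x - v x))"
    proof
      fix n
      have [measurable]: "\<phi> n \<in> borel_measurable borel" "g n \<in> borel_measurable borel" "G \<in> borel_measurable borel"
         "Dcutoff R \<in> (borel_measurable borel :: ('a \<Rightarrow> 'a) set)"
        using Lp L C1_meas(2)[OF cut_C1] by auto
      have b1: "norm (cutoff R x *\<^sub>R (g n x - G x)) \<le> norm (g n x - G x)" for x
        using cut_bounds[of R x] by (simp add: mult_left_le_one_le)
      have b2: "norm ((\<phi> n x - v x) *\<^sub>R Dcutoff R x) \<le> norm ((16 / R) *\<^sub>R (\<phi> n x - v x))" for x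
        using mult_left_mono[OF Dcutoff_bound[OF R, of x], of "\<bar>\<phi> n x - v x\<bar>"] R
        by (simp add: mult.commute abs_mult del: right_diff_distrib left_diff_distrib right_diff_distrib_numeral left_diff_distrib_numeral)
      have m1: "(\<lambda>x. cutoff R x *\<^sub>R (g n x - G x)) \<in> borel_measurable borel" by measurable
      have m2: "(\<lambda>x. (\<phi> n x - v x) *\<^sub>R Dcutoff R x) \<in> borel_measurable borel" by measurable
      note A = L2_dominated[OF L2_diff[OF Lp(2)[of n] L(2)] m1 AE_I2[OF b1]]
      note B = L2_dominated[OF L2_scaleR[OF L2_diff[OF Lp(1)[of n] L(1)]] m2 AE_I2[OF b2]]
      have "n2 (\<lambda>x. DD (\<phi> n) (g n) x - DD v G x) = n2 (\<lambda>x. cutoff R x *\<^sub>R (g n x - G x) + (\<phi> n x - v x) *\<^sub>R Dcutoff R x)"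
        by (simp add: DD_def algebra_simps)
      also have "\<dots> \<le> 2 * n2 (\<lambda>x. cutoff R x *\<^sub>R (g n x - G x)) + 2 * n2 (\<lambda>x. (\<phi> n x - v x) *\<^sub>R Dcutoff R x)"
        by (rule n2_add_le[OF A(1) B(1)])
      also have "\<dots> \<le> 2 * n2 (\<lambda>x. g n x - G x) + 2 * ((16 / R)\<^sup>2 * n2 (\<lambda>x. \<phi> n x - v x))"
        using A(2) B(2) unfolding n2_scaleR by linarith
      finally show "norm (n2 (\<lambda>x. DD (\<phi> n) (g n) x - DD v G x)) \<le> 2 * n2 (\<lambda>x. g n x - G x) + 2 * ((16 / R)\<^sup>2 * n2 (\<lambda>x. \<phi> n x - v x))"
        by simp
    qed
  qed
  have h: "integrable lborel (\<lambda>x. wt \<sigma> x * (cutoff R x * \<phi> n x)\<^sup>2)"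
    "(LINT x|lborel. wt \<sigma> x * (cutoff R x * \<phi> n x)\<^sup>2) \<le> ?C * n2 (DD (\<phi> n) (g n))" for n
  proof -
    have K: "norm x powr (\<sigma> + 2) \<le> (2 * R) powr (\<sigma> + 2)" if "cutoff R x * \<phi> n x \<noteq> 0" for x
    proof -
      have "norm x \<le> 2 * R" using that cut_outside(1)[OF R, of x] by fastforce
      then show ?thesis using s by (intro powr_mono2) auto
    qed
    have "C1 (\<lambda>x. cutoff R x * \<phi> n x) (DD (\<phi> n) (g n))"
      using C1_mult[OF cut_C1[of R] C[of n]] by (simp add: DD_def)
    from hardy_C1[OF this bsupp_mult_right[OF cut_bsupp[OF R]] s(2,3) K]
    show "integrable lborel (\<lambda>x. wt \<sigma> x * (cutoff R x * \<phi> n x)\<^sup>2)"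
      "(LINT x|lborel. wt \<sigma> x * (cutoff R x * \<phi> n x)\<^sup>2) \<le> ?C * n2 (DD (\<phi> n) (g n))" by auto
  qed
  have limn: "(\<lambda>n. ?C * n2 (DD (\<phi> n) (g n))) \<longlonglongrightarrow> ?C * n2 (DD v G)"
    by (intro tendsto_mult tendsto_const L2_lim_n2[OF LD(2) LD(1) limD])
  have ae: "AE x in lborel. (\<lambda>n. wt \<sigma> x * (cutoff R x * \<phi> (n + k) x)\<^sup>2) \<longlonglongrightarrow> wt \<sigma> x * (cutoff R x * v x)\<^sup>2" for k
    using r(2)
  proof eventually_elim
    case (elim x)
    have "(\<lambda>n. \<phi> (n + k) x) \<longlonglongrightarrow> v x" using LIMSEQ_ignore_initial_segment[OF elim, of k] by (simp add: \<phi>_def)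
    then show ?case by (intro tendsto_intros)
  qed
  \<comment> \<open>Fatou wants one bound for the whole sequence, while here the bounds merely
    converge; dropping the first \<open>k\<close> members gives a uniform bound with an error
    \<open>e\<close>.\<close>
  have key: "integrable lborel (\<lambda>x. wt \<sigma> x * (cutoff R x * v x)\<^sup>2) \<and>
      (LINT x|lborel. wt \<sigma> x * (cutoff R x * v x)\<^sup>2) \<le> ?C * n2 (DD v G) + e" if e: "e > 0" for e
  proof -
    obtain k where k: "\<And>n. n \<ge> k \<Longrightarrow> ?C * n2 (DD (\<phi> n) (g n)) < ?C * n2 (DD v G) + e"
      using order_tendstoD(2)[OF limn, of "?C * n2 (DD v G) + e"] e unfolding eventually_sequentially by auto
    have K: "(LINT x|lborel. wt \<sigma> x * (cutoff R x * \<phi> (n + k) x)\<^sup>2) \<le> ?C * n2 (DD v G) + e" for n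
      using h(2)[of "n + k"] k[of "n + k"] by linarith
    have m: "(\<lambda>x. wt \<sigma> x * (cutoff R x * v x)\<^sup>2) \<in> borel_measurable borel" by measurable
    show ?thesis using fatou_bound[OF h(1) _ K ae m] by auto
  qed
  show "integrable lborel (\<lambda>x. wt \<sigma> x * (cutoff R x * v x)\<^sup>2)" using key[of 1] by simp
  have "(LINT x|lborel. wt \<sigma> x * (cutoff R x * v x)\<^sup>2) \<le> ?C * n2 (DD v G)"
    by (rule field_le_epsilon) (use key in blast)
  then show "(LINT x|lborel. wt \<sigma> x * (cutoff R x * v x)\<^sup>2)
      \<le> ?C * n2 (\<lambda>x. cutoff R x *\<^sub>R G x + v x *\<^sub>R Dcutoff R x)" by (simp only: DD_def)
qed

definition wn :: "real \<Rightarrow> ('a::euclidean_space \<Rightarrow> real) \<Rightarrow> real" where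
  "wn \<sigma> v = (LINT x|lborel. wt \<sigma> x * (v x)\<^sup>2)"

text \<open>On a function supported in the ball the cutoff is invisible, so no term in
  \<open>n2 v\<close> appears. This sharper form permits the absorption argument in
  \<open>radial_growth\<close>.\<close>

lemma hardy_support:
  fixes v :: "'a::euclidean_space \<Rightarrow> real"
  assumes v: "sob v G" and s: "-2 < \<sigma>" "\<sigma> < 0" "- real DIM('a) < \<sigma>" and R: "0 < R"
    and z: "\<And>x. norm x > R \<Longrightarrow> v x = 0" "\<And>x. norm x > R \<Longrightarrow> G x = 0"
  shows "wn \<sigma> v \<le> 4 / (real DIM('a) + \<sigma>)\<^sup>2 * (2 * R) powr (\<sigma> + 2) * n2 G"
proof -
  have e1: "cutoff R x * v x = v x" for x
    using z(1)[of x] cut_inside(1)[OF R, of x] by (cases "norm x > R") auto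
  have e2: "cutoff R x *\<^sub>R G x + v x *\<^sub>R Dcutoff R x = G x" for x
    using z[of x] cut_inside[OF R, of x] by (cases "norm x > R") auto
  show ?thesis using hardy_cut(2)[OF v s R] by (simp add: e1 e2 wn_def)
qed

text \<open>512 is 2 times the square of 16: the square comes from the gradient of the cutoff and
  the 2 from \<open>n2_add_le\<close>. The coefficient 2 of the gradient term is enlarged to the
  same number.\<close>

definition hardy_const :: "real \<Rightarrow> 'a::euclidean_space itself \<Rightarrow> real" where
  "hardy_const \<sigma> T = 4 / (real DIM('a) + \<sigma>)\<^sup>2 * 2 powr (\<sigma> + 2) * 512"

lemma hardy_ball:
  fixes v :: "'a::euclidean_space \<Rightarrow> real"
  assumes v: "sob v G" and s: "-2 < \<sigma>" "\<sigma> < 0" "- real DIM('a) < \<sigma>" and R: "0 < R"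
  shows "integrable lborel (\<lambda>x. indicator (cball 0 R) x * (wt \<sigma> x * (v x)\<^sup>2))"
    "(LINT x|lborel. indicator (cball 0 R) x * (wt \<sigma> x * (v x)\<^sup>2))
      \<le> hardy_const \<sigma> TYPE('a) * (R powr (\<sigma> + 2) * n2 G + R powr \<sigma> * n2 v)"
proof -
  note L = sobD[OF v]
  note h = hardy_cut[OF v s R]
  have [measurable]: "v \<in> borel_measurable borel" "cutoff R \<in> borel_measurable borel" "G \<in> borel_measurable borel"
    "Dcutoff R \<in> (borel_measurable borel :: ('a \<Rightarrow> 'a) set)"
    using L C1_meas[OF cut_C1] by auto
  have le: "indicator (cball 0 R) x * (wt \<sigma> x * (v x)\<^sup>2) \<le> wt \<sigma> x * (cutoff R x * v x)\<^sup>2" for x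
    using cut_inside(1)[OF R, of x] by (auto simp: indicator_def)
  show i: "integrable lborel (\<lambda>x. indicator (cball 0 R) x * (wt \<sigma> x * (v x)\<^sup>2))"
  proof (rule Bochner_Integration.integrable_bound[OF h(1)])
    have "indicator (cball 0 R) \<in> (borel_measurable borel :: ('a \<Rightarrow> real) set)"
      by (intro borel_measurable_indicator) auto
    then show "(\<lambda>x. indicator (cball 0 R) x * (wt \<sigma> x * (v x)\<^sup>2)) \<in> borel_measurable lborel" by measurable
    show "AE x in lborel. norm (indicator (cball 0 R) x * (wt \<sigma> x * (v x)\<^sup>2)) \<le> norm (wt \<sigma> x * (cutoff R x * v x)\<^sup>2)"
      using le by (intro AE_I2) simp
  qed
  have b1: "norm (cutoff R x *\<^sub>R G x) \<le> norm (G x)" for x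
    using cut_bounds[of R x] by (simp add: mult_left_le_one_le)
  have b2: "norm (v x *\<^sub>R Dcutoff R x) \<le> norm ((16 / R) *\<^sub>R v x)" for x
    using mult_left_mono[OF Dcutoff_bound[OF R, of x], of "\<bar>v x\<bar>"] R by (simp add: mult.commute)
  have m1: "(\<lambda>x. cutoff R x *\<^sub>R G x) \<in> borel_measurable borel" by measurable
  have m2: "(\<lambda>x. v x *\<^sub>R Dcutoff R x) \<in> borel_measurable borel" by measurable
  note A = L2_dominated[OF L(2) m1 AE_I2[OF b1]]
  note B = L2_dominated[OF L2_scaleR[OF L(1)] m2 AE_I2[OF b2]]
  have n: "n2 (\<lambda>x. cutoff R x *\<^sub>R G x + v x *\<^sub>R Dcutoff R x) \<le> 2 * n2 G + 2 * ((16 / R)\<^sup>2 * n2 v)"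
    using n2_add_le[OF A(1) B(1)] A(2) B(2) unfolding n2_scaleR by linarith
  let ?c = "4 / (real DIM('a) + \<sigma>)\<^sup>2"
  have c0: "0 \<le> ?c" by simp
  have "(LINT x|lborel. indicator (cball 0 R) x * (wt \<sigma> x * (v x)\<^sup>2)) \<le> (LINT x|lborel. wt \<sigma> x * (cutoff R x * v x)\<^sup>2)"
    by (intro integral_mono i h le)
  also have "\<dots> \<le> ?c * (2 * R) powr (\<sigma> + 2) * n2 (\<lambda>x. cutoff R x *\<^sub>R G x + v x *\<^sub>R Dcutoff R x)" by (rule h(2))
  also have "\<dots> \<le> ?c * (2 * R) powr (\<sigma> + 2) * (2 * n2 G + 2 * ((16 / R)\<^sup>2 * n2 v))"
    by (intro mult_left_mono n) simp
  also have "\<dots> \<le> ?c * (2 powr (\<sigma> + 2) * R powr (\<sigma> + 2)) * (512 * n2 G + 512 * (n2 v / R\<^sup>2))"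
    using R by (intro mult_mono) (auto simp: powr_mult power_divide)
  also have "\<dots> = hardy_const \<sigma> TYPE('a) * (R powr (\<sigma> + 2) * n2 G + (R powr (\<sigma> + 2) / R\<^sup>2) * n2 v)"
    by (simp add: hardy_const_def distrib_left mult.assoc)
  also have "R powr (\<sigma> + 2) / R\<^sup>2 = R powr \<sigma>" using R by (simp add: powr_add)
  finally show "(LINT x|lborel. indicator (cball 0 R) x * (wt \<sigma> x * (v x)\<^sup>2))
      \<le> hardy_const \<sigma> TYPE('a) * (R powr (\<sigma> + 2) * n2 G + R powr \<sigma> * n2 v)" .
qed

lemma wt_outside: "\<sigma> < 0 \<Longrightarrow> 0 < R \<Longrightarrow> norm x \<ge> R \<Longrightarrow> wt \<sigma> x \<le> R powr \<sigma>"
  unfolding wt_def by (intro powr_mono2') auto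

text \<open>Hardy's inequality in the unit ball; outside it the weight is at most 1.\<close>

lemma wn_integrable:
  fixes v :: "'a::euclidean_space \<Rightarrow> real"
  assumes v: "sob v G" and s: "-2 < \<sigma>" "\<sigma> < 0" "- real DIM('a) < \<sigma>"
  shows "integrable lborel (\<lambda>x. wt \<sigma> x * (v x)\<^sup>2)"
    "wn \<sigma> v \<le> hardy_const \<sigma> TYPE('a) * (n2 G + n2 v) + n2 v"
proof -
  have h: "integrable lborel (\<lambda>x. indicator (cball 0 1) x * (wt \<sigma> x * (v x)\<^sup>2))"
    "(LINT x|lborel. indicator (cball 0 1) x * (wt \<sigma> x * (v x)\<^sup>2)) \<le> hardy_const \<sigma> TYPE('a) * (n2 G + n2 v)"
    using hardy_ball[OF v s, of 1] by simp_all
  have [measurable]: "v \<in> borel_measurable borel" using sobD[OF v] by auto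
  have i2: "integrable lborel (\<lambda>x. (v x)\<^sup>2)" using L2_int[OF sobD(1)[OF v]] by simp
  have le: "wt \<sigma> x * (v x)\<^sup>2 \<le> indicator (cball 0 1) x * (wt \<sigma> x * (v x)\<^sup>2) + (v x)\<^sup>2" for x
    using wt_outside[OF s(2), of 1 x] mult_right_mono[of "wt \<sigma> x" 1 "(v x)\<^sup>2"] by (auto simp: indicator_def)
  show i: "integrable lborel (\<lambda>x. wt \<sigma> x * (v x)\<^sup>2)"
    by (rule Bochner_Integration.integrable_bound[OF Bochner_Integration.integrable_add[OF h(1) i2]])
      (use le in \<open>auto intro!: AE_I2\<close>)
  have "wn \<sigma> v \<le> (LINT x|lborel. indicator (cball 0 1) x * (wt \<sigma> x * (v x)\<^sup>2) + (v x)\<^sup>2)"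
    unfolding wn_def by (intro integral_mono i Bochner_Integration.integrable_add h i2 le)
  also have "\<dots> = (LINT x|lborel. indicator (cball 0 1) x * (wt \<sigma> x * (v x)\<^sup>2)) + n2 v"
    using h(1) i2 by (simp add: n2_def)
  finally show "wn \<sigma> v \<le> hardy_const \<sigma> TYPE('a) * (n2 G + n2 v) + n2 v" using h(2) by linarith
qed

lemma wt_pos_AE: "AE x in lborel. 0 < wt \<sigma> (x::'a::euclidean_space)"
  using AE_lborel_singleton[of "0::'a"] by eventually_elim (simp add: wt_def)

text \<open>If the gradient vanishes, Hardy's inequality on a ball of radius R leaves only a
  multiple of R^\<sigma> \<open>n2 v\<close>, which tends to 0 for negative \<sigma>. Thus a
  weighted integral of v^2 is 0.\<close>

lemma sob_gradient_zero:
  fixes v :: "'a::euclidean_space \<Rightarrow> real"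
  assumes v: "sob v G" and z: "n2 G = 0"
  shows "AE x in lborel. v x = 0"
proof -
  \<comment> \<open>An exponent that is admissible in every dimension.\<close>
  define \<sigma> where "\<sigma> = - (1/2 :: real)"
  have D1: "real DIM('a) \<ge> 1" using DIM_positive[where 'a='a] by linarith
  have s: "-2 < \<sigma>" "\<sigma> < 0" "- real DIM('a) < \<sigma>" unfolding \<sigma>_def using D1 by linarith+
  have [measurable]: "v \<in> borel_measurable borel" using sobD[OF v] by auto
  define g where "g n x = indicator (cball 0 (real (Suc n))) x * (wt \<sigma> x * (v x)\<^sup>2)" for n and x :: 'a
  have h: "integrable lborel (g n)"
    "(LINT x|lborel. g n x) \<le> hardy_const \<sigma> TYPE('a) * (real (Suc n) powr \<sigma> * n2 v)" for n
    using hardy_ball[OF v s, of "real (Suc n)"] z by (simp_all add: g_def[abs_def])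
  \<comment> \<open>The integrals increase with the radius, so each one is below the bound for every
    later radius.\<close>
  have "(LINT x|lborel. g n x) \<le> 0" for n
  proof (rule LIMSEQ_le_const)
    have "(\<lambda>m. real (Suc m) powr \<sigma>) \<longlonglongrightarrow> 0"
      using tendsto_neg_powr[OF s(2) filterlim_compose[OF filterlim_real_sequentially filterlim_Suc]] by simp
    from tendsto_mult[OF tendsto_const tendsto_mult[OF this tendsto_const]]
    show "(\<lambda>m. hardy_const \<sigma> TYPE('a) * (real (Suc m) powr \<sigma> * n2 v)) \<longlonglongrightarrow> 0" by fastforce
    have "(LINT x|lborel. g n x) \<le> hardy_const \<sigma> TYPE('a) * (real (Suc m) powr \<sigma> * n2 v)" if "m \<ge> n" for m
    proof -
      have "(LINT x|lborel. g n x) \<le> (LINT x|lborel. g m x)"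
        using that by (intro integral_mono h) (auto simp: g_def indicator_def)
      then show ?thesis using h(2)[of m] by linarith
    qed
    then show "\<exists>N. \<forall>m\<ge>N. (LINT x|lborel. g n x) \<le> hardy_const \<sigma> TYPE('a) * (real (Suc m) powr \<sigma> * n2 v)" by blast
  qed
  moreover have lim: "AE x in lborel. (\<lambda>n. g n x) \<longlonglongrightarrow> wt \<sigma> x * (v x)\<^sup>2"
  proof (rule AE_I2, rule tendsto_eventually)
    fix x :: 'a
    obtain N where N: "norm x < real N" using reals_Archimedean2 by blast
    have "g n x = wt \<sigma> x * (v x)\<^sup>2" if "n \<ge> N" for n using N that by (simp add: g_def indicator_def)
    then show "\<forall>\<^sub>F n in sequentially. g n x = wt \<sigma> x * (v x)\<^sup>2" unfolding eventually_sequentially by blast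
  qed
  moreover have gn: "0 \<le> g n x" for n x by (simp add: g_def)
  moreover have m: "(\<lambda>x. wt \<sigma> x * (v x)\<^sup>2) \<in> borel_measurable borel" by measurable
  ultimately have "integrable lborel (\<lambda>x. wt \<sigma> x * (v x)\<^sup>2)" "(LINT x|lborel. wt \<sigma> x * (v x)\<^sup>2) \<le> 0"
    using fatou_bound[of g 0 "\<lambda>x. wt \<sigma> x * (v x)\<^sup>2"] h(1) by blast+
  moreover have "0 \<le> (LINT x|lborel. wt \<sigma> x * (v x)\<^sup>2)" by simp
  ultimately have "AE x in lborel. wt \<sigma> x * (v x)\<^sup>2 = 0"
    by (subst integral_nonneg_eq_0_iff_AE[symmetric]) auto
  then show ?thesis using wt_pos_AE[of \<sigma>] by eventually_elim simp
qed

section \<open>The Nash-type inequality\<close>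

lemma moll_L1_bound:
  fixes b :: "'a::euclidean_space \<Rightarrow> real"
  assumes b: "integrable lborel b" and r: "0 < r"
  shows "integrable lborel (moll r b)" "(LINT x|lborel. \<bar>moll r b x\<bar>) \<le> (LINT x|lborel. \<bar>b x\<bar>)"
    "\<bar>moll r b x\<bar> \<le> kern r (0::'a) * (LINT x|lborel. \<bar>b x\<bar>)"
proof -
  have bm[measurable]: "b \<in> borel_measurable borel" using b by auto
  have mm[measurable]: "moll r b \<in> borel_measurable borel" by (rule moll_meas) simp
  have kb: "0 \<le> kern r y" "kern r y \<le> kern r (0::'a)" for y :: 'a using kern_nonneg[OF r] kern_le[OF r] by auto
  have fl: "integrable lborel (\<lambda>y. \<bar>b (x - y)\<bar>)" "(LINT y|lborel. \<bar>b (x - y)\<bar>) = (LINT y|lborel. \<bar>b y\<bar>)" for x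
    using vol_map_integrable[OF vol_map_flip, of "\<lambda>y. \<bar>b y\<bar>" x] vol_map_integral[OF vol_map_flip, of "\<lambda>y. \<bar>b y\<bar>" x] b
    by auto
  have i: "integrable lborel (\<lambda>y. kern r y * \<bar>b (x - y)\<bar>)" for x
    by (rule Bochner_Integration.integrable_bound[OF integrable_mult_right[OF fl(1), of "kern r (0::'a)"]])
      (auto intro!: AE_I2 mult_right_mono kb simp: abs_mult kb)
  have le: "\<bar>moll r b x\<bar> \<le> (LINT y|lborel. kern r y * \<bar>b (x - y)\<bar>)" for x
    using integral_norm_bound[of lborel "\<lambda>y. kern r y * b (x - y)"] by (simp add: moll_def abs_mult kb)
  show "\<bar>moll r b x\<bar> \<le> kern r (0::'a) * (LINT x|lborel. \<bar>b x\<bar>)" for x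
  proof -
    have "(LINT y|lborel. kern r y * \<bar>b (x - y)\<bar>) \<le> (LINT y|lborel. kern r (0::'a) * \<bar>b (x - y)\<bar>)"
      by (intro integral_mono i integrable_mult_right fl mult_right_mono kb) auto
    then show ?thesis using le[of x] by (simp add: fl(2))
  qed
  have "(\<integral>\<^sup>+x. ennreal \<bar>moll r b x\<bar> \<partial>lborel) \<le> (\<integral>\<^sup>+x. \<integral>\<^sup>+y. ennreal (kern r y * \<bar>b (x - y)\<bar>) \<partial>lborel \<partial>lborel)"
    by (intro nn_integral_mono, subst nn_integral_eq_integral[OF i]) (auto simp: kb intro!: ennreal_leI le)
  also have "\<dots> = (\<integral>\<^sup>+y. \<integral>\<^sup>+x. ennreal (kern r y * \<bar>b (x - y)\<bar>) \<partial>lborel \<partial>lborel)"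
    by (rule lborel_pair.Fubini') measurable
  also have "\<dots> = (\<integral>\<^sup>+y. ennreal (kern r (y::'a) * (LINT x|lborel. \<bar>b x\<bar>)) \<partial>lborel)"
  proof (rule nn_integral_cong)
    fix y :: 'a
    have "integrable lborel (\<lambda>x. \<bar>b (x - y)\<bar>)" "(LINT x|lborel. \<bar>b (x - y)\<bar>) = (LINT x|lborel. \<bar>b x\<bar>)"
      using integrable_translate[of "\<lambda>x. \<bar>b x\<bar>" "- y"] integral_translate[of "\<lambda>x. \<bar>b x\<bar>" "- y"] b by auto
    then show "(\<integral>\<^sup>+x. ennreal (kern r y * \<bar>b (x - y)\<bar>) \<partial>lborel) = ennreal (kern r y * (LINT x|lborel. \<bar>b x\<bar>))"
      by (subst nn_integral_eq_integral) (auto simp: kb)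
  qed
  also have "\<dots> = ennreal (LINT x|lborel. \<bar>b x\<bar>)"
    using kern_integrable[OF r, where 'a='a] kern_integral[OF r, where 'a='a]
    by (subst nn_integral_eq_integral) (auto simp: kb)
  finally have fin: "(\<integral>\<^sup>+x. ennreal \<bar>moll r b x\<bar> \<partial>lborel) \<le> ennreal (LINT x|lborel. \<bar>b x\<bar>)" .
  then have ia: "integrable lborel (\<lambda>x. \<bar>moll r b x\<bar>)"
    by (intro integrableI_nonneg) (auto simp: less_top[symmetric] top_unique)
  then show "integrable lborel (moll r b)" by (subst (asm) integrable_abs_iff) auto
  have "ennreal (LINT x|lborel. \<bar>moll r b x\<bar>) \<le> ennreal (LINT x|lborel. \<bar>b x\<bar>)"
    using fin nn_integral_eq_integral[OF ia] by simp
  then show "(LINT x|lborel. \<bar>moll r b x\<bar>) \<le> (LINT x|lborel. \<bar>b x\<bar>)" by (subst (asm) ennreal_le_iff) auto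
qed

text \<open>After mollification at scale 1, the part of \<open>v\<close> below height 1 is controlled in \<open>L\<^sup>2\<close>
  and the part above it in \<open>L\<^sup>1\<close>, both by the \<open>L\<^sup>p\<close> integral.\<close>
lemma nash:
  fixes v :: "'a::euclidean_space \<Rightarrow> real"
  assumes v: "sob v G" and p: "1 \<le> p" "p \<le> 2" and i: "integrable lborel (\<lambda>x. \<bar>v x\<bar> powr p)"
  shows "n2 v \<le> 2 * n2 G + 4 * (LINT x|lborel. \<bar>v x\<bar> powr p) + 4 * kern 1 (0::'a) * (LINT x|lborel. \<bar>v x\<bar> powr p)\<^sup>2"
proof -
  note L = sobD[OF v]
  have [measurable]: "v \<in> borel_measurable borel" using L by auto
  let ?B = "LINT x|lborel. \<bar>v x\<bar> powr p"
  have B0: "0 \<le> ?B" by simp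
  define a where "a x = (if \<bar>v x\<bar> \<le> 1 then v x else 0)" for x
  define b where "b x = (if \<bar>v x\<bar> \<le> 1 then 0 else v x)" for x
  have [measurable]: "a \<in> borel_measurable borel" "b \<in> borel_measurable borel" unfolding a_def b_def by measurable
  have La: "L2 a" by (rule L2_dominated(1)[OF L(1)]) (auto simp: a_def)
  have Lb: "L2 b" by (rule L2_dominated(1)[OF L(1)]) (auto simp: b_def)
  have k1: "0 < (1::real)" by simp
  have a2: "(norm (a x))\<^sup>2 \<le> \<bar>v x\<bar> powr p" for x
  proof (cases "\<bar>v x\<bar> \<le> 1 \<and> v x \<noteq> 0")
    case True
    have "\<bar>v x\<bar> powr 2 \<le> \<bar>v x\<bar> powr p" using True p by (intro powr_mono') auto
    then show ?thesis using True by (simp add: a_def powr_numeral)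
  qed (auto simp: a_def)
  have b1: "\<bar>b x\<bar> \<le> \<bar>v x\<bar> powr p" for x
  proof (cases "\<bar>v x\<bar> \<le> 1")
    case False
    have "\<bar>v x\<bar> powr 1 \<le> \<bar>v x\<bar> powr p" using False p by (intro powr_mono) auto
    then show ?thesis using False by (simp add: b_def)
  qed (auto simp: b_def)
  have n2a: "n2 a \<le> ?B" unfolding n2_def by (intro integral_mono L2_int La i a2)
  have ib: "integrable lborel b"
    by (rule Bochner_Integration.integrable_bound[OF i]) (use b1 in \<open>auto intro!: AE_I2\<close>)
  have nb: "(LINT x|lborel. \<bar>b x\<bar>) \<le> ?B" using ib by (intro integral_mono i b1) auto
  note mb = moll_L1_bound[OF ib k1]
  have kn: "0 \<le> kern 1 (0::'a)" by (rule kern_nonneg) simp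
  \<comment> \<open>Mollification makes the integrable part bounded, so its square is at most the
    supremum times the absolute value.\<close>
  have "n2 (moll 1 b) \<le> (LINT x|lborel. (kern 1 (0::'a) * ?B) * \<bar>moll 1 b x\<bar>)"
    unfolding n2_def
  proof (intro integral_mono L2_int moll_L2 Lb k1 integrable_mult_right integrable_abs mb(1))
    fix x
    have "\<bar>moll 1 b x\<bar> \<le> kern 1 (0::'a) * ?B"
      using mb(3)[of x] mult_left_mono[OF nb kn] by linarith
    then have "\<bar>moll 1 b x\<bar> * \<bar>moll 1 b x\<bar> \<le> (kern 1 (0::'a) * ?B) * \<bar>moll 1 b x\<bar>"
      by (rule mult_right_mono) simp
    then show "(norm (moll 1 b x))\<^sup>2 \<le> (kern 1 (0::'a) * ?B) * \<bar>moll 1 b x\<bar>" by (simp add: power2_eq_square)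
  qed
  also have "\<dots> \<le> (kern 1 (0::'a) * ?B) * ?B"
    using mb(2) nb kn B0 by (simp add: mult_left_mono)
  finally have n2b: "n2 (moll 1 b) \<le> kern 1 (0::'a) * ?B\<^sup>2" by (simp add: power2_eq_square mult.assoc)
  have "moll 1 v = (\<lambda>x. moll 1 a x + moll 1 b x)"
  proof
    fix x
    have "moll 1 v x = moll 1 (\<lambda>x. a x + b x) x" by (rule arg_cong[where f="\<lambda>f. moll 1 f x"]) (auto simp: a_def b_def)
    then show "moll 1 v x = moll 1 a x + moll 1 b x" by (simp add: moll_add[OF k1 La Lb])
  qed
  then have "n2 (moll 1 v) \<le> 2 * n2 (moll 1 a) + 2 * n2 (moll 1 b)"
    using n2_add_le[OF moll_L2(1)[OF k1 La] moll_L2(1)[OF k1 Lb]] by simp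
  moreover have "n2 (moll 1 a) \<le> ?B" using moll_L2(2)[OF k1 La] n2a by linarith
  moreover have "n2 v \<le> 2 * n2 (\<lambda>x. v x - moll 1 v x) + 2 * n2 (moll 1 v)"
    using n2_add_le[OF L2_diff[OF L(1) moll_L2(1)[OF k1 L(1)]] moll_L2(1)[OF k1 L(1)]] by simp
  moreover have "n2 (\<lambda>x. v x - moll 1 v x) \<le> n2 G"
    using sob_moll_close[OF v k1] n2_diff_commute[of v "moll 1 v"] by simp
  ultimately show ?thesis using n2b by simp
qed

section \<open>Compactness in the weighted space\<close>

lemma wn_n2: "wn \<sigma> v = n2 (\<lambda>x. sqrt (wt \<sigma> x) * v x)"
  by (simp add: wn_def n2_def power_mult_distrib)

lemma L2_weighted:
  assumes "v \<in> borel_measurable borel" "integrable lborel (\<lambda>x. wt \<sigma> x * (v x)\<^sup>2)"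
  shows "L2 (\<lambda>x. sqrt (wt \<sigma> x) * v x)"
  by (rule L2_I) (use assms in \<open>auto simp: power_mult_distrib\<close>)

lemma approx_bound:
  fixes v :: "'a::euclidean_space \<Rightarrow> real"
  assumes "L2 v" shows "\<bar>approx k v x\<bar> \<le> sqrt (n2 v) * sqrt (n2 (kern (1 / real (Suc k)) :: 'a \<Rightarrow> real))"
proof -
  have r: "0 < 1 / real (Suc k)" by simp
  have "approx k v x = (LINT y|lborel. v y *\<^sub>R kern (1 / real (Suc k)) (x - y))"
    unfolding approx_def moll_flip[OF L2_meas[OF assms]] by (simp add: mult.commute)
  then show ?thesis
    using L2_scaleR_bound[OF assms L2_flip(1)[OF kern_L2[OF r]], of x] L2_flip(2)[OF kern_L2[OF r], of x] by simp
qed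

lemma approx_equicontinuous:
  fixes k :: nat
  assumes "0 < e"
  shows "\<exists>d>0. \<forall>(x::'a::euclidean_space) x' v. norm (x - x') < d \<longrightarrow> L2 v \<longrightarrow> \<bar>approx k v x - approx k v x'\<bar> \<le> sqrt (n2 v) * e"
proof -
  have r: "0 < 1 / real (Suc k)" by simp
  have eq: "approx k v x = (LINT y|lborel. v y *\<^sub>R kern (1 / real (Suc k)) (x - y))" if "L2 v" for v :: "'a \<Rightarrow> real" and x
    unfolding approx_def moll_flip[OF L2_meas[OF that]] by (simp add: mult.commute)
  show ?thesis
    using convolution_equicontinuous[OF kern_L2[OF r, where 'a='a] assms] by (simp add: eq real_norm_def)
qed

text \<open>One diagonal selection over all pairs of a mollification scale and a point of a
  countable dense set; equicontinuity at each fixed scale then extends convergence from the dense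
  set to every point.\<close>

lemma sob_bounded_subseq:
  fixes v :: "nat \<Rightarrow> 'a::euclidean_space \<Rightarrow> real"
  assumes L: "\<And>n. L2 (v n)" and K: "\<And>n. n2 (v n) \<le> K"
  obtains r where "strict_mono (r :: nat \<Rightarrow> nat)" "\<And>k x. convergent (\<lambda>n. approx k (v (r n)) x)"
proof -
  have K0: "0 \<le> K" using order_trans[OF n2_nonneg K] by blast
  \<comment> \<open>The bounds on \<open>approx k\<close> grow with \<open>k\<close>; dividing by
    \<open>c k\<close> makes them uniform, as the diagonal selection needs a single bound. The
    summand 1 keeps \<open>c k\<close> positive.\<close>
  define c where "c k = 1 + sqrt (n2 (kern (1 / real (Suc k)) :: 'a \<Rightarrow> real))" for k
  have c: "c k > 0" "sqrt (n2 (kern (1 / real (Suc k)) :: 'a \<Rightarrow> real)) \<le> c k" for k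
    by (auto simp: c_def add_pos_nonneg)
  obtain D :: "'a set" where D: "countable D" "\<And>X. open X \<Longrightarrow> X \<noteq> {} \<Longrightarrow> \<exists>d\<in>D. d \<in> X"
    using countable_dense_exists by blast
  define f where "f n z = approx (fst z) (v n) (snd z) / c (fst z)" for n and z :: "nat \<times> 'a"
  have "norm (f n z) \<le> sqrt K" for n z
  proof -
    have "\<bar>approx (fst z) (v n) (snd z)\<bar> \<le> sqrt K * c (fst z)"
    proof -
      have "\<bar>approx (fst z) (v n) (snd z)\<bar> \<le> sqrt (n2 (v n)) * sqrt (n2 (kern (1 / real (Suc (fst z))) :: 'a \<Rightarrow> real))"
        by (rule approx_bound[OF L])
      also have "\<dots> \<le> sqrt K * c (fst z)" using K K0 c by (intro mult_mono) auto
      finally show ?thesis .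
    qed
    then show ?thesis using c(1)[of "fst z"] by (simp add: f_def divide_le_eq)
  qed
  moreover have "countable (UNIV \<times> D :: (nat \<times> 'a) set)" using D(1) by auto
  ultimately obtain r where r: "strict_mono (r :: nat \<Rightarrow> nat)" "\<And>z. z \<in> UNIV \<times> D \<Longrightarrow> \<exists>l. (\<lambda>n. f (r n) z) \<longlonglongrightarrow> l"
    using function_convergent_subsequence[of "UNIV \<times> D" f "sqrt K"] by metis
  have conv: "convergent (\<lambda>n. approx k (v (r n)) q)" if qD: "q \<in> D" for k q
  proof -
    obtain l where "(\<lambda>n. f (r n) (k, q)) \<longlonglongrightarrow> l" using r(2)[of "(k, q)"] qD by auto
    from tendsto_mult_right[OF this, of "c k"] show ?thesis
      using c(1)[of k] unfolding convergent_def by (auto simp: f_def)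
  qed
  have "convergent (\<lambda>n. approx k (v (r n)) x)" for k x
  proof -
    have "Cauchy (\<lambda>n. approx k (v (r n)) x)"
    proof (rule metric_CauchyI)
      fix e :: real assume e: "e > 0"
      define e' where "e' = e / (3 * (sqrt K + 1))"
      have sK: "0 < sqrt K + 1" using K0 by (simp add: add_nonneg_pos)
      have e': "e' > 0" "sqrt K * e' < e / 3"
      proof -
        show "e' > 0" using e sK by (simp add: e'_def)
        then have "sqrt K * e' < (sqrt K + 1) * e'" by simp
        also have "\<dots> = e / 3" unfolding e'_def using sK by (simp only: times_divide_eq_right mult.commute[of 3] divide_divide_eq_left[symmetric]) simp
        finally show "sqrt K * e' < e / 3" .
      qed
      obtain d where d: "d > 0" "\<And>x x' w. norm (x - x') < d \<Longrightarrow> L2 w \<Longrightarrow> \<bar>approx k w x - approx k w (x'::'a)\<bar> \<le> sqrt (n2 w) * e'"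
        using approx_equicontinuous[OF e'(1), of k] by blast
      obtain q where q: "q \<in> D" "q \<in> ball x d" using D(2)[of "ball x d"] d(1) by auto
      have near: "\<bar>approx k (v n) x - approx k (v n) q\<bar> < e / 3" for n
      proof -
        have "\<bar>approx k (v n) x - approx k (v n) q\<bar> \<le> sqrt (n2 (v n)) * e'"
          using d(2)[OF _ L] q(2) by (simp add: dist_norm)
        also have "\<dots> \<le> sqrt K * e'" using K e' by (intro mult_right_mono) auto
        finally show ?thesis using e' by linarith
      qed
      have "Cauchy (\<lambda>n. approx k (v (r n)) q)" using conv[OF q(1)] by (rule convergent_Cauchy)
      then obtain M where M: "\<And>i j. i \<ge> M \<Longrightarrow> j \<ge> M \<Longrightarrow> dist (approx k (v (r i)) q) (approx k (v (r j)) q) < e / 3"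
        using metric_CauchyD[of _ "e/3"] e by (metis divide_pos_pos zero_less_numeral)
      show "\<exists>M. \<forall>i\<ge>M. \<forall>j\<ge>M. dist (approx k (v (r i)) x) (approx k (v (r j)) x) < e"
      proof (intro exI[of _ M] allI impI)
        fix i j assume "i \<ge> M" "j \<ge> M"
        from M[OF this] near[of "r i"] near[of "r j"]
        show "dist (approx k (v (r i)) x) (approx k (v (r j)) x) < e"
          unfolding dist_real_def by linarith
      qed
    qed
    then show ?thesis by (rule Cauchy_convergent)
  qed
  then show thesis using that r(1) by blast
qed

lemma indicator_ball_meas [measurable]: "(indicator (cball 0 R) :: 'a::euclidean_space \<Rightarrow> real) \<in> borel_measurable borel"
  by (intro borel_measurable_indicator) auto

lemma L2_restrict:
  fixes f :: "'a::euclidean_space \<Rightarrow> real"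
  assumes "L2 f" shows "L2 (\<lambda>x. indicator (cball 0 R) x * f x)" "n2 (\<lambda>x. indicator (cball 0 R) x * f x) \<le> n2 f"
proof -
  have [measurable]: "f \<in> borel_measurable borel" using assms by auto
  have "(\<lambda>x. indicator (cball 0 R) x * f x) \<in> borel_measurable borel" by measurable
  from L2_dominated[OF assms this]
  show "L2 (\<lambda>x. indicator (cball 0 R) x * f x)" "n2 (\<lambda>x. indicator (cball 0 R) x * f x) \<le> n2 f"
    by (auto simp: indicator_def)
qed

text \<open>At a fixed scale the approximants are uniformly bounded, so pointwise convergence
  becomes L^2 convergence on a ball by dominated convergence.\<close>

lemma approx_local_limit:
  fixes v :: "nat \<Rightarrow> 'a::euclidean_space \<Rightarrow> real"
  assumes L: "\<And>n. L2 (v n)" and K: "\<And>n. n2 (v n) \<le> K" and c: "\<And>x. convergent (\<lambda>n. approx k (v n) x)"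
    and e: "e > 0"
  shows "\<exists>N. \<forall>i\<ge>N. \<forall>j\<ge>N. n2 (\<lambda>x. indicator (cball 0 R) x * (approx k (v i) x - approx k (v j) x)) < e"
proof -
  let ?I = "indicator (cball 0 R) :: 'a \<Rightarrow> real"
  define l where "l x = lim (\<lambda>n. approx k (v n) x)" for x
  have l: "(\<lambda>n. approx k (v n) x) \<longlonglongrightarrow> l x" for x using c by (simp add: l_def convergent_LIMSEQ_iff)
  have [measurable]: "approx k (v n) \<in> borel_measurable borel" for n using approx_L2[OF L] by auto
  have [measurable]: "l \<in> borel_measurable borel" by (rule borel_measurable_LIMSEQ_metric[OF _ l]) simp
  define M where "M = sqrt K * sqrt (n2 (kern (1 / real (Suc k)) :: 'a \<Rightarrow> real))"
  have bd: "\<bar>approx k (v n) x\<bar> \<le> M" for n x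
  proof -
    have "\<bar>approx k (v n) x\<bar> \<le> sqrt (n2 (v n)) * sqrt (n2 (kern (1 / real (Suc k)) :: 'a \<Rightarrow> real))"
      by (rule approx_bound[OF L])
    also have "\<dots> \<le> M" unfolding M_def using K by (intro mult_right_mono) auto
    finally show ?thesis .
  qed
  have M0: "0 \<le> M" using order_trans[OF abs_ge_zero bd] by blast
  have "integrable lborel ?I" using emeasure_bounded_finite[of "cball 0 R :: 'a set"] by (auto simp: less_top)
  then have Lg: "L2 (\<lambda>x. M * ?I x)" by (intro L2_cmult L2_indicator)
  have b: "norm (?I x * approx k (v n) x) \<le> norm (M * ?I x)" for n x
    using bd[of n x] M0 by (auto simp: indicator_def)
  have m: "(\<lambda>x. ?I x * approx k (v n) x) \<in> borel_measurable borel" "(\<lambda>x. ?I x * l x) \<in> borel_measurable borel" for n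
    by measurable
  have lim: "AE x in lborel. (\<lambda>n. ?I x * approx k (v n) x) \<longlonglongrightarrow> ?I x * l x" by (intro AE_I2 tendsto_intros l)
  note * = L2_dominated_convergence[OF Lg m lim AE_I2[OF b]]
  obtain N where N: "\<And>n. n \<ge> N \<Longrightarrow> n2 (\<lambda>x. ?I x * approx k (v n) x - ?I x * l x) < e / 4"
    using order_tendstoD(2)[OF *(1), of "e/4"] e by (auto simp: eventually_sequentially)
  have LI: "L2 (\<lambda>x. ?I x * approx k (v n) x)" for n by (intro L2_restrict approx_L2 L)
  show ?thesis
  proof (intro exI[of _ N] allI impI)
    fix i j assume ij: "i \<ge> N" "j \<ge> N"
    have "n2 (\<lambda>x. ?I x * (approx k (v i) x - approx k (v j) x)) = n2 (\<lambda>x. ?I x * approx k (v i) x - ?I x * approx k (v j) x)"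
      by (simp add: right_diff_distrib)
    also have "\<dots> \<le> 2 * n2 (\<lambda>x. ?I x * approx k (v i) x - ?I x * l x) + 2 * n2 (\<lambda>x. ?I x * l x - ?I x * approx k (v j) x)"
      by (rule n2_triangle2[OF LI *(2) LI])
    also have "\<dots> < e" using N[OF ij(1)] N[OF ij(2)] n2_diff_commute[of "\<lambda>x. ?I x * l x"] by simp
    finally show "n2 (\<lambda>x. ?I x * (approx k (v i) x - approx k (v j) x)) < e" .
  qed
qed

text \<open>Three regions. For |x| at most \<delta> the weight is at most \<delta>^(\<sigma> -
  \<sigma>') times the more singular weight with exponent \<sigma>', still controlled by Hardy.
  Between \<delta> and R the weight is at most \<delta>^\<sigma> and only the local L^2 norm
  matters. Beyond R it is at most R^\<sigma>.\<close>

lemma wn_split: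
  fixes z :: "'a::euclidean_space \<Rightarrow> real"
  assumes z: "sob z G" and s': "-2 < \<sigma>'" "- real DIM('a) < \<sigma>'" and s: "\<sigma>' < \<sigma>" "\<sigma> < 0"
    and d: "0 < \<delta>" "\<delta> \<le> 1" and R: "0 < R"
  shows "wn \<sigma> z \<le> \<delta> powr (\<sigma> - \<sigma>') * (hardy_const \<sigma>' TYPE('a) * (n2 G + n2 z))
     + \<delta> powr \<sigma> * n2 (\<lambda>x. indicator (cball 0 R) x * z x) + R powr \<sigma> * n2 z"
proof -
  have s2: "\<sigma>' < 0" "-2 < \<sigma>" "- real DIM('a) < \<sigma>" using s s' by auto
  note h = hardy_ball[OF z s'(1) s2(1) s'(2), of 1, simplified]
  have [measurable]: "z \<in> borel_measurable borel" using sobD[OF z] by auto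
  note Lr = L2_restrict(1)[OF sobD(1)[OF z], of R]
  let ?I = "\<lambda>R. indicator (cball 0 R) :: 'a \<Rightarrow> real"
  have i2: "integrable lborel (\<lambda>x. (z x)\<^sup>2)" using L2_int[OF sobD(1)[OF z]] by simp
  have i3: "integrable lborel (\<lambda>x. (?I R x * z x)\<^sup>2)" using L2_int[OF Lr] by simp
  have pt: "wt \<sigma> x * (z x)\<^sup>2 \<le> \<delta> powr (\<sigma> - \<sigma>') * (?I 1 x * (wt \<sigma>' x * (z x)\<^sup>2))
      + \<delta> powr \<sigma> * (?I R x * z x)\<^sup>2 + R powr \<sigma> * (z x)\<^sup>2" for x
  proof -
    have nn: "0 \<le> \<delta> powr (\<sigma> - \<sigma>') * (?I 1 x * (wt \<sigma>' x * (z x)\<^sup>2))" "0 \<le> \<delta> powr \<sigma> * (?I R x * z x)\<^sup>2" "0 \<le> R powr \<sigma> * (z x)\<^sup>2"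
      by simp_all
    consider "norm x \<le> \<delta>" | "norm x \<ge> \<delta>" "norm x \<le> R" | "norm x \<ge> R" by linarith
    then show ?thesis
    proof cases
      case 1
      have "wt \<sigma> x \<le> \<delta> powr (\<sigma> - \<sigma>') * wt \<sigma>' x"
      proof (cases "x = 0")
        case False
        have "wt \<sigma> x = norm x powr (\<sigma> - \<sigma>') * wt \<sigma>' x" using False by (simp add: wt_def flip: powr_add)
        also have "\<dots> \<le> \<delta> powr (\<sigma> - \<sigma>') * wt \<sigma>' x" using 1 s by (intro mult_right_mono powr_mono2) auto
        finally show ?thesis .
      qed (simp add: wt_def)
      then have "wt \<sigma> x * (z x)\<^sup>2 \<le> \<delta> powr (\<sigma> - \<sigma>') * wt \<sigma>' x * (z x)\<^sup>2" by (rule mult_right_mono) simp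
      moreover have "?I 1 x = 1" using 1 d by (simp add: indicator_def)
      ultimately have "wt \<sigma> x * (z x)\<^sup>2 \<le> \<delta> powr (\<sigma> - \<sigma>') * (?I 1 x * (wt \<sigma>' x * (z x)\<^sup>2))"
        by (simp add: mult.assoc)
      then show ?thesis using nn by linarith
    next
      case 2
      have "wt \<sigma> x * (z x)\<^sup>2 \<le> \<delta> powr \<sigma> * (z x)\<^sup>2" by (intro mult_right_mono wt_outside s d 2) simp
      moreover have "?I R x = 1" using 2 by (simp add: indicator_def)
      ultimately have "wt \<sigma> x * (z x)\<^sup>2 \<le> \<delta> powr \<sigma> * (?I R x * z x)\<^sup>2" by simp
      then show ?thesis using nn by linarith
    next
      case 3
      have "wt \<sigma> x * (z x)\<^sup>2 \<le> R powr \<sigma> * (z x)\<^sup>2" by (intro mult_right_mono wt_outside s R 3) simp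
      then show ?thesis using nn by linarith
    qed
  qed
  have "wn \<sigma> z \<le> (LINT x|lborel. \<delta> powr (\<sigma> - \<sigma>') * (?I 1 x * (wt \<sigma>' x * (z x)\<^sup>2))
      + \<delta> powr \<sigma> * (?I R x * z x)\<^sup>2 + R powr \<sigma> * (z x)\<^sup>2)"
    unfolding wn_def
    by (intro integral_mono wn_integrable(1)[OF z s2(2) s(2) s2(3)] Bochner_Integration.integrable_add integrable_mult_right h(1) i2 i3 pt)
  also have "\<dots> = \<delta> powr (\<sigma> - \<sigma>') * (LINT x|lborel. ?I 1 x * (wt \<sigma>' x * (z x)\<^sup>2))
      + \<delta> powr \<sigma> * n2 (\<lambda>x. ?I R x * z x) + R powr \<sigma> * n2 z"
    using h(1) i2 i3 by (simp add: n2_def)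
  also have "\<dots> \<le> \<delta> powr (\<sigma> - \<sigma>') * (hardy_const \<sigma>' TYPE('a) * (n2 G + n2 z))
      + \<delta> powr \<sigma> * n2 (\<lambda>x. ?I R x * z x) + R powr \<sigma> * n2 z"
    using h(2) by (intro add_mono mult_left_mono order_refl) auto
  finally show ?thesis .
qed

lemma powr_small: "0 < a \<Longrightarrow> 0 < e \<Longrightarrow> \<exists>\<delta>. 0 < \<delta> \<and> \<delta> \<le> 1 \<and> \<delta> powr a * c < (e::real)"
proof -
  assume a: "0 < a" and e: "0 < e"
  define y where "y = e / (2 * (\<bar>c\<bar> + 1))"
  have c1: "0 < 2 * (\<bar>c\<bar> + 1)" by (simp add: add_nonneg_pos)
  have y: "0 < y" unfolding y_def by (rule divide_pos_pos[OF e c1])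
  define \<delta> where "\<delta> = min 1 (y powr (1 / a))"
  have d: "0 < \<delta>" "\<delta> \<le> 1" using y by (auto simp: \<delta>_def)
  have "\<delta> powr a \<le> (y powr (1 / a)) powr a" using a d by (intro powr_mono2) (auto simp: \<delta>_def)
  also have "\<dots> = y" using a y by (simp add: powr_powr)
  finally have "\<delta> powr a * \<bar>c\<bar> \<le> y * \<bar>c\<bar>" by (rule mult_right_mono) simp
  then have "\<delta> powr a * c \<le> y * \<bar>c\<bar>"
    by (rule order_trans[OF mult_left_mono[OF abs_ge_self powr_ge_zero]])
  also have "\<dots> < y * (2 * (\<bar>c\<bar> + 1))" using y by (intro mult_strict_left_mono) auto
  also have "\<dots> = e" unfolding y_def using c1 by (metis less_irrefl nonzero_divide_eq_eq)
  finally show ?thesis using d by blast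
qed

text \<open>Of the three terms in \<open>wn_split\<close> the outer two are small uniformly along a
  bounded sequence. In the middle one, local L^2 convergence follows from convergence of
  mollifications at a fixed scale together with the uniform mollification error of
  \<open>sob_moll_close\<close>.\<close>

lemma weighted_compactness:
  fixes v :: "nat \<Rightarrow> 'a::euclidean_space \<Rightarrow> real"
  assumes s: "-2 < \<sigma>" "- real DIM('a) < \<sigma>" "\<sigma> < 0"
    and v: "\<And>n. sob (v n) (G n)" and K: "\<And>n. n2 (v n) \<le> K" "\<And>n. n2 (G n) \<le> K"
  obtains r where "strict_mono (r :: nat \<Rightarrow> nat)"
    "\<And>e. e > 0 \<Longrightarrow> \<exists>N. \<forall>i\<ge>N. \<forall>j\<ge>N. wn \<sigma> (\<lambda>x. v (r i) x - v (r j) x) < e"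
proof -
  note L = sobD(1)[OF v]
  have K0: "0 \<le> K" using order_trans[OF n2_nonneg K(1)] by blast
  obtain r where r: "strict_mono (r :: nat \<Rightarrow> nat)" "\<And>k x. convergent (\<lambda>n. approx k (v (r n)) x)"
    by (rule sob_bounded_subseq[of v K, OF L K(1)]) blast
  \<comment> \<open>Halfway between \<sigma> and the lower end of the admissible range.\<close>
  define \<sigma>' where "\<sigma>' = (\<sigma> + max (-2) (- real DIM('a))) / 2"
  have s': "-2 < \<sigma>'" "- real DIM('a) < \<sigma>'" "\<sigma>' < \<sigma>" using s by (auto simp: \<sigma>'_def max_def)
  have cauchy: "\<exists>N. \<forall>i\<ge>N. \<forall>j\<ge>N. wn \<sigma> (\<lambda>x. v (r i) x - v (r j) x) < e" if e: "e > 0" for e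
  proof -
    \<comment> \<open>A difference of two members has \<open>n2\<close> of function and gradient at
      most \<open>4 * K\<close> each, hence \<open>8 * K\<close>. The parameters are chosen in this
      order because the mollification scale has to beat the factor
      \<open>\<delta> powr \<sigma>\<close>.\<close>
    obtain \<delta> where d: "0 < \<delta>" "\<delta> \<le> 1" "\<delta> powr (\<sigma> - \<sigma>') * (hardy_const \<sigma>' TYPE('a) * (8 * K)) < e / 4"
      using powr_small[of "\<sigma> - \<sigma>'" "e/4" "hardy_const \<sigma>' TYPE('a) * (8 * K)"] s' e by auto
    obtain q where q: "0 < q" "q \<le> 1" "q powr (- \<sigma>) * (4 * K) < e / 4"
      using powr_small[of "- \<sigma>" "e/4" "4 * K"] s e by auto
    \<comment> \<open>Smallness at infinity is reduced to smallness at 0 by inversion.\<close>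
    define R where "R = 1 / q"
    have "R powr \<sigma> = q powr (- \<sigma>)" unfolding R_def using q by (simp add: powr_divide powr_minus_divide)
    then have R: "0 < R" "R powr \<sigma> * (4 * K) < e / 4" using q by (simp_all add: R_def)
    let ?c = "\<delta> powr \<sigma>"
    have cpos: "0 < ?c" using d by simp
    \<comment> \<open>A bound for the mollification radius: the squared error is at most the squared
      radius times \<open>4 * K\<close>, doubled by splitting and multiplied by
      \<open>?c\<close>.\<close>
    obtain t where t: "0 < t" "t \<le> 1" "t powr 2 * (?c * (8 * K)) < e / 4"
      using powr_small[of 2 "e/4" "?c * (8 * K)"] e by auto
    obtain k where k: "1 / real (Suc k) < t" using t(1) nat_approx_posE by blast
    let ?r = "1 / real (Suc k)"
    have rk: "?r\<^sup>2 * (?c * (8 * K)) < e / 4"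
    proof -
      have "?r\<^sup>2 \<le> t\<^sup>2" using k by (intro power_mono) auto
      then have "?r\<^sup>2 * (?c * (8 * K)) \<le> t\<^sup>2 * (?c * (8 * K))" using K0 cpos by (intro mult_right_mono) auto
      also have "t\<^sup>2 = t powr 2" using t by (simp add: powr_numeral)
      finally show ?thesis using t(3) by linarith
    qed
    obtain N where N: "\<And>i j. i \<ge> N \<Longrightarrow> j \<ge> N \<Longrightarrow>
        n2 (\<lambda>x. indicator (cball 0 R) x * (approx k (v (r i)) x - approx k (v (r j)) x)) < e / (8 * ?c)"
    proof -
      have "0 < e / (8 * ?c)" using e cpos by (intro divide_pos_pos) auto
      then show thesis
        using approx_local_limit[of "\<lambda>n. v (r n)" K k "e / (8 * ?c)" R, OF L K(1) r(2)] that by blast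
    qed
    show ?thesis
    proof (intro exI[of _ N] allI impI)
      fix i j assume ij: "i \<ge> N" "j \<ge> N"
      define z where "z x = v (r i) x - v (r j) x" for x
      define H where "H x = G (r i) x - G (r j) x" for x
      have z: "sob z H" unfolding z_def[abs_def] H_def[abs_def] by (intro sob_diff v)
      have nz: "n2 z \<le> 4 * K" "n2 H \<le> 4 * K"
        using n2_diff_le[OF L L, of "r i" "r j"] n2_diff_le[OF sobD(2)[OF v] sobD(2)[OF v], of "r i" "r j"]
          K(1)[of "r i"] K(1)[of "r j"] K(2)[of "r i"] K(2)[of "r j"]
        unfolding z_def[abs_def] H_def[abs_def] by linarith+
      let ?I = "indicator (cball 0 R) :: 'a \<Rightarrow> real"
      have Lz: "L2 z" "L2 (approx k z)" using sobD[OF z] approx_L2 by auto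
      have "approx k z x = approx k (v (r i)) x - approx k (v (r j)) x" for x
        unfolding approx_def z_def[abs_def] by (rule moll_diff) (use L in auto)
      then have n1: "n2 (\<lambda>x. ?I x * approx k z x) < e / (8 * ?c)" using N[OF ij] by simp
      have "n2 (\<lambda>x. ?I x * z x) = n2 (\<lambda>x. ?I x * (z x - approx k z x) + ?I x * approx k z x)"
        by (simp add: algebra_simps)
      also have "\<dots> \<le> 2 * n2 (\<lambda>x. ?I x * (z x - approx k z x)) + 2 * n2 (\<lambda>x. ?I x * approx k z x)"
        by (intro n2_add_le L2_restrict L2_diff Lz)
      also have "n2 (\<lambda>x. ?I x * (z x - approx k z x)) \<le> n2 (\<lambda>x. z x - approx k z x)"
        by (intro L2_restrict L2_diff Lz)
      also have "\<dots> \<le> ?r\<^sup>2 * n2 H"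
        using sob_moll_close[OF z, of ?r] n2_diff_commute[of z "approx k z"] by (simp add: approx_def)
      also have "\<dots> \<le> ?r\<^sup>2 * (4 * K)" using nz by (intro mult_left_mono) auto
      finally have "n2 (\<lambda>x. ?I x * z x) \<le> 2 * (?r\<^sup>2 * (4 * K)) + 2 * n2 (\<lambda>x. ?I x * approx k z x)" by simp
      then have "n2 (\<lambda>x. ?I x * z x) \<le> 2 * (?r\<^sup>2 * (4 * K)) + 2 * (e / (8 * ?c))" using n1 by linarith
      then have "?c * n2 (\<lambda>x. ?I x * z x) \<le> ?c * (2 * (?r\<^sup>2 * (4 * K)) + 2 * (e / (8 * ?c)))"
        using cpos by (intro mult_left_mono) auto
      also have "\<dots> = ?r\<^sup>2 * (?c * (8 * K)) + e / 4" using d(1) by (simp add: field_simps)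
      also have "\<dots> < e / 4 + e / 4" using rk by linarith
      finally have T2: "?c * n2 (\<lambda>x. ?I x * z x) < e / 2" by simp
      have hc: "0 \<le> hardy_const \<sigma>' TYPE('a)" by (simp add: hardy_const_def)
      have T1: "\<delta> powr (\<sigma> - \<sigma>') * (hardy_const \<sigma>' TYPE('a) * (n2 H + n2 z)) < e / 4"
      proof -
        have "n2 H + n2 z \<le> 8 * K" using nz by linarith
        then have "\<delta> powr (\<sigma> - \<sigma>') * (hardy_const \<sigma>' TYPE('a) * (n2 H + n2 z))
            \<le> \<delta> powr (\<sigma> - \<sigma>') * (hardy_const \<sigma>' TYPE('a) * (8 * K))"
          by (intro mult_left_mono hc) auto
        from le_less_trans[OF this d(3)] show ?thesis .
      qed
      have T3: "R powr \<sigma> * n2 z < e / 4"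
        by (rule le_less_trans[OF mult_left_mono[OF nz(1) powr_ge_zero] R(2)])
      have "wn \<sigma> z < e / 4 + e / 2 + e / 4"
        by (rule le_less_trans[OF wn_split[OF z s'(1,2,3) s(3) d(1,2) R(1)] add_strict_mono[OF add_strict_mono[OF T1 T2] T3]])
      then show "wn \<sigma> (\<lambda>x. v (r i) x - v (r j) x) < e" by (simp add: z_def[abs_def])
    qed
  qed
  show thesis by (rule that[OF r(1) cauchy])
qed

section \<open>The variational problem\<close>

locale ckn =
  fixes m \<sigma> :: real and T :: "'a::euclidean_space itself"
  assumes m: "1 < m" and s1: "-2 < \<sigma>" and s2: "- real DIM('a) < \<sigma>" and s3: "\<sigma> < 0"
begin

definition p :: real where "p = (m + 1) / m"
definition th :: real where "th = theta DIM('a) m"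
text \<open>The exponents of the two norms in the numerator of the functional. Since
  \<open>n2\<close> and \<open>pn\<close> are integrals rather than norms, they occur below as
  \<open>al / 2\<close> and \<open>be / p\<close>.\<close>

definition al :: real where "al = (\<sigma> + 2) * th - \<sigma>"
definition be :: real where "be = (\<sigma> + 2) * (1 - th)"

definition pn :: "('a \<Rightarrow> real) \<Rightarrow> real" where
  "pn v = (LINT x|lborel. \<bar>v x\<bar> powr p)"

definition X :: "('a \<Rightarrow> real) \<Rightarrow> ('a \<Rightarrow> 'a) \<Rightarrow> bool" where
  "X v G \<longleftrightarrow> sob v G \<and> integrable lborel (\<lambda>x. \<bar>v x\<bar> powr p)"

section \<open>Exponents and scaling\<close>

lemma N1: "1 \<le> real DIM('a)" using DIM_positive[where 'a='a] by linarith

lemma p_bounds: "1 < p" "p < 2" using m by (auto simp: p_def field_simps)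

lemma th_denominator: "0 < real DIM('a) * (m - 1) + 2 * (m + 1)"
  using N1 m by (intro add_pos_pos) auto

lemma th_bounds: "0 < th" "th < 1"
  using th_denominator m N1 unfolding th_def theta_def by (auto simp: field_simps)

lemma al_pos: "0 < al"
proof -
  have "0 \<le> (\<sigma> + 2) * th" using s1 th_bounds by (intro mult_nonneg_nonneg) auto
  then show ?thesis using s3 by (simp add: al_def)
qed

lemma be_pos: "0 < be" using s1 th_bounds by (simp add: be_def)

lemma al_be: "al + be = 2" by (simp add: al_def be_def algebra_simps)

text \<open>The balance of powers under x \<mapsto> l x: \<open>n2\<close> of the gradient scales
  with exponent \<open>2 - N\<close>, the L^p integral with \<open>- N\<close>, and the weighted
  norm with \<open>- N - \<sigma>\<close>. This is where the particular value of \<theta>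
  matters.\<close>

lemma scaling_identity: "(2 - real DIM('a)) * (al / 2) - real DIM('a) * (be / p) = - real DIM('a) - \<sigma>"
proof -
  let ?D = "real DIM('a) * (m - 1) + 2 * (m + 1)"
  have D: "?D \<noteq> 0" using th_denominator by simp
  have t1: "th * ?D = real DIM('a) * (m - 1)" "(1 - th) * ?D = 2 * (m + 1)"
    using D unfolding th_def theta_def by (auto simp: field_simps)
  have ip: "1 / p = m / (m + 1)" using m by (simp add: p_def)
  have "(1 - th) * (1 / p) * ?D = ((1 - th) * ?D) * (m / (m + 1))" unfolding ip by simp
  also have "\<dots> = 2 * m"
  proof -
    have "1 + m \<noteq> 0" using m by simp
    then show ?thesis unfolding t1 by (simp add: field_simps)
  qed
  finally have t2: "(1 - th) * (1 / p) * ?D = 2 * m" .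
  have "(th * (1 - real DIM('a) / 2) - real DIM('a) * ((1 - th) * (1 / p)) + real DIM('a) / 2) * ?D
      = (th * ?D) * (1 - real DIM('a) / 2) - real DIM('a) * ((1 - th) * (1 / p) * ?D) + real DIM('a) / 2 * ?D" by (simp add: algebra_simps)
  also have "\<dots> = 0" unfolding t1 t2 by (simp add: field_simps)
  finally have z: "th * (1 - real DIM('a) / 2) - real DIM('a) * ((1 - th) * (1 / p)) + real DIM('a) / 2 = 0" using D by simp
  have "(2 - real DIM('a)) * (al / 2) - real DIM('a) * (be / p) + real DIM('a) + \<sigma>
      = (\<sigma> + 2) * (th * (1 - real DIM('a) / 2) - real DIM('a) * ((1 - th) * (1 / p)) + real DIM('a) / 2)"
    by (simp add: al_def be_def field_simps)
  then show ?thesis using z by simp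
qed

lemma X_dilate:
  assumes X: "X v G" and c: "0 < c" and l: "0 < l"
  defines "v' \<equiv> \<lambda>x. c * v (l *\<^sub>R x)" and "G' \<equiv> \<lambda>x. (c * l) *\<^sub>R G (l *\<^sub>R x)"
  shows "X v' G'" "n2 G' = c powr 2 * l powr (2 - real DIM('a)) * n2 G" "pn v' = c powr p * l powr (- real DIM('a)) * pn v"
    "wn \<sigma> v' = c powr 2 * l powr (- real DIM('a) - \<sigma>) * wn \<sigma> v"
proof -
  have v: "sob v G" and i: "integrable lborel (\<lambda>x. \<bar>v x\<bar> powr p)" using X by (auto simp: X_def)
  have [measurable]: "v \<in> borel_measurable borel" using sobD[OF v] by auto
  have lN: "1 / \<bar>l\<bar> ^ DIM('a) = l powr (- real DIM('a))" using l by (simp add: powr_minus powr_realpow inverse_eq_divide)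
  have vm: "vol_map (l powr (- real DIM('a))) (\<lambda>x::'a. l *\<^sub>R x)"
    unfolding lN[symmetric] using l by (intro vol_map_homothety) simp
  have cl: "(\<lambda>x. \<bar>v' x\<bar> powr p) = (\<lambda>x. c powr p * \<bar>v (l *\<^sub>R x)\<bar> powr p)"
    using c by (simp add: v'_def abs_mult powr_mult)
  have i': "integrable lborel (\<lambda>x. \<bar>v (l *\<^sub>R x)\<bar> powr p)"
    using vol_map_integrable[OF vm, of "\<lambda>x. \<bar>v x\<bar> powr p"] i by simp
  have e: "(LINT x|lborel. \<bar>v (l *\<^sub>R x)\<bar> powr p) = l powr (- real DIM('a)) * pn v"
    using vol_map_integral[OF vm, of "\<lambda>x. \<bar>v x\<bar> powr p"] by (simp add: pn_def)
  note sd = sob_dilate[OF v l]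
  have sd': "sob v' G'" using sob_cmult[OF sd(1), of c] by (simp add: v'_def G'_def)
  then show "X v' G'" unfolding X_def cl using i' by simp
  show "pn v' = c powr p * l powr (- real DIM('a)) * pn v" unfolding pn_def[of v'] cl using e by simp
  have "n2 G' = c\<^sup>2 * n2 (\<lambda>x. l *\<^sub>R G (l *\<^sub>R x))"
    unfolding G'_def using n2_scaleR[of c "\<lambda>x. l *\<^sub>R G (l *\<^sub>R x)"] by simp
  also have "\<dots> = c\<^sup>2 * (l\<^sup>2 / l ^ DIM('a) * n2 G)" using sd(2) by simp
  also have "c\<^sup>2 = c powr 2" using c by (simp add: powr_numeral)
  also have "l\<^sup>2 / l ^ DIM('a) = l powr (2 - real DIM('a))" using l by (simp add: powr_diff powr_numeral powr_realpow)
  finally show "n2 G' = c powr 2 * l powr (2 - real DIM('a)) * n2 G" by simp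
  have "(\<lambda>x. wt \<sigma> x * (v' x)\<^sup>2) = (\<lambda>x. c powr 2 * l powr (- \<sigma>) * (wt \<sigma> (l *\<^sub>R x) * (v (l *\<^sub>R x))\<^sup>2))"
  proof
    fix x :: 'a
    have "wt \<sigma> (l *\<^sub>R x) = l powr \<sigma> * wt \<sigma> x" using l by (simp add: wt_def powr_mult)
    then show "wt \<sigma> x * (v' x)\<^sup>2 = c powr 2 * l powr (- \<sigma>) * (wt \<sigma> (l *\<^sub>R x) * (v (l *\<^sub>R x))\<^sup>2)"
      using c l by (simp add: v'_def power_mult_distrib powr_numeral powr_minus)
  qed
  then have "wn \<sigma> v' = c powr 2 * l powr (- \<sigma>) * (LINT x|lborel. wt \<sigma> (l *\<^sub>R x) * (v (l *\<^sub>R x))\<^sup>2)"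
    by (simp add: wn_def)
  also have "(LINT x|lborel. wt \<sigma> (l *\<^sub>R x) * (v (l *\<^sub>R x))\<^sup>2) = l powr (- real DIM('a)) * wn \<sigma> v"
    using vol_map_integral[OF vm, of "\<lambda>x. wt \<sigma> x * (v x)\<^sup>2"] by (simp add: wn_def)
  finally show "wn \<sigma> v' = c powr 2 * l powr (- real DIM('a) - \<sigma>) * wn \<sigma> v"
  proof -
    have e: "- real DIM('a) - \<sigma> = - \<sigma> + - real DIM('a)" by simp
    assume "wn \<sigma> v' = c powr 2 * l powr (- \<sigma>) * (l powr (- real DIM('a)) * wn \<sigma> v)"
    then show ?thesis unfolding e powr_add by (simp add: mult_ac)
  qed
qed

text \<open>In logarithms of \<open>c\<close> and \<open>l\<close> this is a linear system of two
  equations. Its determinant is -(N(2 - p) + 2p), which is negative because \<open>p < 2\<close>;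
  hence both integrals can be prescribed at the same time.\<close>

lemma dilation_exists:
  assumes "0 < A" "0 < B" "0 < A0" "0 < B0"
  shows "\<exists>c>0. \<exists>l>0. c powr 2 * l powr (2 - real DIM('a)) * A = A0 \<and> c powr p * l powr (- real DIM('a)) * B = B0"
proof -
  define D where "D = - 2 * real DIM('a) - p * (2 - real DIM('a))"
  have "D < 0"
  proof -
    have "0 < real DIM('a) * (2 - p)" using N1 p_bounds by (intro mult_pos_pos) auto
    moreover have "D = - (real DIM('a) * (2 - p)) - 2 * p" by (simp add: D_def algebra_simps)
    ultimately show ?thesis using p_bounds by linarith
  qed
  then have D: "D \<noteq> 0" by simp
  define a where "a = ln (A0 / A)"
  define b where "b = ln (B0 / B)"
  \<comment> \<open>Cramer's rule for \<open>ln c\<close>, and in the next line for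
    \<open>ln l\<close>.\<close>
  define t where "t = (- real DIM('a) * a - (2 - real DIM('a)) * b) / D"
  define s where "s = (2 * b - p * a) / D"
  have "2 * t + (2 - real DIM('a)) * s = (2 * (- real DIM('a) * a - (2 - real DIM('a)) * b) + (2 - real DIM('a)) * (2 * b - p * a)) / D"
    by (simp add: t_def s_def add_divide_distrib)
  also have "\<dots> = a * D / D" by (rule arg_cong[where f="\<lambda>x. x / D"]) (simp add: D_def algebra_simps)
  finally have e1: "2 * t + (2 - real DIM('a)) * s = a" using D by simp
  have "p * t + (- real DIM('a)) * s = (p * (- real DIM('a) * a - (2 - real DIM('a)) * b) + (- real DIM('a)) * (2 * b - p * a)) / D"
    by (simp only: t_def s_def add_divide_distrib times_divide_eq_right)
  also have "\<dots> = b * D / D" by (rule arg_cong[where f="\<lambda>x. x / D"]) (simp add: D_def algebra_simps)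
  finally have e2: "p * t + (- real DIM('a)) * s = b" using D by simp
  have "exp t powr 2 * exp s powr (2 - real DIM('a)) * A = exp (2 * t + (2 - real DIM('a)) * s) * A" by (simp add: powr_def exp_add)
  also have "\<dots> = A0" unfolding e1 a_def using assms by simp
  finally have r1: "exp t powr 2 * exp s powr (2 - real DIM('a)) * A = A0" .
  have "exp t powr p * exp s powr (- real DIM('a)) * B = exp (p * t + (- real DIM('a)) * s) * B"
    by (simp only: powr_def exp_not_eq_zero if_False ln_exp exp_add)
  also have "\<dots> = B0" unfolding e2 b_def using assms by simp
  finally have r2: "exp t powr p * exp s powr (- real DIM('a)) * B = B0" .
  show ?thesis using r1 r2 by (intro exI[of _ "exp t"] conjI exI[of _ "exp s"]) auto
qed

lemma homogeneity:
  assumes "0 < c" "0 < l" "0 \<le> A" "0 \<le> B"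
  shows "(c powr 2 * l powr (2 - real DIM('a)) * A) powr (al / 2) * (c powr p * l powr (- real DIM('a)) * B) powr (be / p)
    = c powr 2 * l powr (- real DIM('a) - \<sigma>) * (A powr (al / 2) * B powr (be / p))"
proof -
  have p0: "p \<noteq> 0" using p_bounds by simp
  have "(c powr 2 * l powr (2 - real DIM('a)) * A) powr (al / 2) * (c powr p * l powr (- real DIM('a)) * B) powr (be / p)
     = (c powr al * c powr be) * (l powr ((2 - real DIM('a)) * (al / 2)) * l powr ((- real DIM('a)) * (be / p))) * (A powr (al / 2) * B powr (be / p))"
    using assms p0 by (simp add: powr_mult powr_powr del: powr_numeral)
  also have "c powr al * c powr be = c powr 2" using al_be by (simp add: powr_add[symmetric])
  also have "l powr ((2 - real DIM('a)) * (al / 2)) * l powr ((- real DIM('a)) * (be / p)) = l powr (- real DIM('a) - \<sigma>)"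
    using scaling_identity by (simp add: powr_add[symmetric])
  finally show ?thesis .
qed

section \<open>The best constant\<close>

lemma pn_nonneg: "0 \<le> pn v" by (simp add: pn_def)

lemma pn_pos:
  assumes "X v G" "\<not> (AE x in lborel. v x = 0)" shows "0 < pn v"
proof -
  have "pn v \<noteq> 0"
  proof
    assume "pn v = 0"
    then have "AE x in lborel. \<bar>v x\<bar> powr p = 0"
      using assms(1) unfolding pn_def X_def by (subst (asm) integral_nonneg_eq_0_iff_AE) auto
    then have "AE x in lborel. v x = 0" by eventually_elim simp
    then show False using assms(2) by simp
  qed
  then show ?thesis using pn_nonneg[of v] by linarith
qed

lemma n2_pos:
  assumes "X v G" "\<not> (AE x in lborel. v x = 0)" shows "0 < n2 G"
proof -
  have "n2 G \<noteq> 0" using sob_gradient_zero[of v G] assms unfolding X_def by auto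
  then show ?thesis using n2_nonneg[of G] by linarith
qed

lemma wn_pos:
  assumes "X v G" "\<not> (AE x in lborel. v x = 0)" shows "0 < wn \<sigma> v"
proof -
  have v: "sob v G" using assms by (simp add: X_def)
  have "wn \<sigma> v \<noteq> 0"
  proof
    assume "wn \<sigma> v = 0"
    then have "AE x in lborel. wt \<sigma> x * (v x)\<^sup>2 = 0"
      unfolding wn_def using wn_integrable(1)[OF v s1 s3 s2] by (subst (asm) integral_nonneg_eq_0_iff_AE) auto
    then have "AE x in lborel. v x = 0" using wt_pos_AE[of \<sigma>] by eventually_elim simp
    then show False using assms(2) by simp
  qed
  moreover have "0 \<le> wn \<sigma> v" by (simp add: wn_def)
  ultimately show ?thesis by linarith
qed

text \<open>The right-hand side of \<open>nash\<close> when both integrals are at most 1.\<close>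

definition K0 :: real where
  "K0 = 6 + 4 * kern 1 (0::'a)"

lemma normalized_bound:
  assumes "X v G" "n2 G \<le> 1" "pn v \<le> 1"
  shows "n2 v \<le> K0" "wn \<sigma> v \<le> hardy_const \<sigma> TYPE('a) * (1 + K0) + K0"
proof -
  have v: "sob v G" and i: "integrable lborel (\<lambda>x. \<bar>v x\<bar> powr p)" using assms(1) by (auto simp: X_def)
  have k: "0 \<le> kern 1 (0::'a)" by (rule kern_nonneg) simp
  have "(pn v)\<^sup>2 \<le> 1" using assms(3) pn_nonneg[of v] by (simp add: power_le_one)
  then have "kern 1 (0::'a) * (pn v)\<^sup>2 \<le> kern 1 (0::'a) * 1" using k by (intro mult_left_mono)
  then show n: "n2 v \<le> K0"
    using nash[OF v _ _ i] p_bounds assms(2,3) unfolding pn_def[symmetric] K0_def by simp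
  have "hardy_const \<sigma> TYPE('a) * (n2 G + n2 v) \<le> hardy_const \<sigma> TYPE('a) * (1 + K0)"
    using n assms(2) by (intro mult_left_mono) (auto simp: hardy_const_def)
  then show "wn \<sigma> v \<le> hardy_const \<sigma> TYPE('a) * (1 + K0) + K0"
    using wn_integrable(2)[OF v s1 s3 s2] n by linarith
qed

definition nset :: "real set" where
  "nset = {wn \<sigma> v | v G. X v G \<and> n2 G = 1 \<and> pn v = 1}"

text \<open>The reciprocal of the infimum of the functional: on normalized pairs the numerator is
  1.\<close>

definition Lam :: real where "Lam = Sup nset"

lemma nset_bdd: "bdd_above nset"
  unfolding nset_def by (intro bdd_aboveI[of _ "hardy_const \<sigma> TYPE('a) * (1 + K0) + K0"]) (auto intro: normalized_bound)

text \<open>The last identity expresses the invariance of the functional in a multiplied-out form,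
  which needs no division.\<close>

lemma normalize:
  assumes X: "X v G" and nz: "\<not> (AE x in lborel. v x = 0)" and A0: "0 < A0" and B0: "0 < B0"
  obtains c l where "0 < c" "0 < l" "X (\<lambda>x. c * v (l *\<^sub>R x)) (\<lambda>x. (c * l) *\<^sub>R G (l *\<^sub>R x))"
    "n2 (\<lambda>x. (c * l) *\<^sub>R G (l *\<^sub>R x)) = A0" "pn (\<lambda>x. c * v (l *\<^sub>R x)) = B0"
    "wn \<sigma> (\<lambda>x. c * v (l *\<^sub>R x)) * (n2 G powr (al / 2) * pn v powr (be / p)) = wn \<sigma> v * (A0 powr (al / 2) * B0 powr (be / p))"
proof -
  obtain c l where c: "0 < c" "0 < l" "c powr 2 * l powr (2 - real DIM('a)) * n2 G = A0" "c powr p * l powr (- real DIM('a)) * pn v = B0"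
    using dilation_exists[OF n2_pos[OF X nz] pn_pos[OF X nz] A0 B0] by blast
  note d = X_dilate[OF X c(1,2)]
  have "A0 powr (al / 2) * B0 powr (be / p) = c powr 2 * l powr (- real DIM('a) - \<sigma>) * (n2 G powr (al / 2) * pn v powr (be / p))"
    using homogeneity[OF c(1,2) n2_nonneg[of G] pn_nonneg[of v]] c(3,4) by simp
  then show thesis using that[OF c(1,2)] d c by simp
qed

lemma exists_nonzero: "\<exists>v G. X v G \<and> \<not> (AE x in lborel. v x = 0)"
proof -
  obtain D where D: "C1 (bump 1 :: 'a \<Rightarrow> real) D" using bump_C1 by blast
  have b: "bsupp (bump 1 :: 'a \<Rightarrow> real)" by (rule bump_bsupp) simp
  have s: "sob (bump 1) D"
    by (intro C1_sob D bsupp_L2 C1_cont[OF D] b C1_contD[OF D] bsupp_gradient[OF D b])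
  have "continuous_on UNIV (\<lambda>x::'a. \<bar>bump 1 x\<bar> powr p)"
    using p_bounds by (intro continuous_on_powr' continuous_intros C1_cont[OF D]) auto
  moreover have "bsupp (\<lambda>x::'a. \<bar>bump 1 x\<bar> powr p)" using b by (auto simp: bsupp_def)
  ultimately have "integrable lborel (\<lambda>x::'a. \<bar>bump 1 x\<bar> powr p)" by (rule bsupp_integrable)
  then have "X (bump 1) D" using s by (simp add: X_def)
  moreover have "\<not> (AE x::'a in lborel. bump 1 x = 0)"
  proof
    assume z: "AE x::'a in lborel. bump 1 x = 0"
    have "(LINT x::'a|lborel. bump 1 x) = 0" by (rule integral_eq_zero_AE[OF z])
    then show False using bump_integral_pos[of 1, where 'a='a] by simp
  qed
  ultimately show ?thesis by blast
qed

lemma Lam_pos: "0 < Lam"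
proof -
  obtain v G where v: "X v G" "\<not> (AE x in lborel. v x = 0)" using exists_nonzero by blast
  obtain c l where c: "0 < c" "0 < l" "X (\<lambda>x. c * v (l *\<^sub>R x)) (\<lambda>x. (c * l) *\<^sub>R G (l *\<^sub>R x))"
    "n2 (\<lambda>x. (c * l) *\<^sub>R G (l *\<^sub>R x)) = 1" "pn (\<lambda>x. c * v (l *\<^sub>R x)) = 1"
    "wn \<sigma> (\<lambda>x. c * v (l *\<^sub>R x)) * (n2 G powr (al / 2) * pn v powr (be / p)) = wn \<sigma> v * (1 powr (al / 2) * 1 powr (be / p))"
    by (rule normalize[OF v zero_less_one zero_less_one])
  have "0 < wn \<sigma> (\<lambda>x. c * v (l *\<^sub>R x)) * (n2 G powr (al / 2) * pn v powr (be / p))"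
    unfolding c(6) using wn_pos[OF v] by simp
  moreover have "0 \<le> n2 G powr (al / 2) * pn v powr (be / p)" by simp
  ultimately have "0 < wn \<sigma> (\<lambda>x. c * v (l *\<^sub>R x))"
    by (simp only: zero_less_mult_iff not_less[symmetric] simp_thms)
  also have "\<dots> \<le> Lam" unfolding Lam_def
    by (intro cSup_upper nset_bdd) (use c(3,4,5) in \<open>auto simp: nset_def\<close>)
  finally show ?thesis .
qed

lemma Lam_inequality:
  assumes X: "X v G" shows "wn \<sigma> v \<le> Lam * (n2 G powr (al / 2) * pn v powr (be / p))"
proof (cases "AE x in lborel. v x = 0")
  case True
  have "wn \<sigma> v = 0" unfolding wn_def by (rule integral_eq_zero_AE) (use True in \<open>eventually_elim, simp\<close>)
  then show ?thesis using Lam_pos by simp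
next
  case False
  obtain c l where c: "0 < c" "0 < l" "X (\<lambda>x. c * v (l *\<^sub>R x)) (\<lambda>x. (c * l) *\<^sub>R G (l *\<^sub>R x))"
    "n2 (\<lambda>x. (c * l) *\<^sub>R G (l *\<^sub>R x)) = 1" "pn (\<lambda>x. c * v (l *\<^sub>R x)) = 1"
    "wn \<sigma> (\<lambda>x. c * v (l *\<^sub>R x)) * (n2 G powr (al / 2) * pn v powr (be / p)) = wn \<sigma> v * (1 powr (al / 2) * 1 powr (be / p))"
    by (rule normalize[OF X False zero_less_one zero_less_one])
  have "wn \<sigma> (\<lambda>x. c * v (l *\<^sub>R x)) \<le> Lam" unfolding Lam_def
    by (intro cSup_upper nset_bdd) (use c(3,4,5) in \<open>auto simp: nset_def\<close>)
  then have "wn \<sigma> (\<lambda>x. c * v (l *\<^sub>R x)) * (n2 G powr (al / 2) * pn v powr (be / p)) \<le> Lam * (n2 G powr (al / 2) * pn v powr (be / p))"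
    by (rule mult_right_mono) simp
  then show ?thesis unfolding c(6) by simp
qed

text \<open>Equality in \<open>Lam_inequality\<close>. Positivity of the weighted norm excludes the
  zero function, for which equality is trivial.\<close>

definition extremal :: "('a \<Rightarrow> real) \<Rightarrow> ('a \<Rightarrow> 'a) \<Rightarrow> bool" where
  "extremal v G \<longleftrightarrow> X v G \<and> 0 < wn \<sigma> v \<and> wn \<sigma> v = Lam * (n2 G powr (al / 2) * pn v powr (be / p))"

lemma L2_sqrt_weighted: "sob v G \<Longrightarrow> L2 (\<lambda>x::'a. sqrt (wt \<sigma> x) * v x)"
  using L2_weighted wn_integrable(1)[OF _ s1 s3 s2] sobD(1) L2_meas by blast

lemma Lam_mono:
  assumes "0 \<le> A" "A \<le> A'" "0 \<le> B" "B \<le> B'"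
  shows "Lam * (A powr (al / 2) * B powr (be / p)) \<le> Lam * (A' powr (al / 2) * B' powr (be / p))"
  using assms Lam_pos al_pos be_pos p_bounds
  by (intro mult_left_mono mult_mono powr_mono2) auto

text \<open>A competitor that is no worse in each of the three quantities must tie in the
  inequality. The resulting equality of the weighted norms is what makes the strictness argument for
  polarization work.\<close>

lemma extremal_improve:
  assumes "extremal v G" "X w H" "n2 H \<le> n2 G" "pn w \<le> pn v" "wn \<sigma> v \<le> wn \<sigma> w"
  shows "extremal w H" "wn \<sigma> w = wn \<sigma> v"
proof -
  have "wn \<sigma> w \<le> Lam * (n2 H powr (al / 2) * pn w powr (be / p))" by (rule Lam_inequality[OF assms(2)])
  moreover have "\<dots> \<le> Lam * (n2 G powr (al / 2) * pn v powr (be / p))"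
    by (intro Lam_mono assms n2_nonneg pn_nonneg)
  moreover have "\<dots> = wn \<sigma> v" using assms(1) by (simp add: extremal_def)
  ultimately have "wn \<sigma> w = wn \<sigma> v" "wn \<sigma> w = Lam * (n2 H powr (al / 2) * pn w powr (be / p))"
    using assms(5) by linarith+
  then show "extremal w H" "wn \<sigma> w = wn \<sigma> v" using assms(1,2) by (auto simp: extremal_def)
qed

section \<open>Existence of an extremal function\<close>

lemma midpoint_powr:
  fixes a b :: real
  shows "\<bar>(a + b) / 2\<bar> powr p \<le> (\<bar>a\<bar> powr p + \<bar>b\<bar> powr p) / 2"
proof -
  have p1: "1 \<le> p" using p_bounds by simp
  have half: "(t / 2) powr p \<le> t powr p / 2" if "0 \<le> t" for t :: real
  proof -
    have "(2::real) powr 1 \<le> 2 powr p" using p1 by (intro powr_mono) auto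
    then have "t powr p / 2 powr p \<le> t powr p / 2" by (intro divide_left_mono) auto
    then show ?thesis using that by (simp add: powr_divide)
  qed
  have "\<bar>(a + b) / 2\<bar> powr p \<le> ((\<bar>a\<bar> + \<bar>b\<bar>) / 2) powr p"
    using p_bounds by (intro powr_mono2) (auto simp: field_simps)
  also have "\<dots> \<le> (\<bar>a\<bar> powr p + \<bar>b\<bar> powr p) / 2"
  \<comment> \<open>Convexity is applied to two positive numbers only; if one of them is 0, the
    estimate \<open>half\<close> suffices.\<close>
  proof (cases "a = 0 \<or> b = 0")
    case True
    then show ?thesis using half[of "\<bar>a\<bar>"] half[of "\<bar>b\<bar>"] by auto
  next
    case False
    have "((1 - 1/2) *\<^sub>R \<bar>a\<bar> + (1/2) *\<^sub>R \<bar>b\<bar>) powr p \<le> (1 - 1/2) * \<bar>a\<bar> powr p + (1/2) * \<bar>b\<bar> powr p"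
      by (rule convex_onD[OF powr_convex[OF p1]]) (use False in auto)
    then show ?thesis by (simp add: add_divide_distrib)
  qed
  finally show ?thesis .
qed

lemma X_midpoint:
  assumes "X v G" "X w H"
  shows "X (\<lambda>x. (v x + w x) / 2) (\<lambda>x. (1/2) *\<^sub>R G x + (1/2) *\<^sub>R H x)"
    "pn (\<lambda>x. (v x + w x) / 2) \<le> (pn v + pn w) / 2"
proof -
  have i: "integrable lborel (\<lambda>x. \<bar>v x\<bar> powr p)" "integrable lborel (\<lambda>x. \<bar>w x\<bar> powr p)"
    and s: "sob v G" "sob w H" using assms by (auto simp: X_def)
  have [measurable]: "v \<in> borel_measurable borel" "w \<in> borel_measurable borel" using sobD(1)[OF s(1)] sobD(1)[OF s(2)] by auto
  have ih: "integrable lborel (\<lambda>x. (\<bar>v x\<bar> powr p + \<bar>w x\<bar> powr p) / 2)" using i by simp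
  have i': "integrable lborel (\<lambda>x. \<bar>(v x + w x) / 2\<bar> powr p)"
    by (rule Bochner_Integration.integrable_bound[OF ih]) (use midpoint_powr in \<open>auto intro!: AE_I2\<close>)
  have "sob (\<lambda>x. (v x + w x) / 2) (\<lambda>x. (1/2) *\<^sub>R G x + (1/2) *\<^sub>R H x)"
    using sob_lincomb[OF s, of "1/2" "1/2"] by (simp add: add_divide_distrib)
  then show "X (\<lambda>x. (v x + w x) / 2) (\<lambda>x. (1/2) *\<^sub>R G x + (1/2) *\<^sub>R H x)" using i' by (simp add: X_def)
  have "pn (\<lambda>x. (v x + w x) / 2) \<le> (LINT x|lborel. (\<bar>v x\<bar> powr p + \<bar>w x\<bar> powr p) / 2)"
    unfolding pn_def by (intro integral_mono i' ih midpoint_powr)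
  also have "\<dots> = (pn v + pn w) / 2" using i by (simp add: pn_def)
  finally show "pn (\<lambda>x. (v x + w x) / 2) \<le> (pn v + pn w) / 2" .
qed

text \<open>The midpoint of two almost optimal functions that are close in the weighted norm is again
  almost optimal, so its gradient norm is almost 1; the parallelogram law then makes the gradients close.
  This replaces weak compactness of the gradients.\<close>
lemma near_extremal_gradients:
  assumes e: "0 < e"
  shows "\<exists>d>0. \<forall>v G w H. X v G \<longrightarrow> X w H \<longrightarrow> n2 G = 1 \<longrightarrow> n2 H = 1 \<longrightarrow> pn v = 1 \<longrightarrow> pn w = 1 \<longrightarrow>
     Lam - d < wn \<sigma> v \<longrightarrow> Lam - d < wn \<sigma> w \<longrightarrow> wn \<sigma> (\<lambda>x. v x - w x) < d \<longrightarrow> n2 (\<lambda>x. G x - H x) < e"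
proof -
  define e' where "e' = min e 2"
  have e': "0 < e'" "e' \<le> 2" "e' \<le> e" using e by (auto simp: e'_def)
  \<comment> \<open>If the gradients were \<open>e\<close> apart, the midpoint would have squared
    gradient norm at most \<open>1 - e' / 4\<close>, and its weighted norm would be at most
    \<open>Lam * q\<close>. Capping \<open>e'\<close> at 2 keeps the base positive.\<close>
  define q where "q = (1 - e' / 4) powr (al / 2)"
  have q: "q < 1" unfolding q_def using e' al_pos powr_less_mono2[of "al / 2" "1 - e' / 4" 1] by simp
  \<comment> \<open>Chosen so that \<open>Lam - 2 * d\<close> equals \<open>Lam * q\<close>, while
    the midpoint of functions within \<open>d\<close> of optimality, at weighted distance below
    \<open>d\<close>, lies strictly above \<open>Lam - 2 * d\<close>.\<close>
  define d where "d = Lam * (1 - q) / 2"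
  have d: "0 < d" using q Lam_pos by (simp add: d_def)
  show ?thesis
  proof (intro exI[of _ d] conjI d allI impI)
    fix v w :: "'a \<Rightarrow> real" and G H
    assume a: "X v G" "X w H" "n2 G = 1" "n2 H = 1" "pn v = 1" "pn w = 1"
      "Lam - d < wn \<sigma> v" "Lam - d < wn \<sigma> w" "wn \<sigma> (\<lambda>x. v x - w x) < d"
    define P where "P x = (1/2) *\<^sub>R G x + (1/2) *\<^sub>R H x" for x
    note mid = X_midpoint[OF a(1,2), folded P_def]
    have s: "sob v G" "sob w H" using a by (auto simp: X_def)
    note LG = sobD(2)[OF s(1)] sobD(2)[OF s(2)]
    have "n2 P + n2 (\<lambda>x. (1/2) *\<^sub>R G x - (1/2) *\<^sub>R H x) = 2 * n2 (\<lambda>x. (1/2) *\<^sub>R G x) + 2 * n2 (\<lambda>x. (1/2) *\<^sub>R H x)"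
      unfolding P_def[abs_def] by (rule n2_parallelogram) (intro L2_scaleR LG)+
    also have "\<dots> = 1" unfolding n2_scaleR using a by (simp add: power2_eq_square)
    also have "(\<lambda>x. (1/2) *\<^sub>R G x - (1/2) *\<^sub>R H x) = (\<lambda>x. (1/2) *\<^sub>R (G x - H x))" by (simp add: algebra_simps)
    finally have par: "n2 P + n2 (\<lambda>x. G x - H x) / 4 = 1" unfolding n2_scaleR by (simp add: power2_eq_square)
    let ?S = "\<lambda>v x. sqrt (wt \<sigma> x) * v x"
    have "n2 (\<lambda>x. ?S v x + ?S w x) + n2 (\<lambda>x. ?S v x - ?S w x) = 2 * n2 (?S v) + 2 * n2 (?S w)"
      by (rule n2_parallelogram) (intro L2_sqrt_weighted[OF s(1)] L2_sqrt_weighted[OF s(2)])+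
    moreover have "n2 (\<lambda>x. ?S v x - ?S w x) = wn \<sigma> (\<lambda>x. v x - w x)" by (simp add: wn_n2 algebra_simps)
    moreover have "n2 (\<lambda>x. ?S v x + ?S w x) = 4 * wn \<sigma> (\<lambda>x. (v x + w x) / 2)"
    proof -
      have "(\<lambda>x. ?S v x + ?S w x) = (\<lambda>x. 2 * (?S (\<lambda>x. (v x + w x) / 2) x))" by (rule ext) (simp add: field_simps)
      then show ?thesis by (simp only: n2_cmult wn_n2) simp
    qed
    \<comment> \<open>The parallelogram law in the weighted space, solved for the midpoint.\<close>
    ultimately have "wn \<sigma> (\<lambda>x. (v x + w x) / 2) = wn \<sigma> v / 2 + wn \<sigma> w / 2 - wn \<sigma> (\<lambda>x. v x - w x) / 4"
      by (simp add: wn_n2[of _ v, symmetric] wn_n2[of _ w, symmetric])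
    then have big: "wn \<sigma> (\<lambda>x. (v x + w x) / 2) > Lam - 2 * d" using a(7,8,9) d by linarith
    have "wn \<sigma> (\<lambda>x. (v x + w x) / 2) \<le> Lam * (n2 P powr (al / 2) * pn (\<lambda>x. (v x + w x) / 2) powr (be / p))"
      by (rule Lam_inequality[OF mid(1)])
    also have "\<dots> \<le> Lam * (n2 P powr (al / 2) * 1 powr (be / p))"
      using mid(2) a(5,6) by (intro Lam_mono n2_nonneg pn_nonneg) auto
    finally have small: "wn \<sigma> (\<lambda>x. (v x + w x) / 2) \<le> Lam * n2 P powr (al / 2)" by simp
    show "n2 (\<lambda>x. G x - H x) < e"
    proof (rule ccontr)
      assume "\<not> n2 (\<lambda>x. G x - H x) < e"
      then have "n2 P \<le> 1 - e' / 4" using par e' by linarith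
      then have "n2 P powr (al / 2) \<le> q" unfolding q_def using al_pos by (intro powr_mono2) auto
      then have "Lam * n2 P powr (al / 2) \<le> Lam * q" using Lam_pos by simp
      moreover have "Lam * q = Lam - 2 * d"
      proof -
        have "2 * d = Lam * (1 - q)" by (simp add: d_def)
        then show ?thesis by (simp add: right_diff_distrib)
      qed
      ultimately show False using big small by linarith
    qed
  qed
qed

text \<open>Two different completeness arguments produce the limit pair: the functions converge in
  the weighted space and the gradients in L^2. Membership of the limit in L^2 and L^p comes from
  Fatou along an a.e. convergent subsequence.\<close>

lemma exists_extremal: "\<exists>v G. extremal v G"
proof -
  have "\<exists>v G. X v G \<and> n2 G = 1 \<and> pn v = 1 \<and> Lam - 1 / real (Suc n) < wn \<sigma> v" for n
  proof -
    have ne: "nset \<noteq> {}"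
    proof -
      obtain v G where v: "X v G" "\<not> (AE x in lborel. v x = 0)" using exists_nonzero by blast
      obtain c l where c: "0 < c" "0 < l" "X (\<lambda>x. c * v (l *\<^sub>R x)) (\<lambda>x. (c * l) *\<^sub>R G (l *\<^sub>R x))"
        "n2 (\<lambda>x. (c * l) *\<^sub>R G (l *\<^sub>R x)) = 1" "pn (\<lambda>x. c * v (l *\<^sub>R x)) = 1"
        by (rule normalize[OF v zero_less_one zero_less_one])
      then show ?thesis unfolding nset_def by blast
    qed
    have "0 < 1 / real (Suc n)" by simp
    then have "Lam - 1 / real (Suc n) < Sup nset" unfolding Lam_def by linarith
    then obtain y where "y \<in> nset" "Lam - 1 / real (Suc n) < y" using less_cSup_iff[OF ne nset_bdd] by blast
    then show ?thesis unfolding nset_def by blast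
  qed
  then obtain v0 G0 where v0: "\<And>n. X (v0 n) (G0 n)" "\<And>n. n2 (G0 n) = 1" "\<And>n. pn (v0 n) = 1"
    "\<And>n. Lam - 1 / real (Suc n) < wn \<sigma> (v0 n)" by metis
  have s0: "sob (v0 n) (G0 n)" for n using v0(1) by (simp add: X_def)
  have nb: "n2 (v0 n) \<le> K0" for n using normalized_bound(1)[OF v0(1)[of n]] v0(2,3)[of n] by simp
  have K01: "1 \<le> K0" using kern_nonneg[of 1 "0::'a"] by (simp add: K0_def)
  have nG: "n2 (G0 n) \<le> K0" for n using v0(2)[of n] K01 by simp
  obtain r where r: "strict_mono (r :: nat \<Rightarrow> nat)"
    "\<And>e. e > 0 \<Longrightarrow> \<exists>N. \<forall>i\<ge>N. \<forall>j\<ge>N. wn \<sigma> (\<lambda>x. v0 (r i) x - v0 (r j) x) < e"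
    by (rule weighted_compactness[of \<sigma> v0 G0 K0, OF s1 s2 s3 s0 nb nG]) blast
  define v where "v n = v0 (r n)" for n
  define G where "G n = G0 (r n)" for n
  have vX: "X (v n) (G n)" "n2 (G n) = 1" "pn (v n) = 1" and vn: "n2 (v n) \<le> K0" for n
    using v0 nb by (auto simp: v_def G_def)
  have vs: "sob (v n) (G n)" for n using vX by (simp add: X_def)
  have vl: "Lam - 1 / real (Suc n) < wn \<sigma> (v n)" for n
  proof -
    have "1 / real (Suc (r n)) \<le> 1 / real (Suc n)" using seq_suble[OF r(1), of n] by (intro divide_left_mono) auto
    then show ?thesis using v0(4)[of "r n"] unfolding v_def by linarith
  qed
  have vc: "\<exists>N. \<forall>i\<ge>N. \<forall>j\<ge>N. wn \<sigma> (\<lambda>x. v i x - v j x) < e" if "e > 0" for e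
    using r(2)[OF that] by (simp add: v_def)
  have vw: "wn \<sigma> (v n) \<le> Lam" for n using Lam_inequality[OF vX(1)[of n]] vX by simp
  have wl: "(\<lambda>n. wn \<sigma> (v n)) \<longlonglongrightarrow> Lam"
  proof (rule tendsto_sandwich[OF always_eventually always_eventually])
    have "(\<lambda>n. Lam - 1 / real (Suc n)) \<longlonglongrightarrow> Lam - 0"
      using LIMSEQ_Suc[OF lim_1_over_n] by (intro tendsto_intros) simp
    then show "(\<lambda>n. Lam - 1 / real (Suc n)) \<longlonglongrightarrow> Lam" by simp
    show "\<forall>n. Lam - 1 / real (Suc n) \<le> wn \<sigma> (v n)" using vl less_imp_le by blast
    show "\<forall>n. wn \<sigma> (v n) \<le> Lam" using vw by blast
  qed (rule tendsto_const)
  have Gc: "\<exists>N. \<forall>i\<ge>N. \<forall>j\<ge>N. n2 (\<lambda>x. G i x - G j x) < e" if e: "e > 0" for e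
  proof -
    from near_extremal_gradients[OF e] obtain d where d: "d > 0" and
      dd: "\<forall>v G w H. X v G \<longrightarrow> X w H \<longrightarrow> n2 G = 1 \<longrightarrow> n2 H = 1 \<longrightarrow> pn v = 1 \<longrightarrow> pn w = 1 \<longrightarrow>
        Lam - d < wn \<sigma> v \<longrightarrow> Lam - d < wn \<sigma> w \<longrightarrow> wn \<sigma> (\<lambda>x. v x - w x) < d \<longrightarrow> n2 (\<lambda>x. G x - H x) < e"
      by (elim exE conjE)
    note dd = dd[rule_format]
    obtain N1 where N1: "\<And>i j. i \<ge> N1 \<Longrightarrow> j \<ge> N1 \<Longrightarrow> wn \<sigma> (\<lambda>x. v i x - v j x) < d" using vc[OF d] by blast
    obtain N2 where N2: "\<And>n. n \<ge> N2 \<Longrightarrow> Lam - d < wn \<sigma> (v n)"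
      using order_tendstoD(1)[OF wl, of "Lam - d"] d unfolding eventually_sequentially by auto
    show ?thesis
      by (intro exI[of _ "max N1 N2"] allI impI dd[OF vX(1) vX(1) vX(2) vX(2) vX(3) vX(3)] N1 N2) auto
  qed
  let ?S = "\<lambda>v x. sqrt (wt \<sigma> x) * v x"
  have LS: "L2 (?S (v n))" for n by (rule L2_sqrt_weighted[OF vs])
  have "(\<lambda>x. ?S (v i) x - ?S (v j) x) = ?S (\<lambda>x. v i x - v j x)" for i j by (simp add: algebra_simps)
  then have Sc: "\<exists>N. \<forall>i\<ge>N. \<forall>j\<ge>N. n2 (\<lambda>x. ?S (v i) x - ?S (v j) x) < e" if "e > 0" for e
    using vc[OF that] by (simp add: wn_n2)
  obtain \<zeta> where z: "L2 \<zeta>" "(\<lambda>n. n2 (\<lambda>x. ?S (v n) x - \<zeta> x)) \<longlonglongrightarrow> 0"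
    using L2_complete[of "\<lambda>n. ?S (v n)", OF LS Sc] by blast
  obtain G' where G': "L2 G'" "(\<lambda>n. n2 (\<lambda>x. G n x - G' x)) \<longlonglongrightarrow> 0"
    using L2_complete[of G, OF sobD(2)[OF vs] Gc] by blast
  have [measurable]: "\<zeta> \<in> borel_measurable borel" using z by auto
  \<comment> \<open>The limit is taken for the weighted functions and the weight is removed
    afterwards; the division fails only at the origin.\<close>
  define v' where "v' x = \<zeta> x / sqrt (wt \<sigma> x)" for x
  have [measurable]: "v' \<in> borel_measurable borel" unfolding v'_def by measurable
  have Sv: "AE x in lborel. ?S v' x = \<zeta> x"
    using wt_pos_AE[of \<sigma>] by eventually_elim (simp add: v'_def)
  obtain r' where r': "strict_mono (r' :: nat \<Rightarrow> nat)" "AE x in lborel. (\<lambda>n. ?S (v (r' n)) x) \<longlonglongrightarrow> \<zeta> x"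
    using L2_lim_AE_subseq[OF LS z] by blast
  have ae: "AE x in lborel. (\<lambda>n. v (r' n) x) \<longlonglongrightarrow> v' x"
    using r'(2) wt_pos_AE[of \<sigma>]
  proof eventually_elim
    case (elim x)
    have "(\<lambda>n. ?S (v (r' n)) x / sqrt (wt \<sigma> x)) \<longlonglongrightarrow> \<zeta> x / sqrt (wt \<sigma> x)"
      using elim by (intro tendsto_divide tendsto_const) auto
    then show ?case using elim by (simp add: v'_def)
  qed
  have Lv': "L2 v'" by (rule L2_fatou(1)[OF sobD(1)[OF vs] vn ae]) simp
  have ipn: "integrable lborel (\<lambda>x. \<bar>v n x\<bar> powr p)" for n using vX(1) by (simp add: X_def)
  have aep: "AE x in lborel. (\<lambda>n. \<bar>v (r' n) x\<bar> powr p) \<longlonglongrightarrow> \<bar>v' x\<bar> powr p"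
    using ae
  proof eventually_elim
    case (elim x)
    then show ?case using p_bounds by (intro tendsto_powr2 tendsto_rabs tendsto_const) auto
  qed
  have pb: "(LINT x|lborel. \<bar>v (r' n) x\<bar> powr p) \<le> 1" for n using vX(3)[of "r' n"] by (simp add: pn_def)
  have pv: "integrable lborel (\<lambda>x. \<bar>v' x\<bar> powr p)" "pn v' \<le> 1"
    using fatou_bound[OF ipn _ pb aep] by (auto simp: pn_def)
  have "sob v' G'"
    unfolding sob_def
  proof (intro conjI allI impI Lv' G'(1))
    fix \<psi> :: "'a \<Rightarrow> real" and D\<psi> e assume ps: "C1 \<psi> D\<psi>" "bsupp \<psi>"
    have Lp: "L2 \<psi>" by (rule bsupp_L2[OF C1_cont[OF ps(1)] ps(2)])
    have [measurable]: "D\<psi> \<in> borel_measurable borel" "\<psi> \<in> borel_measurable borel" using C1_meas[OF ps(1)] by auto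
    have LD: "L2 (\<lambda>x. D\<psi> x \<bullet> e)"
      by (intro L2_component bsupp_L2[OF C1_contD[OF ps(1)] bsupp_gradient[OF ps]])
    obtain R where R: "\<And>x. norm x \<ge> R \<Longrightarrow> D\<psi> x = 0" using bsupp_gradient[OF ps] by (auto simp: bsupp_def)
    \<comment> \<open>The functions converge only in the weighted norm, so the inverse root of the
      weight is shifted to the test function. As \<sigma> is negative, that factor is bounded on the
      bounded support of \<open>D\<psi>\<close>.\<close>
    define g where "g x = (D\<psi> x \<bullet> e) / sqrt (wt \<sigma> x)" for x
    have Lg: "L2 g"
    proof (rule L2_dominated(1)[OF L2_cmult[OF LD, of "\<bar>R\<bar> powr (- \<sigma> / 2)"]])
      show "g \<in> borel_measurable borel" unfolding g_def by measurable
      show "AE x in lborel. norm (g x) \<le> norm (\<bar>R\<bar> powr (- \<sigma> / 2) * (D\<psi> x \<bullet> e))"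
      proof (rule AE_I2)
        fix x
        show "norm (g x) \<le> norm (\<bar>R\<bar> powr (- \<sigma> / 2) * (D\<psi> x \<bullet> e))"
        proof (cases "norm x \<ge> R \<or> x = 0")
          case False
          have "1 / sqrt (wt \<sigma> x) = norm x powr (- \<sigma> / 2)"
            using False by (simp add: wt_def powr_half_sqrt[symmetric] powr_powr powr_minus_divide)
          also have "\<dots> \<le> \<bar>R\<bar> powr (- \<sigma> / 2)" using False s3 by (intro powr_mono2) auto
          finally have "\<bar>D\<psi> x \<bullet> e\<bar> * (1 / sqrt (wt \<sigma> x)) \<le> \<bar>D\<psi> x \<bullet> e\<bar> * \<bar>R\<bar> powr (- \<sigma> / 2)"
            by (rule mult_left_mono) simp
          then show ?thesis by (simp add: g_def abs_mult mult.commute)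
        next
          case True
          then show ?thesis using R[of x] by (auto simp: g_def wt_def)
        qed
      qed
    qed
    have Lpe: "L2 (\<lambda>x. \<psi> x *\<^sub>R e)"
      by (rule L2_dominated(1)[OF L2_cmult[OF Lp, of "norm e"]]) (auto simp: abs_mult)
    have "(\<lambda>n. LINT x|lborel. ?S (v n) x \<bullet> g x) \<longlonglongrightarrow> (LINT x|lborel. \<zeta> x \<bullet> g x)"
      by (rule L2_lim_inner[OF LS z(1) Lg z(2)])
    moreover have "(LINT x|lborel. ?S (v n) x \<bullet> g x) = (LINT x|lborel. v n x * (D\<psi> x \<bullet> e))" for n
    proof (rule integral_cong_AE)
      have [measurable]: "v n \<in> borel_measurable borel" using sobD(1)[OF vs] by auto
      show "(\<lambda>x. ?S (v n) x \<bullet> g x) \<in> borel_measurable lborel" "(\<lambda>x. v n x * (D\<psi> x \<bullet> e)) \<in> borel_measurable lborel"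
        unfolding g_def by measurable
      show "AE x in lborel. ?S (v n) x \<bullet> g x = v n x * (D\<psi> x \<bullet> e)"
        using wt_pos_AE[of \<sigma>] by eventually_elim (simp add: g_def)
    qed
    moreover have "(LINT x|lborel. \<zeta> x \<bullet> g x) = (LINT x|lborel. v' x * (D\<psi> x \<bullet> e))"
      by (simp add: g_def v'_def)
    moreover have "(\<lambda>n. LINT x|lborel. G n x \<bullet> (\<psi> x *\<^sub>R e)) \<longlonglongrightarrow> (LINT x|lborel. G' x \<bullet> (\<psi> x *\<^sub>R e))"
      by (rule L2_lim_inner[OF sobD(2)[OF vs] G'(1) Lpe G'(2)])
    then have "(\<lambda>n. - (LINT x|lborel. \<psi> x * (G n x \<bullet> e))) \<longlonglongrightarrow> - (LINT x|lborel. \<psi> x * (G' x \<bullet> e))"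
      by (intro tendsto_minus) simp
    moreover have "(LINT x|lborel. v n x * (D\<psi> x \<bullet> e)) = - (LINT x|lborel. \<psi> x * (G n x \<bullet> e))" for n
      by (rule sob_parts[OF vs ps])
    ultimately show "(LINT x|lborel. v' x * (D\<psi> x \<bullet> e)) = - (LINT x|lborel. \<psi> x * (G' x \<bullet> e))"
      using LIMSEQ_unique by simp
  qed
  then have X': "X v' G'" using pv by (simp add: X_def)
  have nG': "n2 G' = 1" using L2_lim_n2[OF sobD(2)[OF vs] G'] vX(2) by (simp add: LIMSEQ_const_iff)
  have "wn \<sigma> v' = n2 \<zeta>" unfolding wn_n2 by (rule n2_cong_AE[OF Sv]) measurable
  moreover have "(\<lambda>n. wn \<sigma> (v n)) \<longlonglongrightarrow> n2 \<zeta>" unfolding wn_n2 by (rule L2_lim_n2[OF LS z])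
  from LIMSEQ_unique[OF this wl] have "n2 \<zeta> = Lam" .
  ultimately have w': "wn \<sigma> v' = Lam" by simp
  \<comment> \<open>Only \<open>pn v' \<le> 1\<close> is known. By monotonicity this bounds the
    right-hand side of the inequality by \<open>Lam\<close>, the value of the weighted norm, and
    \<open>Lam_inequality\<close> gives the converse.\<close>
  have "Lam * (n2 G' powr (al / 2) * pn v' powr (be / p)) \<le> Lam * (n2 G' powr (al / 2) * 1 powr (be / p))"
    by (intro Lam_mono n2_nonneg pn_nonneg pv) auto
  also have "\<dots> = Lam" unfolding nG' by simp
  finally have "wn \<sigma> v' = Lam * (n2 G' powr (al / 2) * pn v' powr (be / p))"
    using Lam_inequality[OF X'] w' by linarith
  moreover have "0 < wn \<sigma> v'" using w' Lam_pos by simp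
  ultimately have "extremal v' G'" unfolding extremal_def using X' by blast
  then show ?thesis by blast
qed

lemma extremal_abs:
  assumes "extremal v G"
  shows "extremal (\<lambda>x. \<bar>v x\<bar>) (\<lambda>x. sgn (v x) *\<^sub>R G x)"
proof (rule extremal_improve(1)[OF assms])
  have s: "sob v G" and i: "integrable lborel (\<lambda>x. \<bar>v x\<bar> powr p)" using assms by (auto simp: extremal_def X_def)
  show "X (\<lambda>x. \<bar>v x\<bar>) (\<lambda>x. sgn (v x) *\<^sub>R G x)" using sob_abs[OF s] i by (simp add: X_def)
  show "n2 (\<lambda>x. sgn (v x) *\<^sub>R G x) \<le> n2 G"
    by (rule L2_dominated(2)[OF sobD(2)[OF s]]) (use sobD(2)[OF sob_abs[OF s]] in \<open>auto simp: sgn_if\<close>)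
  show "pn (\<lambda>x. \<bar>v x\<bar>) \<le> pn v" "wn \<sigma> v \<le> wn \<sigma> (\<lambda>x. \<bar>v x\<bar>)" by (simp_all add: pn_def wn_def)
qed

lemma norm_mirror_sq: "norm n = 1 \<Longrightarrow> (norm (mirror n b x))\<^sup>2 = (norm x)\<^sup>2 - 4 * (x \<bullet> n - b) * b"
  unfolding mirror_def power2_norm_eq_inner
  by (simp add: inner_diff_left inner_diff_right inner_commute norm_eq_1 algebra_simps power2_eq_square)

section \<open>Radial monotonicity of extremals\<close>

text \<open>Polarization across a hyperplane that misses the origin keeps the gradient and \<open>L\<^sup>p\<close> norms and
  does not decrease the weighted norm; strict monotonicity of the weight forces an extremal function to
  coincide with its polarization.\<close>
lemma extremal_polarized:
  assumes ex: "extremal v G" and nn: "\<And>x. 0 \<le> v x" and n: "norm n = 1" and b: "0 < b"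
  shows "AE x in lborel. x \<bullet> n < b \<longrightarrow> v (mirror n b x) \<le> v x"
proof -
  have Xv: "X v G" using ex by (simp add: extremal_def)
  then have s: "sob v G" and ip: "integrable lborel (\<lambda>x. \<bar>v x\<bar> powr p)" by (auto simp: X_def)
  let ?H = "{x. x \<bullet> n < b}"
  let ?I = "indicator ?H :: 'a \<Rightarrow> real"
  let ?m = "mirror n b"
  have HS: "?H \<in> sets borel" by (intro borel_open open_Collect_less continuous_intros)
  then have [measurable]: "?I \<in> borel_measurable borel" by (intro borel_measurable_indicator) auto
  note vm = vol_map_mirror[OF n, of b]
  have [measurable]: "?m \<in> borel_measurable borel" by (rule vol_map_meas[OF vm])
  have [measurable]: "v \<in> borel_measurable borel" using sobD[OF s] by auto
  have mm: "?m (?m x) = x" for x by (rule mirror_mirror[OF n])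
  have mi: "?m x \<bullet> n - b = - (x \<bullet> n - b)" for x by (rule mirror_inner[OF n])
  define u where "u x = v (?m x)" for x
  define Gu where "Gu x = mirror0 n (G (?m x))" for x
  have su: "sob u Gu" "n2 Gu = n2 G" using sob_mirror[OF s n, of b] by (simp_all add: u_def[abs_def] Gu_def[abs_def])
  define d where "d x = v x - u x" for x
  define Gd where "Gd x = G x - Gu x" for x
  have sd: "sob d Gd" unfolding d_def[abs_def] Gd_def[abs_def] by (rule sob_diff[OF s su(1)])
  have "d (?m x) = - d x" for x by (simp add: d_def u_def mm)
  note sy = sob_half_space[OF sd n this]
  \<comment> \<open>The odd difference restricted to the half-space and to its complement. The
    polarization, a maximum on one side and a minimum on the other, is the mean of \<open>v\<close>
    and \<open>u\<close> plus half of |y1| - |y2|, so its weak gradient follows from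
    \<open>sob_half_space\<close> and \<open>sob_abs\<close>.\<close>
  define y1 where "y1 x = ?I x * d x" for x
  define y2 where "y2 x = d x - ?I x * d x" for x
  have sy1: "sob y1 (\<lambda>x. ?I x *\<^sub>R Gd x)" using sy by (simp add: y1_def[abs_def])
  have sy2: "sob y2 (\<lambda>x. Gd x - ?I x *\<^sub>R Gd x)" unfolding y2_def[abs_def] by (rule sob_diff[OF sd sy])
  define P where "P x = (1/2) *\<^sub>R G x + (1/2) *\<^sub>R Gu x" for x
  define Q where "Q x = (1/2) *\<^sub>R (sgn (y1 x) *\<^sub>R (?I x *\<^sub>R Gd x)) + (-1/2) *\<^sub>R (sgn (y2 x) *\<^sub>R (Gd x - ?I x *\<^sub>R Gd x))" for x
  have sP: "sob (\<lambda>x. (1/2) * v x + (1/2) * u x) P" unfolding P_def[abs_def] by (rule sob_lincomb[OF s su(1)])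
  have sQ: "sob (\<lambda>x. (1/2) * \<bar>y1 x\<bar> + (-1/2) * \<bar>y2 x\<bar>) Q"
    unfolding Q_def[abs_def] by (rule sob_lincomb[OF sob_abs[OF sy1] sob_abs[OF sy2]])
  define w where "w x = ((1/2) * v x + (1/2) * u x) + ((1/2) * \<bar>y1 x\<bar> + (-1/2) * \<bar>y2 x\<bar>)" for x
  define w' where "w' x = ((1/2) * v x + (1/2) * u x) - ((1/2) * \<bar>y1 x\<bar> + (-1/2) * \<bar>y2 x\<bar>)" for x
  have sw: "sob w (\<lambda>x. P x + Q x)" unfolding w_def[abs_def] by (rule sob_add[OF sP sQ])
  have sw': "sob w' (\<lambda>x. P x - Q x)" unfolding w'_def[abs_def] by (rule sob_diff[OF sP sQ])
  have w1: "w x = max (v x) (u x)" if "x \<in> ?H" for x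
    using that by (simp add: w_def y1_def y2_def d_def max_def abs_if field_simps)
  have w2: "w x = min (v x) (u x)" if "x \<notin> ?H" for x
    using that by (simp add: w_def y1_def y2_def d_def min_def abs_if field_simps)
  have w'1: "w' x = min (v x) (u x)" if "x \<in> ?H" for x
    using that by (simp add: w'_def y1_def y2_def d_def min_def abs_if field_simps)
  have w'2: "w' x = max (v x) (u x)" if "x \<notin> ?H" for x
    using that by (simp add: w'_def y1_def y2_def d_def max_def abs_if field_simps)
  have um: "u (?m x) = v x" "v (?m x) = u x" for x by (simp_all add: u_def mm)
  \<comment> \<open>\<open>w'\<close> is the reflection of \<open>w\<close>, hence has the same
    gradient norm and the same L^p integral.\<close>
  have wm: "w (?m x) = w' x" for x
  proof -
    consider "x \<bullet> n < b" | "x \<bullet> n = b" | "x \<bullet> n > b" by linarith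
    then show ?thesis
    proof cases
      case 1
      then have "?m x \<notin> ?H" using mi[of x] by auto
      then show ?thesis using 1 by (simp add: w2 w'1 um min.commute)
    next
      case 2
      then have "?m x = x" by (simp add: mirror_def)
      moreover from this have "u x = v x" by (simp add: u_def)
      ultimately show ?thesis using 2 by (simp add: w2 w'2)
    next
      case 3
      then have "?m x \<in> ?H" using mi[of x] by auto
      then show ?thesis using 3 by (simp add: w1 w'2 um max.commute)
    qed
  qed
  have swm: "sob w' (\<lambda>x. mirror0 n (P (?m x) + Q (?m x)))" "n2 (\<lambda>x. mirror0 n (P (?m x) + Q (?m x))) = n2 (\<lambda>x. P x + Q x)"
    using sob_mirror[OF sw n, of b] by (simp_all add: wm)
  have "AE x in lborel. P x - Q x = mirror0 n (P (?m x) + Q (?m x))"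
    by (rule sob_unique[OF sw' swm(1)]) simp
  then have eqn: "n2 (\<lambda>x. P x - Q x) = n2 (\<lambda>x. P x + Q x)"
    using n2_cong_AE sobD(2)[OF sw'] sobD(2)[OF swm(1)] swm(2) by (metis L2_meas)
  note LG = sobD(2)[OF s] sobD(2)[OF su(1)] sobD(2)[OF sd]
  \<comment> \<open>On each side of the hyperplane \<open>Q\<close> is half of \<open>Gd\<close> up
    to a sign factor. With two parallelogram identities, one for \<open>P\<close> with
    \<open>Q\<close> and one for \<open>G\<close> with \<open>Gu\<close>, and the equality
    \<open>eqn\<close>, this yields the gradient estimate.\<close>
  have Qb: "n2 Q \<le> n2 (\<lambda>x. (1/2) *\<^sub>R Gd x)"
  proof (rule L2_dominated(2)[OF L2_scaleR[OF LG(3)]])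
    show "Q \<in> borel_measurable borel" using sobD(2)[OF sQ] by auto
    show "AE x in lborel. norm (Q x) \<le> norm ((1/2) *\<^sub>R Gd x)"
      by (rule AE_I2) (auto simp: Q_def indicator_def sgn_if)
  qed
  have "n2 (\<lambda>x. (1/2) *\<^sub>R G x + (1/2) *\<^sub>R Gu x) + n2 (\<lambda>x. (1/2) *\<^sub>R G x - (1/2) *\<^sub>R Gu x)
      = 2 * n2 (\<lambda>x. (1/2) *\<^sub>R G x) + 2 * n2 (\<lambda>x. (1/2) *\<^sub>R Gu x)"
    by (rule n2_parallelogram) (intro L2_scaleR LG)+
  also have "\<dots> = n2 G" unfolding n2_scaleR su(2) by (simp add: power2_eq_square)
  also have "(\<lambda>x. (1/2) *\<^sub>R G x - (1/2) *\<^sub>R Gu x) = (\<lambda>x. (1/2) *\<^sub>R Gd x)" by (simp add: Gd_def scaleR_diff_right)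
  finally have "n2 P + n2 (\<lambda>x. (1/2) *\<^sub>R Gd x) = n2 G" by (simp add: P_def[abs_def])
  moreover have "n2 (\<lambda>x. P x + Q x) + n2 (\<lambda>x. P x - Q x) = 2 * n2 P + 2 * n2 Q"
    by (rule n2_parallelogram[OF sobD(2)[OF sP] sobD(2)[OF sQ]])
  ultimately have grad: "n2 (\<lambda>x. P x + Q x) \<le> n2 G" using eqn Qb by linarith
  have [measurable]: "w \<in> borel_measurable borel" "w' \<in> borel_measurable borel" "u \<in> borel_measurable borel"
    using sobD(1)[OF sw] sobD(1)[OF sw'] sobD(1)[OF su(1)] by auto
  have pw: "\<bar>w x\<bar> powr p + \<bar>w' x\<bar> powr p = \<bar>v x\<bar> powr p + \<bar>u x\<bar> powr p" for x
    by (cases "x \<in> ?H") (auto simp: w1 w2 w'1 w'2 max_def min_def)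
  have iu: "integrable lborel (\<lambda>x. \<bar>u x\<bar> powr p)" "pn u = pn v"
    using vol_map_integrable[OF vm, of "\<lambda>x. \<bar>v x\<bar> powr p"] vol_map_integral[OF vm, of "\<lambda>x. \<bar>v x\<bar> powr p"] ip
    by (auto simp: u_def pn_def)
  have iw: "integrable lborel (\<lambda>x. \<bar>w x\<bar> powr p)"
  proof (rule Bochner_Integration.integrable_bound[OF Bochner_Integration.integrable_add[OF ip iu(1)]])
    have "\<bar>w x\<bar> powr p \<le> \<bar>v x\<bar> powr p + \<bar>u x\<bar> powr p" for x unfolding pw[symmetric] by simp
    then show "AE x in lborel. norm (\<bar>w x\<bar> powr p) \<le> norm (\<bar>v x\<bar> powr p + \<bar>u x\<bar> powr p)"
      by (intro AE_I2) (simp add: abs_of_nonneg)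
  qed measurable
  have iw': "integrable lborel (\<lambda>x. \<bar>w' x\<bar> powr p)" "pn w' = pn w"
    using vol_map_integrable[OF vm, of "\<lambda>x. \<bar>w x\<bar> powr p"] vol_map_integral[OF vm, of "\<lambda>x. \<bar>w x\<bar> powr p"] iw
    by (auto simp: wm pn_def)
  have "pn w + pn w' = (LINT x|lborel. \<bar>w x\<bar> powr p + \<bar>w' x\<bar> powr p)"
    unfolding pn_def using iw iw'(1) by simp
  also have "\<dots> = pn v + pn u" unfolding pw pn_def using ip iu(1) by simp
  finally have pnw: "pn w = pn v" using iw'(2) iu(2) by simp
  define q where "q x = (w x)\<^sup>2 - (v x)\<^sup>2" for x
  have iW: "integrable lborel (\<lambda>x. wt \<sigma> x * (w x)\<^sup>2)" "integrable lborel (\<lambda>x. wt \<sigma> x * (v x)\<^sup>2)"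
    using wn_integrable(1)[OF sw s1 s3 s2] wn_integrable(1)[OF s s1 s3 s2] by auto
  have iq: "integrable lborel (\<lambda>x. wt \<sigma> x * q x)" and wq: "wn \<sigma> w - wn \<sigma> v = (LINT x|lborel. wt \<sigma> x * q x)"
    using iW by (simp_all add: q_def right_diff_distrib wn_def)
  \<comment> \<open>Polarization only redistributes the values between mirror points, so the gain at
    one is the loss at the other.\<close>
  have qm: "q (?m x) = - q x" for x
  proof -
    have "(w' x)\<^sup>2 - (u x)\<^sup>2 = - ((w x)\<^sup>2 - (v x)\<^sup>2)"
      by (cases "x \<in> ?H") (auto simp: w1 w2 w'1 w'2 max_def min_def)
    then show ?thesis by (simp add: q_def wm um)
  qed
  have [measurable]: "q \<in> borel_measurable borel" unfolding q_def by measurable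
  have m: "(\<lambda>x. wt \<sigma> x * q x) \<in> borel_measurable borel" by measurable
  have iqm: "integrable lborel (\<lambda>x. wt \<sigma> (?m x) * q x)" "(LINT x|lborel. wt \<sigma> (?m x) * q x) = - (LINT x|lborel. wt \<sigma> x * q x)"
    using vol_map_integrable[OF vm m] vol_map_integral[OF vm m] iq by (simp_all add: qm)
  \<comment> \<open>Averaging the integral with its reflection exhibits the weight difference, which
    has the same sign as \<open>q\<close> on both sides.\<close>
  have eq2: "2 * (wn \<sigma> w - wn \<sigma> v) = (LINT x|lborel. (wt \<sigma> x - wt \<sigma> (?m x)) * q x)"
    unfolding left_diff_distrib using iq iqm wq by simp
  \<comment> \<open>The second conjunct records the strictness: for \<open>x\<close> on the origin's
    side the weight difference is positive, so a vanishing integrand means that \<open>w\<close>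
    equals \<open>v\<close> there.\<close>
  have nonneg: "AE x in lborel. 0 \<le> (wt \<sigma> x - wt \<sigma> (?m x)) * q x \<and>
      (x \<bullet> n < b \<longrightarrow> (wt \<sigma> x - wt \<sigma> (?m x)) * q x = 0 \<longrightarrow> v (?m x) \<le> v x)"
    using AE_lborel_singleton[of "0::'a"] vol_map_AE[OF vm AE_lborel_singleton[of "0::'a"]]
  proof eventually_elim
    case (elim x)
    show ?case
    proof (cases "x \<bullet> n < b")
      case True
      have "(norm x)\<^sup>2 < (norm (?m x))\<^sup>2" using True b by (simp add: norm_mirror_sq[OF n] mult_neg_pos)
      then have "norm x < norm (?m x)" by (rule power2_less_imp_less) simp
      then have lt: "wt \<sigma> (?m x) < wt \<sigma> x" unfolding wt_def using elim s3 by (intro powr_less_mono2_neg) auto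
      have "v x \<le> w x" using True by (simp add: w1)
      then have q0: "0 \<le> q x" using nn[of x] by (simp add: q_def power_mono)
      have "v (?m x) \<le> v x" if "q x = 0"
      proof -
        have "w x = v x" using that nn[of x] \<open>v x \<le> w x\<close> by (simp add: q_def power2_eq_iff_nonneg)
        then show ?thesis using True by (simp add: w1 u_def)
      qed
      then show ?thesis using lt q0 by simp
    next
      case False
      have "0 \<le> (x \<bullet> n - b) * b" using False b by simp
      then have "(norm (?m x))\<^sup>2 \<le> (norm x)\<^sup>2" unfolding norm_mirror_sq[OF n] mult.assoc by linarith
      then have "norm (?m x) \<le> norm x" by (rule power2_le_imp_le) simp
      then have le: "wt \<sigma> x \<le> wt \<sigma> (?m x)" unfolding wt_def using elim s3 by (intro powr_mono2') auto
      have "w x \<le> v x" "0 \<le> w x" using False nn by (simp_all add: w2 u_def)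
      then have "q x \<le> 0" by (simp add: q_def power_mono)
      then have "0 \<le> (wt \<sigma> x - wt \<sigma> (?m x)) * q x" using le by (intro mult_nonpos_nonpos) auto
      then show ?thesis using False by simp
    qed
  qed
  have "0 \<le> (LINT x|lborel. (wt \<sigma> x - wt \<sigma> (?m x)) * q x)"
    using nonneg by (intro integral_nonneg_AE) auto
  then have "wn \<sigma> v \<le> wn \<sigma> w" using eq2 by simp
  moreover have "X w (\<lambda>x. P x + Q x)" using sw iw by (simp add: X_def)
  ultimately have "wn \<sigma> w = wn \<sigma> v" using extremal_improve(2)[OF ex _ grad] pnw by simp
  then have "(LINT x|lborel. (wt \<sigma> x - wt \<sigma> (?m x)) * q x) = 0" using eq2 by simp
  moreover have "integrable lborel (\<lambda>x. (wt \<sigma> x - wt \<sigma> (?m x)) * q x)"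
    unfolding left_diff_distrib using iq iqm by simp
  ultimately have "AE x in lborel. (wt \<sigma> x - wt \<sigma> (?m x)) * q x = 0"
    using nonneg by (subst integral_nonneg_eq_0_iff_AE[symmetric]) auto
  then show ?thesis using nonneg by eventually_elim auto
qed

text \<open>Take the perpendicular bisector of \<open>x\<close> and \<open>y\<close>; it misses the
  origin because the norms differ, and \<open>x\<close> lies on the origin's side. The difference of
  the two kernels is odd under this reflection and nonnegative on the side of \<open>x\<close>, so
  pairing it with a polarized function gives a nonnegative number.\<close>

lemma extremal_moll_antimono:
  assumes ex: "extremal v G" and nn: "\<And>x. 0 \<le> v x" and r: "0 < r" and xy: "norm x < norm y"
  shows "moll r v y \<le> moll r v x"
proof -
  have s: "sob v G" using ex by (simp add: extremal_def X_def)
  have vm[measurable]: "v \<in> borel_measurable borel" and Lv: "L2 v" using sobD[OF s] by auto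
  define D where "D = norm (y - x)"
  have D: "0 < D" using xy by (auto simp: D_def)
  define n where "n = (1 / D) *\<^sub>R (y - x)"
  \<comment> \<open>The offset of the perpendicular bisector, positive exactly because
    \<open>norm x < norm y\<close>.\<close>
  define b where "b = ((norm y)\<^sup>2 - (norm x)\<^sup>2) / (2 * D)"
  have n: "norm n = 1" using D by (simp add: n_def D_def)
  have b: "0 < b" using xy D by (simp add: b_def power_strict_mono)
  let ?m = "mirror n b"
  have zn: "z \<bullet> n = (z \<bullet> y - z \<bullet> x) / D" for z by (simp add: n_def inner_diff_right)
  have DD: "D\<^sup>2 = (norm y)\<^sup>2 + (norm x)\<^sup>2 - 2 * (x \<bullet> y)"
    unfolding D_def power2_norm_eq_inner by (simp add: inner_diff_left inner_diff_right inner_commute)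
  have xn: "x \<bullet> n - b = - D / 2"
  proof -
    have 1: "2 * D * (x \<bullet> n) = 2 * (x \<bullet> y) - 2 * (norm x)\<^sup>2" using D by (simp add: zn power2_norm_eq_inner)
    have 2: "2 * D * b = (norm y)\<^sup>2 - (norm x)\<^sup>2" using D by (simp add: b_def)
    have "2 * D * (x \<bullet> n - b) = - D\<^sup>2" unfolding right_diff_distrib 1 2 DD by simp
    also have "\<dots> = 2 * D * (- D / 2)" by (simp add: power2_eq_square)
    finally show ?thesis using D by (simp only: mult_cancel_left) simp
  qed
  \<comment> \<open>The sign of \<open>b - z \<bullet> n\<close> decides which of \<open>x\<close>
    and \<open>y\<close> is closer to \<open>z\<close>.\<close>
  have sep: "(norm (y - z))\<^sup>2 = (norm (x - z))\<^sup>2 + 2 * D * (b - z \<bullet> n)" for z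
  proof -
    have "2 * D * (b - z \<bullet> n) = (norm y)\<^sup>2 - (norm x)\<^sup>2 - 2 * (z \<bullet> y - z \<bullet> x)"
      using D by (simp add: zn b_def field_simps)
    then show ?thesis
      unfolding power2_norm_eq_inner by (simp add: inner_diff_left inner_diff_right inner_commute)
  qed
  have sw: "norm (x - ?m z) = norm (y - z)" for z
  proof -
    have "(norm (x - ?m z))\<^sup>2 = (norm (x - z))\<^sup>2 + 4 * (z \<bullet> n - b) * (x \<bullet> n - b)"
    proof -
      have e: "x - ?m z = (x - z) + (2 * (z \<bullet> n - b)) *\<^sub>R n" by (simp add: mirror_def)
      have "(norm (x - ?m z))\<^sup>2 = (norm (x - z))\<^sup>2 + 2 * (2 * (z \<bullet> n - b)) * ((x - z) \<bullet> n) + (2 * (z \<bullet> n - b))\<^sup>2"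
        unfolding e power2_norm_eq_inner using n
        by (simp add: inner_add_left inner_add_right inner_commute norm_eq_1 algebra_simps power2_eq_square)
      then show ?thesis by (simp add: inner_diff_left algebra_simps power2_eq_square)
    qed
    also have "\<dots> = (norm (y - z))\<^sup>2" unfolding sep xn by (simp add: algebra_simps)
    finally show ?thesis by (rule power2_eq_imp_eq) auto
  qed
  have sw2: "norm (y - ?m z) = norm (x - z)" for z using sw[of "?m z"] by (simp add: mirror_mirror[OF n])
  define g where "g z = kern r (x - z) - kern r (y - z)" for z
  have kn: "norm a = norm c \<Longrightarrow> kern r a = kern r c" for a c :: 'a by (simp add: kern_def bump_def)
  have gm: "g (?m z) = - g z" for z
    using kn[OF sw[of z]] kn[OF sw2[of z]] by (simp add: g_def)
  have i: "integrable lborel (\<lambda>z. kern r (x - z) * v z)" for x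
    by (intro L2_mult_integrable L2_flip kern_L2 r Lv)
  have e1: "moll r v x - moll r v y = (LINT z|lborel. g z * v z)"
    unfolding moll_flip[OF vm] g_def left_diff_distrib using i by simp
  have ig: "integrable lborel (\<lambda>z. g z * v z)" unfolding g_def left_diff_distrib using i by simp
  have [measurable]: "g \<in> borel_measurable borel" unfolding g_def by measurable
  have m: "(\<lambda>z. g z * v z) \<in> borel_measurable borel" by measurable
  note vmm = vol_map_mirror[OF n, of b]
  have e2: "integrable lborel (\<lambda>z. g z * v (?m z))" "(LINT z|lborel. g z * v (?m z)) = - (LINT z|lborel. g z * v z)"
    using vol_map_integrable[OF vmm m] vol_map_integral[OF vmm m] ig by (simp_all add: gm)
  \<comment> \<open>The integral averaged with its reflection; now both factors change sign
    together.\<close>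
  have e3: "2 * (moll r v x - moll r v y) = (LINT z|lborel. g z * (v z - v (?m z)))"
    unfolding right_diff_distrib e1 using ig e2 by simp
  have ae: "AE z in lborel. 0 \<le> g z * (v z - v (?m z))"
    using extremal_polarized[OF ex nn n b] vol_map_AE[OF vmm extremal_polarized[OF ex nn n b]]
  proof eventually_elim
    case (elim z)
    consider "z \<bullet> n < b" | "z \<bullet> n = b" | "z \<bullet> n > b" by linarith
    then show ?case
    proof cases
      case 1
      have "(norm (x - z))\<^sup>2 \<le> (norm (y - z))\<^sup>2" unfolding sep using 1 D by simp
      then have "norm (x - z) \<le> norm (y - z)" by (rule power2_le_imp_le) simp
      then have "0 \<le> g z" using kern_antimono[OF r] by (simp add: g_def)
      then show ?thesis using elim 1 by simp
    next
      case 2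
      then show ?thesis by (simp add: mirror_def)
    next
      case 3
      have "2 * D * (b - z \<bullet> n) \<le> 0" using 3 D by (intro mult_nonneg_nonpos) auto
      then have "(norm (y - z))\<^sup>2 \<le> (norm (x - z))\<^sup>2" unfolding sep by linarith
      then have "norm (y - z) \<le> norm (x - z)" by (rule power2_le_imp_le) simp
      then have g0: "g z \<le> 0" using kern_antimono[OF r] by (simp add: g_def)
      have "?m z \<bullet> n < b" using mirror_inner[OF n, of b z] 3 by linarith
      then have "v z \<le> v (?m z)" using elim by (simp add: mirror_mirror[OF n])
      then show ?thesis using g0 by (intro mult_nonpos_nonpos) auto
    qed
  qed
  have "0 \<le> 2 * (moll r v x - moll r v y)" unfolding e3 by (rule integral_nonneg_AE[OF ae])
  then show ?thesis by simp
qed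

text \<open>Equality of norms is reached by approaching \<open>y\<close> from outside along its ray
  and using continuity. Applied in both directions it gives radial symmetry of the mollified
  function.\<close>

lemma extremal_moll_antimono':
  assumes ex: "extremal v G" and nn: "\<And>x. 0 \<le> v x" and r: "0 < r" and xy: "norm x \<le> norm y"
  shows "moll r v y \<le> moll r v x"
proof (cases "y = 0")
  case False
  have s: "sob v G" using ex by (simp add: extremal_def X_def)
  have "continuous_on UNIV (moll r v)" by (rule C1_cont[OF sob_moll_C1[OF s r]])
  then have "isCont (moll r v) y" by (simp add: continuous_on_eq_continuous_at)
  moreover have "(\<lambda>k. (1 + 1 / real (Suc k)) *\<^sub>R y) \<longlonglongrightarrow> (1 + 0) *\<^sub>R y"
    using LIMSEQ_Suc[OF lim_1_over_n] by (intro tendsto_intros) simp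
  then have "(\<lambda>k. (1 + 1 / real (Suc k)) *\<^sub>R y) \<longlonglongrightarrow> y" by simp
  ultimately have "(\<lambda>k. moll r v ((1 + 1 / real (Suc k)) *\<^sub>R y)) \<longlonglongrightarrow> moll r v y"
    by (rule isCont_tendsto_compose)
  moreover have "moll r v ((1 + 1 / real (Suc k)) *\<^sub>R y) \<le> moll r v x" for k
  proof (rule extremal_moll_antimono[OF ex nn r])
    have "norm y < (1 + 1 / real (Suc k)) * norm y" using False by simp
    also have "\<dots> = norm ((1 + 1 / real (Suc k)) *\<^sub>R y)" by simp
    finally show "norm x < norm ((1 + 1 / real (Suc k)) *\<^sub>R y)" using xy by linarith
  qed
  ultimately show ?thesis by (intro LIMSEQ_le_const2) auto
qed (use xy in simp)

lemma AE_open_meets: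
  assumes "AE x in lborel. P x" "open U" "U \<noteq> {}" shows "\<exists>x\<in>U. P (x::'a)"
proof (rule ccontr)
  assume "\<not> ?thesis"
  then have "AE x in lborel. x \<notin> U" using assms(1) by (auto elim!: eventually_mono)
  then have "U \<in> null_sets lborel" using assms(2) by (subst AE_iff_null_sets) auto
  then show False using open_not_negligible[OF assms(2,3)]
    by (auto simp: negligible_iff_null_sets null_sets_completionI)
qed

text \<open>On the set \<open>Z\<close> where the mollifications converge, \<open>v\<close> inherits
  their monotonicity and so depends on the norm only. The value 0 at the origin is a placeholder,
  since the profile is so far bounded only away from 0.\<close>

lemma exists_radial_extremal:
  obtains v G f where "extremal v G" "\<And>x. v x = (if x = 0 then 0 else f (norm x))"
    "\<And>t. 0 < t \<Longrightarrow> 0 \<le> f t" "\<And>t u. 0 < t \<Longrightarrow> t \<le> u \<Longrightarrow> f u \<le> f t"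
proof -
  obtain v0 G0 where "extremal v0 G0" using exists_extremal by blast
  from extremal_abs[OF this] obtain v G where ex: "extremal v G" and nn: "\<And>x. 0 \<le> v x" by (metis abs_ge_zero)
  have s: "sob v G" and Xv: "X v G" using ex by (simp_all add: extremal_def X_def)
  note L = sobD(1)[OF s]
  obtain r where r: "strict_mono (r :: nat \<Rightarrow> nat)" "AE x in lborel. (\<lambda>n. approx (r n) v x) \<longlonglongrightarrow> v x"
    using L2_lim_AE_subseq[OF approx_L2[OF L] L approx_tendsto[OF L]] by blast
  define Z where "Z = {x. (\<lambda>n. approx (r n) v x) \<longlonglongrightarrow> v x}"
  have Z: "AE x in lborel. x \<in> Z" using r(2) by (simp add: Z_def)
  have mono: "v y \<le> v x" if "x \<in> Z" "y \<in> Z" "norm x \<le> norm y" for x y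
  proof (rule LIMSEQ_le)
    show "(\<lambda>n. approx (r n) v y) \<longlonglongrightarrow> v y" "(\<lambda>n. approx (r n) v x) \<longlonglongrightarrow> v x"
      using that by (auto simp: Z_def)
    have "approx (r n) v y \<le> approx (r n) v x" for n
      unfolding approx_def by (rule extremal_moll_antimono'[OF ex nn _ that(3)]) simp
    then show "\<exists>N. \<forall>n\<ge>N. approx (r n) v y \<le> approx (r n) v x" by blast
  qed
  obtain e :: 'a where e: "e \<in> Basis" using nonempty_Basis by blast
  have near: "\<exists>z\<in>Z. z \<noteq> 0 \<and> norm z < t" if t: "0 < t" for t
  proof -
    have "(t / 2) *\<^sub>R e \<in> ball 0 t - {0}" using t e by auto
    then have "ball 0 t - {0} \<noteq> ({} :: 'a set)" by blast
    moreover have "open (ball 0 t - {0} :: 'a set)" by (intro open_Diff) auto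
    ultimately show ?thesis using AE_open_meets[OF Z] by fastforce
  qed
  have far: "\<exists>z\<in>Z. t \<le> norm z" for t
  proof -
    have "norm ((\<bar>t\<bar> + 1) *\<^sub>R e) > t" using e by simp
    then have "{x. t < norm x} \<noteq> ({} :: 'a set)" by blast
    moreover have "open {x::'a. t < norm x}" by (intro open_Collect_less continuous_intros)
    ultimately show ?thesis using AE_open_meets[OF Z] by fastforce
  qed
  \<comment> \<open>A nonincreasing extension from the radii that occur in \<open>Z\<close> to all
    positive radii; the supremum is attained at points of \<open>Z\<close> of the given
    norm.\<close>
  define f where "f t = Sup (v ` {z \<in> Z. t \<le> norm z})" for t
  have bdd: "bdd_above (v ` {z \<in> Z. t \<le> norm z})" if t: "0 < t" for t
  proof -
    obtain z0 where "z0 \<in> Z" "norm z0 < t" using near[OF t] by blast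
    then show ?thesis by (intro bdd_aboveI2[where M="v z0"]) (auto intro!: mono)
  qed
  have ne: "v ` {z \<in> Z. t \<le> norm z} \<noteq> {}" for t using far[of t] by auto
  have f0: "0 \<le> f t" if t: "0 < t" for t
  proof -
    obtain z where z: "z \<in> Z" "t \<le> norm z" using far by blast
    have "v z \<le> f t" unfolding f_def using z by (intro cSup_upper bdd t) auto
    then show ?thesis using nn[of z] by linarith
  qed
  have fmono: "f u \<le> f t" if "0 < t" "t \<le> u" for t u
    unfolding f_def using that by (intro cSup_subset_mono ne bdd) auto
  have fv: "f (norm z) = v z" if z: "z \<in> Z" "z \<noteq> 0" for z
    unfolding f_def
  proof (rule cSup_eq_maximum)
    show "v z \<in> v ` {z' \<in> Z. norm z \<le> norm z'}" using z by auto
  qed (use z mono in auto)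
  define w where "w x = (if x = 0 then 0 else f (norm x))" for x :: 'a
  have ae: "AE x in lborel. v x = w x"
    using Z AE_lborel_singleton[of "0::'a"] by eventually_elim (simp add: w_def fv)
  have wm: "w \<in> borel_measurable borel"
  proof -
    \<comment> \<open>Truncation at height \<open>k\<close> and the constant \<open>k\<close> for
      nonpositive arguments give a function monotone on the whole line, hence Borel, although
      \<open>f\<close> may blow up at 0 and is uncontrolled to the left of it.\<close>
    define h where "h k t = (if t \<le> 0 then real k else min (f t) (real k))" for k t
    have "mono (\<lambda>t. - h k t)" for k
      by (rule monoI) (auto simp: h_def min_def dest: fmono[rotated] intro: order_trans)
    then have "(\<lambda>t. - h k t) \<in> borel_measurable borel" for k by (rule borel_measurable_mono)
    then have "(\<lambda>t. - (- h k t)) \<in> borel_measurable borel" for k by (rule borel_measurable_uminus)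
    then have [measurable]: "h k \<in> borel_measurable borel" for k by simp
    have hm: "(\<lambda>x::'a. if x = 0 then 0 else h k (norm x)) \<in> borel_measurable borel" for k by measurable
    have "(\<lambda>k. if x = 0 then 0 else h k (norm x)) \<longlonglongrightarrow> w x" for x :: 'a
    proof (rule tendsto_eventually)
      obtain K where K: "f (norm x) \<le> real K" using real_arch_simple by blast
      show "\<forall>\<^sub>F k in sequentially. (if x = 0 then 0 else h k (norm x)) = w x"
        unfolding eventually_sequentially by (rule exI[of _ K]) (use K in \<open>auto simp: h_def w_def\<close>)
    qed
    then show ?thesis by (rule borel_measurable_LIMSEQ_metric[OF hm])
  qed
  have [measurable]: "v \<in> borel_measurable borel" "w \<in> borel_measurable borel" using L wm by auto
  have sw: "sob w G" by (rule sob_cong_AE[OF s wm _ ae]) (use sobD(2)[OF s] in auto)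
  have "AE x in lborel. \<bar>v x\<bar> powr p = \<bar>w x\<bar> powr p" using ae by eventually_elim simp
  then have pw: "integrable lborel (\<lambda>x. \<bar>w x\<bar> powr p)" "pn w = pn v"
    using Xv integrable_cong_AE[of "\<lambda>x. \<bar>v x\<bar> powr p" lborel "\<lambda>x. \<bar>w x\<bar> powr p"]
      integral_cong_AE[of "\<lambda>x. \<bar>v x\<bar> powr p" lborel "\<lambda>x. \<bar>w x\<bar> powr p"] by (auto simp: X_def pn_def)
  have "wn \<sigma> w = wn \<sigma> v"
    unfolding wn_def by (rule integral_cong_AE) (use ae in \<open>auto elim!: eventually_mono\<close>)
  then have "extremal w G" using extremal_improve(1)[OF ex, of w G] sw pw by (simp add: X_def)
  then show thesis using that[of w G f] f0 fmono by (simp add: w_def)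
qed

end

section \<open>The Euler-Lagrange equation\<close>

lemma powr_diff_le:
  fixes x y p :: real
  assumes p: "1 \<le> p" and xy: "0 \<le> y" "y \<le> x"
  shows "x powr p - y powr p \<le> p * (x - y) * x powr (p - 1)"
proof (cases "y = 0 \<or> x = y")
  case True
  have "x powr p = x * x powr (p - 1)" if "0 < x" using that by (simp add: powr_mult_base)
  moreover have "x * x powr (p - 1) \<le> p * (x * x powr (p - 1))" if "0 < x"
    using mult_right_mono[OF p, of "x * x powr (p - 1)"] that by simp
  ultimately show ?thesis using True xy p by (cases "x = 0") (auto simp: mult.assoc)
next
  case False
  then have "y < x" "0 < y" using xy by auto
  then have "\<exists>z>y. z < x \<and> x powr p - y powr p = (x - y) * (p * z powr (p - 1))"
    by (intro MVT2 has_real_derivative_powr) auto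
  then obtain z where z: "y < z" "z < x" "x powr p - y powr p = (x - y) * (p * z powr (p - 1))"
    by blast
  have "z powr (p - 1) \<le> x powr (p - 1)" using z \<open>0 < y\<close> p by (intro powr_mono2) auto
  then have "(x - y) * (p * z powr (p - 1)) \<le> (x - y) * (p * x powr (p - 1))"
    using \<open>y < x\<close> p by (intro mult_left_mono) auto
  then show ?thesis using z(3) by (simp add: mult_ac)
qed

text \<open>Linear in \<open>t\<close> with a coefficient that depends on \<open>t\<close> only
  through the bound \<open>M\<close>: the majorant for the difference quotients in
  \<open>pn_derivative\<close>.\<close>

lemma abs_powr_diff_le:
  fixes a b t p M :: real
  assumes p: "1 \<le> p" and t: "\<bar>t\<bar> \<le> M"
  shows "\<bar>\<bar>a + t * b\<bar> powr p - \<bar>a\<bar> powr p\<bar> \<le> p * \<bar>t\<bar> * (\<bar>b\<bar> * (\<bar>a\<bar> + M * \<bar>b\<bar>) powr (p - 1))"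
proof -
  have M: "0 \<le> M" using t by linarith
  have tb: "\<bar>t * b\<bar> \<le> M * \<bar>b\<bar>" using t by (simp add: abs_mult mult_right_mono)
  have key: "x powr p - y powr p \<le> p * \<bar>t\<bar> * (\<bar>b\<bar> * (\<bar>a\<bar> + M * \<bar>b\<bar>) powr (p - 1))"
    if "0 \<le> y" "y \<le> x" "x - y \<le> \<bar>t * b\<bar>" "x \<le> \<bar>a\<bar> + M * \<bar>b\<bar>" for x y
  proof -
    have "x powr p - y powr p \<le> p * (x - y) * x powr (p - 1)" by (rule powr_diff_le[OF p that(1,2)])
    also have "\<dots> \<le> p * \<bar>t * b\<bar> * (\<bar>a\<bar> + M * \<bar>b\<bar>) powr (p - 1)"
      using p that by (intro mult_mono mult_left_mono powr_mono2 mult_nonneg_nonneg) auto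
    finally show ?thesis by (simp add: abs_mult mult_ac)
  qed
  show ?thesis
  proof (cases "\<bar>a\<bar> \<le> \<bar>a + t * b\<bar>")
    case True
    have "\<bar>a\<bar> powr p \<le> \<bar>a + t * b\<bar> powr p" using True p by (intro powr_mono2) auto
    then show ?thesis using key[of "\<bar>a\<bar>" "\<bar>a + t * b\<bar>"] True tb by linarith
  next
    case False
    have "\<bar>a + t * b\<bar> powr p \<le> \<bar>a\<bar> powr p" using False p by (intro powr_mono2) auto
    moreover have "0 \<le> M * \<bar>b\<bar>" using M by simp
    ultimately show ?thesis using key[of "\<bar>a + t * b\<bar>" "\<bar>a\<bar>"] False tb by linarith
  qed
qed

text \<open>At \<open>a = 0\<close> the function is a multiple of |t|^p, which is differentiable
  with derivative 0 because \<open>p > 1\<close>; the formula agrees since 0 raised to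
  \<open>p - 1\<close> is 0.\<close>

lemma abs_powr_has_derivative:
  fixes a b p :: real
  assumes p: "1 < p" and a: "0 \<le> a"
  shows "((\<lambda>t. \<bar>a + t * b\<bar> powr p) has_real_derivative p * (a powr (p - 1) * b)) (at 0)"
proof (cases "a = 0")
  case True
  have "(\<lambda>h. \<bar>b\<bar> powr p * \<bar>h\<bar> powr (p - 1)) \<midarrow>0\<rightarrow> \<bar>b\<bar> powr p * (\<bar>0\<bar> powr (p - 1))"
    using p by (intro tendsto_intros tendsto_powr2) auto
  then have l: "(\<lambda>h. \<bar>b\<bar> powr p * \<bar>h\<bar> powr (p - 1)) \<midarrow>0\<rightarrow> (0::real)" by simp
  have "(\<lambda>h. (\<bar>0 + (0 + h) * b\<bar> powr p - \<bar>0 + 0 * b\<bar> powr p) / h) \<midarrow>0\<rightarrow> 0"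
  proof (rule Lim_null_comparison[OF always_eventually l], rule allI)
    fix h :: real
    have "\<bar>h\<bar> powr p = \<bar>h\<bar> * \<bar>h\<bar> powr (p - 1)" by (cases "h = 0") (simp_all add: powr_mult_base)
    then have "\<bar>h * b\<bar> powr p / \<bar>h\<bar> \<le> \<bar>b\<bar> powr p * \<bar>h\<bar> powr (p - 1)"
      by (cases "h = 0") (simp_all add: abs_mult powr_mult)
    then show "norm ((\<bar>0 + (0 + h) * b\<bar> powr p - \<bar>0 + 0 * b\<bar> powr p) / h) \<le> \<bar>b\<bar> powr p * \<bar>h\<bar> powr (p - 1)" by simp
  qed
  then show ?thesis using True by (simp add: DERIV_def)
next
  case False
  then have a0: "0 < a" using a by simp
  have d: "((\<lambda>t. (a + t * b) powr p) has_real_derivative p * (a + 0 * b) powr (p - 1) * b) (at 0)"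
    by (rule DERIV_chain2[OF has_real_derivative_powr]) (use a0 in \<open>auto intro!: derivative_eq_intros\<close>)
  have o: "open {t. 0 < a + t * b}" by (intro open_Collect_less continuous_intros)
  have "((\<lambda>t. \<bar>a + t * b\<bar> powr p) has_real_derivative p * (a + 0 * b) powr (p - 1) * b) (at 0)"
    by (rule has_field_derivative_transform_within_open[OF d o]) (use a0 in auto)
  then show ?thesis by (simp add: mult.assoc)
qed

context ckn
begin

lemma p_eq: "p - 1 = 1 / m" using m by (simp add: p_def field_simps)

lemma sum_powr_le: "0 \<le> a \<Longrightarrow> 0 \<le> b \<Longrightarrow> (a + b) powr p \<le> 2 powr p * (a powr p + b powr p)"
proof -
  assume ab: "0 \<le> a" "0 \<le> b"
  have "(a + b) powr p = 2 powr p * \<bar>(a + b) / 2\<bar> powr p" using ab by (simp add: powr_divide)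
  also have "\<dots> \<le> 2 powr p * ((\<bar>a\<bar> powr p + \<bar>b\<bar> powr p) / 2)" by (intro mult_left_mono midpoint_powr) auto
  also have "\<dots> \<le> 2 powr p * (a powr p + b powr p)" using ab by (intro mult_left_mono) auto
  finally show ?thesis .
qed

text \<open>Both factors are at most the same sum |a| + (1 + M)|b|, raised to exponents that add up
  to \<open>p\<close>. This replaces Hoelder's inequality.\<close>

lemma mixed_bound:
  assumes "0 \<le> M"
  shows "\<bar>b\<bar> * (\<bar>a\<bar> + M * \<bar>b\<bar>) powr (p - 1) \<le> 2 powr p * (\<bar>a\<bar> powr p + ((1 + M) * \<bar>b\<bar>) powr p)"
proof -
  let ?s = "\<bar>a\<bar> + (1 + M) * \<bar>b\<bar>"
  have Mb: "0 \<le> M * \<bar>b\<bar>" using assms by simp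
  have s: "\<bar>b\<bar> \<le> ?s" "\<bar>a\<bar> + M * \<bar>b\<bar> \<le> ?s" "0 \<le> ?s" using Mb by (simp_all add: distrib_right)
  have "\<bar>b\<bar> * (\<bar>a\<bar> + M * \<bar>b\<bar>) powr (p - 1) \<le> ?s * ?s powr (p - 1)"
    using s p_bounds Mb by (intro mult_mono powr_mono2) auto
  also have "\<dots> = ?s powr p" using s(3) by (cases "?s = 0") (simp_all add: powr_mult_base)
  also have "\<dots> \<le> 2 powr p * (\<bar>a\<bar> powr p + ((1 + M) * \<bar>b\<bar>) powr p)"
    using assms by (intro sum_powr_le) auto
  finally show ?thesis .
qed

lemma mixed_integrable:
  assumes v: "integrable lborel (\<lambda>x. \<bar>v x\<bar> powr p)" "v \<in> borel_measurable borel"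
    and f: "integrable lborel (\<lambda>x::'a. \<bar>\<phi> x\<bar> powr p)" "\<phi> \<in> borel_measurable borel" and M: "0 \<le> M"
  shows "integrable lborel (\<lambda>x. \<bar>\<phi> x\<bar> * (\<bar>v x\<bar> + M * \<bar>\<phi> x\<bar>) powr (p - 1))"
proof -
  have [measurable]: "v \<in> borel_measurable borel" "\<phi> \<in> borel_measurable borel" by fact+
  have M1: "((1 + M) * \<bar>b\<bar>) powr p = (1 + M) powr p * \<bar>b\<bar> powr p" for b
    using M by (simp add: powr_mult)
  have i: "integrable lborel (\<lambda>x. 2 powr p * (\<bar>v x\<bar> powr p + ((1 + M) * \<bar>\<phi> x\<bar>) powr p))"
    unfolding M1 using v f by simp
  show ?thesis
  proof (rule Bochner_Integration.integrable_bound[OF i])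
    show "AE x in lborel. norm (\<bar>\<phi> x\<bar> * (\<bar>v x\<bar> + M * \<bar>\<phi> x\<bar>) powr (p - 1)) \<le> norm (2 powr p * (\<bar>v x\<bar> powr p + ((1 + M) * \<bar>\<phi> x\<bar>) powr p))"
    proof (rule AE_I2)
      fix x show "norm (\<bar>\<phi> x\<bar> * (\<bar>v x\<bar> + M * \<bar>\<phi> x\<bar>) powr (p - 1)) \<le> norm (2 powr p * (\<bar>v x\<bar> powr p + ((1 + M) * \<bar>\<phi> x\<bar>) powr p))"
        using mixed_bound[OF M, of "\<phi> x" "v x"] by (simp add: abs_mult)
    qed
  qed measurable
qed

lemma X_lincomb:
  assumes "X v G" "X \<phi> H" shows "X (\<lambda>x. v x + t * \<phi> x) (\<lambda>x. G x + t *\<^sub>R H x)"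
proof -
  have i: "integrable lborel (\<lambda>x. \<bar>v x\<bar> powr p)" "integrable lborel (\<lambda>x. \<bar>\<phi> x\<bar> powr p)"
    and s: "sob v G" "sob \<phi> H" using assms by (auto simp: X_def)
  have [measurable]: "v \<in> borel_measurable borel" "\<phi> \<in> borel_measurable borel" using sobD(1)[OF s(1)] sobD(1)[OF s(2)] by auto
  have i2: "integrable lborel (\<lambda>x. 2 powr p * (\<bar>v x\<bar> powr p + \<bar>t\<bar> powr p * \<bar>\<phi> x\<bar> powr p))"
    using i by simp
  have b: "\<bar>v x + t * \<phi> x\<bar> powr p \<le> 2 powr p * (\<bar>v x\<bar> powr p + \<bar>t\<bar> powr p * \<bar>\<phi> x\<bar> powr p)" for x
  proof -
    have "\<bar>v x + t * \<phi> x\<bar> powr p \<le> (\<bar>v x\<bar> + \<bar>t * \<phi> x\<bar>) powr p" using p_bounds by (intro powr_mono2) auto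
    also have "\<dots> \<le> 2 powr p * (\<bar>v x\<bar> powr p + \<bar>t * \<phi> x\<bar> powr p)" by (rule sum_powr_le) auto
    finally show ?thesis by (simp add: abs_mult powr_mult)
  qed
  have "integrable lborel (\<lambda>x. \<bar>v x + t * \<phi> x\<bar> powr p)"
    by (rule Bochner_Integration.integrable_bound[OF i2]) (use b in \<open>auto intro!: AE_I2\<close>)
  then show ?thesis using sob_lincomb[OF s, of 1 t] by (simp add: X_def)
qed

lemma pn_derivative:
  assumes v: "integrable lborel (\<lambda>x. \<bar>v x\<bar> powr p)" "v \<in> borel_measurable borel" "\<And>x. 0 \<le> v x"
    and f: "integrable lborel (\<lambda>x. \<bar>\<phi> x\<bar> powr p)" "\<phi> \<in> borel_measurable borel"
    and t: "\<And>t. integrable lborel (\<lambda>x. \<bar>v x + t * \<phi> x\<bar> powr p)"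
  shows "((\<lambda>t. pn (\<lambda>x. v x + t * \<phi> x)) has_real_derivative p * (LINT x|lborel. v x powr (p - 1) * \<phi> x)) (at 0)"
  unfolding DERIV_def tendsto_at_iff_sequentially
proof (intro allI impI)
  fix h :: "nat \<Rightarrow> real" assume h0: "\<forall>i. h i \<in> UNIV - {0}" and h: "h \<longlonglongrightarrow> 0"
  have [measurable]: "v \<in> borel_measurable borel" "\<phi> \<in> borel_measurable borel" by fact+
  have "bounded (range h)" using h by (intro convergent_imp_bounded) (auto simp: convergent_def)
  \<comment> \<open>A bound for the null sequence makes the dominating function independent of the
    index.\<close>
  then obtain M where M: "\<And>i. \<bar>h i\<bar> \<le> M" by (auto simp: bounded_iff)
  then have M0: "0 \<le> M" using order_trans[OF abs_ge_zero] by blast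
  define q where "q i x = (\<bar>v x + h i * \<phi> x\<bar> powr p - \<bar>v x\<bar> powr p) / h i" for i x
  have w: "integrable lborel (\<lambda>x. p * (\<bar>\<phi> x\<bar> * (\<bar>v x\<bar> + M * \<bar>\<phi> x\<bar>) powr (p - 1)))"
    by (intro integrable_mult_right mixed_integrable v f M0)
  have qm: "q i \<in> borel_measurable lborel" for i unfolding q_def by measurable
  have ql: "(\<lambda>i. q i x) \<longlonglongrightarrow> p * (v x powr (p - 1) * \<phi> x)" for x
  proof -
    have "((\<lambda>t. (\<bar>v x + (0 + t) * \<phi> x\<bar> powr p - \<bar>v x + 0 * \<phi> x\<bar> powr p) / t) \<longlongrightarrow> p * (v x powr (p - 1) * \<phi> x)) (at 0)"
      using abs_powr_has_derivative[OF p_bounds(1) v(3)] unfolding DERIV_def .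
    then show ?thesis unfolding tendsto_at_iff_sequentially using h0 h by (auto simp: q_def o_def)
  qed
  have qb: "norm (q i x) \<le> p * (\<bar>\<phi> x\<bar> * (\<bar>v x\<bar> + M * \<bar>\<phi> x\<bar>) powr (p - 1))" for i x
  proof -
    have hi: "0 < \<bar>h i\<bar>" using h0 by auto
    have "\<bar>\<bar>v x + h i * \<phi> x\<bar> powr p - \<bar>v x\<bar> powr p\<bar> \<le> p * \<bar>h i\<bar> * (\<bar>\<phi> x\<bar> * (\<bar>v x\<bar> + M * \<bar>\<phi> x\<bar>) powr (p - 1))"
      using p_bounds by (intro abs_powr_diff_le M) auto
    then have "\<bar>\<bar>v x + h i * \<phi> x\<bar> powr p - \<bar>v x\<bar> powr p\<bar> \<le> (p * (\<bar>\<phi> x\<bar> * (\<bar>v x\<bar> + M * \<bar>\<phi> x\<bar>) powr (p - 1))) * \<bar>h i\<bar>"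
      by (simp add: mult_ac)
    then show ?thesis using hi by (simp add: q_def pos_divide_le_eq)
  qed
  have "(\<lambda>i. LINT x|lborel. q i x) \<longlonglongrightarrow> (LINT x|lborel. p * (v x powr (p - 1) * \<phi> x))"
    by (rule integral_dominated_convergence[OF _ qm w AE_I2[OF ql] AE_I2[OF qb]]) measurable
  moreover have "(LINT x|lborel. q i x) = (pn (\<lambda>x. v x + h i * \<phi> x) - pn v) / h i" for i
    unfolding q_def pn_def using t[of "h i"] v(1) by simp
  ultimately show "((\<lambda>t. (pn (\<lambda>x. v x + (0 + t) * \<phi> x) - pn (\<lambda>x. v x + 0 * \<phi> x)) / t) \<circ> h)
      \<longlonglongrightarrow> p * (LINT x|lborel. v x powr (p - 1) * \<phi> x)"
    by (simp add: o_def)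
qed

lemma extremal_pos:
  assumes "extremal v G" shows "0 < n2 G" "0 < pn v"
proof -
  have X: "X v G" and w: "0 < wn \<sigma> v" using assms by (auto simp: extremal_def)
  have "\<not> (AE x in lborel. v x = 0)"
  proof
    assume z: "AE x in lborel. v x = 0"
    have "wn \<sigma> v = 0" unfolding wn_def by (rule integral_eq_zero_AE) (use z in \<open>eventually_elim, simp\<close>)
    then show False using w by simp
  qed
  then show "0 < n2 G" "0 < pn v" using n2_pos[OF X] pn_pos[OF X] by auto
qed

lemma wn_expand:
  assumes "sob v G" "sob \<phi> H"
  shows "wn \<sigma> (\<lambda>x. v x + t * \<phi> x) = wn \<sigma> v + 2 * t * (LINT x|lborel. wt \<sigma> x * v x * \<phi> x) + t\<^sup>2 * wn \<sigma> \<phi>"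
    "integrable lborel (\<lambda>x. wt \<sigma> x * v x * \<phi> (x::'a))"
proof -
  note L = L2_sqrt_weighted[OF assms(1)] L2_sqrt_weighted[OF assms(2)]
  have e: "(sqrt (wt \<sigma> x) * v x) \<bullet> (sqrt (wt \<sigma> x) * \<phi> x) = wt \<sigma> x * v x * \<phi> x" for x :: 'a
  proof -
    have "(sqrt (wt \<sigma> x) * v x) \<bullet> (sqrt (wt \<sigma> x) * \<phi> x) = (sqrt (wt \<sigma> x) * sqrt (wt \<sigma> x)) * v x * \<phi> x" by simp
    then show ?thesis by (simp del: real_sqrt_mult_self add: real_sqrt_mult_self abs_of_nonneg)
  qed
  show "integrable lborel (\<lambda>x. wt \<sigma> x * v x * \<phi> (x::'a))" using L2_inner_integrable[OF L] unfolding e .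
  have "wn \<sigma> (\<lambda>x. v x + t * \<phi> x) = n2 (\<lambda>x. sqrt (wt \<sigma> x) * v x + t *\<^sub>R (sqrt (wt \<sigma> x) * \<phi> x))"
    unfolding wn_n2 by (simp add: algebra_simps)
  also have "\<dots> = wn \<sigma> v + 2 * t * (LINT x|lborel. wt \<sigma> x * v x * \<phi> x) + t\<^sup>2 * wn \<sigma> \<phi>"
    unfolding n2_add_expand[OF L] e wn_n2 ..
  finally show "wn \<sigma> (\<lambda>x. v x + t * \<phi> x) = wn \<sigma> v + 2 * t * (LINT x|lborel. wt \<sigma> x * v x * \<phi> x) + t\<^sup>2 * wn \<sigma> \<phi>" .
qed

lemma power_integrable:
  assumes "X v G" "X \<phi> H" "\<And>x. 0 \<le> v x"
  shows "integrable lborel (\<lambda>x. v x powr (p - 1) * \<phi> x)"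
proof -
  have i: "integrable lborel (\<lambda>x. \<bar>v x\<bar> powr p)" "integrable lborel (\<lambda>x. \<bar>\<phi> x\<bar> powr p)"
    and s: "sob v G" "sob \<phi> H" using assms by (auto simp: X_def)
  have [measurable]: "v \<in> borel_measurable borel" "\<phi> \<in> borel_measurable borel" using sobD(1)[OF s(1)] sobD(1)[OF s(2)] by auto
  have "integrable lborel (\<lambda>x. \<bar>\<phi> x\<bar> * (\<bar>v x\<bar> + 0 * \<bar>\<phi> x\<bar>) powr (p - 1))"
    by (intro mixed_integrable i) auto
  then show ?thesis
    by (rule Bochner_Integration.integrable_bound) (auto simp: abs_mult assms(3))
qed

text \<open>The deficit in \<open>Lam_inequality\<close> along the line v + t \<phi> is nonnegative
  and 0 at \<open>t = 0\<close>, so its derivative vanishes there. The extremality equation then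
  replaces the powers by \<open>wn \<sigma> v\<close>.\<close>

lemma euler_lagrange:
  assumes ex: "extremal v G" and nn: "\<And>x. 0 \<le> v x" and f: "X \<phi> H"
  shows "wn \<sigma> v * (al * (LINT x|lborel. G x \<bullet> H x) / n2 G + be * (LINT x|lborel. v x powr (p - 1) * \<phi> x) / pn v)
    = 2 * (LINT x|lborel. wt \<sigma> x * v x * \<phi> x)"
proof -
  have Xv: "X v G" using ex by (simp add: extremal_def)
  have i: "integrable lborel (\<lambda>x. \<bar>v x\<bar> powr p)" "integrable lborel (\<lambda>x. \<bar>\<phi> x\<bar> powr p)"
    and s: "sob v G" "sob \<phi> H" using Xv f by (auto simp: X_def)
  have vm: "v \<in> borel_measurable borel" "\<phi> \<in> borel_measurable borel" using sobD(1)[OF s(1)] sobD(1)[OF s(2)] by auto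
  note pos = extremal_pos[OF ex]
  define a where "a = (LINT x|lborel. G x \<bullet> H x)"
  define b where "b = (LINT x|lborel. v x powr (p - 1) * \<phi> x)"
  define c where "c = (LINT x|lborel. wt \<sigma> x * v x * \<phi> x)"
  define A where "A t = n2 (\<lambda>x. G x + t *\<^sub>R H x)" for t
  define B where "B t = pn (\<lambda>x. v x + t * \<phi> x)" for t
  define W where "W t = wn \<sigma> (\<lambda>x. v x + t * \<phi> x)" for t
  have A0: "A 0 = n2 G" "B 0 = pn v" "W 0 = wn \<sigma> v" by (simp_all add: A_def B_def W_def)
  have At: "A = (\<lambda>t. n2 G + 2 * t * a + t\<^sup>2 * n2 H)"
    by (rule ext) (simp add: A_def a_def n2_add_expand[OF sobD(2)[OF s(1)] sobD(2)[OF s(2)]])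
  have Wt: "W = (\<lambda>t. wn \<sigma> v + 2 * t * c + t\<^sup>2 * wn \<sigma> \<phi>)"
    by (rule ext) (simp add: W_def c_def wn_expand(1)[OF s])
  have dA: "(A has_real_derivative 2 * a) (at 0)" unfolding At by (auto intro!: derivative_eq_intros)
  have dW: "(W has_real_derivative 2 * c) (at 0)" unfolding Wt by (auto intro!: derivative_eq_intros)
  have dB: "(B has_real_derivative p * b) (at 0)"
    unfolding B_def[abs_def] b_def using X_lincomb[OF Xv f] by (intro pn_derivative i vm nn) (simp add: X_def)
  define D where "D t = Lam * (A t powr (al / 2) * B t powr (be / p)) - W t" for t
  have d1: "((\<lambda>t. A t powr (al / 2)) has_real_derivative (al / 2) * A 0 powr (al / 2 - 1) * (2 * a)) (at 0)"
    using pos A0 by (intro DERIV_chain2[OF has_real_derivative_powr dA]) simp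
  have d2: "((\<lambda>t. B t powr (be / p)) has_real_derivative (be / p) * B 0 powr (be / p - 1) * (p * b)) (at 0)"
    using pos A0 by (intro DERIV_chain2[OF has_real_derivative_powr dB]) simp
  let ?D = "Lam * ((al / 2) * A 0 powr (al / 2 - 1) * (2 * a) * B 0 powr (be / p) + (be / p) * B 0 powr (be / p - 1) * (p * b) * A 0 powr (al / 2)) - 2 * c"
  have dD: "(D has_real_derivative ?D) (at 0)"
    unfolding D_def by (intro DERIV_diff DERIV_cmult DERIV_mult d1 d2 dW)
  have D0: "D 0 = 0" using ex by (simp add: D_def A0 extremal_def)
  have "D 0 \<le> D t" for t
    using Lam_inequality[OF X_lincomb[OF Xv f, of t]] unfolding D0 by (simp add: D_def A_def B_def W_def)
  then have "?D = 0" by (intro DERIV_local_min[OF dD, of 1]) auto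
  moreover have "A 0 powr (al / 2 - 1) = A 0 powr (al / 2) / A 0" "B 0 powr (be / p - 1) = B 0 powr (be / p) / B 0"
    using pos A0 by (simp_all add: powr_diff)
  ultimately have "Lam * (A 0 powr (al / 2) * B 0 powr (be / p)) * (al * a / A 0 + be * b / B 0) - 2 * c = 0"
    using p_bounds by (simp add: algebra_simps)
  moreover have "Lam * (A 0 powr (al / 2) * B 0 powr (be / p)) = wn \<sigma> v" using ex A0 by (simp add: extremal_def)
  ultimately show ?thesis unfolding a_def[symmetric] b_def[symmetric] c_def[symmetric] A0 by simp
qed

text \<open>Dilation and multiplication leave two free parameters, just enough to fix the two ratios
  that turn the multipliers of the Euler-Lagrange equation into 1 and 1/(m - 1).\<close>

lemma extremal_normalized:
  obtains v G f where "extremal v G" "\<And>x. v x = (if x = 0 then 0 else f (norm x))"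
    "\<And>t. 0 < t \<Longrightarrow> 0 \<le> f t" "\<And>t u. 0 < t \<Longrightarrow> t \<le> u \<Longrightarrow> f u \<le> f t"
    "wn \<sigma> v = 2 * n2 G / al" "pn v = be * (m - 1) * n2 G / al"
proof -
  obtain v G f where ex: "extremal v G" and vf: "\<And>x. v x = (if x = 0 then 0 else f (norm x))"
    and f0: "\<And>t. 0 < t \<Longrightarrow> 0 \<le> f t" and fm: "\<And>t u. 0 < t \<Longrightarrow> t \<le> u \<Longrightarrow> f u \<le> f t"
    by (rule exists_radial_extremal) blast
  have Xv: "X v G" and w0: "0 < wn \<sigma> v" and w: "wn \<sigma> v = Lam * (n2 G powr (al / 2) * pn v powr (be / p))"
    using ex by (auto simp: extremal_def)
  note pos = extremal_pos[OF ex]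
  have nz: "\<not> (AE x in lborel. v x = 0)"
  proof
    assume z: "AE x in lborel. v x = 0"
    have "wn \<sigma> v = 0" unfolding wn_def by (rule integral_eq_zero_AE) (use z in \<open>eventually_elim, simp\<close>)
    then show False using w0 by simp
  qed
  \<comment> \<open>The required ratio of the L^p integral to the squared gradient norm.\<close>
  define \<kappa> where "\<kappa> = be * (m - 1) / al"
  have k: "0 < \<kappa>" using be_pos al_pos m by (simp add: \<kappa>_def)
  \<comment> \<open>Extremality with these ratios reads \<open>Lam\<close> \<kappa>^(be/p)
    A^(\<epsilon> + 1) = 2 A / al. It is solvable for the squared gradient norm A because \<epsilon>
    is positive, which follows from \<open>p < 2\<close> and \<open>al + be = 2\<close>.\<close>
  define \<epsilon> where "\<epsilon> = al / 2 + be / p - 1"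
  have eps: "0 < \<epsilon>"
  proof -
    have "be / 2 < be / p" using be_pos p_bounds by (intro divide_strict_left_mono) auto
    then show ?thesis using al_be unfolding \<epsilon>_def by linarith
  qed
  \<comment> \<open>The value that A^\<epsilon> must take.\<close>
  define y where "y = (2 / al) / (Lam * \<kappa> powr (be / p))"
  have y: "0 < y" using al_pos Lam_pos k by (simp add: y_def)
  define A0 where "A0 = y powr (1 / \<epsilon>)"
  have A0: "0 < A0" using y by (simp add: A0_def)
  have Ae: "A0 powr \<epsilon> = y" using eps y by (simp add: A0_def powr_powr)
  have val: "Lam * (A0 powr (al / 2) * (\<kappa> * A0) powr (be / p)) = 2 * A0 / al"
  proof -
    have "A0 powr (al / 2) * (\<kappa> * A0) powr (be / p) = \<kappa> powr (be / p) * (A0 powr (al / 2) * A0 powr (be / p))"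
      using k A0 by (simp add: powr_mult)
    also have "A0 powr (al / 2) * A0 powr (be / p) = A0 powr (\<epsilon> + 1)" by (simp add: \<epsilon>_def powr_add[symmetric])
    also have "\<dots> = y * A0" using A0 by (simp add: powr_add Ae)
    finally have "Lam * (A0 powr (al / 2) * (\<kappa> * A0) powr (be / p)) = (Lam * \<kappa> powr (be / p)) * y * A0" by simp
    also have "(Lam * \<kappa> powr (be / p)) * y = 2 / al" using Lam_pos k by (simp add: y_def)
    finally show ?thesis by simp
  qed
  have kA: "0 < \<kappa> * A0" using k A0 by simp
  obtain c l where c: "0 < c" "0 < l" "X (\<lambda>x. c * v (l *\<^sub>R x)) (\<lambda>x. (c * l) *\<^sub>R G (l *\<^sub>R x))"
    "n2 (\<lambda>x. (c * l) *\<^sub>R G (l *\<^sub>R x)) = A0" "pn (\<lambda>x. c * v (l *\<^sub>R x)) = \<kappa> * A0"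
    "wn \<sigma> (\<lambda>x. c * v (l *\<^sub>R x)) * (n2 G powr (al / 2) * pn v powr (be / p)) = wn \<sigma> v * (A0 powr (al / 2) * (\<kappa> * A0) powr (be / p))"
    by (rule normalize[OF Xv nz A0 kA])
  let ?P = "n2 G powr (al / 2) * pn v powr (be / p)"
  have P: "0 < ?P" using pos by simp
  have "wn \<sigma> (\<lambda>x. c * v (l *\<^sub>R x)) * ?P = (Lam * (A0 powr (al / 2) * (\<kappa> * A0) powr (be / p))) * ?P"
    unfolding c(6) w by simp
  then have w': "wn \<sigma> (\<lambda>x. c * v (l *\<^sub>R x)) = Lam * (A0 powr (al / 2) * (\<kappa> * A0) powr (be / p))"
    using P by (simp only: mult_cancel_right) auto
  show thesis
  proof (rule that[of "\<lambda>x. c * v (l *\<^sub>R x)" "\<lambda>x. (c * l) *\<^sub>R G (l *\<^sub>R x)" "\<lambda>t. c * f (l * t)"])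
    show "extremal (\<lambda>x. c * v (l *\<^sub>R x)) (\<lambda>x. (c * l) *\<^sub>R G (l *\<^sub>R x))"
      unfolding extremal_def using c(3,4,5) w' val A0 al_pos by simp
    show "c * v (l *\<^sub>R x) = (if x = 0 then 0 else c * f (l * norm x))" for x using c(1,2) by (simp add: vf)
    show "0 \<le> c * f (l * t)" if "0 < t" for t using c f0[of "l * t"] that by simp
    show "c * f (l * u) \<le> c * f (l * t)" if "0 < t" "t \<le> u" for t u
      using c fm[of "l * t" "l * u"] that by simp
    show "wn \<sigma> (\<lambda>x. c * v (l *\<^sub>R x)) = 2 * n2 (\<lambda>x. (c * l) *\<^sub>R G (l *\<^sub>R x)) / al"
      unfolding c(4) w' val ..
    show "pn (\<lambda>x. c * v (l *\<^sub>R x)) = be * (m - 1) * n2 (\<lambda>x. (c * l) *\<^sub>R G (l *\<^sub>R x)) / al"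
      unfolding c(4,5) by (simp add: \<kappa>_def)
  qed
qed

lemma normalized_equation:
  assumes ex: "extremal v G" and nn: "\<And>x. 0 \<le> v x" and f: "X \<phi> H"
    and w: "wn \<sigma> v = 2 * n2 G / al" and pv: "pn v = be * (m - 1) * n2 G / al"
  shows "(LINT x|lborel. G x \<bullet> H x) + 1 / (m - 1) * (LINT x|lborel. v x powr (1 / m) * \<phi> x)
    = (LINT x|lborel. wt \<sigma> x * v x * \<phi> x)"
proof -
  define A where "A = n2 G"
  have A: "0 < A" using extremal_pos(1)[OF ex] by (simp add: A_def)
  have m1: "0 < m - 1" using m by simp
  have "2 * A / al * (al * a / A + be * b / (be * (m - 1) * A / al)) = 2 * (a + 1 / (m - 1) * b)" for a b
  proof -
    have "2 * A / al * (al * a / A) = 2 * a" using A al_pos by simp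
    moreover have "2 * A / al * (be * b / (be * (m - 1) * A / al)) = 2 * (1 / (m - 1) * b)"
      using A al_pos be_pos m1 by simp
    ultimately show ?thesis by (simp add: distrib_left)
  qed
  from this[of "LINT x|lborel. G x \<bullet> H x" "LINT x|lborel. v x powr (1 / m) * \<phi> x"]
  show ?thesis
    using euler_lagrange[OF ex nn f] unfolding w pv A_def[symmetric] p_eq by simp
qed

text \<open>The equation in divided form and with test functions still restricted to pairs in
  \<open>X\<close>, where the power term is integrable by Hoelder-type bounds.\<close>

definition solution :: "('a \<Rightarrow> real) \<Rightarrow> ('a \<Rightarrow> 'a) \<Rightarrow> bool" where
  "solution v G \<longleftrightarrow> X v G \<and> (\<forall>x. 0 \<le> v x) \<and> (\<forall>\<phi> H. X \<phi> H \<longrightarrow>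
     (LINT x|lborel. G x \<bullet> H x) + 1 / (m - 1) * (LINT x|lborel. v x powr (1 / m) * \<phi> x)
      = (LINT x|lborel. wt \<sigma> x * v x * \<phi> x))"

section \<open>From test functions in \<open>X\<close> to all of H^1\<close>

lemma abs_cut_le: "\<bar>cutoff R x\<bar> \<le> 1"
  using cut_bounds[of R x] by simp

text \<open>On a bounded set square integrability implies integrability of the power
  \<open>p < 2\<close>, since |t|^p is at most 1 + t^2.\<close>

lemma X_cut:
  fixes \<phi> :: "'a \<Rightarrow> real"
  assumes f: "sob \<phi> H" and R: "0 < R"
  shows "X (\<lambda>x. cutoff R x * \<phi> x) (\<lambda>x. cutoff R x *\<^sub>R H x + \<phi> x *\<^sub>R Dcutoff R x)"
proof -
  have [measurable]: "\<phi> \<in> borel_measurable borel" "cutoff R \<in> borel_measurable borel"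
    using sobD[OF f] C1_meas[OF cut_C1] by auto
  have i1: "integrable lborel (indicator (cball 0 (2 * R)) :: 'a \<Rightarrow> real)"
    using emeasure_bounded_finite[of "cball 0 (2 * R) :: 'a set"] by (auto simp: less_top)
  have i2: "integrable lborel (\<lambda>x. (\<phi> x)\<^sup>2)" using L2_int[OF sobD(1)[OF f]] by simp
  have "\<bar>cutoff R x * \<phi> x\<bar> powr p \<le> indicator (cball 0 (2 * R)) x + (\<phi> x)\<^sup>2" for x
  proof (cases "norm x \<ge> 2 * R")
    case True
    then show ?thesis using cut_outside(1)[OF R, of x] by simp
  next
    case False
    have "\<bar>cutoff R x * \<phi> x\<bar> \<le> \<bar>\<phi> x\<bar>"
      using cut_bounds[of R x] by (simp add: abs_mult mult_left_le_one_le)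
    then have "\<bar>cutoff R x * \<phi> x\<bar> powr p \<le> \<bar>\<phi> x\<bar> powr p" using p_bounds by (intro powr_mono2) auto
    also have "\<dots> \<le> 1 + (\<phi> x)\<^sup>2"
    proof (cases "\<bar>\<phi> x\<bar> \<le> 1")
      case True
      have "\<bar>\<phi> x\<bar> powr p \<le> 1" using True p_bounds by (intro powr_le1) auto
      then show ?thesis by (simp add: add_increasing2)
    next
      case False
      have "\<bar>\<phi> x\<bar> powr p \<le> \<bar>\<phi> x\<bar> powr 2" using False p_bounds by (intro powr_mono) auto
      then show ?thesis using False by (simp add: powr_numeral)
    qed
    finally show ?thesis using False by (simp add: indicator_def)
  qed
  then have "AE x in lborel. norm (\<bar>cutoff R x * \<phi> x\<bar> powr p) \<le> norm (indicator (cball 0 (2 * R)) x + (\<phi> x)\<^sup>2)"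
    by (intro AE_I2) (simp add: abs_of_nonneg)
  then have "integrable lborel (\<lambda>x. \<bar>cutoff R x * \<phi> x\<bar> powr p)"
    by (intro Bochner_Integration.integrable_bound[OF Bochner_Integration.integrable_add[OF i1 i2]]) measurable
  then show ?thesis using sob_cut[OF f R] by (simp add: X_def)
qed

text \<open>Separates the error made by differentiating the cutoff, which decays like 1/R.\<close>

lemma gradient_cut_bound:
  fixes \<phi> :: "'a \<Rightarrow> real"
  assumes G: "L2 (G :: 'a \<Rightarrow> 'a)" and f: "sob \<phi> H" and R: "0 < R"
  shows "integrable lborel (\<lambda>x. cutoff R x * (G x \<bullet> H x))"
    "(LINT x|lborel. G x \<bullet> (cutoff R x *\<^sub>R H x + \<phi> x *\<^sub>R Dcutoff R x))
      = (LINT x|lborel. cutoff R x * (G x \<bullet> H x)) + (LINT x|lborel. G x \<bullet> (\<phi> x *\<^sub>R Dcutoff R x))"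
    "\<bar>LINT x|lborel. G x \<bullet> (\<phi> x *\<^sub>R Dcutoff R x)\<bar> \<le> 16 / R * (sqrt (n2 G) * sqrt (n2 \<phi>))"
proof -
  note L = sobD[OF f]
  have [measurable]: "\<phi> \<in> borel_measurable borel" "cutoff R \<in> borel_measurable borel" "G \<in> borel_measurable borel"
    "H \<in> borel_measurable borel" "Dcutoff R \<in> (borel_measurable borel :: ('a \<Rightarrow> 'a) set)"
    using L G C1_meas[OF cut_C1] by auto
  have m2: "(\<lambda>x. \<phi> x *\<^sub>R Dcutoff R x) \<in> borel_measurable borel" by measurable
  have b2: "norm (\<phi> x *\<^sub>R Dcutoff R x) \<le> norm ((16 / R) *\<^sub>R \<phi> x)" for x
    using mult_left_mono[OF Dcutoff_bound[OF R, of x], of "\<bar>\<phi> x\<bar>"] R by (simp add: mult.commute)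
  note B = L2_dominated[OF L2_scaleR[OF L(1)] m2 AE_I2[OF b2]]
  have nb: "sqrt (n2 (\<lambda>x. \<phi> x *\<^sub>R Dcutoff R x)) \<le> 16 / R * sqrt (n2 \<phi>)"
    using real_sqrt_le_mono[OF B(2)] R unfolding n2_scaleR by (simp add: real_sqrt_mult)
  show i1: "integrable lborel (\<lambda>x. cutoff R x * (G x \<bullet> H x))"
    by (rule Bochner_Integration.integrable_bound[OF L2_inner_integrable[OF G L(2)]])
      (auto intro!: AE_I2 mult_left_le_one_le simp: abs_mult abs_cut_le)
  have i2: "integrable lborel (\<lambda>x. G x \<bullet> (\<phi> x *\<^sub>R Dcutoff R x))" by (rule L2_inner_integrable[OF G B(1)])
  have "(LINT x|lborel. G x \<bullet> (cutoff R x *\<^sub>R H x + \<phi> x *\<^sub>R Dcutoff R x))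
     = (LINT x|lborel. cutoff R x * (G x \<bullet> H x) + G x \<bullet> (\<phi> x *\<^sub>R Dcutoff R x))"
    by (simp only: inner_add_right inner_scaleR_right)
  also have "\<dots> = (LINT x|lborel. cutoff R x * (G x \<bullet> H x)) + (LINT x|lborel. G x \<bullet> (\<phi> x *\<^sub>R Dcutoff R x))"
    by (rule Bochner_Integration.integral_add[OF i1 i2])
  finally show "(LINT x|lborel. G x \<bullet> (cutoff R x *\<^sub>R H x + \<phi> x *\<^sub>R Dcutoff R x))
      = (LINT x|lborel. cutoff R x * (G x \<bullet> H x)) + (LINT x|lborel. G x \<bullet> (\<phi> x *\<^sub>R Dcutoff R x))" .
  have "\<bar>LINT x|lborel. G x \<bullet> (\<phi> x *\<^sub>R Dcutoff R x)\<bar> \<le> sqrt (n2 G) * sqrt (n2 (\<lambda>x. \<phi> x *\<^sub>R Dcutoff R x))"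
    by (rule L2_Cauchy_Schwarz_abs[OF G B(1)])
  also have "\<dots> \<le> sqrt (n2 G) * (16 / R * sqrt (n2 \<phi>))" by (rule mult_left_mono[OF nb]) simp
  finally show "\<bar>LINT x|lborel. G x \<bullet> (\<phi> x *\<^sub>R Dcutoff R x)\<bar> \<le> 16 / R * (sqrt (n2 G) * sqrt (n2 \<phi>))"
    by (simp add: mult_ac)
qed

lemma cut_tendsto: "(\<lambda>n. cutoff (real (Suc n)) x) \<longlonglongrightarrow> (1::real)"
proof (rule tendsto_eventually)
  obtain K where K: "norm x \<le> real K" using real_arch_simple by blast
  have "cutoff (real (Suc n)) x = 1" if "n \<ge> K" for n
    using K that by (intro cut_inside) auto
  then show "\<forall>\<^sub>F n in sequentially. cutoff (real (Suc n)) x = 1" unfolding eventually_sequentially by blast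
qed

lemma wn_cross_cut:
  fixes \<phi> :: "'a \<Rightarrow> real"
  assumes v: "sob v G" and f: "sob \<phi> H"
  shows "(LINT x|lborel. \<bar>wt \<sigma> x * v x * (cutoff R x * \<phi> x)\<bar>) \<le> (LINT x|lborel. \<bar>wt \<sigma> x * v x * \<phi> x\<bar>)"
    "integrable lborel (\<lambda>x. wt \<sigma> x * v x * (cutoff R x * \<phi> x))"
proof -
  note i = wn_expand(2)[OF v f]
  have [measurable]: "\<phi> \<in> borel_measurable borel" "cutoff R \<in> borel_measurable borel" "v \<in> borel_measurable borel"
    using sobD[OF f] sobD[OF v] C1_meas[OF cut_C1] by auto
  have b: "\<bar>wt \<sigma> x * v x * (cutoff R x * \<phi> x)\<bar> \<le> \<bar>wt \<sigma> x * v x * \<phi> x\<bar>" for x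
  proof -
    have "\<bar>cutoff R x\<bar> * \<bar>wt \<sigma> x * v x * \<phi> x\<bar> \<le> \<bar>wt \<sigma> x * v x * \<phi> x\<bar>"
      using cut_bounds[of R x] by (intro mult_left_le_one_le) auto
    then show ?thesis by (simp add: abs_mult mult_ac)
  qed
  show i': "integrable lborel (\<lambda>x. wt \<sigma> x * v x * (cutoff R x * \<phi> x))"
    by (rule Bochner_Integration.integrable_bound[OF i]) (use b in \<open>auto intro!: AE_I2\<close>)
  show "(LINT x|lborel. \<bar>wt \<sigma> x * v x * (cutoff R x * \<phi> x)\<bar>) \<le> (LINT x|lborel. \<bar>wt \<sigma> x * v x * \<phi> x\<bar>)"
    by (intro integral_mono integrable_abs i i' b)
qed

text \<open>Although \<open>v\<^sup>1\<^sup>/\<^sup>m\<close> need not be square integrable a priori, testing with truncations of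
  \<open>\<psi> \<ge> 0\<close> bounds \<open>\<integral> v\<^sup>1\<^sup>/\<^sup>m \<psi>\<close> by the other two terms of the equation.\<close>
lemma solution_power_integrable_nonneg:
  assumes sol: "solution v G" and f: "sob \<psi> H" and nn: "\<And>x. 0 \<le> \<psi> x"
  shows "integrable lborel (\<lambda>x. v x powr (1 / m) * \<psi> x)"
proof -
  have Xv: "X v G" and v0: "\<And>x. 0 \<le> v x"
    and eq: "\<And>\<phi> H. X \<phi> H \<Longrightarrow> (LINT x|lborel. G x \<bullet> H x) + 1 / (m - 1) * (LINT x|lborel. v x powr (1 / m) * \<phi> x)
      = (LINT x|lborel. wt \<sigma> x * v x * \<phi> x)" using sol unfolding solution_def by blast+
  have s: "sob v G" using Xv by (simp add: X_def)
  note LG = sobD(2)[OF s] and LH = sobD(2)[OF f]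
  have [measurable]: "v \<in> borel_measurable borel" "\<psi> \<in> borel_measurable borel" using sobD[OF s] sobD[OF f] by auto
  \<comment> \<open>The other two terms of the equation in absolute value and the cutoff error at
    its largest, \<open>R = 1\<close>.\<close>
  define C where "C = (m - 1) * ((LINT x|lborel. \<bar>wt \<sigma> x * v x * \<psi> x\<bar>) + (LINT x|lborel. \<bar>G x \<bullet> H x\<bar>) + 16 * (sqrt (n2 G) * sqrt (n2 \<psi>)))"
  define g where "g n x = v x powr (1 / m) * (cutoff (real (Suc n)) x * \<psi> x)" for n x
  have ig: "integrable lborel (g n)" for n
    using power_integrable[OF Xv X_cut[OF f, of "real (Suc n)"] v0] by (simp add: g_def[abs_def] p_eq)
  have bg: "(LINT x|lborel. g n x) \<le> C" for n
  proof -
    let ?R = "real (Suc n)"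
    have R: "0 < ?R" by simp
    note gc = gradient_cut_bound[OF LG f R]
    have "1 / (m - 1) * (LINT x|lborel. g n x) = (LINT x|lborel. wt \<sigma> x * v x * (cutoff ?R x * \<psi> x))
       - (LINT x|lborel. G x \<bullet> (cutoff ?R x *\<^sub>R H x + \<psi> x *\<^sub>R Dcutoff ?R x))"
      using eq[OF X_cut[OF f R]] unfolding g_def by linarith
    moreover have "(LINT x|lborel. wt \<sigma> x * v x * (cutoff ?R x * \<psi> x)) \<le> (LINT x|lborel. \<bar>wt \<sigma> x * v x * \<psi> x\<bar>)"
      using wn_cross_cut(1)[OF s f, of ?R] integral_abs_bound[of lborel "\<lambda>x. wt \<sigma> x * v x * (cutoff ?R x * \<psi> x)"] by linarith
    moreover have "- (LINT x|lborel. cutoff ?R x * (G x \<bullet> H x)) \<le> (LINT x|lborel. \<bar>G x \<bullet> H x\<bar>)"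
    proof -
      have "(LINT x|lborel. \<bar>cutoff ?R x * (G x \<bullet> H x)\<bar>) \<le> (LINT x|lborel. \<bar>G x \<bullet> H x\<bar>)"
        by (intro integral_mono integrable_abs gc(1) L2_inner_integrable LG LH)
          (auto intro!: mult_left_le_one_le simp: abs_mult abs_cut_le)
      then show ?thesis using integral_abs_bound[of lborel "\<lambda>x. cutoff ?R x * (G x \<bullet> H x)"] by linarith
    qed
    moreover have "16 / ?R * (sqrt (n2 G) * sqrt (n2 \<psi>)) \<le> 16 * (sqrt (n2 G) * sqrt (n2 \<psi>))"
      by (intro mult_right_mono) (auto simp: divide_le_eq)
    ultimately have "1 / (m - 1) * (LINT x|lborel. g n x) \<le> (LINT x|lborel. \<bar>wt \<sigma> x * v x * \<psi> x\<bar>) + (LINT x|lborel. \<bar>G x \<bullet> H x\<bar>) + 16 * (sqrt (n2 G) * sqrt (n2 \<psi>))"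
      using gc(2,3) by linarith
    then show ?thesis using m by (simp add: C_def pos_divide_le_eq mult.commute)
  qed
  have gn: "0 \<le> g n x" for n x using cut_bounds(1)[of "real (Suc n)" x] nn[of x] by (simp add: g_def)
  have "(\<lambda>n. g n x) \<longlonglongrightarrow> v x powr (1 / m) * (1 * \<psi> x)" for x unfolding g_def by (intro tendsto_intros cut_tendsto)
  then have lim: "AE x in lborel. (\<lambda>n. g n x) \<longlonglongrightarrow> v x powr (1 / m) * \<psi> x" by simp
  show ?thesis by (rule fatou_bound(1)[OF ig gn bg lim]) measurable
qed

lemma solution_power_integrable:
  assumes sol: "solution v G" and f: "sob \<phi> H"
  shows "integrable lborel (\<lambda>x. v x powr (1 / m) * \<phi> x)"
proof -
  have s: "sob v G" using sol by (simp add: solution_def X_def)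
  have [measurable]: "v \<in> borel_measurable borel" "\<phi> \<in> borel_measurable borel" using sobD[OF s] sobD[OF f] by auto
  have "integrable lborel (\<lambda>x. v x powr (1 / m) * \<bar>\<phi> x\<bar>)"
    by (rule solution_power_integrable_nonneg[OF sol sob_abs[OF f]]) simp
  then show ?thesis by (rule Bochner_Integration.integrable_bound) (auto simp: abs_mult)
qed

text \<open>The cut-off test functions are admissible. All three integrands are already known to be
  integrable, so dominated convergence removes the cutoff, and its gradient contributes only
  1/R.\<close>

lemma solution_equation:
  assumes sol: "solution v G" and f: "sob \<phi> H"
  shows "(LINT x|lborel. G x \<bullet> H x) + 1 / (m - 1) * (LINT x|lborel. v x powr (1 / m) * \<phi> x)
      = (LINT x|lborel. wt \<sigma> x * v x * \<phi> x)"
proof -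
  have Xv: "X v G"
    and eq: "\<And>\<phi> H. X \<phi> H \<Longrightarrow> (LINT x|lborel. G x \<bullet> H x) + 1 / (m - 1) * (LINT x|lborel. v x powr (1 / m) * \<phi> x)
      = (LINT x|lborel. wt \<sigma> x * v x * \<phi> x)" using sol unfolding solution_def by blast+
  have s: "sob v G" using Xv by (simp add: X_def)
  note LG = sobD(2)[OF s] and LH = sobD(2)[OF f]
  have [measurable]: "v \<in> borel_measurable borel" "\<phi> \<in> borel_measurable borel" "G \<in> borel_measurable borel" "H \<in> borel_measurable borel"
    using sobD[OF s] sobD[OF f] by auto
  have [measurable]: "cutoff R \<in> (borel_measurable borel :: ('a \<Rightarrow> real) set)" for R using C1_meas[OF cut_C1] by auto
  let ?c = "\<lambda>n x. cutoff (real (Suc n)) (x::'a)"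
  have dom: "(\<lambda>n. LINT x|lborel. ?c n x * g x) \<longlonglongrightarrow> (LINT x|lborel. g x)" if g: "integrable lborel g" for g :: "'a \<Rightarrow> real"
  proof (rule integral_dominated_convergence[where w="\<lambda>x. \<bar>g x\<bar>"])
    have [measurable]: "g \<in> borel_measurable borel" using g by auto
    show "g \<in> borel_measurable lborel" by measurable
    show "(\<lambda>x. ?c n x * g x) \<in> borel_measurable lborel" for n by measurable
    show "integrable lborel (\<lambda>x. \<bar>g x\<bar>)" using g by simp
    have "(\<lambda>n. ?c n x * g x) \<longlonglongrightarrow> 1 * g x" for x by (intro tendsto_intros cut_tendsto)
    then show "AE x in lborel. (\<lambda>n. ?c n x * g x) \<longlonglongrightarrow> g x" by simp
    show "AE x in lborel. norm (?c n x * g x) \<le> \<bar>g x\<bar>" for n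
      by (auto intro!: AE_I2 mult_left_le_one_le simp: abs_mult abs_cut_le)
  qed
  have l1: "(\<lambda>n. LINT x|lborel. ?c n x * (G x \<bullet> H x)) \<longlonglongrightarrow> (LINT x|lborel. G x \<bullet> H x)"
    by (intro dom L2_inner_integrable LG LH)
  have l2: "(\<lambda>n. LINT x|lborel. G x \<bullet> (\<phi> x *\<^sub>R Dcutoff (real (Suc n)) x)) \<longlonglongrightarrow> 0"
  proof (rule Lim_null_comparison[OF always_eventually])
    show "\<forall>n. norm (LINT x|lborel. G x \<bullet> (\<phi> x *\<^sub>R Dcutoff (real (Suc n)) x)) \<le> 16 * (sqrt (n2 G) * sqrt (n2 \<phi>)) * (1 / real (Suc n))"
      using gradient_cut_bound(3)[OF LG f, of "real (Suc n)" for n] by simp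
    have "(\<lambda>n. 16 * (sqrt (n2 G) * sqrt (n2 \<phi>)) * (1 / real (Suc n))) \<longlonglongrightarrow> 16 * (sqrt (n2 G) * sqrt (n2 \<phi>)) * 0"
      using LIMSEQ_Suc[OF lim_1_over_n] by (intro tendsto_intros) simp
    then show "(\<lambda>n. 16 * (sqrt (n2 G) * sqrt (n2 \<phi>)) * (1 / real (Suc n))) \<longlonglongrightarrow> 0" by simp
  qed
  have "(\<lambda>n. LINT x|lborel. ?c n x * (v x powr (1 / m) * \<phi> x)) \<longlonglongrightarrow> (LINT x|lborel. v x powr (1 / m) * \<phi> x)"
    by (intro dom solution_power_integrable[OF sol f])
  then have l3: "(\<lambda>n. LINT x|lborel. v x powr (1 / m) * (?c n x * \<phi> x)) \<longlonglongrightarrow> (LINT x|lborel. v x powr (1 / m) * \<phi> x)"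
    by (simp add: mult_ac)
  have "(\<lambda>n. LINT x|lborel. ?c n x * (wt \<sigma> x * v x * \<phi> x)) \<longlonglongrightarrow> (LINT x|lborel. wt \<sigma> x * v x * \<phi> x)"
    by (intro dom wn_expand(2)[OF s f])
  then have l4: "(\<lambda>n. LINT x|lborel. wt \<sigma> x * v x * (?c n x * \<phi> x)) \<longlonglongrightarrow> (LINT x|lborel. wt \<sigma> x * v x * \<phi> x)"
    by (simp add: mult_ac)
  have e: "((LINT x|lborel. ?c n x * (G x \<bullet> H x)) + (LINT x|lborel. G x \<bullet> (\<phi> x *\<^sub>R Dcutoff (real (Suc n)) x)))
      + 1 / (m - 1) * (LINT x|lborel. v x powr (1 / m) * (?c n x * \<phi> x)) = (LINT x|lborel. wt \<sigma> x * v x * (?c n x * \<phi> x))" for n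
    using eq[OF X_cut[OF f, of "real (Suc n)"]] gradient_cut_bound(2)[OF LG f, of "real (Suc n)"] by simp
  have "(\<lambda>n. ((LINT x|lborel. ?c n x * (G x \<bullet> H x)) + (LINT x|lborel. G x \<bullet> (\<phi> x *\<^sub>R Dcutoff (real (Suc n)) x)))
      + 1 / (m - 1) * (LINT x|lborel. v x powr (1 / m) * (?c n x * \<phi> x)))
    \<longlonglongrightarrow> ((LINT x|lborel. G x \<bullet> H x) + 0) + 1 / (m - 1) * (LINT x|lborel. v x powr (1 / m) * \<phi> x)"
    by (intro tendsto_add tendsto_mult l1 l2 l3 tendsto_const)
  from LIMSEQ_unique[OF this l4[folded e]] show ?thesis by simp
qed

section \<open>Boundedness of radial solutions\<close>

text \<open>The mass of the ball for the measure with density |x|^\<sigma>.\<close>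

definition nu :: "real \<Rightarrow> real" where
  "nu r = (LINT x::'a|lborel. indicator (cball 0 r) x * wt \<sigma> x)"

text \<open>Hardy's inequality applied to a cutoff gives local integrability of the weight without
  polar coordinates.\<close>

lemma nu_integrable:
  assumes r: "0 < r" shows "integrable lborel (\<lambda>x::'a. indicator (cball 0 r) x * wt \<sigma> x)"
proof -
  have "\<exists>K. \<forall>x::'a. cutoff r x \<noteq> 0 \<longrightarrow> norm x powr (\<sigma> + 2) \<le> K"
  proof (intro exI[of _ "(2 * r) powr (\<sigma> + 2)"] allI impI)
    fix x :: 'a assume "cutoff r x \<noteq> 0"
    then have "norm x \<le> 2 * r" using cut_outside(1)[OF r, of x] by fastforce
    then show "norm x powr (\<sigma> + 2) \<le> (2 * r) powr (\<sigma> + 2)" using s1 by (intro powr_mono2) auto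
  qed
  then obtain K where K: "\<And>x::'a. cutoff r x \<noteq> 0 \<Longrightarrow> norm x powr (\<sigma> + 2) \<le> K" by blast
  have "cutoff r (0::'a) \<noteq> 0" using cut_inside(1)[of r "0::'a"] r by simp
  then have K0: "0 \<le> K" using order_trans[OF powr_ge_zero K] by blast
  have i: "integrable lborel (\<lambda>x::'a. wt \<sigma> x * (cutoff r x)\<^sup>2)"
    by (rule hardy_C1(1)[OF cut_C1 cut_bsupp[OF r] s3 s2 _ K0]) (use K in auto)
  show ?thesis
  proof (rule Bochner_Integration.integrable_bound[OF i])
    show "AE x::'a in lborel. norm (indicator (cball 0 r) x * wt \<sigma> x) \<le> norm (wt \<sigma> x * (cutoff r x)\<^sup>2)"
      by (intro AE_I2) (auto simp: indicator_def cut_inside(1)[OF r])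
  qed measurable
qed

lemma nu_scale: "0 < r \<Longrightarrow> nu r = 2 powr (real DIM('a) + \<sigma>) * nu (r / 2)"
proof -
  assume r: "0 < r"
  have vm: "vol_map (1 / \<bar>2\<bar> ^ DIM('a)) (\<lambda>x::'a. 2 *\<^sub>R x)" by (rule vol_map_homothety) simp
  have m: "(\<lambda>x::'a. indicator (cball 0 r) x * wt \<sigma> x) \<in> borel_measurable borel" by measurable
  have "1 / \<bar>2\<bar> ^ DIM('a) * nu r = (LINT x::'a|lborel. indicator (cball 0 r) (2 *\<^sub>R x) * wt \<sigma> (2 *\<^sub>R x))"
    unfolding nu_def using vol_map_integral[OF vm m] by simp
  also have "\<dots> = (LINT x::'a|lborel. 2 powr \<sigma> * (indicator (cball 0 (r / 2)) x * wt \<sigma> x))"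
    by (intro Bochner_Integration.integral_cong) (auto simp: indicator_def wt_def powr_mult)
  also have "\<dots> = 2 powr \<sigma> * nu (r / 2)" by (simp add: nu_def)
  finally have "nu r = 2 ^ DIM('a) * (2 powr \<sigma> * nu (r / 2))" by (simp add: field_simps)
  then show ?thesis by (simp add: powr_add powr_realpow)
qed

lemma nu_pos: assumes "0 < r" shows "0 < nu r"
proof -
  have "nu r \<noteq> 0"
  proof
    assume "nu r = 0"
    then have "AE x::'a in lborel. indicator (cball 0 r) x * wt \<sigma> x = 0"
      unfolding nu_def using nu_integrable[OF assms] by (subst (asm) integral_nonneg_eq_0_iff_AE) auto
    then have "AE x::'a in lborel. x \<notin> ball 0 r"
      using wt_pos_AE[of \<sigma>] by eventually_elim (auto simp: indicator_def split: if_splits)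
    then show False using AE_open_meets[of "\<lambda>x::'a. x \<notin> ball 0 r" "ball 0 r"] assms by auto
  qed
  moreover have "0 \<le> nu r" by (simp add: nu_def)
  ultimately show ?thesis by linarith
qed

text \<open>The constant of \<open>hardy_support\<close> with the power of the radius split
  off.\<close>

definition Ch :: real where "Ch = 4 / (real DIM('a) + \<sigma>)\<^sup>2 * 2 powr (\<sigma> + 2)"

text \<open>Testing the equation with \<open>(v - f(r))\<^sup>+\<close>, which is supported in the ball of radius \<open>r\<close>.\<close>
lemma radial_growth:
  assumes sol: "solution v G" and vf: "\<And>x. v x = (if x = 0 then 0 else f (norm x))"
    and f0: "\<And>t. 0 < t \<Longrightarrow> 0 \<le> f t" and fm: "\<And>t u. 0 < t \<Longrightarrow> t \<le> u \<Longrightarrow> f u \<le> f t"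
    and r: "0 < r" and small: "Ch * r powr (\<sigma> + 2) \<le> 1 / 2"
  shows "f (r / 2) \<le> f r * (1 + 2 * Ch * 2 powr (real DIM('a) + \<sigma>) * r powr (\<sigma> + 2))"
proof -
  have Xv: "X v G" and v0: "\<And>x. 0 \<le> v x"
    and eq: "\<And>\<phi> H. X \<phi> H \<Longrightarrow> (LINT x|lborel. G x \<bullet> H x) + 1 / (m - 1) * (LINT x|lborel. v x powr (1 / m) * \<phi> x)
      = (LINT x|lborel. wt \<sigma> x * v x * \<phi> x)" using sol unfolding solution_def by blast+
  have s: "sob v G" and ip: "integrable lborel (\<lambda>x. \<bar>v x\<bar> powr p)" using Xv by (auto simp: X_def)
  have [measurable]: "v \<in> borel_measurable borel" "G \<in> borel_measurable borel" using sobD[OF s] by auto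
  define k where "k = f r"
  have k: "0 \<le> k" using f0[OF r] by (simp add: k_def)
  define w where "w x = max 0 (v x - k)" for x
  define H where "H x = (if v x > k then 1 else 0) *\<^sub>R G x" for x
  have sw: "sob w H" unfolding w_def[abs_def] H_def[abs_def] by (rule sob_pos_part[OF s k])
  have w0: "0 \<le> w x" "w x \<le> v x" for x using v0[of x] k by (auto simp: w_def)
  have [measurable]: "w \<in> borel_measurable borel" unfolding w_def by measurable
  have "integrable lborel (\<lambda>x. \<bar>w x\<bar> powr p)"
    by (rule Bochner_Integration.integrable_bound[OF ip])
      (use w0 v0 p_bounds in \<open>auto intro!: AE_I2 powr_mono2\<close>)
  then have Xw: "X w H" using sw by (simp add: X_def)
  have out: "v x \<le> k" if "norm x > r" for x using that fm[OF r, of "norm x"] r k by (auto simp: vf k_def)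
  have wz: "w x = 0" "H x = 0" if "norm x > r" for x using out[OF that] by (auto simp: w_def H_def)
  have hs: "wn \<sigma> w \<le> Ch * r powr (\<sigma> + 2) * n2 H"
    using hardy_support[OF sw s1 s3 s2 r wz] r by (simp add: Ch_def powr_mult)
  let ?I = "indicator (cball 0 r) :: 'a \<Rightarrow> real"
  define J where "J = (LINT x|lborel. wt \<sigma> x * w x)"
  have LI: "L2 (\<lambda>x::'a. sqrt (wt \<sigma> x) * ?I x)" "n2 (\<lambda>x::'a. sqrt (wt \<sigma> x) * ?I x) = nu r"
  proof -
    have e: "(norm (sqrt (wt \<sigma> x) * ?I x))\<^sup>2 = ?I x * wt \<sigma> x" for x :: 'a by (auto simp: indicator_def)
    show "L2 (\<lambda>x::'a. sqrt (wt \<sigma> x) * ?I x)" by (rule L2_I) (measurable, unfold e, rule nu_integrable[OF r])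
    show "n2 (\<lambda>x::'a. sqrt (wt \<sigma> x) * ?I x) = nu r" unfolding n2_def e nu_def ..
  qed
  have e1: "(sqrt (wt \<sigma> x) * ?I x) \<bullet> (sqrt (wt \<sigma> x) * w x) = wt \<sigma> x * w x" for x
  proof (cases "norm x > r")
    case False
    have "(sqrt (wt \<sigma> x) * ?I x) \<bullet> (sqrt (wt \<sigma> x) * w x) = (sqrt (wt \<sigma> x) * sqrt (wt \<sigma> x)) * w x"
      using False by simp
    then show ?thesis by (simp add: abs_of_nonneg)
  qed (simp add: wz)
  have iJ: "integrable lborel (\<lambda>x. wt \<sigma> x * w x)"
    using L2_inner_integrable[OF LI(1) L2_sqrt_weighted[OF sw]] unfolding e1 .
  have J0: "0 \<le> J" unfolding J_def using w0 by (intro Bochner_Integration.integral_nonneg) simp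
  \<comment> \<open>Cauchy-Schwarz for the measure with density |x|^\<sigma> on the ball.\<close>
  have J2: "J\<^sup>2 \<le> nu r * wn \<sigma> w"
    using L2_Cauchy_Schwarz[OF LI(1) L2_sqrt_weighted[OF sw]] unfolding e1 LI(2) J_def wn_n2 .
  have GH: "(LINT x|lborel. G x \<bullet> H x) = n2 H"
    unfolding n2_def by (intro Bochner_Integration.integral_cong) (auto simp: H_def power2_norm_eq_inner)
  have vw: "wt \<sigma> x * v x * w x = wt \<sigma> x * (w x)\<^sup>2 + k * (wt \<sigma> x * w x)" for x
    by (auto simp: w_def max_def power2_eq_square algebra_simps)
  have "(LINT x|lborel. wt \<sigma> x * v x * w x) = wn \<sigma> w + k * J"
    unfolding vw using wn_integrable(1)[OF sw s1 s3 s2] iJ by (simp add: wn_def J_def)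
  moreover have "0 \<le> 1 / (m - 1) * (LINT x|lborel. v x powr (1 / m) * w x)"
    using m w0 by (intro mult_nonneg_nonneg Bochner_Integration.integral_nonneg) auto
  \<comment> \<open>On the support of \<open>w\<close> the factor \<open>v\<close> is
    \<open>w + k\<close>. The power term has a favourable sign and is dropped.\<close>
  ultimately have A: "n2 H \<le> wn \<sigma> w + k * J" using eq[OF Xw] unfolding GH by linarith
  have "Ch * r powr (\<sigma> + 2) * n2 H \<le> 1 / 2 * n2 H" by (rule mult_right_mono[OF small]) simp
  \<comment> \<open>The radius is so small that Hardy's inequality bounds
    \<open>wn \<sigma> w\<close> by half of \<open>n2 H\<close>, which is absorbed on the
    left.\<close>
  then have A2: "n2 H \<le> 2 * (k * J)" using A hs by linarith
  have C0: "0 \<le> Ch * r powr (\<sigma> + 2)" by (simp add: Ch_def)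
  have "wn \<sigma> w \<le> Ch * r powr (\<sigma> + 2) * (2 * (k * J))" using hs mult_left_mono[OF A2 C0] by linarith
  then have "nu r * wn \<sigma> w \<le> nu r * (Ch * r powr (\<sigma> + 2) * (2 * (k * J)))"
    using nu_pos[OF r] by (intro mult_left_mono) auto
  with J2 have "J * J \<le> (2 * k * Ch * r powr (\<sigma> + 2) * nu r) * J" by (simp add: power2_eq_square mult_ac)
  moreover have "0 \<le> 2 * k * Ch * r powr (\<sigma> + 2) * nu r"
    using k nu_pos[OF r] by (simp add: Ch_def)
  ultimately have JJ: "J \<le> 2 * k * Ch * r powr (\<sigma> + 2) * nu r"
    using J0 by (cases "J = 0") auto
  have r2: "0 < r / 2" using r by simp
  \<comment> \<open>On the ball of half the radius \<open>w\<close> is at least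
    \<open>f (r / 2) - k\<close> by monotonicity, so the integral \<open>J\<close> controls this
    number times the mass of that ball.\<close>
  have "(f (r / 2) - k) * nu (r / 2) = (LINT x::'a|lborel. (f (r / 2) - k) * (indicator (cball 0 (r / 2)) x * wt \<sigma> x))"
    by (simp add: nu_def)
  also have "\<dots> \<le> J" unfolding J_def
  proof (intro integral_mono_AE integrable_mult_right nu_integrable r2 iJ)
    show "AE x in lborel. (f (r / 2) - k) * (indicator (cball 0 (r / 2)) x * wt \<sigma> x) \<le> wt \<sigma> x * w x"
      using AE_lborel_singleton[of "0::'a"]
    proof eventually_elim
      case (elim x)
      show ?case
      proof (cases "norm x \<le> r / 2")
        case True
        have "f (r / 2) \<le> f (norm x)" using fm[of "norm x" "r / 2"] True elim by simp
        then have "f (r / 2) - k \<le> w x" using elim by (simp add: w_def vf)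
        from mult_right_mono[OF this, of "wt \<sigma> x"] show ?thesis using True by (simp add: mult.commute)
      qed (simp add: w0)
    qed
  qed
  also have "\<dots> \<le> (2 * k * Ch * r powr (\<sigma> + 2) * 2 powr (real DIM('a) + \<sigma>)) * nu (r / 2)"
    using JJ unfolding nu_scale[OF r] by (simp add: mult_ac)
  finally have "f (r / 2) - k \<le> 2 * k * Ch * r powr (\<sigma> + 2) * 2 powr (real DIM('a) + \<sigma>)"
    using nu_pos[OF r2] by (simp only: mult_le_cancel_right)
  then show ?thesis by (simp add: k_def algebra_simps)
qed

text \<open>Halving the radius repeatedly multiplies the profile by factors 1 + D q^j. Since
  \<sigma> + 2 is positive, \<open>q < 1\<close>, and the infinite product converges.\<close>

lemma radial_bounded:
  assumes sol: "solution v G" and vf: "\<And>x. v x = (if x = 0 then 0 else f (norm x))"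
    and f0: "\<And>t. 0 < t \<Longrightarrow> 0 \<le> f t" and fm: "\<And>t u. 0 < t \<Longrightarrow> t \<le> u \<Longrightarrow> f u \<le> f t"
  shows "\<exists>M\<ge>0. \<forall>t>0. f t \<le> M"
proof -
  define q where "q = 2 powr (- (\<sigma> + 2))"
  have q: "0 < q" "q < 1" using s1 powr_less_mono[of "- (\<sigma> + 2)" 0 2] by (simp_all add: q_def)
  obtain r where r: "0 < r" "r powr (\<sigma> + 2) * Ch < 1 / 2"
    using powr_small[of "\<sigma> + 2" "1/2" Ch] s1 by auto
  define D where "D = 2 * Ch * 2 powr (real DIM('a) + \<sigma>) * r powr (\<sigma> + 2)"
  have C0: "0 \<le> Ch" by (simp add: Ch_def)
  have D0: "0 \<le> D" using C0 by (simp add: D_def)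
  have rj: "(r / 2 ^ j) powr (\<sigma> + 2) = r powr (\<sigma> + 2) * q ^ j" for j
  proof (induction j)
    case (Suc j)
    have "(r / 2 ^ Suc j) powr (\<sigma> + 2) = ((r / 2 ^ j) * (1 / 2)) powr (\<sigma> + 2)" by (simp add: mult.commute)
    also have "\<dots> = (r / 2 ^ j) powr (\<sigma> + 2) * (1 / 2) powr (\<sigma> + 2)" by (rule powr_mult)
    also have "(1 / 2 :: real) powr (\<sigma> + 2) = q"
      by (simp only: q_def powr_minus powr_divide powr_one_eq_one inverse_eq_divide)
    finally show ?case using Suc by simp
  qed simp
  have step: "f (r / 2 ^ Suc j) \<le> f (r / 2 ^ j) * (1 + D * q ^ j)" for j
  proof -
    have q1: "q ^ j \<le> 1" using q by (simp add: power_le_one)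
    have "Ch * r powr (\<sigma> + 2) * q ^ j \<le> Ch * r powr (\<sigma> + 2) * 1"
      using C0 q1 by (intro mult_left_mono) auto
    then have sm: "Ch * (r / 2 ^ j) powr (\<sigma> + 2) \<le> 1 / 2" unfolding rj using r by (simp add: mult_ac)
    have rp: "0 < r / 2 ^ j" using r by simp
    show ?thesis using radial_growth[OF sol vf f0 fm rp sm] unfolding rj by (simp add: D_def mult_ac)
  qed
  \<comment> \<open>Each factor is estimated by an exponential, which turns the product into a
    geometric sum.\<close>
  have b: "f (r / 2 ^ j) \<le> f r * exp (D * (\<Sum>i<j. q ^ i))" for j
  proof (induction j)
    case (Suc j)
    have pos: "0 \<le> 1 + D * q ^ j" using D0 q by simp
    have "f (r / 2 ^ Suc j) \<le> f (r / 2 ^ j) * (1 + D * q ^ j)" by (rule step)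
    also have "\<dots> \<le> (f r * exp (D * (\<Sum>i<j. q ^ i))) * (1 + D * q ^ j)" by (rule mult_right_mono[OF Suc pos])
    also have "\<dots> \<le> (f r * exp (D * (\<Sum>i<j. q ^ i))) * exp (D * q ^ j)"
      using f0[OF r(1)] by (intro mult_left_mono) auto
    also have "\<dots> = f r * exp (D * (\<Sum>i<Suc j. q ^ i))" by (simp add: exp_add[symmetric] distrib_left)
    finally show ?case .
  qed simp
  have sq: "(\<Sum>i<j. q ^ i) \<le> 1 / (1 - q)" for j
  proof -
    have "(\<Sum>i<j. q ^ i) = (1 - q ^ j) / (1 - q)" using q by (simp add: sum_gp_strict)
    also have "\<dots> \<le> 1 / (1 - q)" using q by (intro divide_right_mono) auto
    finally show ?thesis .
  qed
  define M where "M = f r * exp (D * (1 / (1 - q)))"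
  have M0: "0 \<le> M" using f0[OF r(1)] by (simp add: M_def)
  have "f t \<le> M" if t: "0 < t" for t
  proof -
    obtain j where "(1/2) ^ j < t / r" using real_arch_pow_inv[of "t / r" "1/2"] t r by auto
    then have "r / 2 ^ j \<le> t" using r by (simp add: power_one_over field_simps)
    then have "f t \<le> f (r / 2 ^ j)" using r by (intro fm) auto
    also have "\<dots> \<le> f r * exp (D * (\<Sum>i<j. q ^ i))" by (rule b)
    also have "\<dots> \<le> M"
    proof -
      have "D * (\<Sum>i<j. q ^ i) \<le> D * (1 / (1 - q))" by (rule mult_left_mono[OF sq D0])
      then have "exp (D * (\<Sum>i<j. q ^ i)) \<le> exp (D * (1 / (1 - q)))" by (simp only: exp_le_cancel_iff)
      then show ?thesis unfolding M_def by (rule mult_left_mono[OF _ f0[OF r(1)]])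
    qed
    finally show ?thesis .
  qed
  then show ?thesis using M0 by blast
qed

end

section \<open>Borel representatives\<close>

text \<open>The bridge between the Lebesgue measurable functions of the statement and the Borel
  functions of the proof, taken coordinate by coordinate.\<close>

lemma lebesgue_borel_rep:
  fixes g :: "'a::euclidean_space \<Rightarrow> 'b::euclidean_space"
  assumes "g \<in> borel_measurable lebesgue"
  obtains g' where "g' \<in> borel_measurable borel" "AE x in lebesgue. g x = g' x"
proof -
  have "\<exists>h\<in>borel_measurable lborel. AE x in lborel. g x \<bullet> i = h x" for i
    by (intro completion_ex_borel_measurable_real borel_measurable_inner assms borel_measurable_const)
  then obtain h where h: "\<And>i. h i \<in> borel_measurable lborel" "\<And>i. AE x in lborel. g x \<bullet> i = h i x" by metis
  define g' where "g' x = (\<Sum>i\<in>Basis. h i x *\<^sub>R i)" for x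
  have [measurable]: "h i \<in> borel_measurable borel" for i using h(1)[of i] by simp
  have "g' \<in> borel_measurable borel" unfolding g'_def by measurable
  moreover have "AE x in lborel. \<forall>i\<in>Basis. g x \<bullet> i = h i x"
    using h(2) by (intro AE_finite_allI) auto
  then have "AE x in lborel. g x = g' x"
  proof eventually_elim
    fix x assume "\<forall>i\<in>Basis. g x \<bullet> i = h i x"
    then have "g' x = (\<Sum>i\<in>Basis. (g x \<bullet> i) *\<^sub>R i)" unfolding g'_def by (intro sum.cong) auto
    then show "g x = g' x" by (simp only: euclidean_representation)
  qed
  ultimately show thesis using that AE_completion by blast
qed

lemma borel_imp_lebesgue: "f \<in> borel_measurable borel \<Longrightarrow> f \<in> borel_measurable lebesgue"
  by (rule measurable_completion) simp

lemma
  fixes g :: "'a::euclidean_space \<Rightarrow> 'b::euclidean_space"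
  assumes "f \<in> borel_measurable lebesgue" "g \<in> borel_measurable borel" "AE x in lebesgue. f x = g x"
  shows lebesgue_integrable_iff: "integrable lebesgue f \<longleftrightarrow> integrable lborel g"
    and lebesgue_integral_eq: "(LINT x|lebesgue. f x) = (LINT x|lborel. g x)"
proof -
  have g: "g \<in> borel_measurable lebesgue" by (rule borel_imp_lebesgue[OF assms(2)])
  have "integrable lebesgue f \<longleftrightarrow> integrable lebesgue g" by (rule integrable_cong_AE[OF assms(1) g assms(3)])
  then show "integrable lebesgue f \<longleftrightarrow> integrable lborel g" using assms(2) by (simp add: integrable_completion)
  have "(LINT x|lebesgue. f x) = (LINT x|lebesgue. g x)" by (rule integral_cong_AE[OF assms(1) g assms(3)])
  then show "(LINT x|lebesgue. f x) = (LINT x|lborel. g x)" using assms(2) by (simp add: integral_completion)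
qed

lemma abs_powr_2: "\<bar>x\<bar> powr 2 = (x::real)\<^sup>2"
  by (cases "x = 0") (simp_all add: powr_numeral)

lemma weak_grad_imp_sob:
  fixes \<phi> :: "'a::euclidean_space \<Rightarrow> real"
  assumes f: "\<phi> \<in> Lp 2" and w: "weak_grad \<phi> G" and G: "(\<lambda>x. norm (G x)) \<in> Lp 2"
  obtains \<phi>' G' where "sob \<phi>' G'" "AE x in lebesgue. \<phi> x = \<phi>' x" "AE x in lebesgue. G x = G' x"
proof -
  have fm: "\<phi> \<in> borel_measurable lebesgue" and Gm: "G \<in> borel_measurable lebesgue" using w by (auto simp: weak_grad_def)
  obtain \<phi>' where p: "\<phi>' \<in> borel_measurable borel" "AE x in lebesgue. \<phi> x = \<phi>' x" by (rule lebesgue_borel_rep[OF fm])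
  obtain G' where g: "G' \<in> borel_measurable borel" "AE x in lebesgue. G x = G' x" by (rule lebesgue_borel_rep[OF Gm])
  note [measurable] = fm Gm p(1) g(1)
  have "integrable lebesgue (\<lambda>x. \<bar>\<phi> x\<bar> powr 2)" "integrable lebesgue (\<lambda>x. \<bar>norm (G x)\<bar> powr 2)"
    using f G by (auto simp: Lp_def)
  moreover have "AE x in lebesgue. \<bar>\<phi> x\<bar> powr 2 = (norm (\<phi>' x))\<^sup>2" "AE x in lebesgue. \<bar>norm (G x)\<bar> powr 2 = (norm (G' x))\<^sup>2"
    unfolding abs_powr_2 by (use p(2) in \<open>eventually_elim, simp\<close>) (use g(2) in \<open>eventually_elim, simp\<close>)
  ultimately have "integrable lborel (\<lambda>x. (norm (\<phi>' x))\<^sup>2)" "integrable lborel (\<lambda>x. (norm (G' x))\<^sup>2)"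
    using lebesgue_integrable_iff[of "\<lambda>x. \<bar>\<phi> x\<bar> powr 2" "\<lambda>x. (norm (\<phi>' x))\<^sup>2"]
      lebesgue_integrable_iff[of "\<lambda>x. \<bar>norm (G x)\<bar> powr 2" "\<lambda>x. (norm (G' x))\<^sup>2"] by auto
  then have L: "L2 \<phi>'" "L2 G'" using p(1) g(1) by (auto intro: L2_I)
  have "sob \<phi>' G'"
  proof (rule weak_test_imp_sob[OF L])
    fix \<psi> :: "'a \<Rightarrow> real" and i :: 'a assume t: "test_fun \<psi>" and i: "i \<in> Basis"
    obtain D where D: "C1 \<psi> D" "bsupp \<psi>" by (rule test_fun_C1[OF t])
    note [measurable] = C1_meas[OF D(1)]
    note m [measurable] = C1_meas[OF D(1), THEN borel_imp_lebesgue]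
    have "(LINT x|lebesgue. \<phi> x * frechet_derivative \<psi> (at x) i) = - (LINT x|lebesgue. \<psi> x * (G x \<bullet> i))"
      using w t i by (simp only: weak_grad_def)
    then have "(LINT x|lebesgue. \<phi> x * (D x \<bullet> i)) = - (LINT x|lebesgue. \<psi> x * (G x \<bullet> i))"
      by (simp only: C1_frechet[OF D(1)])
    moreover have "(LINT x|lebesgue. \<phi> x * (D x \<bullet> i)) = (LINT x|lborel. \<phi>' x * (D x \<bullet> i))"
      by (rule lebesgue_integral_eq) (use p(2) in \<open>auto elim!: eventually_mono\<close>)
    moreover have "(LINT x|lebesgue. \<psi> x * (G x \<bullet> i)) = (LINT x|lborel. \<psi> x * (G' x \<bullet> i))"
      by (rule lebesgue_integral_eq) (use g(2) in \<open>auto elim!: eventually_mono\<close>)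
    ultimately show "(LINT x|lborel. \<phi>' x * frechet_derivative \<psi> (at x) i) = - (LINT x|lborel. \<psi> x * (G' x \<bullet> i))"
      unfolding C1_frechet[OF D(1)] by simp
  qed
  then show thesis using that p(2) g(2) by blast
qed

text \<open>The gradient \<open>wgrad\<close> is selected by choice from all weak gradients, so it
  is only available through the properties guaranteed by the selection.\<close>

lemma H1_sob:
  assumes "\<phi> \<in> H1"
  obtains \<phi>' G' where "sob \<phi>' G'" "AE x in lebesgue. \<phi> x = \<phi>' x" "AE x in lebesgue. wgrad \<phi> x = G' x"
    "wgrad \<phi> \<in> borel_measurable lebesgue"
proof -
  have "\<exists>G. weak_grad \<phi> G \<and> (\<lambda>x. norm (G x)) \<in> Lp 2" and L: "\<phi> \<in> Lp 2" using assms by (auto simp: H1_def)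
  then have w: "weak_grad \<phi> (wgrad \<phi>)" "(\<lambda>x. norm (wgrad \<phi> x)) \<in> Lp 2"
    unfolding wgrad_def using someI_ex[of "\<lambda>G. weak_grad \<phi> G \<and> (\<lambda>x. norm (G x)) \<in> Lp 2"] by blast+
  obtain \<phi>' G' where "sob \<phi>' G'" "AE x in lebesgue. \<phi> x = \<phi>' x" "AE x in lebesgue. wgrad \<phi> x = G' x"
    by (rule weak_grad_imp_sob[OF L w])
  moreover have "wgrad \<phi> \<in> borel_measurable lebesgue" using w by (simp add: weak_grad_def)
  ultimately show thesis using that by blast
qed

text \<open>The chosen gradient has a Borel representative that is again a weak gradient, and
  \<open>sob_unique\<close> identifies it with \<open>G\<close> almost everywhere.\<close>

lemma sob_imp_H1:
  fixes v :: "'a::euclidean_space \<Rightarrow> real"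
  assumes s: "sob v G" shows "v \<in> H1" "AE x in lebesgue. wgrad v x = G x"
proof -
  note L = sobD[OF s]
  have [measurable]: "v \<in> borel_measurable borel" "G \<in> borel_measurable borel" using L by auto
  have lm: "v \<in> borel_measurable lebesgue" "G \<in> borel_measurable lebesgue" by (rule borel_imp_lebesgue, measurable)+
  have 2: "v \<in> Lp 2" "(\<lambda>x. norm (G x)) \<in> Lp 2"
  proof -
    have "integrable lebesgue (\<lambda>x. (v x)\<^sup>2)" "integrable lebesgue (\<lambda>x. (norm (G x))\<^sup>2)"
      using L2_int[OF L(1)] L2_int[OF L(2)] by (simp_all add: integrable_completion)
    then show "v \<in> Lp 2" "(\<lambda>x. norm (G x)) \<in> Lp 2" using lm by (auto simp: Lp_def abs_powr_2)
  qed
  have "weak_grad v G"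
    unfolding weak_grad_def
  proof (intro conjI allI impI ballI lm)
    fix K :: "'a set" assume K: "compact K"
    have Kb: "K \<in> sets borel" using K by (simp add: borel_compact)
    then have KL: "K \<inter> space lebesgue \<in> sets lebesgue" by simp
    have LI: "L2 (indicator K :: 'a \<Rightarrow> real)"
      using Kb emeasure_compact_finite[OF K] by (intro L2_indicator) (auto simp: less_top)
    have [measurable]: "(indicator K :: 'a \<Rightarrow> real) \<in> borel_measurable borel" using Kb by simp
    have "integrable lborel (\<lambda>x. indicator K x *\<^sub>R v x)" "integrable lborel (\<lambda>x. indicator K x *\<^sub>R G x)"
      by (intro L2_scaleR_integrable LI L)+
    then show "integrable (restrict_space lebesgue K) v" "integrable (restrict_space lebesgue K) G"
      unfolding integrable_restrict_space[OF KL] by (subst integrable_completion; simp)+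
  next
    fix \<psi> :: "'a \<Rightarrow> real" and i :: 'a assume t: "test_fun \<psi>" "i \<in> Basis"
    obtain D where D: "C1 \<psi> D" "bsupp \<psi>" by (rule test_fun_C1[OF t(1)])
    note [measurable] = C1_meas[OF D(1)]
    have "(LINT x|lborel. v x * (D x \<bullet> i)) = - (LINT x|lborel. \<psi> x * (G x \<bullet> i))" by (rule sob_parts[OF s D])
    then show "(LINT x|lebesgue. v x * frechet_derivative \<psi> (at x) i) = - (LINT x|lebesgue. \<psi> x * (G x \<bullet> i))"
      unfolding C1_frechet[OF D(1)] by (simp add: integral_completion)
  qed
  then show h: "v \<in> H1" using 2 by (auto simp: H1_def)
  obtain v' G' where v': "sob v' G'" "AE x in lebesgue. v x = v' x" "AE x in lebesgue. wgrad v x = G' x"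
    by (rule H1_sob[OF h])
  have "AE x in lborel. v x = v' x" using v'(2) by (simp add: AE_completion_iff)
  from sob_unique[OF s v'(1) this] have "AE x in lebesgue. G x = G' x" by (rule AE_completion)
  with v'(3) show "AE x in lebesgue. wgrad v x = G x" by eventually_elim simp
qed

section \<open>The functional and the equation in their original formulation\<close>

context ckn
begin

text \<open>The roots in \<open>Lp_norm\<close> combine with the exponents \<open>al\<close> and
  \<open>be\<close> into \<open>al / 2\<close> and \<open>be / p\<close>.\<close>

lemma Sfun_eq:
  fixes v :: "'a \<Rightarrow> real"
  assumes v: "v \<in> Xsp m"
  obtains v' G' where "X v' G'" "AE x in lebesgue. v x = v' x"
    "Sfun m \<sigma> v = n2 G' powr (al / 2) * pn v' powr (be / p) / wn \<sigma> v'"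
proof -
  have h: "v \<in> H1" and l: "v \<in> Lp p" using v by (auto simp: Xsp_def p_def)
  obtain v' G' where s: "sob v' G'" and ae: "AE x in lebesgue. v x = v' x" "AE x in lebesgue. wgrad v x = G' x"
    and wm: "wgrad v \<in> borel_measurable lebesgue" by (rule H1_sob[OF h])
  have lm: "v \<in> borel_measurable lebesgue" using l by (simp add: Lp_def)
  have [measurable]: "v' \<in> borel_measurable borel" "G' \<in> borel_measurable borel" using sobD[OF s] by auto
  note [measurable] = lm wm
  have aep: "AE x in lebesgue. \<bar>v x\<bar> powr p = \<bar>v' x\<bar> powr p" using ae(1) by eventually_elim simp
  have m: "(\<lambda>x. \<bar>v x\<bar> powr p) \<in> borel_measurable lebesgue" "(\<lambda>x. \<bar>v' x\<bar> powr p) \<in> borel_measurable borel" by measurable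
  have "integrable lborel (\<lambda>x. \<bar>v' x\<bar> powr p)"
    using l lebesgue_integrable_iff[OF m aep] by (simp add: Lp_def)
  then have X: "X v' G'" using s by (simp add: X_def)
  have e1: "(LINT x|lebesgue. \<bar>v x\<bar> powr p) = pn v'" unfolding pn_def by (rule lebesgue_integral_eq[OF m aep])
  have wtl: "wt \<sigma> \<in> (borel_measurable lebesgue :: ('a \<Rightarrow> real) set)" by (rule borel_imp_lebesgue) simp
  note [measurable] = wtl
  have e2: "wnorm2 \<sigma> v = wn \<sigma> v'"
    unfolding wnorm2_def wn_def wt_def[symmetric]
    by (rule lebesgue_integral_eq) (use ae(1) in \<open>auto elim!: eventually_mono\<close>)
  have e3: "(LINT x|lebesgue. \<bar>norm (wgrad v x)\<bar> powr 2) = n2 G'"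
    unfolding n2_def abs_powr_2
    by (rule lebesgue_integral_eq) (use ae(2) in \<open>auto elim!: eventually_mono\<close>)
  have "Sfun m \<sigma> v = n2 G' powr (al / 2) * pn v' powr (be / p) / wn \<sigma> v'"
    unfolding Sfun_def Let_def Lp_norm_def e3 e2 p_def[symmetric] e1 th_def[symmetric] al_def[symmetric] be_def[symmetric]
    by (simp add: powr_powr)
  then show thesis using that X ae(1) by blast
qed

lemma X_imp_Xsp:
  fixes v :: "'a \<Rightarrow> real"
  assumes X: "X v G"
  shows "v \<in> Xsp m" "Sfun m \<sigma> v = n2 G powr (al / 2) * pn v powr (be / p) / wn \<sigma> v"
proof -
  have s: "sob v G" and i: "integrable lborel (\<lambda>x. \<bar>v x\<bar> powr p)" using X by (auto simp: X_def)
  have [measurable]: "v \<in> borel_measurable borel" "G \<in> borel_measurable borel" using sobD[OF s] by auto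
  have lm: "v \<in> borel_measurable lebesgue" by (rule borel_imp_lebesgue) simp
  have "integrable lebesgue (\<lambda>x. \<bar>v x\<bar> powr p)" using i by (simp add: integrable_completion)
  then show vX: "v \<in> Xsp m" using sob_imp_H1(1)[OF s] lm by (auto simp: Xsp_def Lp_def p_def)
  obtain v' G' where v': "X v' G'" "AE x in lebesgue. v x = v' x"
    "Sfun m \<sigma> v = n2 G' powr (al / 2) * pn v' powr (be / p) / wn \<sigma> v'" by (rule Sfun_eq[OF vX])
  have s': "sob v' G'" using v'(1) by (simp add: X_def)
  have [measurable]: "v' \<in> borel_measurable borel" "G' \<in> borel_measurable borel" using sobD[OF s'] by auto
  have ae: "AE x in lborel. v x = v' x" using v'(2) by (simp add: AE_completion_iff)
  have "n2 G = n2 G'" by (rule n2_cong_AE[OF sob_unique[OF s s' ae]]) simp_all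
  moreover have "pn v = pn v'" unfolding pn_def by (rule integral_cong_AE) (use ae in \<open>auto elim!: eventually_mono\<close>)
  moreover have "wn \<sigma> v = wn \<sigma> v'" unfolding wn_def by (rule integral_cong_AE) (use ae in \<open>auto elim!: eventually_mono\<close>)
  ultimately show "Sfun m \<sigma> v = n2 G powr (al / 2) * pn v powr (be / p) / wn \<sigma> v" using v'(3) by simp
qed

text \<open>The weak formulation requires integrability of the whole integrand; each of its three
  terms is integrable for representatives of the test function, and the a.e. equality carries this
  over to \<open>wgrad\<close>.\<close>

lemma solution_imp_var_solution:
  fixes v :: "'a \<Rightarrow> real"
  assumes sol: "solution v G" shows "var_solution m \<sigma> v"
proof -
  have X: "X v G" and v0: "\<And>x. 0 \<le> v x" using sol by (auto simp: solution_def)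
  have s: "sob v G" using X by (simp add: X_def)
  have [measurable]: "v \<in> borel_measurable borel" "G \<in> borel_measurable borel" using sobD[OF s] by auto
  have lm: "v \<in> borel_measurable lebesgue" "wt \<sigma> \<in> (borel_measurable lebesgue :: ('a \<Rightarrow> real) set)"
    by (rule borel_imp_lebesgue, measurable)+
  note [measurable] = lm
  have [measurable]: "wgrad v \<in> borel_measurable lebesgue" by (rule H1_sob[OF sob_imp_H1(1)[OF s]])
  have "integrable lebesgue (\<lambda>x. wt \<sigma> x * (v x)\<^sup>2)"
    using wn_integrable(1)[OF s s1 s3 s2] by (simp add: integrable_completion)
  moreover have "integrable lebesgue (\<lambda>x. wgrad v x \<bullet> wgrad \<phi> x + 1 / (m - 1) * v x powr (1 / m) * \<phi> x - wt \<sigma> x * v x * \<phi> x) \<and>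
     (LINT x|lebesgue. wgrad v x \<bullet> wgrad \<phi> x + 1 / (m - 1) * v x powr (1 / m) * \<phi> x - wt \<sigma> x * v x * \<phi> x) = 0"
    if f: "\<phi> \<in> H1" for \<phi>
  proof -
    obtain \<phi>' H' where p: "sob \<phi>' H'" "AE x in lebesgue. \<phi> x = \<phi>' x" "AE x in lebesgue. wgrad \<phi> x = H' x"
      "wgrad \<phi> \<in> borel_measurable lebesgue" by (rule H1_sob[OF f])
    have fm: "\<phi> \<in> borel_measurable lebesgue" using f by (simp add: H1_def Lp_def)
    note [measurable] = p(4) fm
    have [measurable]: "\<phi>' \<in> borel_measurable borel" "H' \<in> borel_measurable borel" using sobD[OF p(1)] by auto
    let ?f = "\<lambda>x. wgrad v x \<bullet> wgrad \<phi> x + 1 / (m - 1) * v x powr (1 / m) * \<phi> x - wt \<sigma> x * v x * \<phi> x"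
    let ?g = "\<lambda>x. G x \<bullet> H' x + 1 / (m - 1) * (v x powr (1 / m) * \<phi>' x) - wt \<sigma> x * v x * \<phi>' x"
    have m: "?f \<in> borel_measurable lebesgue" "?g \<in> borel_measurable borel" by measurable
    have ae: "AE x in lebesgue. ?f x = ?g x"
      using p(2,3) sob_imp_H1(2)[OF s] by eventually_elim simp
    have i: "integrable lborel (\<lambda>x. G x \<bullet> H' x)" "integrable lborel (\<lambda>x. v x powr (1 / m) * \<phi>' x)" "integrable lborel (\<lambda>x. wt \<sigma> x * v x * \<phi>' x)"
      by (intro L2_inner_integrable sobD(2)[OF s] sobD(2)[OF p(1)] solution_power_integrable[OF sol p(1)] wn_expand(2)[OF s p(1)])+
    have "integrable lborel ?g" using i by simp
    moreover have "(LINT x|lborel. ?g x) = 0" using i solution_equation[OF sol p(1)] by simp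
    ultimately show ?thesis using lebesgue_integrable_iff[OF m ae] lebesgue_integral_eq[OF m ae] by simp
  qed
  ultimately show ?thesis unfolding var_solution_def wt_def using X_imp_Xsp(1)[OF X] v0 by blast
qed

end

theorem theorem1p1:
  fixes m \<sigma> :: real
  assumes "m > 1" and "-2 < \<sigma>" and "- real DIM('a::euclidean_space) < \<sigma>" and "\<sigma> < 0"
  shows "\<exists>v\<^sub>s::'a \<Rightarrow> real.
           v\<^sub>s \<in> Xsp m \<and> \<not> (AE x in lebesgue. v\<^sub>s x = 0) \<and> (\<forall>x. 0 \<le> v\<^sub>s x) \<and>
           (\<exists>f. (\<forall>x. v\<^sub>s x = f (norm x)) \<and> antimono_on {0..} f) \<and>
           Sfun m \<sigma> v\<^sub>s = (INF v\<in>{v :: 'a \<Rightarrow> real. v \<in> Xsp m \<and> \<not> (AE x in lebesgue. v x = 0)}. Sfun m \<sigma> v) \<and>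
           Sfun m \<sigma> v\<^sub>s > 0 \<and>
           var_solution m \<sigma> v\<^sub>s"
proof -
  interpret ckn m \<sigma> "TYPE('a)" using assms by unfold_locales auto
  obtain v G f where ex: "extremal v G" and vf: "\<And>x. v x = (if x = 0 then 0 else f (norm x))"
    and f0: "\<And>t. 0 < t \<Longrightarrow> 0 \<le> f t" and fm: "\<And>t u. 0 < t \<Longrightarrow> t \<le> u \<Longrightarrow> f u \<le> f t"
    and nw: "wn \<sigma> v = 2 * n2 G / al" "pn v = be * (m - 1) * n2 G / al"
    by (rule extremal_normalized) blast
  have v0: "0 \<le> v x" for x using f0[of "norm x"] by (simp add: vf)
  have Xv: "X v G" using ex by (simp add: extremal_def)
  have sol: "solution v G"
    unfolding solution_def using Xv v0 normalized_equation[OF ex v0 _ nw] by blast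
  obtain M where M: "0 \<le> M" "\<And>t. 0 < t \<Longrightarrow> f t \<le> M" using radial_bounded[OF sol vf f0 fm] by blast
  \<comment> \<open>The bound \<open>M\<close> serves as the value at the origin, which makes the
    profile nonincreasing on the closed half-line and changes the function only at one
    point.\<close>
  define F where "F t = (if t \<le> 0 then M else f t)" for t
  define w where "w x = F (norm x)" for x :: 'a
  have w0: "0 \<le> w x" for x using M f0 by (simp add: w_def F_def)
  have Fm: "antimono_on {0..} F" by (rule monotone_onI) (auto simp: F_def intro: M fm)
  have ae: "AE x in lborel. v x = w x"
    using AE_lborel_singleton[of "0::'a"] by eventually_elim (simp add: w_def F_def vf)
  have s: "sob v G" and i: "integrable lborel (\<lambda>x. \<bar>v x\<bar> powr p)" using Xv by (auto simp: X_def)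
  have [measurable]: "v \<in> borel_measurable borel" "G \<in> borel_measurable borel" using sobD[OF s] by auto
  have [measurable]: "w \<in> borel_measurable borel"
  proof -
    have "w = (\<lambda>x. if x = 0 then M else v x)" by (auto simp: w_def F_def vf)
    then show ?thesis by simp
  qed
  have sw: "sob w G" by (rule sob_cong_AE[OF s _ _ ae]) auto
  have "AE x in lborel. \<bar>v x\<bar> powr p = \<bar>w x\<bar> powr p" using ae by eventually_elim simp
  then have Xw: "X w G"
    using i sw integrable_cong_AE[of "\<lambda>x. \<bar>v x\<bar> powr p" lborel "\<lambda>x. \<bar>w x\<bar> powr p"] by (auto simp: X_def)
  have pw: "pn w = pn v" unfolding pn_def by (rule integral_cong_AE) (use ae in \<open>auto elim!: eventually_mono\<close>)
  have ww: "wn \<sigma> w = wn \<sigma> v" unfolding wn_def by (rule integral_cong_AE) (use ae in \<open>auto elim!: eventually_mono\<close>)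
  have exw: "extremal w G" using ex Xw pw ww by (simp add: extremal_def)
  have solw: "solution w G"
    unfolding solution_def using Xw w0 normalized_equation[OF exw w0 _ nw[folded pw ww]] by blast
  have wpos: "0 < wn \<sigma> w" and weq: "wn \<sigma> w = Lam * (n2 G powr (al / 2) * pn w powr (be / p))"
    using exw by (auto simp: extremal_def)
  let ?P = "n2 G powr (al / 2) * pn w powr (be / p)"
  have "0 < ?P" using extremal_pos[OF exw] by simp
  then have "?P / (Lam * ?P) = 1 / Lam" using Lam_pos by (simp only: nonzero_divide_mult_cancel_right)
  then have Sw: "Sfun m \<sigma> w = 1 / Lam" unfolding X_imp_Xsp(2)[OF Xw] weq .
  have nz: "\<not> (AE x in lebesgue. w x = 0)"
  proof
    assume "AE x in lebesgue. w x = 0"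
    then have "AE x in lborel. wt \<sigma> x * (w x)\<^sup>2 = 0" unfolding AE_completion_iff by eventually_elim simp
    then show False using wpos integral_eq_zero_AE[of "\<lambda>x. wt \<sigma> x * (w x)\<^sup>2" lborel] by (simp add: wn_def)
  qed
  have wX: "w \<in> Xsp m" by (rule X_imp_Xsp(1)[OF Xw])
  \<comment> \<open>\<open>Lam_inequality\<close> divided by the positive weighted norm of a Borel
    representative; this is where nontriviality of the competitor is used.\<close>
  have low: "1 / Lam \<le> Sfun m \<sigma> u" if u: "u \<in> Xsp m" "\<not> (AE x in lebesgue. u x = 0)" for u :: "'a \<Rightarrow> real"
  proof -
    obtain u' G' where u': "X u' G'" "AE x in lebesgue. u x = u' x"
      "Sfun m \<sigma> u = n2 G' powr (al / 2) * pn u' powr (be / p) / wn \<sigma> u'" by (rule Sfun_eq[OF u(1)])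
    have "\<not> (AE x in lborel. u' x = 0)"
    proof
      assume "AE x in lborel. u' x = 0"
      then have "AE x in lebesgue. u' x = 0" by (rule AE_completion)
      with u'(2) have "AE x in lebesgue. u x = 0" by eventually_elim simp
      then show False using u(2) by simp
    qed
    then have "0 < wn \<sigma> u'" by (rule wn_pos[OF u'(1)])
    then show ?thesis unfolding u'(3) using Lam_inequality[OF u'(1)] Lam_pos
      by (simp add: divide_simps mult.commute)
  qed
  have "Sfun m \<sigma> w = (INF v\<in>{v :: 'a \<Rightarrow> real. v \<in> Xsp m \<and> \<not> (AE x in lebesgue. v x = 0)}. Sfun m \<sigma> v)"
    using wX nz low by (intro cInf_eq_minimum[symmetric] imageI) (auto simp: Sw)
  moreover have "\<exists>f. (\<forall>x. w x = f (norm x)) \<and> antimono_on {0..} f" using Fm by (auto simp: w_def)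
  moreover have "0 < Sfun m \<sigma> w" using Sw Lam_pos by simp
  ultimately show ?thesis
    using wX nz w0 solution_imp_var_solution[OF solw] by (intro exI[of _ w]) blast
qed

end
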